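(* Let $p$ be a prime. Let $\Gamma$ be a finite group, and let $M$ be a finite $\mathbb{F}_p\Gamma$-module on which $\Gamma$ acts faithfully. Set $G=M\rtimes\Gamma$, choose $T\in\mathrm{Syl}_p(\Gamma)$, and set $S=M\rtimes T\in\mathrm{Syl}_p(G)$. Set $$\mathfrak{X}=\{P\le S\mid P\ge M\}\qquad\text{and}\qquad \mathfrak{Y}=\{P\le S\mid P>M\}=\mathfrak{X}\smallsetminus\{M\}.$$ Then: (a) there is a unique isomorphism class of $\mathfrak{X}$-linking systems associated to $\mathcal{F}_S(G)$; and (b) if $\mathfrak{Y}$ is nonempty (as is required in order to speak of $\mathfrak{Y}$-linking systems), the set of isomorphism classes of $\mathfrak{Y}$-linking systems associated to $\mathcal{F}_S(G)$ is in bijective correspondence with $\Lambda^3(\Gamma;M)$. Thus if $\Lambda^3(\Gamma;M)\ne 0$, then there is, up to isomorphism, more than one $\mathfrak{Y}$-linking system associated to $\mathcal{F}_S(G)$, and (up to isomorphism) only one of them can be extended to an $\mathfrak{X}$-linking system associated to $\mathcal{F}_S(G)$.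
   Context: Conjugation: $c_g(x)={}^g x=gxg^{-1}$. Fusion system of a group: for a finite group $G$ and $S\in\mathrm{Syl}_p(G)$, $\mathcal{F}_S(G)$ is the category whose objects are the subgroups of $S$ and with $\mathrm{Mor}(P,Q)=\{\varphi\in\mathrm{Hom}(P,Q)\mid \varphi=c_g \text{ for some } g\in G\}$. Write $\mathcal{F}=\mathcal{F}_S(G)$ and $\mathrm{Hom}_{\mathcal F}(P,Q)=\mathrm{Mor}_{\mathcal F}(P,Q)$. Two subgroups of $S$ are $\mathcal{F}$-conjugate if they are isomorphic in $\mathcal{F}$. A subgroup $P\le S$ is $\mathcal{F}$-centric if $C_S(Q)\le Q$ for each $Q\le S$ that is $\mathcal{F}$-conjugate to $P$; $\mathcal{F}^c$ is the set of $\mathcal{F}$-centric subgroups. For a set $\mathfrak{X}$ of subgroups of $S$, $\mathcal{F}^{\mathfrak X}$ is the full subcategory of $\mathcal{F}$ with object set $\mathfrak{X}$. Transporter category: $\mathcal{T}^{\mathfrak X}(S)$ has object set $\mathfrak{X}$ and $\mathrm{Mor}(P,Q)=T_S(P,Q)=\{g\in S\mid {}^gP\le Q\}$, with composition given by multiplication in $S$. Linking systems: let $\mathfrak{X}\subseteq\mathcal{F}^c$ be a nonempty family of subgroups of $S$ closed under $\mathcal{F}$-conjugacy and overgroups (in $S$). An $\mathfrak{X}$-linking system associated to $\mathcal{F}$ is a category $\mathcal{L}^{\mathfrak X}$ with object set $\mathfrak{X}$, together with functors $\pi:\mathcal{L}^{\mathfrak X}\to\mathcal{F}^{\mathfrak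 X}$ and $\delta:\mathcal{T}^{\mathfrak X}(S)\to\mathcal{L}^{\mathfrak X}$ such that (writing $\delta_{P,Q}$ for the induced map on morphism sets from $P$ to $Q$, and $\delta_P=\delta_{P,P}$): (A) $\delta$ and $\pi$ are the identity on objects, and $\pi$ is surjective on morphisms. For each $P,Q\in\mathfrak{X}$, $Z(P)$ acts freely on $\mathrm{Mor}_{\mathcal{L}^{\mathfrak X}}(P,Q)$ by composition (identifying $Z(P)$ with $\delta_P(Z(P))\le\mathrm{Aut}_{\mathcal{L}^{\mathfrak X}}(P)$), and $\pi$ induces a bijection $\mathrm{Mor}_{\mathcal{L}^{\mathfrak X}}(P,Q)/Z(P)\to\mathrm{Hom}_{\mathcal F}(P,Q)$. (B) For each $P,Q\in\mathfrak{X}$ and $g\in T_S(P,Q)$, $\pi(\delta_{P,Q}(g))=c_g\in\mathrm{Hom}_{\mathcal F}(P,Q)$. (C) For each $P,Q\in\mathfrak{X}$, $f\in\mathrm{Mor}_{\mathcal{L}^{\mathfrak X}}(P,Q)$ and $g\in P$, $f\circ\delta_P(g)=\delta_Q(\pi(f)(g))\circ f$. Two $\mathfrak{X}$-linking systems $(\mathcal{L}_1,\pi_1,\delta_1)$, $(\mathcal{L}_2,\pi_2,\delta_2)$ associated to $\mathcal{F}$ are isomorphic if there is an isomorphism of categories $\Psi:\mathcal{L}_1\to\mathcal{L}_2$ with $\pi_2\circ\Psi=\pi_1$ and $\Psi\circ\delta_1=\delta_2$. Extending: for nonempty families $\mathfrak{Y}\subseteq\mathfrak{X}\subseteq\mathcal{F}^c$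 of subgroups of $S$, both closed under $\mathcal{F}$-conjugacy and overgroups (in $S$), each $\mathfrak{X}$-linking system restricts to a $\mathfrak{Y}$-linking system, namely its full subcategory with object set $\mathfrak{Y}$ together with the restrictions of $\pi$ and $\delta$. A $\mathfrak{Y}$-linking system can be extended to an $\mathfrak{X}$-linking system if it is isomorphic to such a restriction. The groups $\Lambda^i(\Gamma;M)$: for a finite group $\Gamma$ and $T\in\mathrm{Syl}_p(\Gamma)$, the orbit category $\mathcal{O}_T(\Gamma)$ has as objects the subgroups of $T$, and $\mathrm{Mor}(P,Q)$ is the set of $\Gamma$-equivariant maps $\Gamma/P\to\Gamma/Q$; each such map has the form $gP\mapsto gaQ$ for some $a\in\Gamma$ with $P\le aQa^{-1}$. For a $\mathbb{Z}_{(p)}\Gamma$-module $M$, let $F_M:\mathcal{O}_T(\Gamma)^{\mathrm{op}}\to\mathrm{Ab}$ be the functor with $F_M(1)=M$ and $F_M(P)=0$ for $P\neq1$, where $\mathrm{Aut}_{\mathcal{O}_T(\Gamma)}(1)\cong\Gamma$ acts on $F_M(1)=M$ in the given way (the map $g\mapsto ga$ induces $\xi\mapsto a\xi$). Then $\Lambda^i(\Gamma;M)=H^i(\mathcal{O}_T(\Gamma);F_M)$, where $H^i(\mathcal{C};F)$ denotes the $i$-th higher derived functor of the inverse limit of a functor $F:\mathcal{C}^{\mathrm{op}}\to\mathrm{Ab}$ on a small category $\mathcal{C}$. *)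

theory Defs
  imports "HOL-Algebra.Group_Action" "HOL-Algebra.Left_Coset" "HOL-Algebra.Module"
    "HOL-Number_Theory.Residues"
    "HOL-Computational_Algebra.Factorial_Ring" "HOL-Library.Infinite_Typeclass"
begin

section \<open>Categories and functors\<close>

text \<open>
  Categories are given by hom-sets: a morphism is only meaningful together with its source and
  target, so different hom-sets may overlap (as they do in transporter categories).
  \<open>comp C P Q R g f\<close> is the composite of \<open>f \<in> Mor C P Q\<close> followed by \<open>g \<in> Mor C Q R\<close>.
\<close>

record ('o, 'a) cat =
  Obj :: "'o set"
  Mor :: "'o \<Rightarrow> 'o \<Rightarrow> 'a set"
  comp :: "'o \<Rightarrow> 'o \<Rightarrow> 'o \<Rightarrow> 'a \<Rightarrow> 'a \<Rightarrow> 'a"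
  ident :: "'o \<Rightarrow> 'a"

definition category :: "('o, 'a) cat \<Rightarrow> bool" where
  "category C \<longleftrightarrow>
     (\<forall>P\<in>Obj C. ident C P \<in> Mor C P P) \<and>
     (\<forall>P\<in>Obj C. \<forall>Q\<in>Obj C. \<forall>R\<in>Obj C. \<forall>f\<in>Mor C P Q. \<forall>g\<in>Mor C Q R.
        comp C P Q R g f \<in> Mor C P R) \<and>
     (\<forall>P\<in>Obj C. \<forall>Q\<in>Obj C. \<forall>f\<in>Mor C P Q.
        comp C P P Q f (ident C P) = f \<and> comp C P Q Q (ident C Q) f = f) \<and>
     (\<forall>P\<in>Obj C. \<forall>Q\<in>Obj C. \<forall>R\<in>Obj C. \<forall>U\<in>Obj C.
      \<forall>f\<in>Mor C P Q. \<forall>g\<in>Mor C Q R. \<forall>h\<in>Mor C R U.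
        comp C P Q U (comp C Q R U h g) f = comp C P R U h (comp C P Q R g f))"

definition isomorphic_in :: "('o, 'a) cat \<Rightarrow> 'o \<Rightarrow> 'o \<Rightarrow> bool" where
  "isomorphic_in C P Q \<longleftrightarrow>
     (\<exists>f\<in>Mor C P Q. \<exists>g\<in>Mor C Q P. comp C P Q P g f = ident C P \<and> comp C Q P Q f g = ident C Q)"

definition full_subcat :: "('o, 'a) cat \<Rightarrow> 'o set \<Rightarrow> ('o, 'a) cat" where
  "full_subcat C \<XX> = C\<lparr>Obj := \<XX>\<rparr>"

record ('o1, 'a1, 'o2, 'a2) cfunctor =
  obj_map :: "'o1 \<Rightarrow> 'o2"
  mor_map :: "'o1 \<Rightarrow> 'o1 \<Rightarrow> 'a1 \<Rightarrow> 'a2"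

definition is_cfunctor ::
  "('o1, 'a1) cat \<Rightarrow> ('o2, 'a2) cat \<Rightarrow> ('o1, 'a1, 'o2, 'a2) cfunctor \<Rightarrow> bool" where
  "is_cfunctor C D F \<longleftrightarrow>
     (\<forall>P\<in>Obj C. obj_map F P \<in> Obj D) \<and>
     (\<forall>P\<in>Obj C. \<forall>Q\<in>Obj C. \<forall>f\<in>Mor C P Q.
        mor_map F P Q f \<in> Mor D (obj_map F P) (obj_map F Q)) \<and>
     (\<forall>P\<in>Obj C. mor_map F P P (ident C P) = ident D (obj_map F P)) \<and>
     (\<forall>P\<in>Obj C. \<forall>Q\<in>Obj C. \<forall>R\<in>Obj C. \<forall>f\<in>Mor C P Q. \<forall>g\<in>Mor C Q R.
        mor_map F P R (comp C P Q R g f) =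
          comp D (obj_map F P) (obj_map F Q) (obj_map F R) (mor_map F Q R g) (mor_map F P Q f))"

definition cfunctor_id :: "('o, 'a, 'o, 'a) cfunctor" where
  "cfunctor_id = \<lparr>obj_map = (\<lambda>P. P), mor_map = (\<lambda>P Q f. f)\<rparr>"

definition cfunctor_comp ::
  "('o2, 'a2, 'o3, 'a3) cfunctor \<Rightarrow> ('o1, 'a1, 'o2, 'a2) cfunctor \<Rightarrow> ('o1, 'a1, 'o3, 'a3) cfunctor"
where
  "cfunctor_comp G F =
     \<lparr>obj_map = (\<lambda>P. obj_map G (obj_map F P)),
      mor_map = (\<lambda>P Q f. mor_map G (obj_map F P) (obj_map F Q) (mor_map F P Q f))\<rparr>"

text \<open>
  Equality of functors on \<open>C\<close>: the values of the underlying (total) functions outside the objects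
  and morphisms of \<open>C\<close> are irrelevant.
\<close>

definition cfunctor_eq ::
  "('o1, 'a1) cat \<Rightarrow> ('o1, 'a1, 'o2, 'a2) cfunctor \<Rightarrow> ('o1, 'a1, 'o2, 'a2) cfunctor \<Rightarrow> bool" where
  "cfunctor_eq C F G \<longleftrightarrow>
     (\<forall>P\<in>Obj C. obj_map F P = obj_map G P) \<and>
     (\<forall>P\<in>Obj C. \<forall>Q\<in>Obj C. \<forall>f\<in>Mor C P Q. mor_map F P Q f = mor_map G P Q f)"

definition cat_isomorphism ::
  "('o1, 'a1) cat \<Rightarrow> ('o2, 'a2) cat \<Rightarrow> ('o1, 'a1, 'o2, 'a2) cfunctor \<Rightarrow> bool" where
  "cat_isomorphism C D F \<longleftrightarrow> is_cfunctor C D F \<and>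
     (\<exists>G. is_cfunctor D C G \<and>
        cfunctor_eq C (cfunctor_comp G F) cfunctor_id \<and>
        cfunctor_eq D (cfunctor_comp F G) cfunctor_id)"

section \<open>Fusion systems and linking systems\<close>

definition Syl :: "nat \<Rightarrow> ('g, 'b) monoid_scheme \<Rightarrow> 'g set set" where
  "Syl p G = {P. subgroup P G \<and> card P = p ^ multiplicity p (order G)}"

definition subgroups_of :: "('g, 'b) monoid_scheme \<Rightarrow> 'g set \<Rightarrow> 'g set set" where
  "subgroups_of G S = {P. subgroup P G \<and> P \<subseteq> S}"

definition conj_by :: "('g, 'b) monoid_scheme \<Rightarrow> 'g \<Rightarrow> 'g \<Rightarrow> 'g" where
  "conj_by G g x = g \<otimes>\<^bsub>G\<^esub> x \<otimes>\<^bsub>G\<^esub> inv\<^bsub>G\<^esub> g"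

text \<open>\<open>transporter G S P Q\<close> is $T_S(P,Q)$.\<close>

definition transporter :: "('g, 'b) monoid_scheme \<Rightarrow> 'g set \<Rightarrow> 'g set \<Rightarrow> 'g set \<Rightarrow> 'g set" where
  "transporter G S P Q = {g \<in> S. conj_by G g ` P \<subseteq> Q}"

definition fusion_system :: "('g, 'b) monoid_scheme \<Rightarrow> 'g set \<Rightarrow> ('g set, 'g \<Rightarrow> 'g) cat" where
  "fusion_system G S =
     \<lparr>Obj = subgroups_of G S,
      Mor = (\<lambda>P Q. {\<phi> \<in> extensional P. \<exists>g\<in>carrier G.
               (\<forall>x\<in>P. \<phi> x = conj_by G g x \<and> \<phi> x \<in> Q)}),
      comp = (\<lambda>P Q R g f. compose P g f),
      ident = (\<lambda>P. \<lambda>x\<in>P. x)\<rparr>"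

definition transporter_cat ::
  "('g, 'b) monoid_scheme \<Rightarrow> 'g set \<Rightarrow> 'g set set \<Rightarrow> ('g set, 'g) cat" where
  "transporter_cat G S \<XX> =
     \<lparr>Obj = \<XX>,
      Mor = transporter G S,
      comp = (\<lambda>P Q R g f. g \<otimes>\<^bsub>G\<^esub> f),
      ident = (\<lambda>P. \<one>\<^bsub>G\<^esub>)\<rparr>"

definition centralizer_in :: "('g, 'b) monoid_scheme \<Rightarrow> 'g set \<Rightarrow> 'g set \<Rightarrow> 'g set" where
  "centralizer_in G S Q = {x \<in> S. \<forall>y\<in>Q. x \<otimes>\<^bsub>G\<^esub> y = y \<otimes>\<^bsub>G\<^esub> x}"

definition center_of :: "('g, 'b) monoid_scheme \<Rightarrow> 'g set \<Rightarrow> 'g set" where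
  "center_of G P = centralizer_in G P P"

definition centric_subgroups :: "('g, 'b) monoid_scheme \<Rightarrow> 'g set \<Rightarrow> 'g set set" where
  "centric_subgroups G S =
     {P \<in> subgroups_of G S. \<forall>Q \<in> subgroups_of G S.
        isomorphic_in (fusion_system G S) P Q \<longrightarrow> centralizer_in G S Q \<subseteq> Q}"

text \<open>The families for which one can speak of linking systems.\<close>

definition linking_family :: "('g, 'b) monoid_scheme \<Rightarrow> 'g set \<Rightarrow> 'g set set \<Rightarrow> bool" where
  "linking_family G S \<XX> \<longleftrightarrow>
     \<XX> \<noteq> {} \<and> \<XX> \<subseteq> centric_subgroups G S \<and>
     (\<forall>P\<in>\<XX>. \<forall>Q \<in> subgroups_of G S. isomorphic_in (fusion_system G S) P Q \<longrightarrow> Q \<in> \<XX>) \<and>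
     (\<forall>P\<in>\<XX>. \<forall>Q \<in> subgroups_of G S. P \<subseteq> Q \<longrightarrow> Q \<in> \<XX>)"

text \<open>A category \<open>\<L>\<close> with candidates for the functors $\pi$ and $\delta$.\<close>

type_synonym ('g, 'l) linking_data =
  "('g set, 'l) cat \<times> ('g set, 'l, 'g set, 'g \<Rightarrow> 'g) cfunctor \<times> ('g set, 'g, 'g set, 'l) cfunctor"

text \<open>
  In axiom (A), the statement that $\pi$ induces a bijection from the set of orbits of $Z(P)$ on
  the morphisms of the linking system to those of the fusion system is spelled out as: $\pi$ is
  onto, and its fibres are exactly the orbits.
\<close>

definition linking_system ::
  "('g, 'b) monoid_scheme \<Rightarrow> 'g set \<Rightarrow> 'g set set \<Rightarrow> ('g, 'l) linking_data \<Rightarrow> bool" where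
  "linking_system G S \<XX> = (\<lambda>(L, \<pi>, \<delta>).
     linking_family G S \<XX> \<and>
     category L \<and> Obj L = \<XX> \<and>
     is_cfunctor L (full_subcat (fusion_system G S) \<XX>) \<pi> \<and>
     is_cfunctor (transporter_cat G S \<XX>) L \<delta> \<and>
     \<comment> \<open>(A)\<close>
     (\<forall>P\<in>\<XX>. obj_map \<pi> P = P \<and> obj_map \<delta> P = P) \<and>
     (\<forall>P\<in>\<XX>. \<forall>Q\<in>\<XX>.
        (\<forall>f\<in>Mor L P Q. \<forall>z\<in>center_of G P.
           comp L P P Q f (mor_map \<delta> P P z) = f \<longrightarrow> z = \<one>\<^bsub>G\<^esub>) \<and>
        mor_map \<pi> P Q ` Mor L P Q = Mor (fusion_system G S) P Q \<and>
        (\<forall>f\<in>Mor L P Q. \<forall>f'\<in>Mor L P Q. mor_map \<pi> P Q f = mor_map \<pi> P Q f' \<longleftrightarrow>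
           (\<exists>z\<in>center_of G P. f' = comp L P P Q f (mor_map \<delta> P P z)))) \<and>
     \<comment> \<open>(B)\<close>
     (\<forall>P\<in>\<XX>. \<forall>Q\<in>\<XX>. \<forall>g\<in>transporter G S P Q.
        mor_map \<pi> P Q (mor_map \<delta> P Q g) = restrict (conj_by G g) P) \<and>
     \<comment> \<open>(C)\<close>
     (\<forall>P\<in>\<XX>. \<forall>Q\<in>\<XX>. \<forall>f\<in>Mor L P Q. \<forall>g\<in>P.
        comp L P P Q f (mor_map \<delta> P P g) =
          comp L P Q Q (mor_map \<delta> Q Q (mor_map \<pi> P Q f g)) f))"

definition linking_iso ::
  "('g, 'b) monoid_scheme \<Rightarrow> 'g set \<Rightarrow> 'g set set \<Rightarrow>
   ('g, 'l) linking_data \<Rightarrow> ('g, 'k) linking_data \<Rightarrow> bool" where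
  "linking_iso G S \<XX> = (\<lambda>(L1, \<pi>1, \<delta>1) (L2, \<pi>2, \<delta>2).
     \<exists>\<Psi>. cat_isomorphism L1 L2 \<Psi> \<and>
        cfunctor_eq L1 (cfunctor_comp \<pi>2 \<Psi>) \<pi>1 \<and>
        cfunctor_eq (transporter_cat G S \<XX>) (cfunctor_comp \<Psi> \<delta>1) \<delta>2)"

text \<open>
  Isomorphism classes of linking systems whose morphisms are elements of the type \<open>'l\<close>.
  A linking system of a finite group has finitely many morphisms, so if \<open>'l\<close> is infinite, then
  every linking system is isomorphic to one of these.
\<close>

definition linking_iso_classes ::
  "('g, 'b) monoid_scheme \<Rightarrow> 'g set \<Rightarrow> 'g set set \<Rightarrow> ('g, 'l) linking_data set set" where
  "linking_iso_classes G S \<XX> =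
     {L. linking_system G S \<XX> L} //
     {(L, L'). linking_system G S \<XX> L \<and> linking_system G S \<XX> L' \<and> linking_iso G S \<XX> L L'}"

text \<open>
  Since functors are only ever compared on the objects and morphisms of their source category,
  restricting $\pi$ and $\delta$ leaves the underlying functions alone.
\<close>

definition linking_restrict :: "'g set set \<Rightarrow> ('g, 'l) linking_data \<Rightarrow> ('g, 'l) linking_data" where
  "linking_restrict \<YY> = (\<lambda>(L, \<pi>, \<delta>). (full_subcat L \<YY>, \<pi>, \<delta>))"

definition can_be_extended ::
  "('g, 'b) monoid_scheme \<Rightarrow> 'g set \<Rightarrow> 'g set set \<Rightarrow> 'g set set \<Rightarrow> ('g, 'l) linking_data \<Rightarrow> bool"
where
  "can_be_extended G S \<YY> \<XX> L \<longleftrightarrow>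
     (\<exists>L' :: ('g, 'l) linking_data.
        linking_system G S \<XX> L' \<and> linking_iso G S \<YY> L (linking_restrict \<YY> L'))"

section \<open>Higher derived functors of inverse limits\<close>

text \<open>
  Functors from the opposite of a category to abelian groups; \<open>res F P Q f\<close> is the homomorphism
  from \<open>grp F Q\<close> to \<open>grp F P\<close> induced by \<open>f \<in> Mor C P Q\<close>.
\<close>

record ('o, 'a, 'u) presheaf =
  grp :: "'o \<Rightarrow> 'u monoid"
  res :: "'o \<Rightarrow> 'o \<Rightarrow> 'a \<Rightarrow> 'u \<Rightarrow> 'u"

definition ab_presheaf :: "('o, 'a) cat \<Rightarrow> ('o, 'a, 'u) presheaf \<Rightarrow> bool" where
  "ab_presheaf C F \<longleftrightarrow>
     (\<forall>P\<in>Obj C. comm_group (grp F P)) \<and>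
     (\<forall>P\<in>Obj C. \<forall>Q\<in>Obj C. \<forall>f\<in>Mor C P Q. res F P Q f \<in> hom (grp F Q) (grp F P)) \<and>
     (\<forall>P\<in>Obj C. \<forall>x\<in>carrier (grp F P). res F P P (ident C P) x = x) \<and>
     (\<forall>P\<in>Obj C. \<forall>Q\<in>Obj C. \<forall>R\<in>Obj C. \<forall>f\<in>Mor C P Q. \<forall>g\<in>Mor C Q R. \<forall>x\<in>carrier (grp F R).
        res F P R (comp C P Q R g f) x = res F P Q f (res F Q R g x))"

definition presheaf_hom ::
  "('o, 'a) cat \<Rightarrow> ('o, 'a, 'u) presheaf \<Rightarrow> ('o, 'a, 'v) presheaf \<Rightarrow> ('o \<Rightarrow> 'u \<Rightarrow> 'v) \<Rightarrow> bool" where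
  "presheaf_hom C F G \<eta> \<longleftrightarrow>
     (\<forall>P\<in>Obj C. \<eta> P \<in> hom (grp F P) (grp G P)) \<and>
     (\<forall>P\<in>Obj C. \<forall>Q\<in>Obj C. \<forall>f\<in>Mor C P Q. \<forall>x\<in>carrier (grp F Q).
        \<eta> P (res F P Q f x) = res G P Q f (\<eta> Q x))"

definition presheaf_mono ::
  "('o, 'a) cat \<Rightarrow> ('o, 'a, 'u) presheaf \<Rightarrow> ('o, 'a, 'v) presheaf \<Rightarrow> ('o \<Rightarrow> 'u \<Rightarrow> 'v) \<Rightarrow> bool" where
  "presheaf_mono C F G \<eta> \<longleftrightarrow>
     presheaf_hom C F G \<eta> \<and> (\<forall>P\<in>Obj C. inj_on (\<eta> P) (carrier (grp F P)))"

text \<open>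
  Injective objects of the category of functors to abelian groups with elements in the type \<open>'u\<close>.
  When \<open>C\<close> is finite and \<open>'u\<close> is infinite (the only case used below), this is the same as being
  injective among all functors to abelian groups: by Baer's criterion it is enough to extend
  homomorphisms from subfunctors of the functors $\mathbf{Z}[\mathrm{Mor}_C(-,P)]$, whose values
  are countable. Also, every functor with finite values then has a resolution by such injectives,
  as it embeds in a finite product of functors $\mathrm{Map}(\mathrm{Mor}_C(P,-),D)$ with \<open>D\<close>
  countable and divisible.
\<close>

definition injective_presheaf :: "('o, 'a) cat \<Rightarrow> ('o, 'a, 'u) presheaf \<Rightarrow> bool" where
  "injective_presheaf C I \<longleftrightarrow> ab_presheaf C I \<and>
     (\<forall>(A :: ('o, 'a, 'u) presheaf) (B :: ('o, 'a, 'u) presheaf) i h.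
        ab_presheaf C A \<and> ab_presheaf C B \<and> presheaf_mono C A B i \<and> presheaf_hom C A I h \<longrightarrow>
        (\<exists>k. presheaf_hom C B I k \<and>
           (\<forall>P\<in>Obj C. \<forall>x\<in>carrier (grp A P). k P (i P x) = h P x)))"

text \<open>\<open>0 \<rightarrow> F \<rightarrow> I 0 \<rightarrow> I 1 \<rightarrow> \<dots>\<close> is exact, with all \<open>I n\<close> injective.\<close>

definition injective_resolution ::
  "('o, 'a) cat \<Rightarrow> ('o, 'a, 'v) presheaf \<Rightarrow>
   ('o \<Rightarrow> 'v \<Rightarrow> 'u) \<times> (nat \<Rightarrow> ('o, 'a, 'u) presheaf) \<times> (nat \<Rightarrow> 'o \<Rightarrow> 'u \<Rightarrow> 'u) \<Rightarrow> bool" where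
  "injective_resolution C F = (\<lambda>(\<eta>, I, d).
     (\<forall>n. injective_presheaf C (I n)) \<and>
     presheaf_mono C F (I 0) \<eta> \<and>
     (\<forall>n. presheaf_hom C (I n) (I (Suc n)) (d n)) \<and>
     (\<forall>P\<in>Obj C. \<eta> P ` carrier (grp F P) = kernel (grp (I 0) P) (grp (I 1) P) (d 0 P)) \<and>
     (\<forall>n. \<forall>P\<in>Obj C. d n P ` carrier (grp (I n) P) =
        kernel (grp (I (Suc n)) P) (grp (I (Suc (Suc n))) P) (d (Suc n) P)))"

definition inverse_limit :: "('o, 'a) cat \<Rightarrow> ('o, 'a, 'u) presheaf \<Rightarrow> ('o \<Rightarrow> 'u) monoid" where
  "inverse_limit C F =
     \<lparr>carrier = {x \<in> (\<Pi>\<^sub>E P\<in>Obj C. carrier (grp F P)).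
         \<forall>P\<in>Obj C. \<forall>Q\<in>Obj C. \<forall>f\<in>Mor C P Q. res F P Q f (x Q) = x P},
      monoid.mult = (\<lambda>x y. \<lambda>P\<in>Obj C. x P \<otimes>\<^bsub>grp F P\<^esub> y P),
      one = (\<lambda>P\<in>Obj C. \<one>\<^bsub>grp F P\<^esub>)\<rparr>"

definition inverse_limit_map ::
  "('o, 'a) cat \<Rightarrow> ('o \<Rightarrow> 'u \<Rightarrow> 'v) \<Rightarrow> ('o \<Rightarrow> 'u) \<Rightarrow> ('o \<Rightarrow> 'v)" where
  "inverse_limit_map C \<eta> x = (\<lambda>P\<in>Obj C. \<eta> P (x P))"

definition cochain_cohomology ::
  "(nat \<Rightarrow> 'x monoid) \<Rightarrow> (nat \<Rightarrow> 'x \<Rightarrow> 'x) \<Rightarrow> nat \<Rightarrow> 'x set monoid" where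
  "cochain_cohomology K D n =
     (K n)\<lparr>carrier := kernel (K n) (K (Suc n)) (D n)\<rparr> Mod
       (case n of 0 \<Rightarrow> {\<one>\<^bsub>K 0\<^esub>} | Suc m \<Rightarrow> D m ` carrier (K m))"

text \<open>\<open>higher_limit C F i\<close> is $H^i(C;F)$, computed in terms of some injective resolution.\<close>

definition higher_limit ::
  "('o, 'a) cat \<Rightarrow> ('o, 'a, 'v) presheaf \<Rightarrow> nat \<Rightarrow> ('o \<Rightarrow> 'u) set monoid" where
  "higher_limit C F i =
     (let (\<eta> :: 'o \<Rightarrow> 'v \<Rightarrow> 'u, I, d) = (SOME R. injective_resolution C F R)
      in cochain_cohomology (\<lambda>n. inverse_limit C (I n)) (\<lambda>n. inverse_limit_map C (d n)) i)"

section \<open>Orbit categories and the groups $\Lambda^i(\Gamma;M)$\<close>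

definition orbit_category ::
  "('g, 'b) monoid_scheme \<Rightarrow> 'g set \<Rightarrow> ('g set, 'g set \<Rightarrow> 'g set) cat" where
  "orbit_category \<Gamma> T =
     \<lparr>Obj = subgroups_of \<Gamma> T,
      Mor = (\<lambda>P Q. {\<phi> \<in> lcosets\<^bsub>\<Gamma>\<^esub> P \<rightarrow>\<^sub>E lcosets\<^bsub>\<Gamma>\<^esub> Q.
               \<forall>g\<in>carrier \<Gamma>. \<forall>A\<in>lcosets\<^bsub>\<Gamma>\<^esub> P. \<phi> (g <#\<^bsub>\<Gamma>\<^esub> A) = g <#\<^bsub>\<Gamma>\<^esub> \<phi> A}),
      comp = (\<lambda>P Q R g f. compose (lcosets\<^bsub>\<Gamma>\<^esub> P) g f),
      ident = (\<lambda>P. \<lambda>A\<in>lcosets\<^bsub>\<Gamma>\<^esub> P. A)\<rparr>"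

text \<open>
  The functor $F_M$. An endomorphism \<open>\<phi>\<close> of the trivial subgroup has the form \<open>{g} \<mapsto> {g a}\<close>, where
  \<open>a\<close> is the element of \<open>\<phi> {1}\<close>; every other morphism induces the zero homomorphism, since its
  source or its target is sent to the zero group.
\<close>

definition atomic_presheaf ::
  "('g, 'b) monoid_scheme \<Rightarrow> ('m, 'c) ring_scheme \<Rightarrow> ('g \<Rightarrow> 'm \<Rightarrow> 'm) \<Rightarrow>
   ('g set, 'g set \<Rightarrow> 'g set, 'm) presheaf" where
  "atomic_presheaf \<Gamma> M act =
     \<lparr>grp = (\<lambda>P. \<lparr>carrier = (if P = {\<one>\<^bsub>\<Gamma>\<^esub>} then carrier M else {\<zero>\<^bsub>M\<^esub>}),
                  monoid.mult = add M, one = \<zero>\<^bsub>M\<^esub>\<rparr>),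
      res = (\<lambda>P Q \<phi> \<xi>. if P = {\<one>\<^bsub>\<Gamma>\<^esub>} \<and> Q = {\<one>\<^bsub>\<Gamma>\<^esub>}
                        then act (the_elem (\<phi> {\<one>\<^bsub>\<Gamma>\<^esub>})) \<xi> else \<zero>\<^bsub>M\<^esub>)\<rparr>"

text \<open>The type \<open>'u\<close> is the type of elements of the abelian groups used in resolving.\<close>

definition Lambda_group ::
  "('g, 'b) monoid_scheme \<Rightarrow> 'g set \<Rightarrow> ('m, 'c) ring_scheme \<Rightarrow> ('g \<Rightarrow> 'm \<Rightarrow> 'm) \<Rightarrow> nat \<Rightarrow>
   ('g set \<Rightarrow> 'u) set monoid" where
  "Lambda_group \<Gamma> T M act i = higher_limit (orbit_category \<Gamma> T) (atomic_presheaf \<Gamma> M act) i"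

section \<open>Modules and semidirect products\<close>

text \<open>
  A module over the group algebra $\mathbf{F}_p\Gamma$ is given as a vector space over
  $\mathbf{F}_p$ together with an action of \<open>\<Gamma>\<close> by linear maps.
\<close>

definition Fp_module ::
  "nat \<Rightarrow> ('g, 'b) monoid_scheme \<Rightarrow> (int, 'm) module \<Rightarrow> ('g \<Rightarrow> 'm \<Rightarrow> 'm) \<Rightarrow> bool" where
  "Fp_module p \<Gamma> M act \<longleftrightarrow>
     module (residue_ring (int p)) M \<and> group_action \<Gamma> (carrier M) act \<and>
     (\<forall>g\<in>carrier \<Gamma>. \<forall>x\<in>carrier M. \<forall>y\<in>carrier M.
        act g (x \<oplus>\<^bsub>M\<^esub> y) = act g x \<oplus>\<^bsub>M\<^esub> act g y) \<and>
     (\<forall>g\<in>carrier \<Gamma>. \<forall>a\<in>carrier (residue_ring (int p)). \<forall>x\<in>carrier M.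
        act g (a \<odot>\<^bsub>M\<^esub> x) = a \<odot>\<^bsub>M\<^esub> act g x)"

definition semidirect ::
  "('m, 'c) ring_scheme \<Rightarrow> ('g, 'b) monoid_scheme \<Rightarrow> ('g \<Rightarrow> 'm \<Rightarrow> 'm) \<Rightarrow> ('m \<times> 'g) monoid" where
  "semidirect M \<Gamma> act =
     \<lparr>carrier = carrier M \<times> carrier \<Gamma>,
      monoid.mult = (\<lambda>(x, g) (y, h). (x \<oplus>\<^bsub>M\<^esub> act g y, g \<otimes>\<^bsub>\<Gamma>\<^esub> h)),
      one = (\<zero>\<^bsub>M\<^esub>, \<one>\<^bsub>\<Gamma>\<^esub>)\<rparr>"

end

theory Submission
  imports Defs Complex_Main "HOL-Library.Function_Algebras" "HOL-Algebra.Sylow"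
    "HOL-Algebra.Multiplicative_Group"
begin

text \<open>
  Let \<open>A\<close> be the image of \<open>M\<close> in \<open>G\<close>. All subgroups involved contain \<open>A\<close>, which is its own centralizer,
  so the centre of such a \<open>P\<close> consists of the elements of \<open>A\<close> fixed by \<open>P/A\<close>. In a linking system choose
  for each \<open>g\<close> transporting \<open>P\<close> into \<open>Q\<close> a morphism over conjugation by \<open>g\<close>, compatibly with composition
  with elements of \<open>P\<close> and \<open>Q\<close>, and equal to the given morphism when \<open>g\<close> lies in \<open>S\<close>. Composites then
  agree with the choice for the product up to an element of the centre of the source. These deviations
  form a 2-cocycle, and the linking system is recovered from it by twisting the transporter category.
  Other choices change the cocycle by a coboundary (\<open>twisted_linking_system\<close>, \<open>is_twisted\<close>,
  \<open>twist_iso_iff\<close>, summed up in \<open>linking_systems_correspond\<close>).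

  The cocycle is an equivariant function on chains of a preordered \<open>\<Gamma>\<close>-set: its points are the cosets of
  the subgroups of \<open>T\<close>, ordered by inclusion of stabilizers. A morphism \<open>g\<close> from \<open>P\<close> to \<open>Q\<close> is the chain that
  consists of the coset \<open>P/A\<close> and the translate of the coset \<open>Q/A\<close> by the inverse of \<open>g\<close>. Thus linking systems on a
  family are classified by the second equivariant cohomology with values in \<open>M\<close> of the part of
  this preorder that belongs to the family.

  On the whole preorder this cohomology vanishes, as for every coset of \<open>T\<close> the meet with that coset is
  a contraction, and the average over the cosets of \<open>T\<close> is equivariant; the number of cosets is prime
  to \<open>p\<close> (\<open>acyclic_2\<close>, \<open>acyclic_3\<close>). This gives existence and uniqueness for the family of all overgroups of \<open>M\<close>.
  Without the trivial subgroup, the long exact sequence of the pair identifies the second cohomology with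
  the third cohomology of the cochains on the whole preorder that vanish on chains whose first
  point has a nontrivial stabilizer (\<open>connecting_corr\<close>). Such a cochain only sees chains that start in a free orbit, so it is
  a bar cochain of the functor \<open>F_M\<close> on the orbit category (\<open>atomic_bar_corr\<close>). Dimension shifting
  along an injective resolution turns bar cohomology into the third derived functor
  (\<open>dimension_shift\<close>, \<open>higher_limit_resolves\<close>), which is \<open>\<Lambda>\<^sup>3(\<Gamma>;M)\<close>. If no proper overgroup exists, then
  \<open>T\<close> is trivial, relative cochains are all cochains, and \<open>\<Lambda>\<^sup>3(\<Gamma>;M)\<close> vanishes.

  Finally, a linking system on the smaller family that extends is a restriction of the unique one on
  the larger family, so exactly one class extends.
\<close>

abbreviation (input) equivalent (infixr "<->" 25) where "P <-> Q \<equiv> P \<longleftrightarrow> Q"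

section \<open>Characters of abelian groups\<close>

primrec nmul :: "nat => 'a::monoid_add => 'a" where
 "nmul 0 u = 0"
| "nmul (Suc n) u = u + nmul n u"

lemma nmul_add: "nmul (m + n) u = nmul m u + nmul n u"
 by (induction m) (simp_all add: add.assoc)

lemma nmul_nmul: "nmul m (nmul n u) = nmul (m * n) u"
 by (induction m) (simp_all add: nmul_add)

lemma nmul_zero [simp]: "nmul n 0 = 0"
 by (induction n) simp_all

lemma nmul_fun: "nmul n f x = nmul n (f x)"
 by (induction n) (simp_all add: zero_fun_def)

lemma sum_const_nmul: "finite I ==> (\<Sum>i\<in>I. u) = nmul (card I) u"
 by (induction I rule: finite_induct) simp_all

definition typegroup :: "'a::ab_group_add set => 'a monoid" where
 "typegroup D = \<lparr>carrier = D, monoid.mult = (+), one = 0\<rparr>"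

lemma typegroup_simps [simp]:
 "carrier (typegroup D) = D" "x \<otimes>\<^bsub>typegroup D\<^esub> y = x + y" "\<one>\<^bsub>typegroup D\<^esub> = 0"
 by (simp_all add: typegroup_def)

definition add_subgroup :: "'a::ab_group_add set => bool" where
 "add_subgroup D <-> 0 : D & (ALL x:D. ALL y:D. x + y : D) & (ALL x:D. - x : D)"

lemma add_subgroupD:
 assumes "add_subgroup D"
 shows "0 : D" "x : D ==> y : D ==> x + y : D" "x : D ==> - x : D" "x : D ==> y : D ==> x - y : D"
 using assms unfolding add_subgroup_def diff_conv_add_uminus by blast+

lemma add_subgroup_sum:
 "add_subgroup D ==> (!!i. i : I ==> f i : D) ==> sum f I : D"
 by (induction I rule: infinite_finite_induct) (auto simp: add_subgroupD)

lemma add_subgroup_nmul: "add_subgroup D ==> x : D ==> nmul n x : D"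
 by (induction n) (auto simp: add_subgroupD)

lemma comm_group_typegroup: "add_subgroup D ==> comm_group (typegroup D)"
 by (intro comm_groupI) (auto simp: add_subgroup_def add_ac intro: bexI[of _ "- _"])

lemma typegroup_pow: "x [^]\<^bsub>typegroup D\<^esub> (n::nat) = nmul n x"
 by (induction n) (simp_all add: add.commute)

text \<open>
  The circle is divisible and has elements of every finite order. Hence homomorphisms into it extend
  from subgroups and separate elements, and every abelian group, given as a record, embeds in a type of
  class \<open>ab_group_add\<close>. Cochains can then be added and subtracted pointwise.
\<close>

typedef circle = "{z::complex. norm z = 1}"
 by (rule exI[of _ 1]) simp

setup_lifting type_definition_circle

instantiation circle :: ab_group_add
begin
lift_definition zero_circle :: circle is 1 by simp
lift_definition plus_circle :: "circle => circle => circle" is "(*)" by (simp add: norm_mult)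
lift_definition uminus_circle :: "circle => circle" is inverse by (simp add: norm_inverse)
lift_definition minus_circle :: "circle => circle => circle" is "(/)" by (simp add: norm_divide)
instance
proof
 fix a b c :: circle
 show "a + b + c = a + (b + c)" by transfer simp
 show "a + b = b + a" by transfer simp
 show "0 + a = a" by transfer simp
 show "- a + a = 0" by transfer (auto intro!: left_inverse)
 show "a - b = a + - b" by transfer (simp add: divide_inverse)
qed
end

lift_definition cis_circle :: "real => circle" is cis by simp

lemma cis_circle_surj: "EX t. z = cis_circle t"
proof (transfer)
 fix z :: complex assume "norm z = 1"
 hence "z = cis (Arg z)" using rcis_cmod_Arg[of z] by (simp add: rcis_def)
 thus "EX t. z = cis t" by blast
qed

lemma nmul_cis_circle: "nmul n (cis_circle t) = cis_circle (real n * t)"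
proof (induction n)
 case 0 show ?case by simp (transfer, simp)
next
 case (Suc n) thus ?case by simp (transfer, simp add: cis_mult algebra_simps)
qed

lemma circle_divisible:
 assumes "n > 0" shows "EX w::circle. nmul n w = z"
proof -
 obtain t where t: "z = cis_circle t" using cis_circle_surj by blast
 have "nmul n (cis_circle (t / n)) = z" using assms by (simp add: nmul_cis_circle t)
 thus ?thesis by blast
qed

lemma circle_torsion:
 assumes "n >= 2" shows "EX d::circle. d ~= 0 & nmul n d = 0"
proof -
 let ?d = "cis_circle (2 * pi / n)"
 have "nmul n ?d = 0" using assms by (simp add: nmul_cis_circle) (transfer, simp)
 moreover have "?d ~= 0"
 proof
  assume "?d = 0"
  hence "cis (2 * pi / n) = 1" by transfer simp
  hence "cos (2 * pi / n) = 1" by (metis cis.sel(1) one_complex.sel(1))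
  moreover have "0 < 2 * pi / n" "2 * pi / n <= pi" using assms by (auto simp: field_simps)
  ultimately show False using cos_monotone_0_pi[of 0 "2 * pi / n"] by simp
 qed
 ultimately show ?thesis by blast
qed

text \<open>
  Graphs of homomorphisms from subgroups of \<open>A\<close>, so that a partial homomorphism is a set and Zorn's
  lemma applies to inclusion.
\<close>

definition partial_hom_graph ::
  "('a, 'b) monoid_scheme => ('d, 'c) monoid_scheme => ('a \<times> 'd) set => bool" where
 "partial_hom_graph A D R <-> subgroup R (A \<times>\<times> D) & (ALL d. (\<one>\<^bsub>A\<^esub>, d) : R --> d = \<one>\<^bsub>D\<^esub>)"

lemma comm_group_DirProd:
 assumes "comm_group A" "comm_group D" shows "comm_group (A \<times>\<times> D)"
proof -
 interpret A: comm_group A by fact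
 interpret D: comm_group D by fact
 interpret AD: group "A \<times>\<times> D" by (rule DirProd_group) unfold_locales
 show ?thesis
  by (rule AD.group_comm_groupI) (auto simp: A.m_comm D.m_comm)
qed

lemma int_pow_DirProd:
 assumes "group A" "group D" "x : carrier A" "d : carrier D"
 shows "(x, d) [^]\<^bsub>A \<times>\<times> D\<^esub> (n::int) = (x [^]\<^bsub>A\<^esub> n, d [^]\<^bsub>D\<^esub> n)"
proof -
 interpret AD: group "A \<times>\<times> D" by (rule DirProd_group) fact+
 have nat: "(x, d) [^]\<^bsub>A \<times>\<times> D\<^esub> (k::nat) = (x [^]\<^bsub>A\<^esub> k, d [^]\<^bsub>D\<^esub> k)" for k
  by (induction k) simp_all
 have cl: "x [^]\<^bsub>A\<^esub> (k::nat) : carrier A" "d [^]\<^bsub>D\<^esub> (k::nat) : carrier D" for k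
  using assms by (auto intro: monoid.nat_pow_closed group.is_monoid)
 show ?thesis
 proof (cases "n >= 0")
  case True
  then obtain m where "n = int m" using nonneg_int_cases by blast
  thus ?thesis by (simp only: int_pow_int nat)
 next
  case False
  then obtain m where n: "n = - int m" by (metis nat_0_le neg_0_le_iff_le minus_minus nle_le)
  have "(x, d) : carrier (A \<times>\<times> D)" using assms by simp
  thus ?thesis
   unfolding n using assms cl
   by (simp only: AD.int_pow_neg_int group.int_pow_neg_int nat inv_DirProd)
 qed
qed

lemma partial_hom_graph_unique:
 assumes "group A" "group D" "partial_hom_graph A D R" "(x, d) : R" "(x, e) : R"
 shows "d = e"
proof -
 interpret A: group A by fact
 interpret D: group D by fact
 interpret AD: group "A \<times>\<times> D" by (rule DirProd_group) fact+
 interpret R: subgroup R "A \<times>\<times> D" using assms(3) by (simp add: partial_hom_graph_def)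
 have c: "x : carrier A" "d : carrier D" "e : carrier D" using assms(4,5) R.subset by auto
 have "(x, d) \<otimes>\<^bsub>A \<times>\<times> D\<^esub> inv\<^bsub>A \<times>\<times> D\<^esub> (x, e) : R" using assms(4,5) by blast
 hence "(\<one>\<^bsub>A\<^esub>, d \<otimes>\<^bsub>D\<^esub> inv\<^bsub>D\<^esub> e) : R" using c assms(1,2) by simp
 hence "d \<otimes>\<^bsub>D\<^esub> inv\<^bsub>D\<^esub> e = \<one>\<^bsub>D\<^esub>" using assms(3) by (simp add: partial_hom_graph_def)
 thus ?thesis using c by (simp add: D.inv_equality D.inv_solve_right')
qed

text \<open>
  To extend by \<open>a\<close>, it is enough to find a value whose multiples agree with the values already
  prescribed on the multiples of \<open>a\<close>.
\<close>

lemma partial_hom_graph_step: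
 assumes "comm_group A" "comm_group D" "partial_hom_graph A D R" "x : carrier A" "d : carrier D"
  and d: "!!n::int. !!e. (x [^]\<^bsub>A\<^esub> n, e) : R ==> e = d [^]\<^bsub>D\<^esub> n"
 shows "EX R'. partial_hom_graph A D R' & R \<subseteq> R' & (x, d) : R'"
proof -
 interpret A: comm_group A by fact
 interpret D: comm_group D by fact
 interpret AD: comm_group "A \<times>\<times> D" by (rule comm_group_DirProd) fact+
 have R: "subgroup R (A \<times>\<times> D)" using assms(3) by (simp add: partial_hom_graph_def)
 interpret R: subgroup R "A \<times>\<times> D" by (rule R)
 let ?K = "generate (A \<times>\<times> D) {(x, d)}"
 have K: "subgroup ?K (A \<times>\<times> D)" using assms by (intro AD.generate_is_subgroup) auto
 interpret K: subgroup ?K "A \<times>\<times> D" by (rule K)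
 let ?R' = "R <#>\<^bsub>A \<times>\<times> D\<^esub> ?K"
 have Kel: "?K = {(x [^]\<^bsub>A\<^esub> n, d [^]\<^bsub>D\<^esub> n) | n::int. n : UNIV}"
  using assms by (simp add: AD.generate_pow int_pow_DirProd)
 have "subgroup ?R' (A \<times>\<times> D)" using R K by (rule AD.mult_subgroups)
 moreover have "c = \<one>\<^bsub>D\<^esub>" if "(\<one>\<^bsub>A\<^esub>, c) : ?R'" for c
 proof -
  from that obtain y e n where ye: "(y, e) : R" "\<one>\<^bsub>A\<^esub> = y \<otimes>\<^bsub>A\<^esub> x [^]\<^bsub>A\<^esub> (n::int)" "c = e \<otimes>\<^bsub>D\<^esub> d [^]\<^bsub>D\<^esub> n"
   unfolding set_mult_def Kel by auto
  have c: "y : carrier A" "e : carrier D" using ye(1) R.subset by auto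
  have "y = inv\<^bsub>A\<^esub> (x [^]\<^bsub>A\<^esub> n)" using ye(2) c assms(4) by (metis A.inv_equality A.int_pow_closed)
  hence "y = x [^]\<^bsub>A\<^esub> (- n)" using assms(4) by (simp add: A.int_pow_neg)
  hence "e = d [^]\<^bsub>D\<^esub> (- n)" using d ye(1) by blast
  thus ?thesis using ye(3) assms(5) by (simp add: D.int_pow_neg)
 qed
 moreover have "R \<subseteq> ?R'"
 proof
  fix r assume r: "r : R"
  hence "r \<otimes>\<^bsub>A \<times>\<times> D\<^esub> \<one>\<^bsub>A \<times>\<times> D\<^esub> : ?R'" using K.one_closed unfolding set_mult_def by blast
  thus "r : ?R'" using r R.subset by (metis AD.r_one subsetD)
 qed
 moreover have "(x, d) : ?R'"
 proof -
  have "(x, d) : ?K" by (rule generate.incl) simp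
  hence "\<one>\<^bsub>A \<times>\<times> D\<^esub> \<otimes>\<^bsub>A \<times>\<times> D\<^esub> (x, d) : ?R'" using R.one_closed unfolding set_mult_def by blast
  thus ?thesis using assms(4,5) by simp
 qed
 ultimately show ?thesis unfolding partial_hom_graph_def by blast
qed

lemma least_power_divides:
 assumes A: "group A" and H: "subgroup H A" and "x : carrier A"
  and k: "k = (LEAST k::nat. k > 0 & x [^]\<^bsub>A\<^esub> k : H)" "k > 0" "x [^]\<^bsub>A\<^esub> k : H"
  and n: "x [^]\<^bsub>A\<^esub> (n::int) : H"
 shows "int k dvd n"
proof -
 interpret A: group A by fact
 let ?r = "n mod int k"
 have "x [^]\<^bsub>A\<^esub> ?r = x [^]\<^bsub>A\<^esub> n \<otimes>\<^bsub>A\<^esub> inv\<^bsub>A\<^esub> ((x [^]\<^bsub>A\<^esub> int k) [^]\<^bsub>A\<^esub> (n div int k))"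
  using assms(3) by (simp add: A.int_pow_pow A.int_pow_diff [symmetric] minus_mult_div_eq_mod)
 moreover have "(x [^]\<^bsub>A\<^esub> int k) [^]\<^bsub>A\<^esub> (n div int k) : H"
  using A.subgroup_int_pow_closed[OF H] k(3) by (simp add: int_pow_int)
 ultimately have "x [^]\<^bsub>A\<^esub> ?r : H" using n H by (simp add: subgroup.m_closed subgroup.m_inv_closed)
 moreover have "?r = int (nat ?r)" using k(2) by simp
 ultimately have "x [^]\<^bsub>A\<^esub> nat ?r : H" by (metis int_pow_int)
 moreover have "nat ?r < k" using k(2) by (simp add: nat_less_iff)
 ultimately have "nat ?r = 0" using k(1) not_less_Least by blast
 moreover have "0 <= ?r" using k(2) by simp
 ultimately have "?r = 0" by simp
 thus ?thesis by (simp only: dvd_eq_mod_eq_0)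
qed

lemma no_power_zero:
 assumes A: "group A" and H: "subgroup H A" and "x : carrier A"
  and no: "~ (EX k::nat. k > 0 & x [^]\<^bsub>A\<^esub> k : H)" and n: "x [^]\<^bsub>A\<^esub> (n::int) : H"
 shows "n = 0"
proof (rule ccontr)
 interpret A: group A by fact
 assume "n ~= 0"
 have "x [^]\<^bsub>A\<^esub> (- n) : H"
  using n assms(3) H by (simp add: A.int_pow_neg subgroup.m_inv_closed)
 hence "x [^]\<^bsub>A\<^esub> int (nat \<bar>n\<bar>) : H" using n by (cases "n >= 0") auto
 hence "x [^]\<^bsub>A\<^esub> nat \<bar>n\<bar> : H" by (simp only: int_pow_int)
 thus False using no \<open>n ~= 0\<close> by (metis zero_less_abs_iff zero_less_nat_eq)
qed

lemma subgroup_fst: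
 assumes "group A" "group D" "subgroup R (A \<times>\<times> D)"
 shows "subgroup (fst ` R) A"
proof -
 interpret A: group A by fact
 interpret D: group D by fact
 interpret AD: group "A \<times>\<times> D" by (rule DirProd_group) fact+
 interpret h: group_hom "A \<times>\<times> D" A fst
  by unfold_locales (auto simp: hom_def)
 show ?thesis using assms(3) by (rule h.subgroup_img_is_subgroup)
qed

definition divisible :: "('d, 'c) monoid_scheme => bool" where
 "divisible D <-> (ALL d:carrier D. ALL n::nat. n > 0 --> (EX e:carrier D. e [^]\<^bsub>D\<^esub> n = d))"

text \<open>
  The multiples of \<open>a\<close> in the domain are generated by the least positive one, if there is any, and
  divisibility gives a value at \<open>a\<close> with the prescribed multiple.
\<close>

lemma partial_hom_graph_extend:
 assumes A: "comm_group A" and D: "comm_group D" and dv: "divisible D"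
  and R0: "partial_hom_graph A D R0"
 shows "EX R. partial_hom_graph A D R & R0 \<subseteq> R & fst ` R = carrier A"
proof -
 interpret A: comm_group A by fact
 interpret D: comm_group D by fact
 interpret AD: comm_group "A \<times>\<times> D" by (rule comm_group_DirProd) fact+
 let ?X = "{R. partial_hom_graph A D R & R0 \<subseteq> R}"
 have "EX R:?X. ALL R':?X. R \<subseteq> R' --> R' = R"
 proof (rule subset_Zorn_nonempty)
  show "?X ~= {}" using R0 by blast
  fix C assume C: "C ~= {}" "subset.chain ?X C"
  hence CX: "!!R. R : C ==> partial_hom_graph A D R" "!!R. R : C ==> R0 \<subseteq> R"
   and tot: "!!R R'. R : C ==> R' : C ==> R \<subseteq> R' | R' \<subseteq> R"
   unfolding subset.chain_def by blast+
  have sg: "!!R. R : C ==> subgroup R (A \<times>\<times> D)" using CX(1) by (simp add: partial_hom_graph_def)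
  have "subgroup (\<Union>C) (A \<times>\<times> D)"
  proof (rule AD.subgroupI)
   show "\<Union>C \<subseteq> carrier (A \<times>\<times> D)" using sg subgroup.subset by blast
   show "\<Union>C ~= {}" using C(1) sg subgroup.one_closed by blast
   show "inv\<^bsub>A \<times>\<times> D\<^esub> a : \<Union>C" if "a : \<Union>C" for a
    using that sg subgroup.m_inv_closed by (metis Union_iff)
   show "a \<otimes>\<^bsub>A \<times>\<times> D\<^esub> b : \<Union>C" if ab: "a : \<Union>C" "b : \<Union>C" for a b
   proof -
    from ab obtain R R' where "a : R" "R : C" "b : R'" "R' : C" by blast
    with tot[of R R'] obtain R'' where "R'' : C" "a : R''" "b : R''" by blast
    thus ?thesis using subgroup.m_closed[OF sg] by (intro UnionI[of R'']) auto
   qed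
  qed
  moreover have "d = \<one>\<^bsub>D\<^esub>" if "(\<one>\<^bsub>A\<^esub>, d) : \<Union>C" for d
   using that CX(1) by (auto simp: partial_hom_graph_def)
  moreover have "R0 \<subseteq> \<Union>C" using C(1) CX(2) by blast
  ultimately show "\<Union>C : ?X" by (simp add: partial_hom_graph_def)
 qed
 then obtain R where RX: "R : ?X" and mx: "ALL R':?X. R \<subseteq> R' --> R' = R" by (rule bexE)
 from RX have R: "partial_hom_graph A D R" "R0 \<subseteq> R" by simp_all
 have max: "R' = R" if "partial_hom_graph A D R'" "R \<subseteq> R'" for R'
 proof -
  have "R' : ?X" using that R(2) by simp
  thus ?thesis using mx that(2) by simp
 qed
 have sR: "subgroup R (A \<times>\<times> D)" using R(1) by (simp add: partial_hom_graph_def)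
 have sF: "subgroup (fst ` R) A" by (rule subgroup_fst[OF _ _ sR]) unfold_locales
 have "x : fst ` R" if x: "x : carrier A" for x
 proof -
  have "EX d:carrier D. ALL n::int. ALL e. (x [^]\<^bsub>A\<^esub> n, e) : R --> e = d [^]\<^bsub>D\<^esub> n"
  proof (cases "EX k::nat. k > 0 & x [^]\<^bsub>A\<^esub> k : fst ` R")
   case False
   have "e = \<one>\<^bsub>D\<^esub> [^]\<^bsub>D\<^esub> n" if "(x [^]\<^bsub>A\<^esub> n, e) : R" for n :: int and e
   proof -
    have "n = 0" using no_power_zero[OF A.is_group sF x False] that by force
    thus ?thesis using that R(1) by (simp add: partial_hom_graph_def)
   qed
   thus ?thesis by blast
  next
   case True
   define k where "k = (LEAST k::nat. k > 0 & x [^]\<^bsub>A\<^esub> k : fst ` R)"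
   have k: "k > 0" "x [^]\<^bsub>A\<^esub> k : fst ` R" using LeastI_ex[OF True] unfolding k_def by auto
   then obtain e0 where e0: "(x [^]\<^bsub>A\<^esub> k, e0) : R" by auto
   have e0D: "e0 : carrier D" using e0 sR subgroup.subset by fastforce
   then obtain d where d: "d : carrier D" "d [^]\<^bsub>D\<^esub> k = e0" using dv k(1) unfolding divisible_def by blast
   have "e = d [^]\<^bsub>D\<^esub> n" if xe: "(x [^]\<^bsub>A\<^esub> n, e) : R" for n :: int and e
   proof -
    have "int k dvd n" using least_power_divides[OF A.is_group sF x k_def k] xe by force
    then obtain q where q: "n = int k * q" by blast
    have "(x [^]\<^bsub>A\<^esub> k, e0) [^]\<^bsub>A \<times>\<times> D\<^esub> q : R" using AD.subgroup_int_pow_closed[OF sR e0] .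
    hence "((x [^]\<^bsub>A\<^esub> int k) [^]\<^bsub>A\<^esub> q, (d [^]\<^bsub>D\<^esub> int k) [^]\<^bsub>D\<^esub> q) : R"
     using x d by (simp add: int_pow_DirProd A.is_group D.is_group int_pow_int e0D)
    hence "(x [^]\<^bsub>A\<^esub> n, d [^]\<^bsub>D\<^esub> n) : R"
     using x d q by (simp add: A.int_pow_pow D.int_pow_pow)
    thus ?thesis using partial_hom_graph_unique[OF A.is_group D.is_group R(1) xe] by blast
   qed
   thus ?thesis using d(1) by blast
  qed
  then obtain d where "d : carrier D" "!!n::int. !!e. (x [^]\<^bsub>A\<^esub> n, e) : R ==> e = d [^]\<^bsub>D\<^esub> n" by blast
  then obtain R' where "partial_hom_graph A D R'" "R \<subseteq> R'" "(x, d) : R'"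
   using partial_hom_graph_step[OF A D R(1) x] by blast
  thus ?thesis using max by force
 qed
 hence "fst ` R = carrier A" using sF subgroup.subset by blast
 thus ?thesis using R by blast
qed

lemma partial_hom_graph_hom:
 assumes A: "comm_group A" and D: "comm_group D" and R: "partial_hom_graph A D R" "fst ` R = carrier A"
 shows "EX ps:hom A D. ALL (x, d):R. ps x = d"
proof -
 interpret A: comm_group A by fact
 interpret D: comm_group D by fact
 have sR: "subgroup R (A \<times>\<times> D)" using R(1) by (simp add: partial_hom_graph_def)
 have RD: "!!x d. (x, d) : R ==> d : carrier D" using sR subgroup.subset by fastforce
 note u = partial_hom_graph_unique[OF A.is_group D.is_group R(1)]
 define ps where "ps x = (SOME d. (x, d) : R)" for x
 have ps: "(x, ps x) : R" if "x : carrier A" for x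
  using that R(2) someI_ex[of "%d. (x, d) : R"] unfolding ps_def by force
 have "ps : hom A D"
 proof (rule homI)
  fix x y assume xy: "x : carrier A" "y : carrier A"
  show "ps x : carrier D" using ps RD xy by blast
  have "(x \<otimes>\<^bsub>A\<^esub> y, ps x \<otimes>\<^bsub>D\<^esub> ps y) : R" using subgroup.m_closed[OF sR ps[OF xy(1)] ps[OF xy(2)]] by simp
  thus "ps (x \<otimes>\<^bsub>A\<^esub> y) = ps x \<otimes>\<^bsub>D\<^esub> ps y" using u ps xy by blast
 qed
 moreover have "ALL (x, d):R. ps x = d"
 proof safe
  fix x d assume xd: "(x, d) : R"
  hence "x : carrier A" using R(2) by force
  thus "ps x = d" using u[OF ps xd] by blast
 qed
 ultimately show ?thesis by blast
qed

lemma hom_extend_divisible: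
 assumes A: "comm_group A" and D: "comm_group D" and dv: "divisible D"
  and H: "subgroup H A" and \<phi>: "\<phi> : hom (A\<lparr>carrier := H\<rparr>) D"
 shows "EX ps:hom A D. ALL x:H. ps x = \<phi> x"
proof -
 interpret A: comm_group A by fact
 interpret D: comm_group D by fact
 interpret H: subgroup H A by fact
 interpret AD: comm_group "A \<times>\<times> D" by (rule comm_group_DirProd) fact+
 interpret HG: group "A\<lparr>carrier := H\<rparr>" using H by (rule A.subgroup_imp_group)
 interpret h: group_hom "A\<lparr>carrier := H\<rparr>" D \<phi> by unfold_locales (rule \<phi>)
 define R0 where "R0 = (%x. (x, \<phi> x)) ` H"
 have "subgroup R0 (A \<times>\<times> D)"
 proof (rule AD.subgroupI)
  show "R0 \<subseteq> carrier (A \<times>\<times> D)" using H.subset h.hom_closed by (auto simp: R0_def)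
  show "R0 ~= {}" using H.one_closed unfolding R0_def by blast
  show "inv\<^bsub>A \<times>\<times> D\<^esub> a : R0" if a: "a : R0" for a
  proof -
   from a obtain x where x: "x : H" "a = (x, \<phi> x)" by (auto simp: R0_def)
   have "\<phi> (inv\<^bsub>A\<^esub> x) = inv\<^bsub>D\<^esub> (\<phi> x)" using h.hom_inv[of x] x(1) A.m_inv_consistent[OF H] by simp
   thus ?thesis using x h.hom_closed[of x] by (auto simp: R0_def A.is_group D.is_group H.mem_carrier intro!: image_eqI[of _ _ "inv\<^bsub>A\<^esub> x"])
  qed
  show "a \<otimes>\<^bsub>A \<times>\<times> D\<^esub> b : R0" if ab: "a : R0" "b : R0" for a b
  proof -
   from ab obtain x y where xy: "x : H" "a = (x, \<phi> x)" "y : H" "b = (y, \<phi> y)" by (auto simp: R0_def)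
   have "\<phi> (x \<otimes>\<^bsub>A\<^esub> y) = \<phi> x \<otimes>\<^bsub>D\<^esub> \<phi> y" using h.hom_mult[of x y] xy by simp
   thus ?thesis using xy by (auto simp: R0_def intro!: image_eqI[of _ _ "x \<otimes>\<^bsub>A\<^esub> y"])
  qed
 qed
 hence "partial_hom_graph A D R0"
  using h.hom_one by (auto simp: partial_hom_graph_def R0_def)
 then obtain R where R: "partial_hom_graph A D R" "R0 \<subseteq> R" "fst ` R = carrier A"
  using partial_hom_graph_extend[OF A D dv] by blast
 then obtain ps where "ps : hom A D" "ALL (x, d):R. ps x = d" using partial_hom_graph_hom[OF A D R(1,3)] by blast
 thus ?thesis using R(2) by (intro bexI[of _ ps]) (auto simp: R0_def)
qed

abbreviation circle_group :: "circle monoid" where "circle_group \<equiv> typegroup UNIV"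

lemma comm_group_circle: "comm_group circle_group"
 by (rule comm_group_typegroup) (simp add: add_subgroup_def)

text \<open>
  A nontrivial character of the cyclic group generated by the class of \<open>x\<close>, extended to everything.
\<close>

lemma characters_separate:
 assumes A: "comm_group A" and N: "subgroup N A" and x: "x : carrier A" "x ~: N"
 shows "EX \<chi>:hom A circle_group. (ALL y:N. \<chi> y = 0) & \<chi> x ~= 0"
proof -
 interpret A: comm_group A by fact
 interpret D: comm_group circle_group by (rule comm_group_circle)
 interpret N: subgroup N A by fact
 interpret AD: comm_group "A \<times>\<times> circle_group" by (rule comm_group_DirProd) unfold_locales
 have dv: "divisible circle_group" using circle_divisible by (auto simp: divisible_def typegroup_pow)
 define R0 where "R0 = N \<times> {0::circle}"
 have "subgroup R0 (A \<times>\<times> circle_group)"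
  unfolding R0_def using D.triv_subgroup by (intro DirProd_subgroups) (auto simp: A.is_group D.is_group N)
 hence R0: "partial_hom_graph A circle_group R0" by (auto simp: partial_hom_graph_def R0_def)
 have "EX d~=0. ALL n::int. x [^]\<^bsub>A\<^esub> n : N --> d [^]\<^bsub>circle_group\<^esub> n = 0"
 proof (cases "EX k::nat. k > 0 & x [^]\<^bsub>A\<^esub> k : N")
  case False
  obtain d :: circle where "d ~= 0" using circle_torsion[of 2] by auto
  thus ?thesis using no_power_zero[OF A.is_group N x(1) False]
   by (intro exI[of _ d]) (metis int_pow_0 typegroup_simps(3))
 next
  case True
  define k where "k = (LEAST k::nat. k > 0 & x [^]\<^bsub>A\<^esub> k : N)"
  have k: "k > 0" "x [^]\<^bsub>A\<^esub> k : N" using LeastI_ex[OF True] unfolding k_def by auto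
  have "k ~= 1" using k x by auto
  then obtain d :: circle where d: "d ~= 0" "nmul k d = 0" using circle_torsion[of k] k by force
  have "d [^]\<^bsub>circle_group\<^esub> n = 0" if xn: "x [^]\<^bsub>A\<^esub> n : N" for n :: int
  proof -
   obtain q where q: "n = int k * q" using least_power_divides[OF A.is_group N x(1) k_def k xn] by blast
   have "d [^]\<^bsub>circle_group\<^esub> n = (d [^]\<^bsub>circle_group\<^esub> int k) [^]\<^bsub>circle_group\<^esub> q"
    by (simp add: q D.int_pow_pow)
   also have "... = 0" using D.int_pow_one[of q] by (simp add: int_pow_int typegroup_pow d)
   finally show ?thesis .
  qed
  thus ?thesis using d(1) by blast
 qed
 then obtain d where d: "d ~= 0" "!!n::int. x [^]\<^bsub>A\<^esub> n : N ==> d [^]\<^bsub>circle_group\<^esub> n = 0" by blast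
 have "!!n::int. !!e. (x [^]\<^bsub>A\<^esub> n, e) : R0 ==> e = d [^]\<^bsub>circle_group\<^esub> n" using d(2) by (auto simp: R0_def)
 then obtain R1 where R1: "partial_hom_graph A circle_group R1" "R0 \<subseteq> R1" "(x, d) : R1"
  using partial_hom_graph_step[OF A comm_group_circle R0 x(1), of d] by auto
 then obtain R where R: "partial_hom_graph A circle_group R" "R1 \<subseteq> R" "fst ` R = carrier A"
  using partial_hom_graph_extend[OF A comm_group_circle dv] by blast
 then obtain ps where ps: "ps : hom A circle_group" "ALL (x, d):R. ps x = d"
  using partial_hom_graph_hom[OF A comm_group_circle R(1,3)] by blast
 have "ps y = 0" if "y : N" for y
 proof -
  have "(y, 0) : R0" using that by (simp add: R0_def)
  thus ?thesis using R1(2) R(2) ps(2) by fastforce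
 qed
 moreover have "ps x = d" using R1(3) R(2) ps(2) by fastforce
 ultimately show ?thesis using ps(1) d(1) by (intro bexI[of _ ps]) auto
qed

type_synonym 'v bidual = "('v => circle) => circle"

text \<open>
  Evaluation at the characters that vanish on \<open>N\<close>.
\<close>

lemma bidual_embedding:
 assumes A: "comm_group A" and N: "subgroup N A"
 shows "EX e :: 'v => 'v bidual. (ALL x:carrier A. ALL y:carrier A. e (x \<otimes>\<^bsub>A\<^esub> y) = e x + e y) &
      (ALL x:carrier A. e x = 0 <-> x : N)"
proof -
 define e :: "'v => 'v bidual" where
  "e x = (%\<chi>. if \<chi> : hom A circle_group & (ALL y:N. \<chi> y = 0) then \<chi> x else 0)" for x
 have "e (x \<otimes>\<^bsub>A\<^esub> y) = e x + e y" if "x : carrier A" "y : carrier A" for x y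
  using that by (auto simp: e_def fun_eq_iff hom_def)
 moreover have "e x = 0 <-> x : N" if xA: "x : carrier A" for x
 proof
  assume "x : N" thus "e x = 0" by (auto simp: e_def fun_eq_iff)
 next
  assume e0: "e x = 0"
  show "x : N"
  proof (rule ccontr)
   assume "x ~: N"
   then obtain \<chi> where "\<chi> : hom A circle_group" "ALL y:N. \<chi> y = 0" "\<chi> x ~= 0"
    using characters_separate[OF A N xA \<open>x ~: N\<close>] by blast
   moreover have "e x \<chi> = 0" by (simp add: e0)
   ultimately show False by (simp add: e_def)
  qed
 qed
 ultimately show ?thesis by blast
qed

section \<open>Injective presheaves\<close>

lemma infinite_pairing: "EX pr :: 'u::infinite \<times> 'u => 'u. inj pr"
proof -
 have "(card_of ((UNIV :: 'u set) \<times> (UNIV :: 'u set)), card_of (UNIV :: 'u set)) : ordIso"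
  by (rule card_of_Times_same_infinite) (rule infinite_UNIV)
 then obtain f :: "'u \<times> 'u => 'u" where "bij_betw f (UNIV \<times> UNIV) UNIV" using card_of_ordIso by blast
 hence "inj f" by (simp add: bij_betw_def)
 thus ?thesis by blast
qed

lemma infinite_nat_embedding: "EX nm :: nat => 'u::infinite. inj nm"
 using infinite_countable_subset[OF infinite_UNIV[where 'a = 'u]] by blast

text \<open>
  The resolving presheaves must have values in the given infinite type. Presheaves are therefore built
  in a convenient type and transported along injections into that type; finitely many values of
  a function on a finite set can be coded by one element.
\<close>

lemma code_functions:
 assumes "finite W"
 shows "EX kp :: ('w => 'u::infinite) => 'u. inj_on kp (extensional W)"
 using assms
proof (induction W rule: finite_induct)
 case empty
 have "extensional {} = {%_::'w. undefined :: 'u}" by (auto simp: extensional_def)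
 thus ?case by (intro exI[of _ "%_. undefined"]) simp
next
 case (insert w W)
 then obtain kp :: "('w => 'u) => 'u" where kp: "inj_on kp (extensional W)" by blast
 obtain pr :: "'u \<times> 'u => 'u" where pr: "inj pr" using infinite_pairing by blast
 have "inj_on (%f. pr (f w, kp (restrict f W))) (extensional (insert w W))"
 proof (rule inj_onI)
  fix f g assume fg: "f : extensional (insert w W)" "g : extensional (insert w W)"
   and eq: "pr (f w, kp (restrict f W)) = pr (g w, kp (restrict g W))"
  have "(f w, kp (restrict f W)) = (g w, kp (restrict g W))" using pr eq by (rule injD)
  hence w: "f w = g w" and k: "kp (restrict f W) = kp (restrict g W)" by simp_all
  have r: "restrict f W = restrict g W" using kp k unfolding inj_on_def by simp
  show "f = g"
  proof (rule extensionalityI[OF fg])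
   fix x assume "x : insert w W"
   thus "f x = g x" using w fun_cong[OF r, of x] by (auto simp: restrict_def split: if_splits)
  qed
 qed
 thus ?case by blast
qed

datatype 'v tm = Leaf 'v | Plus "'v tm" "'v tm" | Neg "'v tm" | Div nat "'v tm"

text \<open>
  Elements of the divisible hull constructed below are named by terms over a subgroup, so there are no more
  of them than elements of an infinite type.
\<close>

lemma code_terms:
 fixes io :: "'v => 'u::infinite"
 assumes "inj_on io C"
 shows "EX enc :: 'v tm => 'u. inj_on enc {t. set_tm t \<subseteq> C}"
proof -
 obtain pr :: "'u \<times> 'u => 'u" where pr: "inj pr" using infinite_pairing by blast
 obtain nm :: "nat => 'u" where nm: "inj nm" using infinite_nat_embedding by blast
 define enc :: "'v tm => 'u" where
  "enc = rec_tm (%x. pr (nm 0, io x)) (%s t a b. pr (nm 1, pr (a, b))) (%t a. pr (nm 2, a)) (%n t a. pr (nm 3, pr (nm n, a)))"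
 have enc: "enc (Leaf x) = pr (nm 0, io x)" "enc (Plus s t) = pr (nm 1, pr (enc s, enc t))"
  "enc (Neg t) = pr (nm 2, enc t)" "enc (Div n t) = pr (nm 3, pr (nm n, enc t))" for x s t n
  by (simp_all add: enc_def)
 have prD: "pr (a, b) = pr (c, d) <-> a = c & b = d" for a b c d using pr by (auto dest: injD)
 have nmD: "nm a = nm b <-> a = b" for a b using nm by (auto dest: injD)
 have "s = t" if "set_tm s \<subseteq> C" "set_tm t \<subseteq> C" "enc s = enc t" for s t
  using that
 proof (induction s arbitrary: t)
  case (Leaf x)
  thus ?case using inj_onD[OF assms] by (cases t) (auto simp: enc prD nmD)
 next
  case (Plus s1 s2)
  thus ?case by (cases t) (auto simp: enc prD nmD)
 next
  case (Neg s)
  thus ?case by (cases t) (auto simp: enc prD nmD)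
 next
  case (Div n s)
  thus ?case by (cases t) (auto simp: enc prD nmD)
 qed
 thus ?thesis by (intro exI[of _ enc] inj_onI) simp
qed

lemma bidual_divisible:
 assumes "n > 0" shows "EX w :: 'v bidual. nmul n w = z"
proof -
 define w :: "'v bidual" where "w \<chi> = (SOME c. nmul n c = z \<chi>)" for \<chi>
 have "nmul n (w \<chi>) = z \<chi>" for \<chi>
  unfolding w_def by (rule someI_ex) (rule circle_divisible[OF assms])
 hence "nmul n w = z" by (intro ext) (simp add: nmul_fun)
 thus ?thesis by blast
qed

definition code_group :: "('v => 'u) => ('v, 'b) monoid_scheme => 'u monoid" where
 "code_group kp K = \<lparr>carrier = kp ` carrier K,
   monoid.mult = (%x y. kp (inv_into (carrier K) kp x \<otimes>\<^bsub>K\<^esub> inv_into (carrier K) kp y)), one = kp \<one>\<^bsub>K\<^esub>\<rparr>"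

lemma comm_group_code:
 assumes K: "comm_group K" and kp: "inj_on kp (carrier K)"
 shows "comm_group (code_group kp K)"
proof -
 interpret K: comm_group K by fact
 note [simp] = inv_into_f_f[OF kp]
 show ?thesis
 proof (rule comm_groupI)
  fix x y z
  assume x: "x : carrier (code_group kp K)" and y: "y : carrier (code_group kp K)" and z: "z : carrier (code_group kp K)"
  thus "x \<otimes>\<^bsub>code_group kp K\<^esub> y \<otimes>\<^bsub>code_group kp K\<^esub> z = x \<otimes>\<^bsub>code_group kp K\<^esub> (y \<otimes>\<^bsub>code_group kp K\<^esub> z)"
   by (auto simp: code_group_def K.m_assoc)
 next
  fix x y
  assume x: "x : carrier (code_group kp K)" and y: "y : carrier (code_group kp K)"
  thus "x \<otimes>\<^bsub>code_group kp K\<^esub> y : carrier (code_group kp K)"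
   and "x \<otimes>\<^bsub>code_group kp K\<^esub> y = y \<otimes>\<^bsub>code_group kp K\<^esub> x"
   by (auto simp: code_group_def K.m_comm)
 next
  show "\<one>\<^bsub>code_group kp K\<^esub> : carrier (code_group kp K)" by (simp add: code_group_def)
  fix x assume x: "x : carrier (code_group kp K)"
  thus "\<one>\<^bsub>code_group kp K\<^esub> \<otimes>\<^bsub>code_group kp K\<^esub> x = x" by (auto simp: code_group_def)
  from x obtain k where k: "k : carrier K" "x = kp k" by (auto simp: code_group_def)
  have "kp (inv\<^bsub>K\<^esub> k) \<otimes>\<^bsub>code_group kp K\<^esub> x = \<one>\<^bsub>code_group kp K\<^esub>" "kp (inv\<^bsub>K\<^esub> k) : carrier (code_group kp K)"
   using k by (auto simp: code_group_def)
  thus "EX y:carrier (code_group kp K). y \<otimes>\<^bsub>code_group kp K\<^esub> x = \<one>\<^bsub>code_group kp K\<^esub>" by blast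
 qed
qed

lemma hom_code:
 assumes kp: "inj_on kp (carrier K)" and K: "group K"
 shows "kp : hom K (code_group kp K)" "inv_into (carrier K) kp : hom (code_group kp K) K"
proof -
 interpret K: group K by fact
 note [simp] = inv_into_f_f[OF kp]
 show "kp : hom K (code_group kp K)" "inv_into (carrier K) kp : hom (code_group kp K) K"
  by (auto simp: hom_def code_group_def)
qed

text \<open>
  The bidual is divisible but too large. Closing a subgroup under choices of quotients by positive
  integers stays divisible, and every element is then named by a term over the subgroup.
\<close>

lemma divisible_hull:
 fixes A :: "('v, 'b) monoid_scheme" and io :: "'v => 'u::infinite"
 assumes A: "comm_group A" and N: "subgroup N A" and io: "inj_on io (carrier A)"
 shows "EX D :: 'u monoid. comm_group D & divisible D & (EX h:hom A D. ALL x:carrier A. h x = \<one>\<^bsub>D\<^esub> <-> x : N)"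
proof -
 interpret A: comm_group A by fact
 obtain e :: "'v => 'v bidual" where e: "!!x y. x : carrier A ==> y : carrier A ==> e (x \<otimes>\<^bsub>A\<^esub> y) = e x + e y"
   "!!x. x : carrier A ==> e x = 0 <-> x : N"
  using bidual_embedding[OF A N] by blast
 obtain enc :: "'v tm => 'u" where enc: "inj_on enc {t. set_tm t \<subseteq> carrier A}" using code_terms[OF io] by blast
 define dv :: "nat => 'v bidual => 'v bidual" where "dv n z = (SOME w. nmul (Suc n) w = z)" for n z
 have dv: "nmul (Suc n) (dv n z) = z" for n z
  unfolding dv_def by (rule someI_ex[OF bidual_divisible]) simp
 define ev :: "'v tm => 'v bidual" where
  "ev = rec_tm e (%s t a b. a + b) (%t a. - a) (%n t a. dv n a)"
 have ev: "ev (Leaf x) = e x" "ev (Plus s t) = ev s + ev t" "ev (Neg t) = - ev t" "ev (Div n t) = dv n (ev t)" for x s t n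
  by (simp_all add: ev_def)
 define Tm where "Tm = {t. set_tm t \<subseteq> carrier A}"
 define U where "U = ev ` Tm"
 have e1: "e \<one>\<^bsub>A\<^esub> = 0" using e(2)[of "\<one>\<^bsub>A\<^esub>"] N by (simp add: subgroup.one_closed)
 have U: "add_subgroup U"
  unfolding add_subgroup_def
 proof (intro conjI ballI)
  have "ev (Leaf \<one>\<^bsub>A\<^esub>) : U" unfolding U_def by (rule imageI) (simp add: Tm_def)
  thus "0 : U" by (simp add: ev e1)
  fix x assume "x : U"
  then obtain s where s: "s : Tm" "x = ev s" by (auto simp: U_def)
  have "ev (Neg s) : U" unfolding U_def by (rule imageI) (use s in \<open>simp add: Tm_def\<close>)
  thus "- x : U" by (simp add: ev s)
  fix y assume "y : U"
  then obtain t where t: "t : Tm" "y = ev t" by (auto simp: U_def)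
  have "ev (Plus s t) : U" unfolding U_def by (rule imageI) (use s t in \<open>simp add: Tm_def\<close>)
  thus "x + y : U" by (simp add: ev s t)
 qed
 have Udiv: "EX w:U. nmul n w = z" if "n > 0" "z : U" for n z
 proof -
  obtain t where t: "t : Tm" "z = ev t" using \<open>z : U\<close> by (auto simp: U_def)
  have "ev (Div (n - 1) t) : U" unfolding U_def by (rule imageI) (use t in \<open>simp add: Tm_def\<close>)
  moreover have "nmul n (ev (Div (n - 1) t)) = z" using dv[of "n - 1" "ev t"] \<open>n > 0\<close> t by (simp add: ev)
  ultimately show ?thesis by blast
 qed
 define kp where "kp = enc \<circ> inv_into Tm ev"
 have kp: "inj_on kp U"
 proof -
  have "inv_into Tm ev ` U \<subseteq> Tm" unfolding U_def by (auto intro: inv_into_into)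
  hence "inj_on enc (inv_into Tm ev ` U)" using enc by (simp add: Tm_def [symmetric] inj_on_subset)
  moreover have "inj_on (inv_into Tm ev) U" unfolding U_def by (rule inj_on_inv_into) simp
  ultimately show ?thesis unfolding kp_def by (intro comp_inj_on)
 qed
 let ?K = "typegroup U"
 let ?D = "code_group kp ?K"
 have K: "comm_group ?K" using U by (rule comm_group_typegroup)
 have D: "comm_group ?D" using K by (rule comm_group_code) (simp add: kp)
 interpret K: comm_group ?K by fact
 interpret D: comm_group ?D by fact
 have hK: "kp : hom ?K ?D" by (rule hom_code(1)) (simp_all add: kp K.is_group)
 interpret h: group_hom ?K ?D kp by unfold_locales (rule hK)
 have "divisible ?D"
  unfolding divisible_def
 proof (intro ballI allI impI)
  fix d and n :: nat assume d: "d : carrier ?D" and n: "n > 0"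
  then obtain z where z: "z : U" "d = kp z" by (auto simp: code_group_def)
  from Udiv[OF n z(1)] obtain w where w: "w : U" "nmul n w = z" by blast
  have "kp w [^]\<^bsub>?D\<^esub> n = d" using h.hom_nat_pow[of w n] w z by (simp add: typegroup_pow)
  thus "EX e:carrier ?D. e [^]\<^bsub>?D\<^esub> n = d" using w by (intro bexI[of _ "kp w"]) (auto simp: code_group_def)
 qed
 moreover have eU: "e x : U" if "x : carrier A" for x
 proof -
  have "ev (Leaf x) : U" unfolding U_def by (rule imageI) (use that in \<open>simp add: Tm_def\<close>)
  thus ?thesis by (simp add: ev)
 qed
 moreover have "(%x. kp (e x)) : hom A ?D"
  using h.hom_mult h.hom_closed eU e(1) by (intro homI) auto
 moreover have "kp (e x) = \<one>\<^bsub>?D\<^esub> <-> x : N" if "x : carrier A" for x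
 proof -
  have "kp (e x) = \<one>\<^bsub>?D\<^esub> <-> kp (e x) = kp 0" by (simp add: code_group_def)
  also have "... <-> e x = 0" using inj_on_eq_iff[OF kp eU[OF that]] U by (simp add: add_subgroupD)
  finally show ?thesis using e(2)[OF that] by simp
 qed
 ultimately show ?thesis using D by (intro exI[of _ ?D] conjI bexI[of _ "%x. kp (e x)"]) auto
qed

abbreviation sect :: "('o, 'a, 'v) presheaf => 'o => 'v set" where "sect F P \<equiv> carrier (grp F P)"

definition code_presheaf :: "('o => 'v => 'u) => ('o, 'a, 'v) presheaf => ('o, 'a, 'u) presheaf" where
 "code_presheaf kp K = \<lparr>grp = (%P. code_group (kp P) (grp K P)),
   res = (%P Q f x. kp P (res K P Q f (inv_into (sect K Q) (kp Q) x)))\<rparr>"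

lemma hom_closed: "h : hom G H ==> x : carrier G ==> h x : carrier H"
 by (auto simp: hom_def)

lemma ab_presheafD:
 assumes "ab_presheaf C F"
 shows "P : Obj C ==> comm_group (grp F P)"
  "P : Obj C ==> Q : Obj C ==> f : Mor C P Q ==> res F P Q f : hom (grp F Q) (grp F P)"
  "P : Obj C ==> x : sect F P ==> res F P P (ident C P) x = x"
  "P : Obj C ==> Q : Obj C ==> R : Obj C ==> f : Mor C P Q ==> g : Mor C Q R ==> y : sect F R ==>
    res F P R (comp C P Q R g f) y = res F P Q f (res F Q R g y)"
  "P : Obj C ==> Q : Obj C ==> f : Mor C P Q ==> z : sect F Q ==> res F P Q f z : sect F P"
 using assms unfolding ab_presheaf_def by (blast intro: hom_closed)+

lemma presheaf_homD:
 assumes "presheaf_hom C F G \<eta>"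
 shows "P : Obj C ==> \<eta> P : hom (grp F P) (grp G P)"
  "P : Obj C ==> x : sect F P ==> \<eta> P x : sect G P"
  "P : Obj C ==> Q : Obj C ==> f : Mor C P Q ==> y : sect F Q ==> \<eta> P (res F P Q f y) = res G P Q f (\<eta> Q y)"
 using assms unfolding presheaf_hom_def by (blast intro: hom_closed)+

lemma categoryD:
 assumes "category C"
 shows "P : Obj C ==> ident C P : Mor C P P"
  "P : Obj C ==> Q : Obj C ==> R : Obj C ==> f : Mor C P Q ==> g : Mor C Q R ==> comp C P Q R g f : Mor C P R"
  "P : Obj C ==> Q : Obj C ==> f : Mor C P Q ==> comp C P P Q f (ident C P) = f"
  "P : Obj C ==> Q : Obj C ==> f : Mor C P Q ==> comp C P Q Q (ident C Q) f = f"
  "P : Obj C ==> Q : Obj C ==> R : Obj C ==> U : Obj C ==> f : Mor C P Q ==> g : Mor C Q R ==> h : Mor C R U ==>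
    comp C P Q U (comp C Q R U h g) f = comp C P R U h (comp C P Q R g f)"
 using assms unfolding category_def by blast+

lemma presheaf_hom_comp:
 assumes "presheaf_hom C F G \<eta>" "presheaf_hom C G H \<theta>"
 shows "presheaf_hom C F H (%P x. \<theta> P (\<eta> P x))"
 unfolding presheaf_hom_def
proof (intro conjI ballI)
 fix P assume P: "P : Obj C"
 show "(%x. \<theta> P (\<eta> P x)) : hom (grp F P) (grp H P)"
  using presheaf_homD(1)[OF assms(1) P] presheaf_homD(1)[OF assms(2) P]
  by (intro homI) (simp_all add: hom_mult hom_closed)
 fix Q f x assume "Q : Obj C" "f : Mor C P Q" "x : sect F Q"
 thus "\<theta> P (\<eta> P (res F P Q f x)) = res H P Q f (\<theta> Q (\<eta> Q x))"
  using presheaf_homD[OF assms(1)] presheaf_homD[OF assms(2)] P by simp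
qed

lemma code_presheaf:
 assumes F: "ab_presheaf C F" and kp: "!!P. P : Obj C ==> inj_on (kp P) (sect F P)"
 shows "ab_presheaf C (code_presheaf kp F)"
  and "presheaf_hom C F (code_presheaf kp F) kp"
  and "presheaf_hom C (code_presheaf kp F) F (%P. inv_into (sect F P) (kp P))"
proof -
 let ?G = "code_presheaf kp F"
 have G: "grp ?G P = code_group (kp P) (grp F P)"
  "res ?G P Q f x = kp P (res F P Q f (inv_into (sect F Q) (kp Q) x))" for P Q f x
  by (simp_all add: code_presheaf_def)
 have gF: "group (grp F P)" if "P : Obj C" for P using ab_presheafD(1)[OF F that] by (rule comm_group.axioms(2))
 have h: "kp P : hom (grp F P) (grp ?G P)" "inv_into (sect F P) (kp P) : hom (grp ?G P) (grp F P)" if "P : Obj C" for P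
  unfolding G using hom_code[OF kp[OF that] gF[OF that]] by auto
 have i: "inv_into (sect F P) (kp P) (kp P x) = x" if "P : Obj C" "x : sect F P" for P x
  using kp[OF that(1)] that(2) by simp
 have c: "x : sect ?G P <-> (EX y:sect F P. x = kp P y)" for P x
  unfolding G by (auto simp: code_group_def)
 show "ab_presheaf C ?G"
  unfolding ab_presheaf_def
 proof (intro conjI ballI)
  fix P assume P: "P : Obj C"
  show "comm_group (grp ?G P)" unfolding G by (rule comm_group_code[OF ab_presheafD(1)[OF F P] kp[OF P]])
  show "res ?G P P (ident C P) x = x" if "x : sect ?G P" for x
   using that P by (auto simp: c G(2) i ab_presheafD(3)[OF F])
  fix Q assume Q: "Q : Obj C"
  show "res ?G P Q f : hom (grp ?G Q) (grp ?G P)" if "f : Mor C P Q" for f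
   unfolding G(2)
   using hom_mult[OF h(1)[OF P]] hom_mult[OF h(2)[OF Q]] hom_closed[OF h(1)[OF P]] hom_closed[OF h(2)[OF Q]]
    hom_mult[OF ab_presheafD(2)[OF F P Q that]] ab_presheafD(5)[OF F P Q that]
   by (intro homI) simp_all
  fix R f g x assume R: "R : Obj C" "f : Mor C P Q" "g : Mor C Q R" "x : sect ?G R"
  then obtain y where y: "y : sect F R" "x = kp R y" by (auto simp: c)
  show "res ?G P R (comp C P Q R g f) x = res ?G P Q f (res ?G Q R g x)"
   using P Q R y by (simp add: G(2) i ab_presheafD(4,5)[OF F])
 qed
 show "presheaf_hom C F ?G kp"
  unfolding presheaf_hom_def using h(1) by (auto simp: G(2) i)
 show "presheaf_hom C ?G F (%P. inv_into (sect F P) (kp P))"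
  unfolding presheaf_hom_def using h(2) by (auto simp: G(2) i c ab_presheafD(5)[OF F])
qed

definition into :: "('o, 'a) cat => 'o => ('o \<times> 'a) set" where
 "into C P = {(Q, f). Q : Obj C & f : Mor C Q P}"

lemma into_iff: "(Q, f) : into C P <-> Q : Obj C & f : Mor C Q P"
 by (simp add: into_def)

text \<open>
  The functor \<open>P \<mapsto> \<Prod>D Q\<close>, the product over all morphisms from some \<open>Q\<close> to \<open>P\<close>. It is right adjoint to
  forgetting the morphisms of \<open>C\<close>.
\<close>

definition coind :: "('o, 'a) cat => ('o => ('u, 'b) monoid_scheme) => ('o, 'a, 'o \<times> 'a => 'u) presheaf" where
 "coind C D = \<lparr>grp = (%P. \<lparr>carrier = (\<Pi>\<^sub>E w\<in>into C P. carrier (D (fst w))),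
    monoid.mult = (%x y. \<lambda>w\<in>into C P. x w \<otimes>\<^bsub>D (fst w)\<^esub> y w), one = (\<lambda>w\<in>into C P. \<one>\<^bsub>D (fst w)\<^esub>)\<rparr>),
   res = (%P P' g y. \<lambda>w\<in>into C P. y (fst w, comp C (fst w) P P' g (snd w)))\<rparr>"

lemma coind_simps:
 "sect (coind C D) P = (\<Pi>\<^sub>E w\<in>into C P. carrier (D (fst w)))"
 "x \<otimes>\<^bsub>grp (coind C D) P\<^esub> y = (\<lambda>w\<in>into C P. x w \<otimes>\<^bsub>D (fst w)\<^esub> y w)"
 "\<one>\<^bsub>grp (coind C D) P\<^esub> = (\<lambda>w\<in>into C P. \<one>\<^bsub>D (fst w)\<^esub>)"
 "res (coind C D) P P' g y = (\<lambda>w\<in>into C P. y (fst w, comp C (fst w) P P' g (snd w)))"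
 by (simp_all add: coind_def)

lemma coind_undefined:
 "x : sect (coind C D) P ==> w ~: into C P ==> x w = undefined"
 unfolding coind_simps by (rule PiE_arb)

lemma into_comp:
 assumes "category C" "P : Obj C" "P' : Obj C" "g : Mor C P P'" "w : into C P"
 shows "(fst w, comp C (fst w) P P' g (snd w)) : into C P'"
 using assms by (auto simp: into_def categoryD)

lemma ab_presheaf_coind:
 assumes C: "category C" and D: "!!Q. Q : Obj C ==> comm_group (D Q)"
 shows "ab_presheaf C (coind C D)"
 unfolding ab_presheaf_def
proof (intro conjI ballI)
 have Df: "comm_group (D (fst w))" if "w : into C P" for w P using D that by (auto simp: into_def)
 have mon: "monoid (D (fst w))" "group (D (fst w))" if "w : into C P" for w P
  using Df[OF that] by (simp_all add: comm_group_def group.is_monoid)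
 have mem: "x w : carrier (D (fst w))" if "x : sect (coind C D) P" "w : into C P" for x w P
  using PiE_mem[OF that(1)[unfolded coind_simps] that(2)] .
 fix P assume P: "P : Obj C"
 show "comm_group (grp (coind C D) P)"
 proof (rule comm_groupI)
  fix x y z assume x: "x : sect (coind C D) P" and y: "y : sect (coind C D) P" and z: "z : sect (coind C D) P"
  show "x \<otimes>\<^bsub>grp (coind C D) P\<^esub> y \<otimes>\<^bsub>grp (coind C D) P\<^esub> z = x \<otimes>\<^bsub>grp (coind C D) P\<^esub> (y \<otimes>\<^bsub>grp (coind C D) P\<^esub> z)"
   unfolding coind_simps
   by (intro restrict_ext) (simp add: monoid.m_assoc[OF mon(1)] mem[OF x] mem[OF y] mem[OF z])
 next
  fix x y assume x: "x : sect (coind C D) P" and y: "y : sect (coind C D) P"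
  show "x \<otimes>\<^bsub>grp (coind C D) P\<^esub> y : sect (coind C D) P"
   unfolding coind_simps by (simp add: monoid.m_closed[OF mon(1)] mem[OF x] mem[OF y])
  show "x \<otimes>\<^bsub>grp (coind C D) P\<^esub> y = y \<otimes>\<^bsub>grp (coind C D) P\<^esub> x"
   unfolding coind_simps
   by (intro restrict_ext comm_monoid.m_comm[OF comm_group.axioms(1)[OF Df]]) (simp_all add: mem[OF x] mem[OF y])
 next
  show "\<one>\<^bsub>grp (coind C D) P\<^esub> : sect (coind C D) P"
   unfolding coind_simps by (simp add: monoid.one_closed[OF mon(1)])
  fix x assume x: "x : sect (coind C D) P"
  show "\<one>\<^bsub>grp (coind C D) P\<^esub> \<otimes>\<^bsub>grp (coind C D) P\<^esub> x = x"
  proof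
   fix w show "(\<one>\<^bsub>grp (coind C D) P\<^esub> \<otimes>\<^bsub>grp (coind C D) P\<^esub> x) w = x w"
   proof (cases "w : into C P")
    case True
    thus ?thesis using monoid.l_one[OF mon(1)[OF True] mem[OF x True]] by (simp add: coind_simps)
   next
    case False
    hence "x w = undefined" by (rule coind_undefined[OF x])
    thus ?thesis using False by (simp add: coind_simps)
   qed
  qed
  let ?y = "\<lambda>w\<in>into C P. inv\<^bsub>D (fst w)\<^esub> (x w)"
  have "?y : sect (coind C D) P"
   unfolding coind_simps by (simp add: group.inv_closed[OF mon(2)] mem[OF x])
  moreover have "?y \<otimes>\<^bsub>grp (coind C D) P\<^esub> x = \<one>\<^bsub>grp (coind C D) P\<^esub>"
   unfolding coind_simps by (intro restrict_ext) (simp add: group.l_inv[OF mon(2)] mem[OF x])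
  ultimately show "EX y:sect (coind C D) P. y \<otimes>\<^bsub>grp (coind C D) P\<^esub> x = \<one>\<^bsub>grp (coind C D) P\<^esub>" by blast
 qed
 show "res (coind C D) P P (ident C P) x = x" if "x : sect (coind C D) P" for x
 proof
  fix w show "res (coind C D) P P (ident C P) x w = x w"
  proof (cases "w : into C P")
   case True
   thus ?thesis using P categoryD(4)[OF C] by (auto simp: coind_simps into_def)
  next
   case False
   thus ?thesis using coind_undefined[OF that False] by (simp add: coind_simps)
  qed
 qed
 fix P' assume P': "P' : Obj C"
 show "res (coind C D) P P' g : hom (grp (coind C D) P') (grp (coind C D) P)" if g: "g : Mor C P P'" for g
 proof (rule homI)
  note ic = into_comp[OF C P P' g]
  fix x y assume x: "x : sect (coind C D) P'" and y: "y : sect (coind C D) P'"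
  show "res (coind C D) P P' g x : sect (coind C D) P"
   using x ic by (auto simp: coind_simps dest!: PiE_mem)
  show "res (coind C D) P P' g (x \<otimes>\<^bsub>grp (coind C D) P'\<^esub> y) = res (coind C D) P P' g x \<otimes>\<^bsub>grp (coind C D) P\<^esub> res (coind C D) P P' g y"
   using x y ic by (auto simp: coind_simps fun_eq_iff)
 qed
 fix R f g x assume R: "R : Obj C" "f : Mor C P P'" "g : Mor C P' R" "x : sect (coind C D) R"
 show "res (coind C D) P R (comp C P P' R g f) x = res (coind C D) P P' f (res (coind C D) P' R g x)"
  using R P P' into_comp[OF C P P' R(2)] categoryD(5)[OF C]
  by (auto simp: coind_simps fun_eq_iff into_def)
qed

definition coind_hom :: "('o, 'a) cat => ('o, 'a, 'v) presheaf => ('o => 'v => 'u) => 'o => 'v => 'o \<times> 'a => 'u" where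
 "coind_hom C B k P b = (\<lambda>w\<in>into C P. k (fst w) (res B (fst w) P (snd w) b))"

lemma presheaf_hom_coind:
 assumes C: "category C" and B: "ab_presheaf C B" and k: "!!Q. Q : Obj C ==> k Q : hom (grp B Q) (D Q)"
 shows "presheaf_hom C B (coind C D) (coind_hom C B k)"
 unfolding presheaf_hom_def
proof (intro conjI ballI)
 fix P assume P: "P : Obj C"
 have r: "res B (fst w) P (snd w) : hom (grp B P) (grp B (fst w))" "k (fst w) : hom (grp B (fst w)) (D (fst w))" if "w : into C P" for w
  using that P k ab_presheafD(2)[OF B] by (auto simp: into_def)
 show "coind_hom C B k P : hom (grp B P) (grp (coind C D) P)"
 proof (rule homI)
  fix x y assume x: "x : sect B P" and y: "y : sect B P"
  show "coind_hom C B k P x : sect (coind C D) P"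
   using x hom_closed[OF r(1)] hom_closed[OF r(2)] by (auto simp: coind_simps coind_hom_def)
  show "coind_hom C B k P (x \<otimes>\<^bsub>grp B P\<^esub> y) = coind_hom C B k P x \<otimes>\<^bsub>grp (coind C D) P\<^esub> coind_hom C B k P y"
   using x y hom_closed[OF r(1)] hom_mult[OF r(1)] hom_mult[OF r(2)] by (auto simp: coind_simps coind_hom_def fun_eq_iff)
 qed
 fix P' g x assume P': "P' : Obj C" "g : Mor C P P'" "x : sect B P'"
 show "coind_hom C B k P (res B P P' g x) = res (coind C D) P P' g (coind_hom C B k P' x)"
 proof
  fix w show "coind_hom C B k P (res B P P' g x) w = res (coind C D) P P' g (coind_hom C B k P' x) w"
   using P P' into_comp[OF C P P'(1,2)] ab_presheafD(4)[OF B]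
   by (cases "w : into C P") (auto simp: coind_simps coind_hom_def into_def)
 qed
qed

definition finite_cat :: "('o, 'a) cat => bool" where
 "finite_cat C <-> category C & finite (Obj C) & (ALL P:Obj C. ALL Q:Obj C. finite (Mor C P Q))"

lemma finite_into: assumes "finite_cat C" "P : Obj C" shows "finite (into C P)"
proof -
 have "into C P = (SIGMA Q:Obj C. Mor C Q P)" by (auto simp: into_def)
 thus ?thesis using assms by (simp add: finite_cat_def finite_SigmaI)
qed

lemma coind_code:
 assumes "finite_cat C"
 shows "EX kp :: 'o => ('o \<times> 'a => 'u::infinite) => 'u. ALL P:Obj C. inj_on (kp P) (carrier (grp (coind (C :: ('o, 'a) cat) D) P))"
proof -
 have "ALL P. EX kp :: ('o \<times> 'a => 'u) => 'u. P : Obj C --> inj_on kp (extensional (into C P))"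
  using code_functions[OF finite_into[OF assms]] by blast
 then obtain kp :: "'o => ('o \<times> 'a => 'u) => 'u" where "ALL P. P : Obj C --> inj_on (kp P) (extensional (into C P))"
  by (rule choice[THEN exE])
 hence "ALL P:Obj C. inj_on (kp P) (sect (coind C D) P)"
  unfolding coind_simps PiE_def by (blast intro: inj_on_subset)
 thus ?thesis by blast
qed

text \<open>
  A presheaf map into \<open>coind\<close> is a family of group homomorphisms without naturality condition, and these
  extend because the values are divisible.
\<close>

lemma injective_coind:
 fixes C :: "('o, 'a) cat" and D :: "'o => 'u::infinite monoid" and kp :: "'o => ('o \<times> 'a => 'u) => 'u"
 assumes C: "category C" and D: "!!Q. Q : Obj C ==> comm_group (D Q)" "!!Q. Q : Obj C ==> divisible (D Q)"
  and kp: "!!P. P : Obj C ==> inj_on (kp P) (sect (coind C D) P)"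
 shows "injective_presheaf C (code_presheaf kp (coind C D))"
 unfolding injective_presheaf_def
proof (intro conjI allI impI)
 let ?J = "coind C D"
 have J: "ab_presheaf C ?J" by (rule ab_presheaf_coind[OF C D(1)])
 note cp = code_presheaf[OF J kp]
 show "ab_presheaf C (code_presheaf kp ?J)" by (rule cp(1))
 fix A B :: "('o, 'a, 'u) presheaf" and i h
 assume *: "ab_presheaf C A & ab_presheaf C B & presheaf_mono C A B i & presheaf_hom C A (code_presheaf kp ?J) h"
 hence A: "ab_presheaf C A" and B: "ab_presheaf C B" and i: "presheaf_hom C A B i" "!!P. P : Obj C ==> inj_on (i P) (sect A P)"
  and h: "presheaf_hom C A (code_presheaf kp ?J) h" by (auto simp: presheaf_mono_def)
 define h' where "h' P x = inv_into (sect ?J P) (kp P) (h P x)" for P x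
 have h': "presheaf_hom C A ?J h'" unfolding h'_def by (rule presheaf_hom_comp[OF h cp(3)])
 have kph': "kp P (h' P x) = h P x" if "P : Obj C" "x : sect A P" for P x
 proof -
  have "h P x : sect (code_presheaf kp ?J) P" by (rule presheaf_homD(2)[OF h that])
  hence "h P x : kp P ` sect ?J P" by (simp add: code_presheaf_def code_group_def)
  thus ?thesis unfolding h'_def by (rule f_inv_into_f)
 qed
 have "EX ps:hom (grp B Q) (D Q). ALL a:sect A Q. ps (i Q a) = h' Q a (Q, ident C Q)" if Q: "Q : Obj C" for Q
 proof -
  interpret AQ: comm_group "grp A Q" by (rule ab_presheafD(1)[OF A Q])
  interpret BQ: comm_group "grp B Q" by (rule ab_presheafD(1)[OF B Q])
  interpret ih: group_hom "grp A Q" "grp B Q" "i Q" by unfold_locales (rule presheaf_homD(1)[OF i(1) Q])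
  let ?H = "i Q ` sect A Q"
  have H: "subgroup ?H (grp B Q)" by (rule ih.img_is_subgroup)
  have idQ: "(Q, ident C Q) : into C Q" using Q C by (simp add: into_def categoryD)
  let ?\<phi> = "%y. h' Q (inv_into (sect A Q) (i Q) y) (Q, ident C Q)"
  have hh: "h' Q : hom (grp A Q) (grp ?J Q)" by (rule presheaf_homD(1)[OF h' Q])
  have "?\<phi> : hom (grp B Q\<lparr>carrier := ?H\<rparr>) (D Q)"
  proof (rule homI)
   fix x y assume "x : carrier (grp B Q\<lparr>carrier := ?H\<rparr>)" "y : carrier (grp B Q\<lparr>carrier := ?H\<rparr>)"
   then obtain a b where ab: "a : sect A Q" "x = i Q a" "b : sect A Q" "y = i Q b" by auto
   have m: "i Q a \<otimes>\<^bsub>grp B Q\<^esub> i Q b = i Q (a \<otimes>\<^bsub>grp A Q\<^esub> b)" using ab by simp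
   have "h' Q a : sect ?J Q" using hh ab(1) by (rule hom_closed)
   hence "h' Q a (Q, ident C Q) : carrier (D Q)"
    using PiE_mem[of "h' Q a" "into C Q" "%w. carrier (D (fst w))", OF _ idQ] by (simp add: coind_simps)
   thus "?\<phi> x : carrier (D Q)" using i(2)[OF Q] ab by simp
   have hm: "h' Q (a \<otimes>\<^bsub>grp A Q\<^esub> b) (Q, ident C Q) = h' Q a (Q, ident C Q) \<otimes>\<^bsub>D Q\<^esub> h' Q b (Q, ident C Q)"
    unfolding hom_mult[OF hh ab(1,3)] using idQ by (simp add: coind_simps)
   show "?\<phi> (x \<otimes>\<^bsub>grp B Q\<lparr>carrier := ?H\<rparr>\<^esub> y) = ?\<phi> x \<otimes>\<^bsub>D Q\<^esub> ?\<phi> y"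
   proof -
    have "inv_into (sect A Q) (i Q) (i Q a \<otimes>\<^bsub>grp B Q\<^esub> i Q b) = a \<otimes>\<^bsub>grp A Q\<^esub> b"
     unfolding m by (rule inv_into_f_f[OF i(2)[OF Q]]) (use ab in simp)
    thus ?thesis using ab(1,3) i(2)[OF Q] hm unfolding ab(2,4) by simp
   qed
  qed
  then obtain ps where "ps : hom (grp B Q) (D Q)" "ALL y:?H. ps y = ?\<phi> y"
   using hom_extend_divisible[OF BQ.comm_group_axioms D(1)[OF Q] D(2)[OF Q] H] by blast
  thus ?thesis using i(2)[OF Q] by (intro bexI[of _ ps]) auto
 qed
 hence "ALL Q. EX ps. Q : Obj C --> ps : hom (grp B Q) (D Q) & (ALL a:sect A Q. ps (i Q a) = h' Q a (Q, ident C Q))"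
  by blast
 then obtain ps where ps: "!!Q. Q : Obj C ==> ps Q : hom (grp B Q) (D Q)"
  "!!Q a. Q : Obj C ==> a : sect A Q ==> ps Q (i Q a) = h' Q a (Q, ident C Q)" by metis
 have k: "presheaf_hom C B (code_presheaf kp ?J) (%P x. kp P (coind_hom C B ps P x))"
  by (rule presheaf_hom_comp[OF presheaf_hom_coind[OF C B ps(1)] cp(2)])
 have "coind_hom C B ps P (i P a) = h' P a" if P: "P : Obj C" "a : sect A P" for P a
 proof
  have ext: "h' P a : sect ?J P" by (rule presheaf_homD(2)[OF h' P])
  fix w show "coind_hom C B ps P (i P a) w = h' P a w"
  proof (cases "w : into C P")
   case False thus ?thesis using coind_undefined[OF ext False] by (simp add: coind_hom_def)
  next
   case True
   then obtain Q f where w: "w = (Q, f)" "Q : Obj C" "f : Mor C Q P" by (auto simp: into_def)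
   have "coind_hom C B ps P (i P a) w = ps Q (res B Q P f (i P a))" using True w by (simp add: coind_hom_def)
   also have "... = ps Q (i Q (res A Q P f a))" using presheaf_homD(3)[OF i(1) w(2) P(1) w(3) P(2)] by simp
   also have "... = h' Q (res A Q P f a) (Q, ident C Q)" by (rule ps(2)[OF w(2) ab_presheafD(5)[OF A w(2) P(1) w(3) P(2)]])
   also have "... = h' P a (Q, f)"
    using presheaf_homD(3)[OF h' w(2) P(1) w(3) P(2)] w P categoryD(1,3)[OF C] by (simp add: coind_simps into_iff)
   finally show ?thesis by (simp add: w)
  qed
 qed
 thus "EX k. presheaf_hom C B (code_presheaf kp ?J) k & (ALL P:Obj C. ALL x:sect A P. k P (i P x) = h P x)"
  using k kph' by (intro exI[of _ "%P x. kp P (coind_hom C B ps P x)"]) simp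
qed

definition subpresheaf :: "('o, 'a) cat => ('o, 'a, 'v) presheaf => ('o => 'v set) => bool" where
 "subpresheaf C B N <-> (ALL P:Obj C. subgroup (N P) (grp B P)) &
   (ALL P:Obj C. ALL Q:Obj C. ALL f:Mor C P Q. ALL x:N Q. res B P Q f x : N P)"

text \<open>
  Embed each value modulo the given subgroup in a divisible group and coinduce.
\<close>

lemma enough_injectives:
 fixes C :: "('o, 'a) cat" and B :: "('o, 'a, 'v) presheaf" and io :: "'o => 'v => 'u::infinite"
 assumes C: "finite_cat C" and B: "ab_presheaf C B" and N: "subpresheaf C B N"
  and io: "!!P. P : Obj C ==> inj_on (io P) (sect B P)"
 shows "EX (I :: ('o, 'a, 'u) presheaf) \<eta>. injective_presheaf C I & presheaf_hom C B I \<eta> &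
  (ALL P:Obj C. kernel (grp B P) (grp I P) (\<eta> P) = N P)"
proof -
 have cC: "category C" using C by (simp add: finite_cat_def)
 have NP: "subgroup (N P) (grp B P)" if "P : Obj C" for P using N that by (simp add: subpresheaf_def)
 have "ALL Q. EX D :: 'u monoid. EX h. Q : Obj C --> comm_group D & divisible D & h : hom (grp B Q) D &
   (ALL x:sect B Q. h x = \<one>\<^bsub>D\<^esub> <-> x : N Q)"
 proof
  fix Q
  show "EX D :: 'u monoid. EX h. Q : Obj C --> comm_group D & divisible D & h : hom (grp B Q) D &
   (ALL x:sect B Q. h x = \<one>\<^bsub>D\<^esub> <-> x : N Q)"
  proof (cases "Q : Obj C")
   case True
   show ?thesis using divisible_hull[OF ab_presheafD(1)[OF B True] NP[OF True] io[OF True]] by blast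
  qed simp
 qed
 then obtain D :: "'o => 'u monoid" and h where D: "!!Q. Q : Obj C ==> comm_group (D Q)" "!!Q. Q : Obj C ==> divisible (D Q)"
  "!!Q. Q : Obj C ==> h Q : hom (grp B Q) (D Q)"
  "!!Q x. Q : Obj C ==> x : sect B Q ==> h Q x = \<one>\<^bsub>D Q\<^esub> <-> x : N Q" by metis
 obtain kp :: "'o => ('o \<times> 'a => 'u) => 'u" where kp: "!!P. P : Obj C ==> inj_on (kp P) (sect (coind C D) P)"
  using coind_code[OF C, of D] by blast
 let ?J = "coind C D"
 let ?I = "code_presheaf kp ?J"
 have J: "ab_presheaf C ?J" by (rule ab_presheaf_coind[OF cC D(1)])
 have hJ: "presheaf_hom C B ?J (coind_hom C B h)" by (rule presheaf_hom_coind[OF cC B D(3)])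
 have "injective_presheaf C ?I" by (rule injective_coind[OF cC D(1,2) kp])
 moreover have "presheaf_hom C B ?I (%P x. kp P (coind_hom C B h P x))"
  by (rule presheaf_hom_comp[OF hJ code_presheaf(2)[OF J kp]])
 moreover have "kernel (grp B P) (grp ?I P) (%x. kp P (coind_hom C B h P x)) = N P" if P: "P : Obj C" for P
 proof -
  have "kp P (coind_hom C B h P x) = \<one>\<^bsub>grp ?I P\<^esub> <-> x : N P" if x: "x : sect B P" for x
  proof -
   have one: "\<one>\<^bsub>grp ?J P\<^esub> : sect ?J P"
    by (rule monoid.one_closed) (use ab_presheafD(1)[OF J P] in \<open>simp add: comm_group_def group.is_monoid\<close>)
   have "kp P (coind_hom C B h P x) = \<one>\<^bsub>grp ?I P\<^esub> <-> coind_hom C B h P x = \<one>\<^bsub>grp ?J P\<^esub>"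
    using inj_on_eq_iff[OF kp[OF P] presheaf_homD(2)[OF hJ P x] one] by (simp add: code_presheaf_def code_group_def)
   also have "... <-> (ALL w:into C P. h (fst w) (res B (fst w) P (snd w) x) = \<one>\<^bsub>D (fst w)\<^esub>)"
    by (auto simp: coind_hom_def coind_simps fun_eq_iff restrict_def)
   also have "... <-> (ALL w:into C P. res B (fst w) P (snd w) x : N (fst w))"
    by (intro ball_cong refl D(4)) (use P x in \<open>auto simp: into_def intro: ab_presheafD(5)[OF B]\<close>)
   also have "... <-> x : N P"
   proof
    assume "ALL w:into C P. res B (fst w) P (snd w) x : N (fst w)"
    from bspec[OF this, of "(P, ident C P)"] show "x : N P"
     using P x categoryD(1)[OF cC P] by (simp add: into_iff ab_presheafD(3)[OF B])
   next
    assume "x : N P"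
    thus "ALL w:into C P. res B (fst w) P (snd w) x : N (fst w)"
     using N P by (auto simp: into_def subpresheaf_def)
   qed
   finally show ?thesis .
  qed
  thus ?thesis using subgroup.subset[OF NP[OF P]] by (auto simp: kernel_def)
 qed
 ultimately show ?thesis by blast
qed

text \<open>
  The unit of the coinduction adjunction is injective, so injectivity splits it.
\<close>

lemma injective_retraction:
 fixes C :: "('o, 'a) cat" and I :: "('o, 'a, 'u::infinite) presheaf"
 assumes C: "finite_cat C" and I: "injective_presheaf C I"
 shows "EX \<rho>. presheaf_hom C (coind C (grp I)) I \<rho> &
  (ALL P:Obj C. ALL x:sect I P. \<rho> P (\<lambda>w\<in>into C P. res I (fst w) P (snd w) x) = x)"
proof -
 have cC: "category C" using C by (simp add: finite_cat_def)
 have aI: "ab_presheaf C I" using I by (simp add: injective_presheaf_def)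
 let ?J = "coind C (grp I)"
 have J: "ab_presheaf C ?J" by (rule ab_presheaf_coind[OF cC ab_presheafD(1)[OF aI]])
 obtain kp :: "'o => ('o \<times> 'a => 'u) => 'u" where kp: "!!P. P : Obj C ==> inj_on (kp P) (sect ?J P)"
  using coind_code[OF C, of "grp I"] by blast
 let ?B = "code_presheaf kp ?J"
 note cp = code_presheaf[OF J kp]
 define j where "j = coind_hom C I (%Q x. x)"
 have j: "presheaf_hom C I ?J j" unfolding j_def by (rule presheaf_hom_coind[OF cC aI]) (simp add: hom_def)
 have ji: "inj_on (j P) (sect I P)" if P: "P : Obj C" for P
 proof (rule inj_onI)
  fix x y assume "x : sect I P" "y : sect I P" "j P x = j P y"
  from fun_cong[OF this(3), of "(P, ident C P)"] this(1,2) show "x = y"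
   using P categoryD(1)[OF cC P] by (simp add: j_def coind_hom_def into_iff ab_presheafD(3)[OF aI])
 qed
 have i: "presheaf_mono C I ?B (%P x. kp P (j P x))"
  unfolding presheaf_mono_def
 proof (intro conjI ballI)
  show "presheaf_hom C I ?B (%P x. kp P (j P x))" by (rule presheaf_hom_comp[OF j cp(2)])
  fix P assume P: "P : Obj C"
  show "inj_on (%x. kp P (j P x)) (sect I P)"
   using inj_onD[OF ji[OF P]] inj_onD[OF kp[OF P]] presheaf_homD(2)[OF j P] by (intro inj_onI) blast
 qed
 have "presheaf_hom C I I (%P x. x)" by (simp add: presheaf_hom_def hom_def)
 then obtain k where k: "presheaf_hom C ?B I k" "!!P x. P : Obj C ==> x : sect I P ==> k P (kp P (j P x)) = x"
  using I aI cp(1) i unfolding injective_presheaf_def by blast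
 have "presheaf_hom C ?J I (%P y. k P (kp P y))" by (rule presheaf_hom_comp[OF cp(2) k(1)])
 thus ?thesis using k(2) by (intro exI[of _ "%P y. k P (kp P y)"]) (simp add: j_def coind_hom_def)
qed

lemma subpresheaf_image:
 assumes "ab_presheaf C A" "ab_presheaf C B" "presheaf_hom C A B h"
 shows "subpresheaf C B (%P. h P ` sect A P)"
 unfolding subpresheaf_def
proof (intro conjI ballI)
 fix P assume P: "P : Obj C"
 interpret A: comm_group "grp A P" by (rule ab_presheafD(1)[OF assms(1) P])
 interpret B: comm_group "grp B P" by (rule ab_presheafD(1)[OF assms(2) P])
 interpret h: group_hom "grp A P" "grp B P" "h P" by unfold_locales (rule presheaf_homD(1)[OF assms(3) P])
 show "subgroup (h P ` sect A P) (grp B P)" by (rule h.img_is_subgroup)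
 fix Q f x assume "Q : Obj C" "f : Mor C P Q" "x : h Q ` sect A Q"
 thus "res B P Q f x : h P ` sect A P"
  using P presheaf_homD(3)[OF assms(3), symmetric] ab_presheafD(5)[OF assms(1)] by auto
qed

text \<open>
  Each term is an embedding of the previous cokernel; a sequence of dependent choices.
\<close>

lemma injective_resolution_exists:
 fixes C :: "('o, 'a) cat" and F :: "('o, 'a, 'v) presheaf" and io :: "'o => 'v => 'u::infinite"
 assumes C: "finite_cat C" and F: "ab_presheaf C F"
  and io: "!!P. P : Obj C ==> inj_on (io P) (sect F P)"
 shows "EX R :: ('o => 'v => 'u) \<times> (nat => ('o, 'a, 'u) presheaf) \<times> (nat => 'o => 'u => 'u). injective_resolution C F R"
proof -
 have "subpresheaf C F (%P. {\<one>\<^bsub>grp F P\<^esub>})"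
  unfolding subpresheaf_def
 proof (intro conjI ballI)
  fix P assume P: "P : Obj C"
  interpret comm_group "grp F P" by (rule ab_presheafD(1)[OF F P])
  show "subgroup {\<one>\<^bsub>grp F P\<^esub>} (grp F P)" by (rule triv_subgroup)
  fix Q f x assume Q: "Q : Obj C" "f : Mor C P Q" "x : {\<one>\<^bsub>grp F Q\<^esub>}"
  interpret Q: comm_group "grp F Q" by (rule ab_presheafD(1)[OF F Q(1)])
  have "res F P Q f \<one>\<^bsub>grp F Q\<^esub> = \<one>\<^bsub>grp F P\<^esub>"
   by (rule hom_one[OF ab_presheafD(2)[OF F P Q(1,2)]]) unfold_locales
  thus "res F P Q f x : {\<one>\<^bsub>grp F P\<^esub>}" using Q(3) by simp
 qed
 from enough_injectives[OF C F this io]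
 obtain I0 :: "('o, 'a, 'u) presheaf" and \<eta> where I0: "injective_presheaf C I0" "presheaf_hom C F I0 \<eta>"
  "!!P. P : Obj C ==> kernel (grp F P) (grp I0 P) (\<eta> P) = {\<one>\<^bsub>grp F P\<^esub>}" by blast
 define OK where "OK s <-> injective_presheaf C (fst s) & subpresheaf C (fst s) (snd s)" for s :: "('o, 'a, 'u) presheaf \<times> ('o => 'u set)"
 define step where "step s s' <-> (EX d. presheaf_hom C (fst s) (fst s') d &
   (ALL P:Obj C. kernel (grp (fst s) P) (grp (fst s') P) (d P) = snd s P & snd s' P = d P ` sect (fst s) P))"
   for s s' :: "('o, 'a, 'u) presheaf \<times> ('o => 'u set)"
 have ab: "ab_presheaf C (fst s)" if "OK s" for s using that by (simp add: OK_def injective_presheaf_def)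
 let ?s0 = "(I0, %P. \<eta> P ` sect F P)"
 have s0: "OK ?s0" using I0 subpresheaf_image[OF F _ I0(2)] by (simp add: OK_def injective_presheaf_def)
 have "EX s'. OK s' & step s s'" if s: "OK s" for s
 proof -
  obtain I' :: "('o, 'a, 'u) presheaf" and d where I': "injective_presheaf C I'" "presheaf_hom C (fst s) I' d"
   "!!P. P : Obj C ==> kernel (grp (fst s) P) (grp I' P) (d P) = snd s P"
   using enough_injectives[OF C ab[OF s], of "snd s" "%_ x. x"] s by (auto simp: OK_def)
  let ?s' = "(I', %P. d P ` sect (fst s) P)"
  have "OK ?s'" using I' subpresheaf_image[OF ab[OF s] _ I'(2)] by (simp add: OK_def injective_presheaf_def)
  moreover have "step s ?s'" unfolding step_def using I' by (intro exI[of _ d]) simp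
  ultimately show ?thesis by blast
 qed
 then obtain S where S: "S 0 = ?s0" "!!n. OK (S n)" "!!n. step (S n) (S (Suc n))"
  using dependent_nat_choice[of "%n s. OK s & (n = 0 --> s = ?s0)" "%n. step"] s0 by (metis nat.distinct(1))
 hence "ALL n. EX d. presheaf_hom C (fst (S n)) (fst (S (Suc n))) d &
   (ALL P:Obj C. kernel (grp (fst (S n)) P) (grp (fst (S (Suc n))) P) (d P) = snd (S n) P & snd (S (Suc n)) P = d P ` carrier (grp (fst (S n)) P))"
  unfolding step_def by blast
 then obtain d where d: "!!n. presheaf_hom C (fst (S n)) (fst (S (Suc n))) (d n)"
  "!!n P. P : Obj C ==> kernel (grp (fst (S n)) P) (grp (fst (S (Suc n))) P) (d n P) = snd (S n) P"
  "!!n P. P : Obj C ==> snd (S (Suc n)) P = d n P ` carrier (grp (fst (S n)) P)" by metis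
 have "presheaf_mono C F I0 \<eta>"
  unfolding presheaf_mono_def
 proof (intro conjI ballI I0(2))
  fix P assume P: "P : Obj C"
  interpret A: comm_group "grp F P" by (rule ab_presheafD(1)[OF F P])
  interpret B: comm_group "grp I0 P" by (rule ab_presheafD(1)[OF _ P]) (use I0(1) in \<open>simp add: injective_presheaf_def\<close>)
  interpret h: group_hom "grp F P" "grp I0 P" "\<eta> P" by unfold_locales (rule presheaf_homD(1)[OF I0(2) P])
  show "inj_on (\<eta> P) (sect F P)" using I0(3)[OF P] by (rule h.trivial_ker_imp_inj)
 qed
 hence "injective_resolution C F (\<eta>, %n. fst (S n), d)"
  unfolding injective_resolution_def
  using S(1,2) d d(2)[of _ 0] by (simp add: OK_def d(3)[symmetric])
 thus ?thesis by blast
qed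

section \<open>Correspondences between quotient sets\<close>

text \<open>
  A relation between representatives that induces a bijection of quotients. Such relations compose, so
  the steps of a classification can be chained without naming the intermediate quotient sets.
\<close>

definition corr :: "'a set => ('a => 'a => bool) => 'b set => ('b => 'b => bool) => bool" where
 "corr A p B q <-> (EX R. (ALL a:A. EX b:B. R a b) & (ALL b:B. EX a:A. R a b) &
   (ALL a:A. ALL a':A. ALL b:B. ALL b':B. R a b --> R a' b' --> (p a a' <-> q b b')))"

lemma corrI:
 assumes "!!a. a : A ==> EX b:B. R a b" "!!b. b : B ==> EX a:A. R a b"
  and "!!a a' b b'. a : A ==> a' : A ==> b : B ==> b' : B ==> R a b ==> R a' b' ==> p a a' <-> q b b'"
 shows "corr A p B q"
 unfolding corr_def using assms by (intro exI[of _ R]) blast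

lemma corrE:
 assumes "corr A p B q"
 obtains R where "ALL a:A. EX b:B. R a b" "ALL b:B. EX a:A. R a b"
  "ALL a:A. ALL a':A. ALL b:B. ALL b':B. R a b --> R a' b' --> (p a a' <-> q b b')"
 using assms unfolding corr_def by (elim exE conjE)

lemma corr_sym:
 assumes "corr A p B q" shows "corr B q A p"
proof (rule corrE[OF assms])
 fix R assume R: "ALL a:A. EX b:B. R a b" "ALL b:B. EX a:A. R a b"
  "ALL a:A. ALL a':A. ALL b:B. ALL b':B. R a b --> R a' b' --> (p a a' <-> q b b')"
 show ?thesis by (rule corrI[where R = "%b a. R a b"]) (use R in simp_all)
qed

lemma corr_trans:
 assumes "corr A p B q" "corr B q C s" shows "corr A p C s"
proof -
 obtain R where R0: "ALL a:A. EX b:B. R a b" "ALL b:B. EX a:A. R a b"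
  "ALL a:A. ALL a':A. ALL b:B. ALL b':B. R a b --> R a' b' --> (p a a' <-> q b b')"
  by (rule corrE[OF assms(1)])
 have R: "EX b:B. R a b" if "a : A" for a using R0(1) that by simp
 have R2: "EX a:A. R a b" if "b : B" for b using R0(2) that by simp
 have R3: "p a a' <-> q b b'" if "a : A" "a' : A" "b : B" "b' : B" "R a b" "R a' b'" for a a' b b'
  using R0(3) that by simp
 note R = R R2 R3
 obtain R' where R0': "ALL a:B. EX b:C. R' a b" "ALL b:C. EX a:B. R' a b"
  "ALL a:B. ALL a':B. ALL b:C. ALL b':C. R' a b --> R' a' b' --> (q a a' <-> s b b')"
  by (rule corrE[OF assms(2)])
 have R': "EX b:C. R' a b" if "a : B" for a using R0'(1) that by simp
 have R2': "EX a:B. R' a b" if "b : C" for b using R0'(2) that by simp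
 have R3': "q a a' <-> s b b'" if "a : B" "a' : B" "b : C" "b' : C" "R' a b" "R' a' b'" for a a' b b'
  using R0'(3) that by simp
 note R' = R' R2' R3'
 show ?thesis
 proof (rule corrI[where R = "%a c. EX b:B. R a b & R' b c"])
  show "EX c:C. EX b:B. R a b & R' b c" if "a : A" for a using R(1)[OF that] R'(1) by blast
  show "EX a:A. EX b:B. R a b & R' b c" if "c : C" for c using R'(2)[OF that] R(2) by blast
  show "p a a' <-> s c c'" if h: "a : A" "a' : A" "c : C" "c' : C" "EX b:B. R a b & R' b c"
   "EX b:B. R a' b & R' b c'" for a a' c c'
  proof -
   obtain b b' where b: "b : B" "R a b" "R' b c" "b' : B" "R a' b'" "R' b' c'" using h(5,6) by blast
   show ?thesis using R(3)[OF h(1,2) b(1,4,2,5)] R'(3)[OF b(1,4) h(3,4) b(3,6)] by simp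
  qed
 qed
qed

lemma corr_bij:
 assumes "corr A p B q"
  and P: "equiv A {(a, a'). a : A & a' : A & p a a'}" (is "equiv A ?p")
  and Q: "equiv B {(b, b'). b : B & b' : B & q b b'}" (is "equiv B ?q")
 shows "EX f. bij_betw f (A // ?p) (B // ?q)"
proof -
 obtain R where R0: "ALL a:A. EX b:B. R a b" "ALL b:B. EX a:A. R a b"
  "ALL a:A. ALL a':A. ALL b:B. ALL b':B. R a b --> R a' b' --> (p a a' <-> q b b')"
  by (rule corrE[OF assms(1)])
 have R: "EX b:B. R a b" if "a : A" for a using R0(1) that by simp
 have R2: "EX a:A. R a b" if "b : B" for b using R0(2) that by simp
 have R3: "p a a' <-> q b b'" if "a : A" "a' : A" "b : B" "b' : B" "R a b" "R a' b'" for a a' b b'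
  using R0(3) that by simp
 note R = R R2 R3
 define g where "g a = (SOME b. b : B & R a b)" for a
 have g: "g a : B" "R a (g a)" if "a : A" for a
  using R(1)[OF that] someI_ex[of "%b. b : B & R a b"] unfolding g_def by blast+
 have pg: "p a a' <-> q (g a) (g a')" if "a : A" "a' : A" for a a'
  using R(3)[OF that g(1)[OF that(1)] g(1)[OF that(2)] g(2)[OF that(1)] g(2)[OF that(2)]] .
 define f where "f c = ?q `` {g (SOME a. a : c)}" for c
 have rep: "(SOME a'. a' : ?p `` {a}) : A & p a (SOME a'. a' : ?p `` {a})" if "a : A" for a
 proof -
  have "a : ?p `` {a}" using that P by (rule equiv_class_self[rotated])
  hence "(SOME a'. a' : ?p `` {a}) : ?p `` {a}" by (rule someI)
  thus ?thesis by blast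
 qed
 have f: "f (?p `` {a}) = ?q `` {g a}" if "a : A" for a
  unfolding f_def
  by (rule equiv_class_eq[OF Q, symmetric]) (use rep[OF that] pg that g in blast)
 have "bij_betw f (A // ?p) (B // ?q)"
 proof (rule bij_betwI')
  show "f x = f y <-> x = y" if xy: "x : A // ?p" "y : A // ?p" for x y
  proof -
   from xy obtain a a' where a: "a : A" "x = ?p `` {a}" "a' : A" "y = ?p `` {a'}" by (auto elim!: quotientE)
   have "f x = f y <-> (g a, g a') : ?q"
    unfolding a(2,4) f[OF a(1)] f[OF a(3)] by (rule eq_equiv_class_iff[OF Q g(1)[OF a(1)] g(1)[OF a(3)]])
   also have "... <-> (a, a') : ?p" using a pg g by simp
   also have "... <-> x = y" unfolding a(2,4) by (rule eq_equiv_class_iff[OF P a(1,3), symmetric])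
   finally show ?thesis .
  qed
  show "f x : B // ?q" if "x : A // ?p" for x
  proof -
   from that obtain a where a: "a : A" "x = ?p `` {a}" by (auto elim!: quotientE)
   show ?thesis using quotientI[OF g(1)[OF a(1)], of ?q] f[OF a(1)] a(2) by simp
  qed
  show "EX x:A // ?p. y = f x" if "y : B // ?q" for y
  proof -
   from that obtain b where b: "b : B" "y = ?q `` {b}" by (auto elim!: quotientE)
   then obtain a where a: "a : A" "R a b" using R(2) by blast
   have "b : ?q `` {b}" by (rule equiv_class_self[OF Q b(1)])
   hence "q b b" by simp
   hence "p a a" using R(3)[OF a(1) a(1) b(1) b(1) a(2) a(2)] by blast
   hence "q b (g a)" using R(3)[OF a(1) a(1) b(1) g(1)[OF a(1)] a(2) g(2)[OF a(1)]] by blast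
   hence "(b, g a) : ?q" using b(1) g(1)[OF a(1)] by simp
   hence "y = ?q `` {g a}" unfolding b(2) by (rule equiv_class_eq[OF Q])
   thus ?thesis using f[OF a(1)] quotientI[OF a(1), of ?p] by blast
  qed
 qed
 thus ?thesis by blast
qed

section \<open>Bar cochains and dimension shifting\<close>

text \<open>
  A resolution \<open>X 0 \<rightarrow> X 1 \<rightarrow> \<dots>\<close> of presheaves on a category with objects \<open>Ob\<close> and arrows \<open>Ar\<close>. The map \<open>r\<close> is a
  natural retraction of \<open>X i P\<close> from the families indexed by the arrows into \<open>P\<close>; it makes \<open>X i\<close> acyclic
  for bar cochains, and an injective presheaf has such a retraction.
\<close>

locale acyclic_resolution =
 fixes Ob :: "'o set" and Ar :: "'x set" and dm cd :: "'x => 'o" and cmp :: "'x => 'x => 'x"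
  and X :: "nat => 'o => 'u::ab_group_add set" and \<rho> :: "nat => 'x => 'u => 'u"
  and d :: "nat => 'o => 'u => 'u" and r :: "nat => 'o => ('x => 'u) => 'u"
 assumes ar: "a : Ar ==> dm a : Ob" "a : Ar ==> cd a : Ob"
  and cmp: "a : Ar ==> b : Ar ==> cd a = dm b ==> cmp b a : Ar"
   "a : Ar ==> b : Ar ==> cd a = dm b ==> dm (cmp b a) = dm a"
   "a : Ar ==> b : Ar ==> cd a = dm b ==> cd (cmp b a) = cd b"
   "a : Ar ==> b : Ar ==> e : Ar ==> cd a = dm b ==> cd b = dm e ==> cmp e (cmp b a) = cmp (cmp e b) a"
  and X: "P : Ob ==> add_subgroup (X i P)"
  and \<rho>: "a : Ar ==> u : X i (cd a) ==> \<rho> i a u : X i (dm a)"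
   "a : Ar ==> u : X i (cd a) ==> v : X i (cd a) ==> \<rho> i a (u + v) = \<rho> i a u + \<rho> i a v"
   "a : Ar ==> b : Ar ==> cd a = dm b ==> u : X i (cd b) ==> \<rho> i (cmp b a) u = \<rho> i a (\<rho> i b u)"
  and d: "P : Ob ==> u : X i P ==> d i P u : X (Suc i) P"
   "P : Ob ==> u : X i P ==> v : X i P ==> d i P (u + v) = d i P u + d i P v"
   "a : Ar ==> u : X i (cd a) ==> d i (dm a) (\<rho> i a u) = \<rho> (Suc i) a (d i (cd a) u)"
   "P : Ob ==> u : X i P ==> d (Suc i) P (d i P u) = 0"
  and exact: "P : Ob ==> u : X (Suc i) P ==> d (Suc i) P u = 0 ==> EX v:X i P. d i P v = u"
  and r: "P : Ob ==> (!!a. a : Ar ==> cd a = P ==> y a : X i (dm a)) ==> r i P y : X i P"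
   "P : Ob ==> (!!a. a : Ar ==> cd a = P ==> y a : X i (dm a)) ==>
    (!!a. a : Ar ==> cd a = P ==> z a : X i (dm a)) ==> r i P (%a. y a - z a) = r i P y - r i P z"
   "b : Ar ==> (!!a. a : Ar ==> cd a = cd b ==> y a : X i (dm a)) ==>
    r i (dm b) (%a. y (cmp b a)) = \<rho> i b (r i (cd b) y)"
   "P : Ob ==> u : X i P ==> r i P (%a. \<rho> i a u) = u"
   "P : Ob ==> (!!a. a : Ar ==> cd a = P ==> y a = z a) ==> r i P y = r i P z"
begin

definition comp2 where "comp2 a b <-> a : Ar & b : Ar & cd a = dm b"
definition comp3 where "comp3 a b e <-> comp2 a b & comp2 b e"
definition comp4 where "comp4 a b e f <-> comp3 a b e & comp2 e f"

lemmas comps = comp2_def comp3_def comp4_def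

text \<open>
  Bar cochains with values in \<open>X i\<close>: \<open>Cn\<close> consists of functions of \<open>n\<close> composable arrows with values at the
  source of the first. Only values on composable arrows matter.
\<close>

definition "C0 i c <-> (ALL P:Ob. c P : X i P)"
definition "C1 i c <-> (ALL a:Ar. c a : X i (dm a))"
definition "C2 i c <-> (ALL a b. comp2 a b --> c a b : X i (dm a))"
definition "C3 i c <-> (ALL a b e. comp3 a b e --> c a b e : X i (dm a))"

definition "dt0 i c a = \<rho> i a (c (cd a)) - c (dm a)"
definition "dt1 i c a b = \<rho> i a (c b) - c (cmp b a) + c a"
definition "dt2 i c a b e = \<rho> i a (c b e) - c (cmp b a) e + c a (cmp e b) - c a b"
definition "dt3 i c a b e f = \<rho> i a (c b e f) - c (cmp b a) e f + c a (cmp e b) f - c a b (cmp f e) + c a b e"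

lemmas dts = dt0_def dt1_def dt2_def dt3_def

lemma \<rho>_zero: assumes "a : Ar" shows "\<rho> i a 0 = 0"
 using \<rho>(2)[OF assms, of 0 i 0] add_subgroupD(1)[OF X] ar(2)[OF assms] by simp

lemma \<rho>_uminus: assumes "a : Ar" "u : X i (cd a)" shows "\<rho> i a (- u) = - \<rho> i a u"
 using \<rho>(2)[OF assms(1), of u i "- u"] \<rho>_zero[OF assms(1), of i] add_subgroupD(3)[OF X] ar(2)[OF assms(1)] assms
 by (simp add: eq_neg_iff_add_eq_0 add.commute)

lemma \<rho>_diff: assumes "a : Ar" "u : X i (cd a)" "v : X i (cd a)" shows "\<rho> i a (u - v) = \<rho> i a u - \<rho> i a v"
 using \<rho>(2)[OF assms(1), of u i "- v"] \<rho>_uminus[of a v i] add_subgroupD(3)[OF X] ar(2)[OF assms(1)] assms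
 by simp

lemma d_zero: assumes "P : Ob" shows "d i P 0 = 0"
 using d(2)[OF assms, of 0 i 0] add_subgroupD(1)[OF X] assms by simp

lemma d_uminus: assumes "P : Ob" "u : X i P" shows "d i P (- u) = - d i P u"
 using d(2)[OF assms(1), of u i "- u"] d_zero[OF assms(1), of i] add_subgroupD(3)[OF X] assms
 by (simp add: eq_neg_iff_add_eq_0 add.commute)

lemma d_diff: assumes "P : Ob" "u : X i P" "v : X i P" shows "d i P (u - v) = d i P u - d i P v"
 using d(2)[OF assms(1), of u i "- v"] d_uminus[of P v i] add_subgroupD(3)[OF X] assms
 by simp

lemmas Xcl = add_subgroupD[OF X]
lemmas lin = \<rho>(2) \<rho>_diff d(2) d_diff

lemma r_zero:
 assumes "P : Ob" shows "r i P (%a. 0) = 0"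
 using r(2)[OF assms, of "%a. 0" i "%a. 0"] Xcl(1) ar by simp

lemma r_add:
 assumes "P : Ob" "!!a. a : Ar ==> cd a = P ==> y a : X i (dm a)" "!!a. a : Ar ==> cd a = P ==> z a : X i (dm a)"
 shows "r i P (%a. y a + z a) = r i P y + r i P z"
proof -
 have 1: "r i P (%a. 0 - z a) = - r i P z"
  using r(2)[OF assms(1), of "%a. 0" i z] assms Xcl(1) ar r_zero by simp
 have "r i P (%a. y a - (0 - z a)) = r i P y - r i P (%a. 0 - z a)"
  by (rule r(2)) (use assms Xcl ar in auto)
 thus ?thesis using 1 by simp
qed

text \<open>
  Applying \<open>r\<close> to a cocycle in its first argument is a contracting homotopy; likewise for the next two degrees.
\<close>

lemma bar_acyclic_1:
 assumes c: "C1 i c" "!!a b. comp2 a b ==> dt1 i c a b = 0"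
 shows "EX b. C0 i b & (ALL a:Ar. dt0 i b a = c a)"
proof (intro exI conjI ballI)
 let ?s = "%P. r i P c"
 show "C0 i ?s" using c(1) by (auto simp: C0_def C1_def intro!: r(1))
 fix b assume b: "b : Ar"
 have cX: "!!a. a : Ar ==> c a : X i (dm a)" using c(1) by (auto simp: C1_def)
 have "dt0 i ?s b = r i (dm b) (%a. c (cmp b a)) - r i (dm b) c"
  unfolding dt0_def by (subst r(3)) (use b cX in auto)
 also have "... = r i (dm b) (%a. c (cmp b a) - c a)"
 proof (rule r(2)[symmetric])
  show "c (cmp b a) : X i (dm a)" if "a : Ar" "cd a = dm b" for a
   using cX[of "cmp b a"] that b by (simp add: cmp)
 qed (use b cX ar in auto)
 also have "... = r i (dm b) (%a. \<rho> i a (c b))"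
 proof (rule r(5))
  fix a assume "a : Ar" "cd a = dm b"
  hence "dt1 i c a b = 0" using c(2) b by (simp add: comp2_def)
  thus "c (cmp b a) - c a = \<rho> i a (c b)" by (simp add: dt1_def algebra_simps)
 qed (use b ar in auto)
 also have "... = c b" by (rule r(4)) (use b ar cX in auto)
 finally show "dt0 i ?s b = c b" .
qed

lemma bar_acyclic_2:
 assumes c: "C2 i c" "!!a b e. comp3 a b e ==> dt2 i c a b e = 0"
 shows "EX b. C1 i b & (ALL a b'. comp2 a b' --> dt1 i b a b' = c a b')"
proof (intro exI conjI allI impI)
 let ?s = "%b. r i (dm b) (%a. c a b)"
 have cX: "!!a b. a : Ar ==> b : Ar ==> cd a = dm b ==> c a b : X i (dm a)"
  using c(1) by (auto simp: C2_def comp2_def)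
 show "C1 i ?s" using cX by (auto simp: C1_def intro!: r(1) ar)
 fix b e assume "comp2 b e"
 hence be: "b : Ar" "e : Ar" "cd b = dm e" by (auto simp: comp2_def)
 note [simp] = cmp ar be
 have X1: "c (cmp b a) e : X i (dm a)" "c a (cmp e b) : X i (dm a)" "c a b : X i (dm a)"
  if "a : Ar" "cd a = dm b" for a
  using that cX[of "cmp b a" e] by (auto intro!: cX)
 have "dt1 i ?s b e = r i (dm b) (%a. c (cmp b a) e) - r i (dm b) (%a. c a (cmp e b)) + r i (dm b) (%a. c a b)"
  unfolding dt1_def using r(3)[of b "%a. c a e" i] by (simp add: cX)
 also have "... = r i (dm b) (%a. (c (cmp b a) e - c a (cmp e b)) + c a b)"
  by (subst r_add) (use X1 Xcl in \<open>auto simp: r(2)\<close>)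
 also have "... = r i (dm b) (%a. \<rho> i a (c b e))"
 proof (rule r(5))
  fix a assume "a : Ar" "cd a = dm b"
  hence "dt2 i c a b e = 0" using c(2) by (simp add: comps)
  thus "c (cmp b a) e - c a (cmp e b) + c a b = \<rho> i a (c b e)" by (simp add: dt2_def algebra_simps)
 qed auto
 also have "... = c b e" by (rule r(4)) (auto intro!: cX)
 finally show "dt1 i ?s b e = c b e" .
qed

lemma bar_acyclic_3:
 assumes c: "C3 i c" "!!a b e f. comp4 a b e f ==> dt3 i c a b e f = 0"
 shows "EX b. C2 i b & (ALL a b' e. comp3 a b' e --> dt2 i b a b' e = c a b' e)"
proof (intro exI conjI allI impI)
 let ?s = "%b e. r i (dm b) (%a. c a b e)"
 have cX: "!!a b e. a : Ar ==> b : Ar ==> e : Ar ==> cd a = dm b ==> cd b = dm e ==> c a b e : X i (dm a)"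
  using c(1) by (auto simp: C3_def comps)
 show "C2 i ?s" using cX by (auto simp: C2_def comp2_def intro!: r(1) ar)
 fix b e f assume "comp3 b e f"
 hence be: "b : Ar" "e : Ar" "cd b = dm e" "f : Ar" "cd e = dm f" by (auto simp: comps)
 note [simp] = cmp ar be
 have X1: "c (cmp b a) e f : X i (dm a)" "c a (cmp e b) f : X i (dm a)" "c a b (cmp f e) : X i (dm a)" "c a b e : X i (dm a)"
  if "a : Ar" "cd a = dm b" for a
  using that cX[of "cmp b a" e f] by (auto intro!: cX)
 have "dt2 i ?s b e f = r i (dm b) (%a. c (cmp b a) e f) - r i (dm b) (%a. c a (cmp e b) f) + r i (dm b) (%a. c a b (cmp f e))
   - r i (dm b) (%a. c a b e)"
  unfolding dt2_def using r(3)[of b "%a. c a e f" i] by (simp add: cX)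
 also have "... = r i (dm b) (%a. ((c (cmp b a) e f - c a (cmp e b) f) + c a b (cmp f e)) - c a b e)"
 proof -
  have "r i (dm b) (%a. ((c (cmp b a) e f - c a (cmp e b) f) + c a b (cmp f e)) - c a b e) =
   r i (dm b) (%a. (c (cmp b a) e f - c a (cmp e b) f) + c a b (cmp f e)) - r i (dm b) (%a. c a b e)"
   by (rule r(2)) (use X1 Xcl in auto)
  also have "r i (dm b) (%a. (c (cmp b a) e f - c a (cmp e b) f) + c a b (cmp f e)) =
    r i (dm b) (%a. c (cmp b a) e f - c a (cmp e b) f) + r i (dm b) (%a. c a b (cmp f e))"
   by (rule r_add) (use X1 Xcl in auto)
  also have "r i (dm b) (%a. c (cmp b a) e f - c a (cmp e b) f) = r i (dm b) (%a. c (cmp b a) e f) - r i (dm b) (%a. c a (cmp e b) f)"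
   by (rule r(2)) (use X1 Xcl in auto)
  finally show ?thesis by simp
 qed
 also have "... = r i (dm b) (%a. \<rho> i a (c b e f))"
 proof (rule r(5))
  fix a assume "a : Ar" "cd a = dm b"
  hence "dt3 i c a b e f = 0" using c(2) by (simp add: comps)
  thus "c (cmp b a) e f - c a (cmp e b) f + c a b (cmp f e) - c a b e = \<rho> i a (c b e f)" by (simp add: dt3_def algebra_simps)
 qed auto
 also have "... = c b e f" by (rule r(4)) (auto intro!: cX)
 finally show "dt2 i ?s b e f = c b e f" .
qed

lemma CX:
 "C0 i c ==> P : Ob ==> c P : X i P"
 "C1 i c1 ==> a : Ar ==> c1 a : X i (dm a)"
 "C2 i c2 ==> a : Ar ==> b : Ar ==> cd a = dm b ==> c2 a b : X i (dm a)"
 by (simp_all add: C0_def C1_def C2_def comps)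

lemma CX_cmp:
 assumes "a : Ar" "b : Ar" "cd a = dm b"
 shows "C1 i c1 ==> c1 (cmp b a) : X i (dm a)"
  and "C2 i c2 ==> e : Ar ==> cd b = dm e ==> c2 (cmp b a) e : X i (dm a)"
  and "C2 i c2 ==> e : Ar ==> f : Ar ==> cd b = dm e ==> cd e = dm f ==> c2 (cmp b a) (cmp f e) : X i (dm a)"
  and "C2 i c2 ==> e : Ar ==> f : Ar ==> cd b = dm e ==> cd e = dm f ==> c2 (cmp (cmp e b) a) f : X i (dm a)"
proof -
 show "C1 i c1 ==> c1 (cmp b a) : X i (dm a)"
  using CX(2)[of i c1 "cmp b a"] assms by (simp add: cmp)
 show "C2 i c2 ==> e : Ar ==> cd b = dm e ==> c2 (cmp b a) e : X i (dm a)"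
  using CX(3)[of i c2 "cmp b a" e] assms by (simp add: cmp)
 show "C2 i c2 ==> e : Ar ==> f : Ar ==> cd b = dm e ==> cd e = dm f ==> c2 (cmp b a) (cmp f e) : X i (dm a)"
  using CX(3)[of i c2 "cmp b a" "cmp f e"] assms by (simp add: cmp)
 show "C2 i c2 ==> e : Ar ==> f : Ar ==> cd b = dm e ==> cd e = dm f ==> c2 (cmp (cmp e b) a) f : X i (dm a)"
  using CX(3)[of i c2 "cmp (cmp e b) a" f] assms by (simp add: cmp)
qed

lemmas CXs = CX CX_cmp

lemma dt_closed:
 "C0 i c ==> C1 i (dt0 i c)" "C1 i c1 ==> C2 i (dt1 i c1)" "C2 i c2 ==> C3 i (dt2 i c2)"
proof -
 assume "C0 i c" thus "C1 i (dt0 i c)"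
  unfolding C1_def by (simp add: dts CXs ar Xcl \<rho>(1))
next
 assume c: "C1 i c1" show "C2 i (dt1 i c1)"
  unfolding C2_def comps
 proof clarify
  fix a b assume "a : Ar" "b : Ar" "cd a = dm b"
  thus "dt1 i c1 a b : X i (dm a)" using c \<rho>(1)[of a "c1 b" i] by (simp add: dts CXs ar Xcl)
 qed
next
 assume c: "C2 i c2" show "C3 i (dt2 i c2)"
  unfolding C3_def comps
 proof clarify
  fix a b e assume "a : Ar" "b : Ar" "cd a = dm b" "e : Ar" "cd b = dm e"
  thus "dt2 i c2 a b e : X i (dm a)" using c \<rho>(1)[of a "c2 b e" i] by (simp add: dts CXs ar Xcl cmp)
 qed
qed

lemma \<rho>_lin3:
 assumes "a : Ar" "u : X i (cd a)" "v : X i (cd a)" "w : X i (cd a)"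
 shows "\<rho> i a (u - v + w) = \<rho> i a u - \<rho> i a v + \<rho> i a w"
 using assms by (simp add: lin Xcl ar)

lemma \<rho>_lin4:
 assumes "a : Ar" "u : X i (cd a)" "v : X i (cd a)" "w : X i (cd a)" "x : X i (cd a)"
 shows "\<rho> i a (u - v + w - x) = \<rho> i a u - \<rho> i a v + \<rho> i a w - \<rho> i a x"
 using assms by (simp add: lin Xcl ar)

lemma d_lin3:
 assumes "P : Ob" "u : X i P" "v : X i P" "w : X i P"
 shows "d i P (u - v + w) = d i P u - d i P v + d i P w"
 using assms by (simp add: lin Xcl ar)

lemma d_lin4:
 assumes "P : Ob" "u : X i P" "v : X i P" "w : X i P" "x : X i P"
 shows "d i P (u - v + w - x) = d i P u - d i P v + d i P w - d i P x"
 using assms by (simp add: lin Xcl ar)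

lemma dt_dt:
 "C0 i c ==> comp2 a b ==> dt1 i (dt0 i c) a b = 0"
 "C1 i c1 ==> comp3 a b e ==> dt2 i (dt1 i c1) a b e = 0"
 "C2 i c2 ==> comp4 a b e f ==> dt3 i (dt2 i c2) a b e f = 0"
proof -
 assume c: "C0 i c" and "comp2 a b"
 hence [simp]: "a : Ar" "b : Ar" "cd a = dm b" by (simp_all add: comps)
 have "\<rho> i a (dt0 i c b) = \<rho> i a (\<rho> i b (c (cd b))) - \<rho> i a (c (dm b))"
  unfolding dts by (rule \<rho>_diff) (use c in \<open>simp_all add: CXs ar \<rho>(1)\<close>)
 thus "dt1 i (dt0 i c) a b = 0"
  using c by (simp add: dt1_def) (simp add: dt0_def cmp ar \<rho>(3) CXs)
next
 assume c: "C1 i c1" and "comp3 a b e"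
 hence [simp]: "a : Ar" "b : Ar" "cd a = dm b" "e : Ar" "cd b = dm e" by (simp_all add: comps)
 have "\<rho> i a (dt1 i c1 b e) = \<rho> i a (\<rho> i b (c1 e)) - \<rho> i a (c1 (cmp e b)) + \<rho> i a (c1 b)"
  unfolding dts by (rule \<rho>_lin3) (use c \<rho>(1)[of b "c1 e" i] in \<open>simp_all add: CXs\<close>)
 thus "dt2 i (dt1 i c1) a b e = 0"
  using c \<rho>(3)[of a b "c1 e" i] by (simp add: dt2_def) (simp add: dt1_def cmp CXs)
next
 assume c: "C2 i c2" and "comp4 a b e f"
 hence [simp]: "a : Ar" "b : Ar" "cd a = dm b" "e : Ar" "cd b = dm e" "f : Ar" "cd e = dm f" by (simp_all add: comps)
 have "\<rho> i a (dt2 i c2 b e f) = \<rho> i a (\<rho> i b (c2 e f)) - \<rho> i a (c2 (cmp e b) f) + \<rho> i a (c2 b (cmp f e)) - \<rho> i a (c2 b e)"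
  unfolding dts by (rule \<rho>_lin4) (use c \<rho>(1)[of b "c2 e f" i] in \<open>simp_all add: CXs cmp\<close>)
 thus "dt3 i (dt2 i c2) a b e f = 0"
  using c \<rho>(3)[of a b "c2 e f" i] by (simp add: dt3_def) (simp add: dt2_def cmp CXs)
qed

lemma d_dt:
 "C0 i c ==> a : Ar ==> d i (dm a) (dt0 i c a) = dt0 (Suc i) (%P. d i P (c P)) a"
 "C1 i c1 ==> comp2 a b ==> d i (dm a) (dt1 i c1 a b) = dt1 (Suc i) (%a. d i (dm a) (c1 a)) a b"
 "C2 i c2 ==> comp3 a b e ==> d i (dm a) (dt2 i c2 a b e) = dt2 (Suc i) (%a b. d i (dm a) (c2 a b)) a b e"
proof -
 assume "C0 i c" "a : Ar"
 thus "d i (dm a) (dt0 i c a) = dt0 (Suc i) (%P. d i P (c P)) a"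
  by (simp add: dts CXs cmp ar d_diff \<rho>(1) d(3))
next
 assume c: "C1 i c1" and "comp2 a b"
 hence [simp]: "a : Ar" "b : Ar" "cd a = dm b" by (simp_all add: comps)
 have "d i (dm a) (dt1 i c1 a b) = d i (dm a) (\<rho> i a (c1 b)) - d i (dm a) (c1 (cmp b a)) + d i (dm a) (c1 a)"
  unfolding dts by (rule d_lin3) (use c \<rho>(1)[of a "c1 b" i] in \<open>simp_all add: CXs ar\<close>)
 thus "d i (dm a) (dt1 i c1 a b) = dt1 (Suc i) (%a. d i (dm a) (c1 a)) a b"
  using d(3)[of a "c1 b" i] c by (simp add: CXs) (simp add: dt1_def cmp)
next
 assume c: "C2 i c2" and "comp3 a b e"
 hence [simp]: "a : Ar" "b : Ar" "cd a = dm b" "e : Ar" "cd b = dm e" by (simp_all add: comps)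
 have "d i (dm a) (dt2 i c2 a b e) = d i (dm a) (\<rho> i a (c2 b e)) - d i (dm a) (c2 (cmp b a) e) + d i (dm a) (c2 a (cmp e b))
   - d i (dm a) (c2 a b)"
  unfolding dts by (rule d_lin4) (use c \<rho>(1)[of a "c2 b e" i] in \<open>simp_all add: CXs ar cmp\<close>)
 thus "d i (dm a) (dt2 i c2 a b e) = dt2 (Suc i) (%a b. d i (dm a) (c2 a b)) a b e"
  using d(3)[of a "c2 b e" i] c by (simp add: CXs) (simp add: dt2_def cmp)
qed

lemma dt_diff:
 "C0 i x0 ==> C0 i y0 ==> a : Ar ==> dt0 i (%P. x0 P - y0 P) a = dt0 i x0 a - dt0 i y0 a"
 "C1 i x1 ==> C1 i y1 ==> comp2 a b ==> dt1 i (%a. x1 a - y1 a) a b = dt1 i x1 a b - dt1 i y1 a b"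
 "C2 i x2 ==> C2 i y2 ==> comp3 a b e ==> dt2 i (%a b. x2 a b - y2 a b) a b e = dt2 i x2 a b e - dt2 i y2 a b e"
 by (simp_all add: C0_def C1_def C2_def comps dts cmp ar \<rho>_diff algebra_simps)

lemma dt_cong:
 "(!!P. P : Ob ==> x0 P = y0 P) ==> a : Ar ==> dt0 i x0 a = dt0 i y0 a"
 "(!!a. a : Ar ==> x1 a = y1 a) ==> comp2 a b ==> dt1 i x1 a b = dt1 i y1 a b"
 "(!!a b. comp2 a b ==> x2 a b = y2 a b) ==> comp3 a b e ==> dt2 i x2 a b e = dt2 i y2 a b e"
 by (simp_all add: comps dts cmp ar)

lemma C_diff:
 "C0 i x0 ==> C0 i y0 ==> C0 i (%P. x0 P - y0 P)"
 "C1 i x1 ==> C1 i y1 ==> C1 i (%a. x1 a - y1 a)"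
 "C2 i x2 ==> C2 i y2 ==> C2 i (%a b. x2 a b - y2 a b)"
 by (simp_all add: C0_def C1_def C2_def comps ar Xcl)

lemma C_d:
 "C0 i x0 ==> C0 (Suc i) (%P. d i P (x0 P))"
 "C1 i x1 ==> C1 (Suc i) (%a. d i (dm a) (x1 a))"
 "C2 i x2 ==> C2 (Suc i) (%a b. d i (dm a) (x2 a b))"
 by (simp_all add: C0_def C1_def C2_def comps ar d(1))

lemma C_exact:
 "C0 (Suc i) x0 ==> (!!P. P : Ob ==> d (Suc i) P (x0 P) = 0) ==> EX y. C0 i y & (ALL P:Ob. d i P (y P) = x0 P)"
 "C1 (Suc i) x1 ==> (!!a. a : Ar ==> d (Suc i) (dm a) (x1 a) = 0) ==> EX y. C1 i y & (ALL a:Ar. d i (dm a) (y a) = x1 a)"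
 "C2 (Suc i) x2 ==> (!!a b. comp2 a b ==> d (Suc i) (dm a) (x2 a b) = 0) ==>
   EX y. C2 i y & (ALL a b. comp2 a b --> d i (dm a) (y a b) = x2 a b)"
proof -
 define g where "g P u = (SOME v. v : X i P & d i P v = u)" for P u
 have g: "g P u : X i P" "d i P (g P u) = u" if "P : Ob" "u : X (Suc i) P" "d (Suc i) P u = 0" for P u
  using someI_ex[of "%v. v : X i P & d i P v = u"] exact[OF that] unfolding g_def by blast+
 show "C0 (Suc i) x0 ==> (!!P. P : Ob ==> d (Suc i) P (x0 P) = 0) ==> EX y. C0 i y & (ALL P:Ob. d i P (y P) = x0 P)"
  by (rule exI[of _ "%P. g P (x0 P)"]) (simp add: C0_def g)
 show "C1 (Suc i) x1 ==> (!!a. a : Ar ==> d (Suc i) (dm a) (x1 a) = 0) ==> EX y. C1 i y & (ALL a:Ar. d i (dm a) (y a) = x1 a)"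
  by (rule exI[of _ "%a. g (dm a) (x1 a)"]) (simp add: C1_def g ar)
 show "C2 (Suc i) x2 ==> (!!a b. comp2 a b ==> d (Suc i) (dm a) (x2 a b) = 0) ==>
   EX y. C2 i y & (ALL a b. comp2 a b --> d i (dm a) (y a b) = x2 a b)"
  by (rule exI[of _ "%a b. g (dm a) (x2 a b)"]) (simp add: C2_def comps g ar)
qed

text \<open>
  In the double complex of bar cochains with values in the resolution, \<open>Zn i\<close> and \<open>En i\<close> are the bar \<open>n\<close>-cocycles
  with values in the kernel of \<open>d i\<close>, and the relation of being cohomologous through such cochains. The relation \<open>E0\<close> is
  instead equality modulo the image of \<open>d\<close> on invariants, since \<open>Z0 (Suc i)\<close> is the group of cocycles of inverse limits.
\<close>

definition "Z0 i = {c. C0 i c & (ALL P:Ob. d i P (c P) = 0) & (ALL a:Ar. dt0 i c a = 0)}"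
definition "Z1 i = {c. C1 i c & (ALL a:Ar. d i (dm a) (c a) = 0) & (ALL a b. comp2 a b --> dt1 i c a b = 0)}"
definition "Z2 i = {c. C2 i c & (ALL a b. comp2 a b --> d i (dm a) (c a b) = 0) &
 (ALL a b e. comp3 a b e --> dt2 i c a b e = 0)}"
definition "Z3 i = {c. C3 i c & (ALL a b e. comp3 a b e --> d i (dm a) (c a b e) = 0) &
 (ALL a b e f. comp4 a b e f --> dt3 i c a b e f = 0)}"

definition "E0 i c c' <-> (EX y. C0 i y & (ALL a:Ar. dt0 i y a = 0) & (ALL P:Ob. c P - c' P = d i P (y P)))"
definition "E1 i c c' <-> (EX y. C0 i y & (ALL P:Ob. d i P (y P) = 0) & (ALL a:Ar. c a - c' a = dt0 i y a))"
definition "E2 i c c' <-> (EX y. C1 i y & (ALL a:Ar. d i (dm a) (y a) = 0) &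
 (ALL a b. comp2 a b --> c a b - c' a b = dt1 i y a b))"
definition "E3 i c c' <-> (EX y. C2 i y & (ALL a b. comp2 a b --> d i (dm a) (y a b) = 0) &
 (ALL a b e. comp3 a b e --> c a b e - c' a b e = dt2 i y a b e))"

text \<open>
  A bar cocycle in the kernel of \<open>d i\<close> bounds a cochain in \<open>X i\<close>, whose image under \<open>d i\<close> is the corresponding
  cocycle one degree lower. Backwards, lift along \<open>d i\<close> by exactness and apply the bar differential.
\<close>

lemma shift_1: "corr (Z1 i) (E1 i) (Z0 (Suc i)) (E0 i)"
proof (rule corrI[where R = "%c c'. EX x. C0 i x & (ALL a:Ar. dt0 i x a = c a) & (ALL P:Ob. d i P (x P) = c' P)"])
 fix c assume c: "c : Z1 i"
 obtain x where x: "C0 i x" "ALL a:Ar. dt0 i x a = c a" using bar_acyclic_1[of i c] c by (auto simp: Z1_def)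
 have "(%P. d i P (x P)) : Z0 (Suc i)"
  using C_d(1)[OF x(1)] d_dt(1)[OF x(1)] x c by (auto simp: Z0_def Z1_def C0_def d(4))
 thus "EX b:Z0 (Suc i). EX x. C0 i x & (ALL a:Ar. dt0 i x a = c a) & (ALL P:Ob. d i P (x P) = b P)"
  using x by (intro bexI[where x = "%P. d i P (x P)"] exI[of _ x]) simp_all
next
 fix c' assume c': "c' : Z0 (Suc i)"
 obtain x where x: "C0 i x" "ALL P:Ob. d i P (x P) = c' P" using C_exact(1)[of i c'] c' by (auto simp: Z0_def)
 have "d i (dm a) (dt0 i x a) = 0" if a: "a : Ar" for a
  using d_dt(1)[OF x(1) a] dt_cong(1)[of "%P. d i P (x P)" c' a "Suc i"] x(2) a c' by (auto simp: Z0_def)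
 hence "dt0 i x : Z1 i" using dt_closed(1)[OF x(1)] dt_dt(1)[OF x(1)] by (auto simp: Z1_def)
 thus "EX a:Z1 i. EX x. C0 i x & (ALL aa:Ar. dt0 i x aa = a aa) & (ALL P:Ob. d i P (x P) = c' P)"
  using x by (intro bexI[where x = "dt0 i x"] exI[of _ x]) simp_all
next
 fix c c1 c' c1'
 assume "EX x. C0 i x & (ALL a:Ar. dt0 i x a = c a) & (ALL P:Ob. d i P (x P) = c' P)"
  "EX x. C0 i x & (ALL a:Ar. dt0 i x a = c1 a) & (ALL P:Ob. d i P (x P) = c1' P)"
 then obtain x x1 where x: "C0 i x" "!!a. a : Ar ==> dt0 i x a = c a" "!!P. P : Ob ==> d i P (x P) = c' P"
  and x1: "C0 i x1" "!!a. a : Ar ==> dt0 i x1 a = c1 a" "!!P. P : Ob ==> d i P (x1 P) = c1' P" by blast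
 define z where "z P = x P - x1 P" for P
 have z: "C0 i z" "!!a. a : Ar ==> dt0 i z a = c a - c1 a" "!!P. P : Ob ==> d i P (z P) = c' P - c1' P"
  using C_diff(1)[OF x(1) x1(1)] dt_diff(1)[OF x(1) x1(1)] x x1 by (auto simp: z_def [abs_def] C0_def d_diff)
 show "E1 i c c1 <-> E0 i c' c1'"
 proof
  assume "E1 i c c1"
  then obtain e where e: "C0 i e" "ALL P:Ob. d i P (e P) = 0" "ALL a:Ar. c a - c1 a = dt0 i e a" by (auto simp: E1_def)
  show "E0 i c' c1'" unfolding E0_def
   by (rule exI[of _ "%P. z P - e P"])
    (use z e C_diff(1)[OF z(1) e(1)] dt_diff(1)[OF z(1) e(1)] in \<open>auto simp: C0_def d_diff\<close>)
 next
  assume "E0 i c' c1'"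
  then obtain e where e: "C0 i e" "ALL a:Ar. dt0 i e a = 0" "ALL P:Ob. c' P - c1' P = d i P (e P)" by (auto simp: E0_def)
  show "E1 i c c1" unfolding E1_def
   by (rule exI[of _ "%P. z P - e P"])
    (use z e C_diff(1)[OF z(1) e(1)] dt_diff(1)[OF z(1) e(1)] in \<open>auto simp: C0_def d_diff\<close>)
 qed
qed

lemma shift_2: "corr (Z2 i) (E2 i) (Z1 (Suc i)) (E1 (Suc i))"
proof (rule corrI[where R = "%c c'. EX x. C1 i x & (ALL a b. comp2 a b --> dt1 i x a b = c a b) & (ALL a:Ar. d i (dm a) (x a) = c' a)"])
 fix c assume c: "c : Z2 i"
 obtain x where x: "C1 i x" "ALL a b. comp2 a b --> dt1 i x a b = c a b" using bar_acyclic_2[of i c] c by (auto simp: Z2_def)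
 have "(%a. d i (dm a) (x a)) : Z1 (Suc i)"
  using C_d(2)[OF x(1)] d_dt(2)[OF x(1)] x c by (auto simp: Z1_def Z2_def C1_def d(4) ar)
 thus "EX b:Z1 (Suc i). EX x. C1 i x & (ALL a b. comp2 a b --> dt1 i x a b = c a b) & (ALL a:Ar. d i (dm a) (x a) = b a)"
  using x by (intro bexI[where x = "%a. d i (dm a) (x a)"] exI[of _ x]) simp_all
next
 fix c' assume c': "c' : Z1 (Suc i)"
 obtain x where x: "C1 i x" "ALL a:Ar. d i (dm a) (x a) = c' a" using C_exact(2)[of i c'] c' by (auto simp: Z1_def)
 have "d i (dm a) (dt1 i x a b) = 0" if a: "comp2 a b" for a b
  using d_dt(2)[OF x(1) a] dt_cong(2)[of "%a. d i (dm a) (x a)" c' a b "Suc i"] x(2) a c' by (auto simp: Z1_def)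
 hence "dt1 i x : Z2 i" using dt_closed(2)[OF x(1)] dt_dt(2)[OF x(1)] by (auto simp: Z2_def)
 thus "EX a:Z2 i. EX x. C1 i x & (ALL aa b. comp2 aa b --> dt1 i x aa b = a aa b) & (ALL a:Ar. d i (dm a) (x a) = c' a)"
  using x by (intro bexI[where x = "dt1 i x"] exI[of _ x]) simp_all
next
 fix c c1 c' c1'
 assume "EX x. C1 i x & (ALL a b. comp2 a b --> dt1 i x a b = c a b) & (ALL a:Ar. d i (dm a) (x a) = c' a)"
  "EX x. C1 i x & (ALL a b. comp2 a b --> dt1 i x a b = c1 a b) & (ALL a:Ar. d i (dm a) (x a) = c1' a)"
 then obtain x x1 where x: "C1 i x" "!!a b. comp2 a b ==> dt1 i x a b = c a b" "!!a. a : Ar ==> d i (dm a) (x a) = c' a"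
  and x1: "C1 i x1" "!!a b. comp2 a b ==> dt1 i x1 a b = c1 a b" "!!a. a : Ar ==> d i (dm a) (x1 a) = c1' a" by blast
 define z where "z P = x P - x1 P" for P
 have z: "C1 i z" "!!a b. comp2 a b ==> dt1 i z a b = c a b - c1 a b" "!!a. a : Ar ==> d i (dm a) (z a) = c' a - c1' a"
  using C_diff(2)[OF x(1) x1(1)] dt_diff(2)[OF x(1) x1(1)] x x1 by (auto simp: z_def [abs_def] C1_def d_diff ar)
 show "E2 i c c1 <-> E1 (Suc i) c' c1'"
 proof
  assume "E2 i c c1"
  then obtain e where e: "C1 i e" "ALL a:Ar. d i (dm a) (e a) = 0" "ALL a b. comp2 a b --> c a b - c1 a b = dt1 i e a b" by (auto simp: E2_def)
  have "C1 i (%a. z a - e a)" "!!a b. comp2 a b ==> dt1 i (%a. z a - e a) a b = 0"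
   using C_diff(2)[OF z(1) e(1)] dt_diff(2)[OF z(1) e(1)] z e by auto
  then obtain f where f: "C0 i f" "ALL a:Ar. dt0 i f a = z a - e a" using bar_acyclic_1 by blast
  show "E1 (Suc i) c' c1'" unfolding E1_def
   by (rule exI[of _ "%P. d i P (f P)"])
    (use z e f C_d(1)[OF f(1)] d_dt(1)[OF f(1), symmetric] in \<open>auto simp: C0_def C1_def d_diff d(4) ar\<close>)
 next
  assume "E1 (Suc i) c' c1'"
  then obtain f' where f': "C0 (Suc i) f'" "ALL P:Ob. d (Suc i) P (f' P) = 0" "ALL a:Ar. c' a - c1' a = dt0 (Suc i) f' a" by (auto simp: E1_def)
  obtain f where f: "C0 i f" "ALL P:Ob. d i P (f P) = f' P" using C_exact(1)[OF f'(1)] f'(2) by blast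
  have df: "d i (dm a) (dt0 i f a) = c' a - c1' a" if "a : Ar" for a
   using d_dt(1)[OF f(1) that] dt_cong(1)[of "%P. d i P (f P)" f' a "Suc i"] f(2) f'(3) that by simp
  have f1: "C1 i (dt0 i f)" by (rule dt_closed(1)[OF f(1)])
  show "E2 i c c1" unfolding E2_def
   by (rule exI[of _ "%a. z a - dt0 i f a"])
    (use z df f1 C_diff(2)[OF z(1) f1] dt_diff(2)[OF z(1) f1] dt_dt(1)[OF f(1)] in \<open>auto simp: C1_def d_diff ar\<close>)
 qed
qed

lemma shift_3: "corr (Z3 i) (E3 i) (Z2 (Suc i)) (E2 (Suc i))"
proof (rule corrI[where R = "%c c'. EX x. C2 i x & (ALL a b e. comp3 a b e --> dt2 i x a b e = c a b e) &
  (ALL a b. comp2 a b --> d i (dm a) (x a b) = c' a b)"])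
 fix c assume c: "c : Z3 i"
 obtain x where x: "C2 i x" "ALL a b e. comp3 a b e --> dt2 i x a b e = c a b e" using bar_acyclic_3[of i c] c by (auto simp: Z3_def)
 have "(%a b. d i (dm a) (x a b)) : Z2 (Suc i)"
  using C_d(3)[OF x(1)] d_dt(3)[OF x(1)] x c by (auto simp: Z2_def Z3_def C2_def comp2_def d(4) ar)
 thus "EX b:Z2 (Suc i). EX x. C2 i x & (ALL a b e. comp3 a b e --> dt2 i x a b e = c a b e) &
   (ALL a b'. comp2 a b' --> d i (dm a) (x a b') = b a b')"
  using x by (intro bexI[where x = "%a b. d i (dm a) (x a b)"] exI[of _ x]) simp_all
next
 fix c' assume c': "c' : Z2 (Suc i)"
 obtain x where x: "C2 i x" "ALL a b. comp2 a b --> d i (dm a) (x a b) = c' a b" using C_exact(3)[of i c'] c' by (auto simp: Z2_def)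
 have "d i (dm a) (dt2 i x a b e) = 0" if a: "comp3 a b e" for a b e
  using d_dt(3)[OF x(1) a] dt_cong(3)[of "%a b. d i (dm a) (x a b)" c' a b e "Suc i"] x(2) a c' by (auto simp: Z2_def)
 hence "dt2 i x : Z3 i" using dt_closed(3)[OF x(1)] dt_dt(3)[OF x(1)] by (auto simp: Z3_def)
 thus "EX a:Z3 i. EX x. C2 i x & (ALL aa b e. comp3 aa b e --> dt2 i x aa b e = a aa b e) &
   (ALL a b. comp2 a b --> d i (dm a) (x a b) = c' a b)"
  using x by (intro bexI[where x = "dt2 i x"] exI[of _ x]) simp_all
next
 fix c c1 c' c1'
 assume "EX x. C2 i x & (ALL a b e. comp3 a b e --> dt2 i x a b e = c a b e) & (ALL a b. comp2 a b --> d i (dm a) (x a b) = c' a b)"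
  "EX x. C2 i x & (ALL a b e. comp3 a b e --> dt2 i x a b e = c1 a b e) & (ALL a b. comp2 a b --> d i (dm a) (x a b) = c1' a b)"
 then obtain x x1 where x: "C2 i x" "!!a b e. comp3 a b e ==> dt2 i x a b e = c a b e" "!!a b. comp2 a b ==> d i (dm a) (x a b) = c' a b"
  and x1: "C2 i x1" "!!a b e. comp3 a b e ==> dt2 i x1 a b e = c1 a b e" "!!a b. comp2 a b ==> d i (dm a) (x1 a b) = c1' a b" by blast
 define z where "z a b = x a b - x1 a b" for a b
 have z: "C2 i z" "!!a b e. comp3 a b e ==> dt2 i z a b e = c a b e - c1 a b e" "!!a b. comp2 a b ==> d i (dm a) (z a b) = c' a b - c1' a b"
  using C_diff(3)[OF x(1) x1(1)] dt_diff(3)[OF x(1) x1(1)] x x1 by (auto simp: z_def [abs_def] C2_def comp2_def d_diff ar)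
 show "E3 i c c1 <-> E2 (Suc i) c' c1'"
 proof
  assume "E3 i c c1"
  then obtain e where e: "C2 i e" "ALL a b. comp2 a b --> d i (dm a) (e a b) = 0" "ALL a b g. comp3 a b g --> c a b g - c1 a b g = dt2 i e a b g" by (auto simp: E3_def)
  have "C2 i (%a b. z a b - e a b)" "!!a b g. comp3 a b g ==> dt2 i (%a b. z a b - e a b) a b g = 0"
   using C_diff(3)[OF z(1) e(1)] dt_diff(3)[OF z(1) e(1)] z e by auto
  then obtain f where f: "C1 i f" "ALL a b. comp2 a b --> dt1 i f a b = z a b - e a b" using bar_acyclic_2 by blast
  show "E2 (Suc i) c' c1'" unfolding E2_def
   by (rule exI[of _ "%a. d i (dm a) (f a)"])
    (use z e f C_d(2)[OF f(1)] d_dt(2)[OF f(1), symmetric] in \<open>auto simp: C1_def C2_def comp2_def d_diff d(4) ar\<close>)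
 next
  assume "E2 (Suc i) c' c1'"
  then obtain f' where f': "C1 (Suc i) f'" "ALL a:Ar. d (Suc i) (dm a) (f' a) = 0" "ALL a b. comp2 a b --> c' a b - c1' a b = dt1 (Suc i) f' a b" by (auto simp: E2_def)
  obtain f where f: "C1 i f" "ALL a:Ar. d i (dm a) (f a) = f' a" using C_exact(2)[OF f'(1)] f'(2) by blast
  have df: "d i (dm a) (dt1 i f a b) = c' a b - c1' a b" if "comp2 a b" for a b
   using d_dt(2)[OF f(1) that] dt_cong(2)[of "%a. d i (dm a) (f a)" f' a b "Suc i"] f(2) f'(3) that by simp
  have f1: "C2 i (dt1 i f)" by (rule dt_closed(2)[OF f(1)])
  show "E3 i c c1" unfolding E3_def
   by (rule exI[of _ "%a b. z a b - dt1 i f a b"])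
    (use z df f1 C_diff(3)[OF z(1) f1] dt_diff(3)[OF z(1) f1] dt_dt(2)[OF f(1)] in \<open>auto simp: C2_def comp2_def d_diff ar\<close>)
 qed
qed

lemma dimension_shift: "corr (Z3 0) (E3 0) (Z0 3) (E0 2)"
 unfolding numeral_2_eq_2 numeral_3_eq_3
 by (rule corr_trans[OF corr_trans[OF shift_3 shift_2] shift_1])

end

section \<open>Higher limits computed by bar cochains\<close>

definition arrows :: "('o, 'a) cat => ('o \<times> 'a \<times> 'o) set" where
 "arrows C = {(P, f, Q). P : Obj C & Q : Obj C & f : Mor C P Q}"

definition src :: "'o \<times> 'a \<times> 'o => 'o" where "src a = fst a"
definition mor :: "'o \<times> 'a \<times> 'o => 'a" where "mor a = fst (snd a)"
definition tgt :: "'o \<times> 'a \<times> 'o => 'o" where "tgt a = snd (snd a)"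

definition arrow_comp :: "('o, 'a) cat => 'o \<times> 'a \<times> 'o => 'o \<times> 'a \<times> 'o => 'o \<times> 'a \<times> 'o" where
 "arrow_comp C b a = (src a, comp C (src a) (tgt a) (tgt b) (mor b) (mor a), tgt b)"

lemma arrow_simps [simp]: "src (P, f, Q) = P" "mor (P, f, Q) = f" "tgt (P, f, Q) = Q"
 by (simp_all add: src_def mor_def tgt_def)

lemma arrowsD: "a : arrows C ==> src a : Obj C & tgt a : Obj C & mor a : Mor C (src a) (tgt a)"
 by (auto simp: arrows_def)

text \<open>
  The acyclic resolution computes \<open>\<Lambda>\<close> as the third cohomology of its inverse limits, and its \<open>0\<close>-th kernel is \<open>F\<close>.
\<close>

definition resolves_limit ::
 "('o, 'a) cat => ('o, 'a, 'v) presheaf => ('o => 'u) set monoid =>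
  (nat => 'o => 'w::ab_group_add set) => (nat => 'o \<times> 'a \<times> 'o => 'w => 'w) => (nat => 'o => 'w => 'w) =>
  (nat => 'o => ('o \<times> 'a \<times> 'o => 'w) => 'w) => ('o => 'v => 'w) => bool" where
 "resolves_limit C F \<Lambda> X \<rho> d r \<theta> <->
   acyclic_resolution (Obj C) (arrows C) src tgt (arrow_comp C) X \<rho> d r &
   (ALL P:Obj C. (ALL x:sect F P. ALL y:sect F P. \<theta> P (x \<otimes>\<^bsub>grp F P\<^esub> y) = \<theta> P x + \<theta> P y) &
    inj_on (\<theta> P) (sect F P) & \<theta> P ` sect F P = {u : X 0 P. d 0 P u = 0}) &
   (ALL a:arrows C. ALL x:sect F (tgt a). \<theta> (src a) (res F (src a) (tgt a) (mor a) x) = \<rho> 0 a (\<theta> (tgt a) x)) &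
   (EX f. bij_betw f (acyclic_resolution.Z0 (Obj C) (arrows C) src tgt X \<rho> d 3 //
     {(c, c'). c : acyclic_resolution.Z0 (Obj C) (arrows C) src tgt X \<rho> d 3 &
       c' : acyclic_resolution.Z0 (Obj C) (arrows C) src tgt X \<rho> d 3 &
       acyclic_resolution.E0 (Obj C) (arrows C) src tgt X \<rho> d 2 c c'}) (carrier \<Lambda>)) &
   \<one>\<^bsub>\<Lambda>\<^esub> : carrier \<Lambda>"

context acyclic_resolution
begin

lemma d_Suc_zero: "P : Ob ==> u : X 2 P ==> d 3 P (d 2 P u) = 0"
 using d(4)[of P u 2] by (simp add: numeral_3_eq_3 numeral_2_eq_2)

lemma E0_equiv: "equiv (Z0 (Suc i)) {(c, c'). c : Z0 (Suc i) & c' : Z0 (Suc i) & E0 i c c'}"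
proof (rule equivI)
 have z0: "C0 i (%P. 0)" using Xcl(1) by (simp add: C0_def)
 show "refl_on (Z0 (Suc i)) {(c, c'). c : Z0 (Suc i) & c' : Z0 (Suc i) & E0 i c c'}"
  unfolding refl_on_def E0_def using z0 by (auto intro!: exI[of _ "%P. 0"] simp: dt0_def \<rho>_zero d_zero)
 show "sym {(c, c'). c : Z0 (Suc i) & c' : Z0 (Suc i) & E0 i c c'}"
 proof (rule symI, clarify)
  fix c c' assume "c : Z0 (Suc i)" "c' : Z0 (Suc i)" "E0 i c c'"
  then obtain y where y: "C0 i y" "ALL a:Ar. dt0 i y a = 0" "ALL P:Ob. c P - c' P = d i P (y P)" by (auto simp: E0_def)
  show "E0 i c' c" unfolding E0_def
  proof (rule exI[of _ "%P. 0 - y P"], intro conjI ballI)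
   show "C0 i (%P. 0 - y P)" by (rule C_diff(1)[OF z0 y(1)])
   show "dt0 i (%P. 0 - y P) a = 0" if "a : Ar" for a
    using dt_diff(1)[OF z0 y(1) that] y(2) that by (simp add: dt0_def \<rho>_zero)
   show "c' P - c P = d i P (0 - y P)" if "P : Ob" for P
   proof -
    have "d i P (0 - y P) = - d i P (y P)" using d_uminus[OF that CX(1)[OF y(1) that]] by simp
    also have "... = c' P - c P" using y(3) that by (metis minus_diff_eq)
    finally show ?thesis by simp
   qed
  qed
 qed
 show "trans {(c, c'). c : Z0 (Suc i) & c' : Z0 (Suc i) & E0 i c c'}"
 proof (rule transI, clarify)
  fix c c' c'' assume "c : Z0 (Suc i)" "c' : Z0 (Suc i)" "c'' : Z0 (Suc i)" "E0 i c c'" "E0 i c' c''"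
  then obtain y z where y: "C0 i y" "ALL a:Ar. dt0 i y a = 0" "ALL P:Ob. c P - c' P = d i P (y P)"
   and z: "C0 i z" "ALL a:Ar. dt0 i z a = 0" "ALL P:Ob. c' P - c'' P = d i P (z P)" by (auto simp: E0_def)
  have z': "C0 i (%P. 0 - z P)" by (rule C_diff(1)[OF z0 z(1)])
  show "E0 i c c''" unfolding E0_def
  proof (rule exI[of _ "%P. y P - (0 - z P)"], intro conjI ballI)
   show "C0 i (%P. y P - (0 - z P))" by (rule C_diff(1)[OF y(1) z'])
   show "dt0 i (%P. y P - (0 - z P)) a = 0" if "a : Ar" for a
    using dt_diff(1)[OF y(1) z' that] dt_diff(1)[OF z0 z(1) that] y(2) z(2) that by (simp add: dt0_def \<rho>_zero)
   show "c P - c'' P = d i P (y P - (0 - z P))" if "P : Ob" for P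
    using d(2)[OF that CX(1)[OF y(1) that] CX(1)[OF z(1) that]] y(3) z(3) that by (simp add: algebra_simps)
  qed
 qed
qed (auto simp: Z0_def)

end

text \<open>
  The injective resolution behind \<open>higher_limit\<close> is moved, value by value, into types with pointwise
  addition by the embeddings in biduals; the retractions come from injectivity.
\<close>

lemma higher_limit_resolves:
 fixes C :: "('o, 'a) cat" and F :: "('o, 'a, 'v) presheaf" and io :: "'o => 'v => 'u::infinite"
 assumes C: "finite_cat C" and F: "ab_presheaf C F"
  and io: "!!P. P : Obj C ==> inj_on (io P) (sect F P)"
 shows "EX (X :: nat => 'o => 'u bidual set) \<rho> d r \<theta>.
  resolves_limit C F (higher_limit C F 3 :: ('o => 'u) set monoid) X \<rho> d r \<theta>"
proof -
 have cC: "category C" using C by (simp add: finite_cat_def)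
 define R where "R = (SOME R :: ('o => 'v => 'u) \<times> (nat => ('o, 'a, 'u) presheaf) \<times> (nat => 'o => 'u => 'u).
  injective_resolution C F R)"
 obtain \<eta> I D where R_eq: "R = (\<eta>, I, D)" using prod_cases3 by blast
 have "injective_resolution C F R"
  unfolding R_def by (rule someI_ex) (rule injective_resolution_exists[OF C F io])
 hence inj: "!!n. injective_presheaf C (I n)" and mono: "presheaf_mono C F (I 0) \<eta>"
  and Dh: "!!n. presheaf_hom C (I n) (I (Suc n)) (D n)"
  and ex0: "!!P. P : Obj C ==> \<eta> P ` sect F P = kernel (grp (I 0) P) (grp (I 1) P) (D 0 P)"
  and ex: "!!n P. P : Obj C ==> D n P ` sect (I n) P = kernel (grp (I (Suc n)) P) (grp (I (Suc (Suc n))) P) (D (Suc n) P)"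
  unfolding R_eq injective_resolution_def by auto
 have \<Lambda>: "(higher_limit C F 3 :: ('o => 'u) set monoid) =
   cochain_cohomology (%n. inverse_limit C (I n)) (%n. inverse_limit_map C (D n)) 3"
  unfolding higher_limit_def R_def[symmetric] R_eq by simp
 have aI: "ab_presheaf C (I n)" for n using inj by (simp add: injective_presheaf_def)
 have cg: "comm_group (grp (I n) P)" if "P : Obj C" for n P by (rule ab_presheafD(1)[OF aI that])
 have mo: "monoid (grp (I n) P)" if "P : Obj C" for n P using cg[OF that] by (simp add: comm_group_def group.is_monoid)
 have gr: "group (grp (I n) P)" if "P : Obj C" for n P using cg[OF that] by (simp add: comm_group_def)
 define ep :: "nat => 'o => 'u => 'u bidual" where "ep n P = (SOME e.
   (ALL x:sect (I n) P. ALL y:sect (I n) P. e (x \<otimes>\<^bsub>grp (I n) P\<^esub> y) = e x + e y) &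
   (ALL x:sect (I n) P. e x = 0 <-> x : {\<one>\<^bsub>grp (I n) P\<^esub>}))" for n P
 have ep': "(ALL x:sect (I n) P. ALL y:sect (I n) P. ep n P (x \<otimes>\<^bsub>grp (I n) P\<^esub> y) = ep n P x + ep n P y) &
   (ALL x:sect (I n) P. ep n P x = 0 <-> x : {\<one>\<^bsub>grp (I n) P\<^esub>})" if "P : Obj C" for n P
  unfolding ep_def by (rule someI_ex[OF bidual_embedding[OF cg[OF that] group.triv_subgroup[OF gr[OF that]]]])
 have ep:
  "!!n P x y. P : Obj C ==> x : sect (I n) P ==> y : sect (I n) P ==> ep n P (x \<otimes>\<^bsub>grp (I n) P\<^esub> y) = ep n P x + ep n P y"
  "!!n P x. P : Obj C ==> x : sect (I n) P ==> ep n P x = 0 <-> x = \<one>\<^bsub>grp (I n) P\<^esub>"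
  using ep' by simp_all
 have ep1: "ep n P \<one>\<^bsub>grp (I n) P\<^esub> = 0" if "P : Obj C" for n P
  using ep(2)[OF that monoid.one_closed[OF mo[OF that]]] by simp
 have epinv: "ep n P (inv\<^bsub>grp (I n) P\<^esub> x) = - ep n P x" if P: "P : Obj C" and x: "x : sect (I n) P" for n P x
 proof -
  have "ep n P (inv\<^bsub>grp (I n) P\<^esub> x) + ep n P x = 0"
   using ep(1)[OF P group.inv_closed[OF gr[OF P] x] x] ep1[OF P] group.l_inv[OF gr[OF P] x] by simp
  thus ?thesis by (simp add: eq_neg_iff_add_eq_0)
 qed
 have epinj: "inj_on (ep n P) (sect (I n) P)" if P: "P : Obj C" for n P
 proof (rule inj_onI)
  fix x y assume x: "x : sect (I n) P" and y: "y : sect (I n) P" and eq: "ep n P x = ep n P y"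
  interpret g: comm_group "grp (I n) P" by (rule cg[OF P])
  have "ep n P (x \<otimes>\<^bsub>grp (I n) P\<^esub> inv\<^bsub>grp (I n) P\<^esub> y) = 0" using x y P eq by (simp add: ep(1) epinv)
  hence "x \<otimes>\<^bsub>grp (I n) P\<^esub> inv\<^bsub>grp (I n) P\<^esub> y = \<one>\<^bsub>grp (I n) P\<^esub>" using ep(2)[OF P] x y by simp
  thus "x = y" using x y by (simp add: g.inv_equality g.inv_solve_right')
 qed
 define X where "X n P = ep n P ` sect (I n) P" for n P
 define kp where "kp n P = inv_into (sect (I n) P) (ep n P)" for n P
 have kpep: "kp n P (ep n P x) = x" if "P : Obj C" "x : sect (I n) P" for n P x
  unfolding kp_def by (rule inv_into_f_f[OF epinj[OF that(1)] that(2)])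
 have Xi: "ep n P x : X n P" if "x : sect (I n) P" for n P x using that by (simp add: X_def)
 have kp: "kp n P u : sect (I n) P" "ep n P (kp n P u) = u" if "u : X n P" for n P u
  using that unfolding kp_def X_def by (auto intro: inv_into_into f_inv_into_f)
 have kpadd: "kp n P (u + v) = kp n P u \<otimes>\<^bsub>grp (I n) P\<^esub> kp n P v" if "P : Obj C" "u : X n P" "v : X n P" for n P u v
 proof -
  have "u + v = ep n P (kp n P u \<otimes>\<^bsub>grp (I n) P\<^esub> kp n P v)" using that kp by (simp add: ep(1))
  thus ?thesis using kpep[OF that(1)] monoid.m_closed[OF mo[OF that(1)]] kp(1) that by simp
 qed
 have kpdiff: "kp n P (u - v) = kp n P u \<otimes>\<^bsub>grp (I n) P\<^esub> inv\<^bsub>grp (I n) P\<^esub> kp n P v" if P: "P : Obj C" and u: "u : X n P" "v : X n P" for n P u v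
 proof -
  have "u - v = ep n P (kp n P u \<otimes>\<^bsub>grp (I n) P\<^esub> inv\<^bsub>grp (I n) P\<^esub> kp n P v)"
   using P u kp by (simp add: ep(1) epinv group.inv_closed[OF gr[OF P]])
  thus ?thesis
   using kpep[OF P, of "kp n P u \<otimes>\<^bsub>grp (I n) P\<^esub> inv\<^bsub>grp (I n) P\<^esub> kp n P v" n] monoid.m_closed[OF mo[OF P]] group.inv_closed[OF gr[OF P]] kp(1) u by simp
 qed
 define \<rho> where "\<rho> n a u = ep n (src a) (res (I n) (src a) (tgt a) (mor a) (kp n (tgt a) u))" for n a u
 define d where "d n P u = ep (Suc n) P (D n P (kp n P u))" for n P u
 have "ALL n. EX ps. presheaf_hom C (coind C (grp (I n))) (I n) ps &
  (ALL P:Obj C. ALL x:sect (I n) P. ps P (\<lambda>w\<in>into C P. res (I n) (fst w) P (snd w) x) = x)"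
  using injective_retraction[OF C inj] by blast
 from choice[OF this] obtain ps where ps': "ALL n. presheaf_hom C (coind C (grp (I n))) (I n) (ps n) &
  (ALL P:Obj C. ALL x:sect (I n) P. ps n P (\<lambda>w\<in>into C P. res (I n) (fst w) P (snd w) x) = x)" ..
 hence ps: "!!n. presheaf_hom C (coind C (grp (I n))) (I n) (ps n)"
  "!!n P x. P : Obj C ==> x : sect (I n) P ==> ps n P (\<lambda>w\<in>into C P. res (I n) (fst w) P (snd w) x) = x" by simp_all
 define lift where "lift n P y = (\<lambda>w\<in>into C P. kp n (fst w) (y (fst w, snd w, P)))" for n P y
 define r where "r n P y = ep n P (ps n P (lift n P y))" for n P y
 have \<eta>h: "presheaf_hom C F (I 0) \<eta>" and \<eta>i: "!!P. P : Obj C ==> inj_on (\<eta> P) (sect F P)"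
  using mono by (auto simp: presheaf_mono_def)
 define \<theta> where "\<theta> P x = ep 0 P (\<eta> P x)" for P x
 have rc: "res (I n) (src a) (tgt a) (mor a) x : sect (I n) (src a)" if "a : arrows C" "x : sect (I n) (tgt a)" for n a x
  using arrowsD[OF that(1)] ab_presheafD(5)[OF aI] that(2) by blast
 have DD: "D (Suc n) P (D n P x) = \<one>\<^bsub>grp (I (Suc (Suc n))) P\<^esub>" if "P : Obj C" "x : sect (I n) P" for n P x
  using ex[OF that(1), of n] that(2) by (auto simp: kernel_def)
 have liftc: "lift n P y : carrier (grp (coind C (grp (I n))) P)"
  if "P : Obj C" "!!a. a : arrows C ==> tgt a = P ==> y a : X n (src a)" for n P y
 proof -
  have "kp n (fst w) (y (fst w, snd w, P)) : sect (I n) (fst w)" if "w : into C P" for w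
   using \<open>P : Obj C\<close> that kp(1) \<open>!!a. a : arrows C ==> tgt a = P ==> y a : X n (src a)\<close>[of "(fst w, snd w, P)"]
   by (auto simp: into_def arrows_def)
  thus ?thesis by (auto simp: coind_simps lift_def)
 qed
 have "acyclic_resolution (Obj C) (arrows C) src tgt (arrow_comp C) X \<rho> d r"
 proof (unfold_locales, goal_cases)
  case (1 a) thus ?case by (simp add: arrowsD)
 next
  case (2 a) thus ?case by (simp add: arrowsD)
 next
  case (3 a b) thus ?case using categoryD(2)[OF cC] by (auto simp: arrows_def arrow_comp_def)
 next
  case (4 a b) thus ?case by (simp add: arrow_comp_def)
 next
  case (5 a b) thus ?case by (simp add: arrow_comp_def)
 next
  case (6 a b e) thus ?case using categoryD(5)[OF cC] by (auto simp: arrows_def arrow_comp_def)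
 next
  case (7 P n)
  thus ?case unfolding add_subgroup_def
  proof (intro conjI ballI)
   show "0 : X n P" using Xi[OF monoid.one_closed[OF mo[OF 7]]] ep1[OF 7] by metis
   fix u assume u: "u : X n P"
   show "- u : X n P" using Xi[OF group.inv_closed[OF gr[OF 7] kp(1)[OF u]]] by (simp add: epinv[OF 7 kp(1)[OF u]] kp(2)[OF u])
   fix v assume v: "v : X n P"
   show "u + v : X n P" using Xi[OF monoid.m_closed[OF mo[OF 7] kp(1)[OF u] kp(1)[OF v]]] by (simp add: ep(1)[OF 7 kp(1)[OF u] kp(1)[OF v]] kp(2) u v)
  qed
 next
  case (8 a u n) thus ?case unfolding \<rho>_def by (intro Xi rc kp(1))
 next
  case (9 a u n v)
  hence A: "src a : Obj C" "tgt a : Obj C" "mor a : Mor C (src a) (tgt a)" by (simp_all add: arrowsD)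
  show ?case unfolding \<rho>_def kpadd[OF A(2) 9(2,3)]
   using hom_mult[OF ab_presheafD(2)[OF aI A] kp(1)[OF 9(2)] kp(1)[OF 9(3)]] ep(1)[OF A(1) rc[OF 9(1) kp(1)[OF 9(2)]] rc[OF 9(1) kp(1)[OF 9(3)]]]
   by simp
 next
  case (10 a b u n)
  hence A: "src a : Obj C" "tgt a : Obj C" "mor a : Mor C (src a) (tgt a)" "tgt b : Obj C" "mor b : Mor C (tgt a) (tgt b)"
   using arrowsD[of a C] arrowsD[of b C] by auto
  have rb: "res (I n) (tgt a) (tgt b) (mor b) (kp n (tgt b) u) : sect (I n) (tgt a)"
   using rc[OF 10(2) kp(1)[OF 10(4)]] 10(3) by simp
  show ?case unfolding \<rho>_def using ab_presheafD(4)[OF aI A(1,2,4,3,5) kp(1)[OF 10(4)]] 10(3)[symmetric] kpep[OF A(2) rb]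
   by (simp add: arrow_comp_def)
 next
  case (11 P u n) thus ?case unfolding d_def by (intro Xi presheaf_homD(2)[OF Dh] kp(1))
 next
  case (12 P u n v)
  show ?case unfolding d_def kpadd[OF 12]
   using hom_mult[OF presheaf_homD(1)[OF Dh 12(1)] kp(1)[OF 12(2)] kp(1)[OF 12(3)]]
    ep(1)[OF 12(1) presheaf_homD(2)[OF Dh 12(1) kp(1)[OF 12(2)]] presheaf_homD(2)[OF Dh 12(1) kp(1)[OF 12(3)]]]
   by simp
 next
  case (13 a u n)
  hence A: "src a : Obj C" "tgt a : Obj C" "mor a : Mor C (src a) (tgt a)" by (simp_all add: arrowsD)
  show ?case unfolding d_def \<rho>_def
   using presheaf_homD(3)[OF Dh A kp(1)[OF 13(2)]] kpep[OF A(1) rc[OF 13(1) kp(1)[OF 13(2)]]] kpep[OF A(2) presheaf_homD(2)[OF Dh A(2) kp(1)[OF 13(2)]]]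
   by simp
 next
  case (14 P u n)
  show ?case unfolding d_def kpep[OF 14(1) presheaf_homD(2)[OF Dh 14(1) kp(1)[OF 14(2)]]] DD[OF 14(1) kp(1)[OF 14(2)]]
   by (rule ep1[OF 14(1)])
 next
  case (15 P u n)
  have "D (Suc n) P (kp (Suc n) P u) = \<one>\<^bsub>grp (I (Suc (Suc n))) P\<^esub>"
   using 15(3) ep(2)[OF 15(1) presheaf_homD(2)[OF Dh 15(1) kp(1)[OF 15(2)]]] by (simp add: d_def)
  hence "kp (Suc n) P u : D n P ` sect (I n) P" using ex[OF 15(1), of n] kp(1)[OF 15(2)] by (simp add: kernel_def)
  then obtain x where x: "x : sect (I n) P" "kp (Suc n) P u = D n P x" by blast
  have "d n P (ep n P x) = u" unfolding d_def using kpep[OF 15(1) x(1)] x(2) kp(2)[OF 15(2)] by simp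
  thus ?case using Xi[OF x(1)] by blast
 next
  case (16 P y n)
  thus ?case unfolding r_def by (intro Xi presheaf_homD(2)[OF ps(1)] liftc) auto
 next
  case (17 P y n z)
  have ly: "lift n P y : carrier (grp (coind C (grp (I n))) P)" and lz: "lift n P z : carrier (grp (coind C (grp (I n))) P)"
   by (rule liftc[OF 17(1)], use 17 in blast)+
  interpret J: comm_group "grp (coind C (grp (I n))) P" by (rule ab_presheafD(1)[OF ab_presheaf_coind[OF cC cg] 17(1)])
  interpret IP: comm_group "grp (I n) P" by (rule cg[OF 17(1)])
  interpret h: group_hom "grp (coind C (grp (I n))) P" "grp (I n) P" "ps n P" by unfold_locales (rule presheaf_homD(1)[OF ps(1) 17(1)])
  have lyz: "lift n P (%a. y a - z a) : carrier (grp (coind C (grp (I n))) P)"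
  proof (rule liftc[OF 17(1)])
   fix a assume a: "a : arrows C" "tgt a = P"
   hence P': "src a : Obj C" by (simp add: arrowsD)
   have "ep n (src a) (kp n (src a) (y a) \<otimes>\<^bsub>grp (I n) (src a)\<^esub> inv\<^bsub>grp (I n) (src a)\<^esub> kp n (src a) (z a)) = y a - z a"
    using kp[OF 17(2)[OF a]] kp[OF 17(3)[OF a]] P' by (simp add: ep(1) epinv group.inv_closed[OF gr[OF P']])
   thus "y a - z a : X n (src a)"
    using Xi[of "kp n (src a) (y a) \<otimes>\<^bsub>grp (I n) (src a)\<^esub> inv\<^bsub>grp (I n) (src a)\<^esub> kp n (src a) (z a)" n "src a"]
     kp(1)[OF 17(2)[OF a]] kp(1)[OF 17(3)[OF a]] by (simp add: monoid.m_closed[OF mo[OF P']] group.inv_closed[OF gr[OF P']])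
  qed
  have "lift n P y = lift n P (%a. y a - z a) \<otimes>\<^bsub>grp (coind C (grp (I n))) P\<^esub> lift n P z"
   unfolding coind_simps
  proof (rule extensionalityI[where A = "into C P"])
   fix w assume w: "w : into C P"
   have a: "(fst w, snd w, P) : arrows C" "tgt (fst w, snd w, P) = P" using w 17(1) by (auto simp: into_def arrows_def)
   have P': "fst w : Obj C" using w by (auto simp: into_def)
   have k: "kp n (fst w) (y (fst w, snd w, P)) : sect (I n) (fst w)" "kp n (fst w) (z (fst w, snd w, P)) : sect (I n) (fst w)"
    using kp(1)[OF 17(2)[OF a]] kp(1)[OF 17(3)[OF a]] by simp_all
   interpret w: comm_group "grp (I n) (fst w)" by (rule cg[OF P'])
   show "lift n P y w = (\<lambda>w\<in>into C P. lift n P (%a. y a - z a) w \<otimes>\<^bsub>grp (I n) (fst w)\<^esub> lift n P z w) w"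
    using w kpdiff[OF P', of "y (fst w, snd w, P)" n "z (fst w, snd w, P)"] 17(2)[OF a] 17(3)[OF a] k
    by (simp add: lift_def w.m_assoc)
  qed (simp_all add: lift_def)
  hence "ps n P (lift n P y) = ps n P (lift n P (%a. y a - z a)) \<otimes>\<^bsub>grp (I n) P\<^esub> ps n P (lift n P z)"
   using h.hom_mult[OF lyz lz] by simp
  thus ?case unfolding r_def using ep(1)[OF 17(1) h.hom_closed[OF lyz] h.hom_closed[OF lz]] by simp
 next
  case (18 b y n)
  hence A: "src b : Obj C" "tgt b : Obj C" "mor b : Mor C (src b) (tgt b)" by (simp_all add: arrowsD)
  have ly: "lift n (tgt b) y : carrier (grp (coind C (grp (I n))) (tgt b))" by (rule liftc[OF A(2)]) (use 18 in blast)
  have "lift n (src b) (%a. y (arrow_comp C b a)) = res (coind C (grp (I n))) (src b) (tgt b) (mor b) (lift n (tgt b) y)"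
   unfolding coind_simps using into_comp[OF cC A]
   by (intro extensionalityI[where A = "into C (src b)"]) (simp_all add: lift_def arrow_comp_def)
  thus ?case unfolding r_def \<rho>_def
   using presheaf_homD(3)[OF ps(1) A ly] kpep[OF A(2) presheaf_homD(2)[OF ps(1) A(2) ly]] by simp
 next
  case (19 P u n)
  have "lift n P (%a. \<rho> n a u) = (\<lambda>w\<in>into C P. res (I n) (fst w) P (snd w) (kp n P u))"
  proof (rule extensionalityI[where A = "into C P"])
   fix w assume w: "w : into C P"
   thus "lift n P (%a. \<rho> n a u) w = (\<lambda>w\<in>into C P. res (I n) (fst w) P (snd w) (kp n P u)) w"
    using kpep[of "fst w"] ab_presheafD(5)[OF aI _ 19(1) _ kp(1)[OF 19(2)]] by (auto simp: lift_def \<rho>_def into_def)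
  qed (simp_all add: lift_def)
  thus ?case unfolding r_def using ps(2)[OF 19(1) kp(1)[OF 19(2)]] kp(2)[OF 19(2)] by simp
 next
  case (20 P y z n)
  have "lift n P y = lift n P z"
   unfolding lift_def by (intro restrict_ext) (use 20 in \<open>auto simp: into_def arrows_def\<close>)
  thus ?case by (simp add: r_def)
 qed
 then interpret AR: acyclic_resolution "Obj C" "arrows C" src tgt "arrow_comp C" X \<rho> d r .
 define L where "L n = inverse_limit C (I n)" for n
 define DL where "DL n = inverse_limit_map C (D n)" for n
 have Lc: "x : carrier (L n) <-> x : (\<Pi>\<^sub>E P\<in>Obj C. sect (I n) P) &
   (ALL P:Obj C. ALL Q:Obj C. ALL f:Mor C P Q. res (I n) P Q f (x Q) = x P)" for n x
  by (simp add: L_def inverse_limit_def)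
 have Lm: "x \<otimes>\<^bsub>L n\<^esub> y = (\<lambda>P\<in>Obj C. x P \<otimes>\<^bsub>grp (I n) P\<^esub> y P)" "\<one>\<^bsub>L n\<^esub> = (\<lambda>P\<in>Obj C. \<one>\<^bsub>grp (I n) P\<^esub>)" for n x y
  by (simp_all add: L_def inverse_limit_def)
 have DLx: "DL n x = (\<lambda>P\<in>Obj C. D n P (x P))" for n x by (simp add: DL_def inverse_limit_map_def)
 define Ker where "Ker = kernel (L 3) (L 4) (DL 3)"
 define N where "N = DL 2 ` carrier (L 2)"
 define H where "H = (L 3)\<lparr>carrier := Ker\<rparr>"
 have \<Lambda>': "(higher_limit C F 3 :: ('o => 'u) set monoid) = H Mod N"
  unfolding \<Lambda> cochain_cohomology_def H_def Ker_def N_def L_def DL_def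
  by (simp add: numeral_3_eq_3 numeral_2_eq_2 eval_nat_numeral)
 define \<Phi> where "\<Phi> n x = (%P. ep n P (x P))" for n and x :: "'o => 'u"
 define \<Psi> where "\<Psi> n c = (\<lambda>P\<in>Obj C. kp n P (c P))" for n and c :: "'o => 'u bidual"
 have Lx: "x P : sect (I n) P" if "x : carrier (L n)" "P : Obj C" for x n P using that by (auto simp: Lc)
 have \<Phi>C: "AR.C0 n (\<Phi> n x)" "ALL a:arrows C. AR.dt0 n (\<Phi> n x) a = 0" if "x : carrier (L n)" for n x
  using that Lx[OF that] by (auto simp: AR.C0_def AR.dt0_def \<Phi>_def Xi \<rho>_def kpep Lc arrows_def)
 have \<Psi>L: "\<Psi> n c : carrier (L n)" "P : Obj C ==> \<Phi> n (\<Psi> n c) P = c P" if c: "AR.C0 n c" "ALL a:arrows C. AR.dt0 n c a = 0" for n c P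
 proof -
  have cX: "c P : X n P" if "P : Obj C" for P using c(1) that by (simp add: AR.C0_def)
  show "P : Obj C ==> \<Phi> n (\<Psi> n c) P = c P" using kp(2)[OF cX] by (simp add: \<Phi>_def \<Psi>_def)
  have "res (I n) P Q f (kp n Q (c Q)) = kp n P (c P)" if P: "P : Obj C" "Q : Obj C" "f : Mor C P Q" for P Q f
  proof -
   have "AR.dt0 n c (P, f, Q) = 0" using c(2) P by (simp add: arrows_def)
   hence "ep n P (res (I n) P Q f (kp n Q (c Q))) = c P" by (simp add: AR.dt0_def \<rho>_def)
   thus ?thesis using kpep[OF P(1) ab_presheafD(5)[OF aI P kp(1)[OF cX[OF P(2)]]]] by simp
  qed
  thus "\<Psi> n c : carrier (L n)" using kp(1)[OF cX] by (auto simp: Lc \<Psi>_def)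
 qed
 have \<Phi>eq: "x = x'" if "x : carrier (L n)" "x' : carrier (L n)" "!!P. P : Obj C ==> \<Phi> n x P = \<Phi> n x' P" for n x x'
 proof (rule extensionalityI[where A = "Obj C"])
  show "x : extensional (Obj C)" "x' : extensional (Obj C)" using that(1,2) by (auto simp: Lc PiE_def)
  show "x P = x' P" if P: "P : Obj C" for P
   using inj_onD[OF epinj[OF P]] Lx \<open>x : carrier (L n)\<close> \<open>x' : carrier (L n)\<close> P \<open>!!P. P : Obj C ==> \<Phi> n x P = \<Phi> n x' P\<close>[OF P]
   unfolding \<Phi>_def by metis
 qed
 have Kx: "x : Ker <-> x : carrier (L 3) & (ALL P:Obj C. D 3 P (x P) = \<one>\<^bsub>grp (I 4) P\<^esub>)" for x
  unfolding Ker_def kernel_def by (auto simp: DLx Lm fun_eq_iff restrict_def)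
 have D3: "D 3 P y = \<one>\<^bsub>grp (I 4) P\<^esub> <-> d 3 P (ep 3 P y) = 0" if "P : Obj C" "y : sect (I 3) P" for P y
  unfolding d_def kpep[OF that] using ep(2)[OF that(1) presheaf_homD(2)[OF Dh that]] by (simp add: eval_nat_numeral)
 have KZ: "\<Phi> 3 x : AR.Z0 3" if "x : Ker" for x
  using \<Phi>C[of x 3] that D3 Lx by (auto simp: AR.Z0_def Kx) (auto simp: \<Phi>_def)
 have ZK: "\<Psi> 3 c : Ker" "P : Obj C ==> \<Phi> 3 (\<Psi> 3 c) P = c P" if "c : AR.Z0 3" for c P
 proof -
  have c: "AR.C0 3 c" "ALL a:arrows C. AR.dt0 3 c a = 0" "ALL P:Obj C. d 3 P (c P) = 0" using that by (auto simp: AR.Z0_def)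
  show 1: "P : Obj C ==> \<Phi> 3 (\<Psi> 3 c) P = c P" for P by (rule \<Psi>L(2)[OF c(1,2)])
  show "\<Psi> 3 c : Ker"
   using \<Psi>L(1)[OF c(1,2)] D3 Lx[OF \<Psi>L(1)[OF c(1,2)]] 1 c(3) by (auto simp: Kx \<Phi>_def)
 qed
 have E: "AR.E0 2 (\<Phi> 3 x) (\<Phi> 3 x') <-> (EX y:carrier (L 2). x' = DL 2 y \<otimes>\<^bsub>L 3\<^esub> x)" if x: "x : carrier (L 3)" "x' : carrier (L 3)" for x x'
 proof -
  have Ey: "ep 3 P (D 2 P y) = d 2 P (ep 2 P y)" if "P : Obj C" "y : sect (I 2) P" for P y
   unfolding d_def kpep[OF that] by (simp add: eval_nat_numeral)
  have Dc: "D 2 P y : sect (I 3) P" if "P : Obj C" "y : sect (I 2) P" for P y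
   using presheaf_homD(2)[OF Dh that] by (simp add: eval_nat_numeral)
  have z0: "AR.C0 2 (%P. 0)" using AR.Xcl(1) by (simp add: AR.C0_def)
  show ?thesis
  proof
   assume "AR.E0 2 (\<Phi> 3 x) (\<Phi> 3 x')"
   then obtain y where y: "AR.C0 2 y" "ALL a:arrows C. AR.dt0 2 y a = 0" "ALL P:Obj C. \<Phi> 3 x P - \<Phi> 3 x' P = d 2 P (y P)"
    by (auto simp: AR.E0_def)
   define y' where "y' P = 0 - y P" for P
   have y': "AR.C0 2 y'" "ALL a:arrows C. AR.dt0 2 y' a = 0"
    unfolding y'_def using AR.C_diff(1)[OF z0 y(1)] AR.dt_diff(1)[OF z0 y(1)] y(2) by (auto simp: AR.dt0_def AR.\<rho>_zero)
   have dy': "\<Phi> 3 x' P = d 2 P (y' P) + \<Phi> 3 x P" if "P : Obj C" for P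
   proof -
    have "d 2 P (y' P) = - d 2 P (y P)" unfolding y'_def using AR.d_uminus[OF that AR.CX(1)[OF y(1) that]] by simp
    also have "... = \<Phi> 3 x' P - \<Phi> 3 x P" using y(3) that by (metis minus_diff_eq)
    finally show ?thesis by simp
   qed
   note \<Psi>y = \<Psi>L[OF y']
   have "x' = DL 2 (\<Psi> 2 y') \<otimes>\<^bsub>L 3\<^esub> x"
   proof (rule extensionalityI[where A = "Obj C"])
    show "x' : extensional (Obj C)" using x by (auto simp: Lc PiE_def)
    show "DL 2 (\<Psi> 2 y') \<otimes>\<^bsub>L 3\<^esub> x : extensional (Obj C)" by (simp add: Lm)
    fix P assume P: "P : Obj C"
    have c: "\<Psi> 2 y' P : sect (I 2) P" "x P : sect (I 3) P" "x' P : sect (I 3) P"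
     using Lx \<Psi>y(1) x P by auto
    have m: "D 2 P (\<Psi> 2 y' P) \<otimes>\<^bsub>grp (I 3) P\<^esub> x P : sect (I 3) P"
     by (rule monoid.m_closed[OF mo[OF P] Dc[OF P c(1)] c(2)])
    have "ep 3 P (x' P) = ep 3 P (D 2 P (\<Psi> 2 y' P) \<otimes>\<^bsub>grp (I 3) P\<^esub> x P)"
     using dy'[OF P] \<Psi>y(2)[OF P] unfolding ep(1)[OF P Dc[OF P c(1)] c(2)] Ey[OF P c(1)] by (simp add: \<Phi>_def)
    hence "x' P = D 2 P (\<Psi> 2 y' P) \<otimes>\<^bsub>grp (I 3) P\<^esub> x P" using inj_onD[OF epinj[OF P]] c(3) m by blast
    thus "x' P = (DL 2 (\<Psi> 2 y') \<otimes>\<^bsub>L 3\<^esub> x) P" using P by (simp add: Lm DLx)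
   qed
   thus "EX y:carrier (L 2). x' = DL 2 y \<otimes>\<^bsub>L 3\<^esub> x" using \<Psi>y(1) by blast
  next
   assume "EX y:carrier (L 2). x' = DL 2 y \<otimes>\<^bsub>L 3\<^esub> x"
   then obtain y where y: "y : carrier (L 2)" "x' = DL 2 y \<otimes>\<^bsub>L 3\<^esub> x" by blast
   note \<Phi>y = \<Phi>C[OF y(1)]
   show "AR.E0 2 (\<Phi> 3 x) (\<Phi> 3 x')"
    unfolding AR.E0_def
   proof (rule exI[of _ "%P. 0 - \<Phi> 2 y P"], intro conjI ballI)
    show "AR.C0 2 (%P. 0 - \<Phi> 2 y P)" by (rule AR.C_diff(1)[OF z0 \<Phi>y(1)])
    show "AR.dt0 2 (%P. 0 - \<Phi> 2 y P) a = 0" if "a : arrows C" for a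
     using AR.dt_diff(1)[OF z0 \<Phi>y(1) that] \<Phi>y(2) that by (simp add: AR.dt0_def AR.\<rho>_zero)
    fix P assume P: "P : Obj C"
    have c: "y P : sect (I 2) P" "x P : sect (I 3) P" using Lx y x P by auto
    have "\<Phi> 3 x' P = d 2 P (\<Phi> 2 y P) + \<Phi> 3 x P"
     using P ep(1)[OF P Dc[OF P c(1)] c(2)] Ey[OF P c(1)] by (simp add: \<Phi>_def y(2) Lm DLx)
    moreover have "d 2 P (0 - \<Phi> 2 y P) = - d 2 P (\<Phi> 2 y P)"
     using AR.d_uminus[OF P AR.CX(1)[OF \<Phi>y(1) P]] by simp
    ultimately show "\<Phi> 3 x P - \<Phi> 3 x' P = d 2 P (0 - \<Phi> 2 y P)" by simp
   qed
  qed
 qed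
 have E0_cong: "AR.E0 2 c c' <-> AR.E0 2 b b'" if "!!P. P : Obj C ==> c P = b P" "!!P. P : Obj C ==> c' P = b' P" for c c' b b'
  using that by (simp add: AR.E0_def)
 let ?q = "%x x'. AR.E0 2 (\<Phi> 3 x) (\<Phi> 3 x')"
 let ?Q = "{(x, x'). x : Ker & x' : Ker & ?q x x'}"
 let ?E = "{(c, c'). c : AR.Z0 3 & c' : AR.Z0 3 & AR.E0 2 c c'}"
 have eqE: "equiv (AR.Z0 3) ?E" using AR.E0_equiv[of 2] by (simp add: numeral_3_eq_3)
 have eqQ: "equiv Ker ?Q"
 proof (rule equivI)
  show "refl_on Ker ?Q" using KZ eqE by (auto simp: refl_on_def equiv_def)
  show "sym ?Q" using KZ eqE by (auto simp: sym_def equiv_def)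
  show "trans ?Q" using KZ eqE unfolding trans_def equiv_def by (auto, blast)
 qed auto
 have "corr (AR.Z0 3) (AR.E0 2) Ker ?q"
 proof (rule corrI[where R = "%c x. ALL P:Obj C. \<Phi> 3 x P = c P"])
  show "EX x:Ker. ALL P:Obj C. \<Phi> 3 x P = c P" if "c : AR.Z0 3" for c using ZK[OF that] by blast
  show "EX c:AR.Z0 3. ALL P:Obj C. \<Phi> 3 x P = c P" if "x : Ker" for x using KZ[OF that] by blast
  show "AR.E0 2 c c' <-> ?q x x'" if "ALL P:Obj C. \<Phi> 3 x P = c P" "ALL P:Obj C. \<Phi> 3 x' P = c' P" for c c' x x'
   by (rule E0_cong) (use that in simp_all)
 qed
 hence bij: "EX f. bij_betw f (AR.Z0 3 // ?E) (Ker // ?Q)" by (rule corr_bij[OF _ eqE eqQ])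
 have cls: "?Q `` {x} = N #>\<^bsub>H\<^esub> x" if x: "x : Ker" for x
 proof -
  have xL: "x : carrier (L 3)" using x by (simp add: Kx)
  have "N #>\<^bsub>H\<^esub> x = {DL 2 y \<otimes>\<^bsub>L 3\<^esub> x | y. y : carrier (L 2)}"
   by (auto simp: r_coset_def N_def H_def)
  moreover have "DL 2 y \<otimes>\<^bsub>L 3\<^esub> x : Ker" if y: "y : carrier (L 2)" for y
  proof -
   note \<Phi>y = \<Phi>C[OF y]
   define c where "c P = \<Phi> 3 x P - (0 - d 2 P (\<Phi> 2 y P))" for P
   have z0: "AR.C0 3 (%P. 0)" using AR.Xcl(1) by (simp add: AR.C0_def)
   have dd: "AR.C0 3 (%P. d 2 P (\<Phi> 2 y P))" using AR.C_d(1)[OF \<Phi>y(1)] by (simp add: numeral_3_eq_3)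
   have dd0: "AR.dt0 3 (%P. d 2 P (\<Phi> 2 y P)) a = 0" if "a : arrows C" for a
    using AR.d_dt(1)[OF \<Phi>y(1) that] \<Phi>y(2) that AR.d_zero[of "src a"] by (simp add: numeral_3_eq_3 arrowsD)
   have xz: "AR.C0 3 (\<Phi> 3 x)" "ALL a:arrows C. AR.dt0 3 (\<Phi> 3 x) a = 0" "ALL P:Obj C. d 3 P (\<Phi> 3 x P) = 0"
    using KZ[OF x] by (auto simp: AR.Z0_def)
   have nd: "AR.C0 3 (%P. 0 - d 2 P (\<Phi> 2 y P))" by (rule AR.C_diff(1)[OF z0 dd])
   have "c : AR.Z0 3"
    unfolding AR.Z0_def
   proof (intro CollectI conjI ballI)
    show "AR.C0 3 c" unfolding c_def by (rule AR.C_diff(1)[OF xz(1) nd])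
    show "AR.dt0 3 c a = 0" if "a : arrows C" for a
     unfolding c_def using AR.dt_diff(1)[OF xz(1) nd that] AR.dt_diff(1)[OF z0 dd that] xz(2) dd0 that
     by (simp add: AR.dt0_def AR.\<rho>_zero)
    show "d 3 P (c P) = 0" if "P : Obj C" for P
     unfolding c_def using AR.d(2)[OF that AR.CX(1)[OF xz(1) that] AR.CX(1)[OF dd that]] xz(3) that
      AR.d_Suc_zero[OF that AR.CX(1)[OF \<Phi>y(1) that]] by simp
   qed
   note cK = ZK[OF this]
   have "DL 2 y \<otimes>\<^bsub>L 3\<^esub> x = \<Psi> 3 c"
   proof (rule extensionalityI[where A = "Obj C"])
    fix P assume P: "P : Obj C"
    have cc: "y P : sect (I 2) P" "x P : sect (I 3) P" using Lx y xL P by auto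
    have Dc: "D 2 P (y P) : sect (I 3) P" using presheaf_homD(2)[OF Dh P cc(1)] by (simp add: eval_nat_numeral)
    have "c P = ep 3 P (D 2 P (y P) \<otimes>\<^bsub>grp (I 3) P\<^esub> x P)"
     unfolding ep(1)[OF P Dc cc(2)] c_def \<Phi>_def d_def kpep[OF P cc(1)] by (simp add: eval_nat_numeral add.commute)
    thus "(DL 2 y \<otimes>\<^bsub>L 3\<^esub> x) P = \<Psi> 3 c P"
     using P kpep[OF P monoid.m_closed[OF mo[OF P] Dc cc(2)]] by (simp add: Lm DLx \<Psi>_def)
   qed (simp_all add: Lm \<Psi>_def)
   thus ?thesis using cK by simp
  qed
  moreover have "?q x x' <-> (EX y:carrier (L 2). x' = DL 2 y \<otimes>\<^bsub>L 3\<^esub> x)" if "x' : Ker" for x'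
   by (rule E[OF xL]) (use that in \<open>simp add: Kx\<close>)
  ultimately show ?thesis using x by auto
 qed
 have "carrier (H Mod N) = rcosets\<^bsub>H\<^esub> N" by (simp add: FactGroup_def)
 also have "... = (\<Union>x\<in>Ker. {N #>\<^bsub>H\<^esub> x})" by (simp add: RCOSETS_def H_def)
 also have "... = Ker // ?Q" unfolding quotient_def using cls by simp
 finally have carr: "carrier (H Mod N) = Ker // ?Q" .
 have one_Mod: "\<one>\<^bsub>H Mod N\<^esub> : carrier (H Mod N)"
 proof -
  have oneK: "\<one>\<^bsub>L 3\<^esub> : Ker"
  proof -
   have "(%P. 0) : AR.Z0 3" using AR.Xcl(1) by (auto simp: AR.Z0_def AR.C0_def AR.dt0_def AR.\<rho>_zero AR.d_zero)
   note ZK(1)[OF this]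
   moreover have "kp 3 P 0 = \<one>\<^bsub>grp (I 3) P\<^esub>" if "P : Obj C" for P
    using kpep[OF that monoid.one_closed[OF mo[OF that]], of 3] ep1[OF that, of 3] by simp
   hence "\<Psi> 3 (%P. 0) = \<one>\<^bsub>L 3\<^esub>" unfolding \<Psi>_def Lm by (intro restrict_ext) simp
   ultimately show ?thesis by simp
  qed
  have "DL 2 y \<otimes>\<^bsub>L 3\<^esub> \<one>\<^bsub>L 3\<^esub> = DL 2 y" if y: "y : carrier (L 2)" for y
  proof -
   have "D 2 P (y P) : sect (I 3) P" if "P : Obj C" for P
    using presheaf_homD(2)[OF Dh that Lx[OF y that]] by (simp add: eval_nat_numeral)
   thus ?thesis unfolding Lm DLx using mo by (intro restrict_ext) (simp add: monoid.r_one)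
  qed
  hence "N #>\<^bsub>H\<^esub> \<one>\<^bsub>L 3\<^esub> = N" by (auto simp: r_coset_def N_def H_def)
  hence "N : Ker // ?Q" using cls[OF oneK] quotientI[OF oneK, of ?Q] by simp
  thus ?thesis by (simp add: carr)
 qed
 have "resolves_limit C F (higher_limit C F 3 :: ('o => 'u) set monoid) X \<rho> d r \<theta>"
  unfolding resolves_limit_def
 proof (intro conjI ballI)
  show "acyclic_resolution (Obj C) (arrows C) src tgt (arrow_comp C) X \<rho> d r" by (rule AR.acyclic_resolution_axioms)
  show "\<one>\<^bsub>higher_limit C F 3 :: ('o => 'u) set monoid\<^esub> : carrier (higher_limit C F 3 :: ('o => 'u) set monoid)"
   unfolding \<Lambda>' by (rule one_Mod)
  show "EX f. bij_betw f (AR.Z0 3 // ?E) (carrier (higher_limit C F 3 :: ('o => 'u) set monoid))"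
   unfolding \<Lambda>' carr by (rule bij)
  fix P assume P: "P : Obj C"
  show "\<theta> P (x \<otimes>\<^bsub>grp F P\<^esub> y) = \<theta> P x + \<theta> P y" if "x : sect F P" "y : sect F P" for x y
   unfolding \<theta>_def hom_mult[OF presheaf_homD(1)[OF \<eta>h P] that]
   by (rule ep(1)[OF P presheaf_homD(2)[OF \<eta>h P that(1)] presheaf_homD(2)[OF \<eta>h P that(2)]])
  show "inj_on (\<theta> P) (sect F P)"
   unfolding \<theta>_def using inj_onD[OF \<eta>i[OF P]] inj_onD[OF epinj[OF P]] presheaf_homD(2)[OF \<eta>h P] by (intro inj_onI) blast
  have "\<theta> P ` sect F P = ep 0 P ` (\<eta> P ` sect F P)" by (auto simp: \<theta>_def)
  also have "... = {u : X 0 P. d 0 P u = 0}"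
   unfolding ex0[OF P]
  proof safe
   fix x assume "x : kernel (grp (I 0) P) (grp (I 1) P) (D 0 P)"
   hence x: "x : sect (I 0) P" "D 0 P x = \<one>\<^bsub>grp (I 1) P\<^esub>" by (auto simp: kernel_def)
   show "ep 0 P x : X 0 P" by (rule Xi[OF x(1)])
   show "d 0 P (ep 0 P x) = 0" unfolding d_def kpep[OF P x(1)] x(2) using ep1[OF P, of 1] by simp
  next
   fix u assume u: "u : X 0 P" "d 0 P u = 0"
   have "D 0 P (kp 0 P u) = \<one>\<^bsub>grp (I 1) P\<^esub>"
    using u(2) ep(2)[OF P presheaf_homD(2)[OF Dh P kp(1)[OF u(1)]]] by (simp add: d_def)
   hence "kp 0 P u : kernel (grp (I 0) P) (grp (I 1) P) (D 0 P)" using kp(1)[OF u(1)] by (simp add: kernel_def)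
   thus "u : ep 0 P ` kernel (grp (I 0) P) (grp (I 1) P) (D 0 P)" using kp(2)[OF u(1)] by (metis imageI)
  qed
  finally show "\<theta> P ` sect F P = {u : X 0 P. d 0 P u = 0}" .
 next
  fix a x assume a: "a : arrows C" and x: "x : sect F (tgt a)"
  have A: "src a : Obj C" "tgt a : Obj C" "mor a : Mor C (src a) (tgt a)" using arrowsD[OF a] by auto
  show "\<theta> (src a) (res F (src a) (tgt a) (mor a) x) = \<rho> 0 a (\<theta> (tgt a) x)"
   unfolding \<theta>_def \<rho>_def using presheaf_homD(3)[OF \<eta>h A x] kpep[OF A(2) presheaf_homD(2)[OF \<eta>h A(2) x]] by simp
 qed
 thus ?thesis by blast
qed

no_notation subset_mset (infix \<open><#\<close> 50)

section \<open>Equivariant cochains on the cosets of subgroups\<close>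

locale coset_cochains = group \<Gamma> for \<Gamma> :: "('g, 'b) monoid_scheme" (structure) +
 fixes T :: "'g set" and A :: "'a::ab_group_add set" and act :: "'g => 'a => 'a"
 assumes fin: "finite (carrier \<Gamma>)" and T: "subgroup T \<Gamma>" and A: "add_subgroup A"
  and act_closed: "g : carrier \<Gamma> ==> u : A ==> act g u : A"
  and act_add: "g : carrier \<Gamma> ==> u : A ==> v : A ==> act g (u + v) = act g u + act g v"
  and act_mult: "g : carrier \<Gamma> ==> h : carrier \<Gamma> ==> u : A ==> act (g \<otimes> h) u = act g (act h u)"
  and act_one: "u : A ==> act \<one> u = u"
begin

declare split_paired_All [simp del] split_paired_Ex [simp del]

abbreviation els where "els \<equiv> carrier \<Gamma>"

lemmas Acl = add_subgroupD[OF A]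

lemma act_zero: assumes "g : els" shows "act g 0 = 0"
 using act_add[OF assms, of 0 0] Acl(1) by simp

lemma act_uminus: assumes "g : els" "u : A" shows "act g (- u) = - act g u"
 using act_add[OF assms(1), of u "- u"] act_zero[OF assms(1)] Acl assms
 by (simp add: eq_neg_iff_add_eq_0 add.commute)

lemma act_diff: assumes "g : els" "u : A" "v : A" shows "act g (u - v) = act g u - act g v"
 using act_add[OF assms(1,2), of "- v"] act_uminus[OF assms(1,3)] Acl assms by simp

lemma act_sum:
 assumes "g : els" shows "(!!i. i : I ==> f i : A) ==> act g (sum f I) = (\<Sum>i\<in>I. act g (f i))"
proof (induction I rule: infinite_finite_induct)
 case (insert x F)
 thus ?case using assms by (simp add: act_add add_subgroup_sum[OF A])
qed (simp_all add: act_zero assms)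

lemma act_nmul: assumes "g : els" "u : A" shows "act g (nmul n u) = nmul n (act g u)"
 using assms by (induction n) (simp_all add: act_zero act_add add_subgroup_nmul[OF A])

lemma lcoset_eq_iff:
 assumes "subgroup P \<Gamma>" "a : els" "b : els"
 shows "a <# P = b <# P <-> inv a \<otimes> b : P"
proof
 assume "a <# P = b <# P"
 hence "b : a <# P" using lcos_self[OF assms(3,1)] by simp
 thus "inv a \<otimes> b : P" using subgroup.lcos_module_imp[OF assms(1) is_group assms(2)] by simp
next
 assume h: "inv a \<otimes> b : P"
 have "b <# P = (a \<otimes> (inv a \<otimes> b)) <# P" using assms by (simp add: m_assoc [symmetric])
 also have "... = a <# ((inv a \<otimes> b) <# P)"
  using assms by (simp add: lcos_m_assoc subgroup.subset)
 also have "(inv a \<otimes> b) <# P = P" using h assms by (intro coset_join3) auto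
 finally show "a <# P = b <# P" by simp
qed

text \<open>
  An element of the orbit \<open>\<Gamma>/P\<close>, paired with the object \<open>P\<close> of the orbit category. The action moves the
  coset only.
\<close>

definition pts :: "('g set \<times> 'g set) set" where
 "pts = {(P, a <# P) | P a. subgroup P \<Gamma> & P \<subseteq> T & a : els}"

definition mv :: "'g => 'g set \<times> 'g set => 'g set \<times> 'g set" where
 "mv g e = (fst e, g <# snd e)"

definition stab :: "'g set \<times> 'g set => 'g set" where
 "stab e = {g : els. g <# snd e = snd e}"

text \<open>
  The coset of \<open>T\<close> that contains the given coset.
\<close>

definition top_pt :: "'g set \<times> 'g set => 'g set \<times> 'g set" where
 "top_pt e = (T, \<Union>x\<in>snd e. x <# T)"

lemma ptsI: "subgroup P \<Gamma> ==> P \<subseteq> T ==> a : els ==> (P, a <# P) : pts"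
 by (auto simp: pts_def)

lemma ptsE:
 assumes "e : pts"
 obtains P a where "subgroup P \<Gamma>" "P \<subseteq> T" "a : els" "e = (P, a <# P)"
 using assms by (auto simp: pts_def)

lemma mv_pt: "subgroup P \<Gamma> ==> g : els ==> a : els ==> mv g (P, a <# P) = (P, (g \<otimes> a) <# P)"
 by (simp add: mv_def lcos_m_assoc subgroup.subset)

lemma mv_pts: "g : els ==> e : pts ==> mv g e : pts"
 by (elim ptsE) (simp add: mv_pt ptsI)

lemma mv_mult: "g : els ==> h : els ==> e : pts ==> mv (g \<otimes> h) e = mv g (mv h e)"
 by (elim ptsE) (simp add: mv_pt m_assoc)

lemma mv_one: "e : pts ==> mv \<one> e = e"
 by (elim ptsE) (simp add: mv_pt)

lemma mv_inv: "g : els ==> e : pts ==> mv (inv g) (mv g e) = e" "g : els ==> e : pts ==> mv g (mv (inv g) e) = e"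
 by (simp_all add: mv_mult [symmetric] mv_one)

lemma stab_pt:
 assumes "subgroup P \<Gamma>" "a : els" "g : els"
 shows "g : stab (P, a <# P) <-> inv a \<otimes> g \<otimes> a : P"
proof -
 have "g <# (a <# P) = (g \<otimes> a) <# P" using assms by (simp add: lcos_m_assoc subgroup.subset)
 hence "g : stab (P, a <# P) <-> (g \<otimes> a) <# P = a <# P" using assms(3) by (simp add: stab_def)
 also have "... <-> a <# P = (g \<otimes> a) <# P" by blast
 also have "... <-> inv a \<otimes> g \<otimes> a : P" using lcoset_eq_iff[OF assms(1,2), of "g \<otimes> a"] assms by (simp add: m_assoc)
 finally show ?thesis .
qed

lemma stab_carrier: "stab e \<subseteq> els"
 by (auto simp: stab_def)

lemma stab_fix: "g : stab e ==> mv g e = e"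
 by (simp add: stab_def mv_def)

lemma stab_mv_iff:
 assumes "e : pts" "g : els" "x : els"
 shows "x : stab (mv g e) <-> inv g \<otimes> x \<otimes> g : stab e"
 using assms(1)
proof (rule ptsE)
 fix P a assume P: "subgroup P \<Gamma>" "a : els" "e = (P, a <# P)"
 show ?thesis
  using P assms stab_pt[OF P(1), of "g \<otimes> a" x] stab_pt[OF P(1,2), of "inv g \<otimes> x \<otimes> g"]
  by (simp add: mv_pt inv_mult_group m_assoc)
qed

lemma stab_mv_mono:
 assumes "e : pts" "e' : pts" "g : els" "stab e \<subseteq> stab e'"
 shows "stab (mv g e) \<subseteq> stab (mv g e')"
proof
 fix x assume x: "x : stab (mv g e)"
 hence "x : els" using stab_carrier by blast
 thus "x : stab (mv g e')" using x assms by (simp add: stab_mv_iff) blast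
qed

lemma stab_mv_Int:
 assumes "e : pts" "e1 : pts" "e2 : pts" "g : els" "stab e = stab e1 \<inter> stab e2"
 shows "stab (mv g e) = stab (mv g e1) \<inter> stab (mv g e2)"
proof -
 have "x : stab (mv g e) <-> x : stab (mv g e1) \<inter> stab (mv g e2)" if "x : els" for x
  using that assms by (simp add: stab_mv_iff)
 thus ?thesis using stab_carrier by blast
qed

lemma top_pt:
 assumes "subgroup P \<Gamma>" "P \<subseteq> T" "a : els"
 shows "top_pt (P, a <# P) = (T, a <# T)"
proof -
 have "x <# T = a <# T" if "x : a <# P" for x
 proof -
  have "x : els" using that assms l_coset_carrier by blast
  moreover have "inv a \<otimes> x : T" using subgroup.lcos_module_imp[OF assms(1) is_group assms(3) that] assms(2) by blast
  ultimately show ?thesis using lcoset_eq_iff[OF T assms(3), of x] by simp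
 qed
 moreover have "a : a <# P" using lcos_self assms by simp
 ultimately have "(\<Union>x\<in>a <# P. x <# T) = a <# T" by blast
 thus ?thesis by (simp add: top_pt_def)
qed

lemma top_pts: "e : pts ==> top_pt e : pts"
 by (elim ptsE) (simp add: top_pt ptsI T)

lemma top_mv: "e : pts ==> g : els ==> top_pt (mv g e) = mv g (top_pt e)"
 by (elim ptsE) (simp add: top_pt mv_pt T)

lemma top_top: "e : pts ==> top_pt (top_pt e) = top_pt e"
 by (elim ptsE) (simp add: top_pt T)

lemma stab_top: assumes "e : pts" shows "stab e \<subseteq> stab (top_pt e)"
 using assms
proof (rule ptsE)
 fix P a assume P: "subgroup P \<Gamma>" "P \<subseteq> T" "a : els" "e = (P, a <# P)"
 have "x : stab (top_pt e)" if "x : stab e" for x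
 proof -
  have "x : els" using that stab_carrier by blast
  thus ?thesis using that P by (auto simp: top_pt stab_pt T)
 qed
 thus ?thesis by blast
qed

definition tops :: "('g set \<times> 'g set) set" where
 "tops = (%B. (T, B)) ` (lcosets T)"

lemma tops_iff: "ta : tops <-> (EX b:els. ta = (T, b <# T))"
 by (auto simp: tops_def LCOSETS_def)

lemma tops_pts: "ta : tops ==> ta : pts"
 by (auto simp: tops_iff intro: ptsI T)

lemma mv_tops: "g : els ==> ta : tops ==> mv g ta : tops"
 by (auto simp: tops_iff mv_pt T)

lemma finite_tops: "finite tops"
 using fin by (simp add: tops_def LCOSETS_def)

lemma card_tops: "card tops = card (lcosets T)"
 unfolding tops_def by (rule card_image) (simp add: inj_on_def)

lemma bij_mv_tops: assumes "g : els" shows "bij_betw (mv g) tops tops"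
 by (rule bij_betwI[where g = "mv (inv g)"]) (use assms in \<open>auto simp: mv_inv tops_pts mv_tops\<close>)

text \<open>
  If \<open>e\<close> is \<open>a P\<close> and the top point is \<open>b T\<close>, then the intersection of the stabilizers, moved by \<open>b\<close> into \<open>T\<close>, is a subgroup
  of \<open>T\<close> whose coset at \<open>b\<close> has this stabilizer.
\<close>

lemma meet_exists:
 assumes "e : pts" "ta : tops"
 shows "EX e':pts. stab e' = stab e \<inter> stab ta"
proof -
 from assms(1) obtain P a where P: "subgroup P \<Gamma>" "P \<subseteq> T" "a : els" "e = (P, a <# P)" by (rule ptsE)
 from assms(2) obtain b where b: "b : els" "ta = (T, b <# T)" by (auto simp: tops_iff)
 have Tc: "T \<subseteq> els" and Pc: "P \<subseteq> els" using T P(1) by (auto dest: subgroup.subset)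
 define c where "c = inv a \<otimes> b"
 have c: "c : els" using P b by (simp add: c_def)
 define Q where "Q = {x : T. c \<otimes> x \<otimes> inv c : P}"
 have Q: "subgroup Q \<Gamma>"
 proof (rule subgroupI)
  show "Q \<subseteq> els" using Tc by (auto simp: Q_def)
  have "\<one> : Q" using c P(1) T by (simp add: Q_def subgroup.one_closed)
  thus "Q ~= {}" by blast
  show "inv x : Q" if "x : Q" for x
  proof -
   have x: "x : T" "x : els" "c \<otimes> x \<otimes> inv c : P" using that Tc by (auto simp: Q_def)
   hence "inv (c \<otimes> x \<otimes> inv c) : P" using P(1) by (simp add: subgroup.m_inv_closed)
   thus ?thesis using x c T by (simp add: Q_def inv_mult_group m_assoc subgroup.m_inv_closed)
  qed
  show "x \<otimes> y : Q" if "x : Q" "y : Q" for x y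
  proof -
   have x: "x : T" "x : els" "c \<otimes> x \<otimes> inv c : P" and y: "y : T" "y : els" "c \<otimes> y \<otimes> inv c : P"
    using that Tc by (auto simp: Q_def)
   have "(c \<otimes> x \<otimes> inv c) \<otimes> (c \<otimes> y \<otimes> inv c) : P" using x y P(1) by (simp add: subgroup.m_closed)
   moreover have "(c \<otimes> x \<otimes> inv c) \<otimes> (c \<otimes> y \<otimes> inv c) = c \<otimes> (x \<otimes> y) \<otimes> inv c"
    using x y c by (simp add: m_assoc) (simp add: m_assoc [symmetric])
   ultimately show ?thesis using x y T by (simp add: Q_def subgroup.m_closed)
  qed
 qed
 have "x : stab (Q, b <# Q) <-> x : stab e \<inter> stab ta" if x: "x : els" for x
 proof -
  have eq: "c \<otimes> (inv b \<otimes> x \<otimes> b) \<otimes> inv c = inv a \<otimes> x \<otimes> a"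
   using x P b by (simp add: c_def inv_mult_group m_assoc) (simp add: m_assoc [symmetric])
  have "x : stab (Q, b <# Q) <-> inv b \<otimes> x \<otimes> b : T & c \<otimes> (inv b \<otimes> x \<otimes> b) \<otimes> inv c : P"
   using stab_pt[OF Q b(1) x] by (simp add: Q_def)
  also have "... <-> x : stab e \<inter> stab ta"
   unfolding eq using stab_pt[OF P(1,3) x] stab_pt[OF T b(1) x] P(4) b(2) by auto
  finally show ?thesis .
 qed
 hence "stab (Q, b <# Q) = stab e \<inter> stab ta" using stab_carrier by blast
 moreover have "(Q, b <# Q) : pts" using Q b by (intro ptsI) (auto simp: Q_def)
 ultimately show ?thesis by blast
qed

text \<open>
  Choose meets at representatives of the orbits of pairs and translate. The translate is well defined only
  up to the stabilizer of the pair, which fixes the chosen meet because it is the stabilizer of that meet.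
\<close>

lemma equivariant_meet:
 obtains m where "!!e ta. e : pts ==> ta : tops ==> m e ta : pts"
  and "!!e ta. e : pts ==> ta : tops ==> stab (m e ta) = stab e \<inter> stab ta"
  and "!!g e ta. g : els ==> e : pts ==> ta : tops ==> m (mv g e) (mv g ta) = mv g (m e ta)"
proof -
 define orb where "orb e ta = {(mv g e, mv g ta) | g. g : els}" for e ta
 define rep where "rep e ta = (SOME z. z : orb e ta)" for e ta
 define ga where "ga e ta = (SOME g. g : els & mv g (fst (rep e ta)) = e & mv g (snd (rep e ta)) = ta)" for e ta
 define w where "w z = (SOME e'. e' : pts & stab e' = stab (fst z) \<inter> stab (snd z))" for z :: "('g set \<times> 'g set) \<times> ('g set \<times> 'g set)"
 define m where "m e ta = mv (ga e ta) (w (rep e ta))" for e ta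
 have rep: "rep e ta : orb e ta" if "e : pts" "ta : tops" for e ta
 proof -
  have "(mv \<one> e, mv \<one> ta) : orb e ta" by (auto simp: orb_def)
  thus ?thesis unfolding rep_def by (rule someI)
 qed
 have rep_pts: "fst (rep e ta) : pts" "snd (rep e ta) : tops" if "e : pts" "ta : tops" for e ta
  using rep[OF that] that by (auto simp: orb_def mv_pts mv_tops)
 have ga: "ga e ta : els" "mv (ga e ta) (fst (rep e ta)) = e" "mv (ga e ta) (snd (rep e ta)) = ta"
  if et: "e : pts" "ta : tops" for e ta
 proof -
  obtain g where g: "g : els" "rep e ta = (mv g e, mv g ta)" using rep[OF et] by (auto simp: orb_def)
  have "inv g : els & mv (inv g) (fst (rep e ta)) = e & mv (inv g) (snd (rep e ta)) = ta"
   using g et by (simp add: mv_inv tops_pts)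
  hence "ga e ta : els & mv (ga e ta) (fst (rep e ta)) = e & mv (ga e ta) (snd (rep e ta)) = ta"
   unfolding ga_def by (rule someI)
  thus "ga e ta : els" "mv (ga e ta) (fst (rep e ta)) = e" "mv (ga e ta) (snd (rep e ta)) = ta" by auto
 qed
 have w: "w z : pts" "stab (w z) = stab (fst z) \<inter> stab (snd z)" if "fst z : pts" "snd z : tops" for z
  using someI_ex[of "%e'. e' : pts & stab e' = stab (fst z) \<inter> stab (snd z)"] meet_exists[OF that] unfolding w_def by blast+
 have orb_mv: "orb (mv g e) (mv g ta) = orb e ta" if "g : els" "e : pts" "ta : tops" for g e ta
 proof
  show "orb (mv g e) (mv g ta) \<subseteq> orb e ta"
  proof (clarsimp simp: orb_def)
   fix h assume h: "h : els"
   have "mv h (mv g e) = mv (h \<otimes> g) e" "mv h (mv g ta) = mv (h \<otimes> g) ta"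
    using that h by (simp_all add: mv_mult tops_pts)
   thus "EX k. mv h (mv g e) = mv k e & mv h (mv g ta) = mv k ta & k : els" using h that by blast
  qed
  show "orb e ta \<subseteq> orb (mv g e) (mv g ta)"
  proof (clarsimp simp: orb_def)
   fix h assume h: "h : els"
   have "mv h e = mv (h \<otimes> inv g) (mv g e)" "mv h ta = mv (h \<otimes> inv g) (mv g ta)"
    using that h by (simp_all add: mv_mult mv_pts tops_pts mv_inv)
   thus "EX k. mv h e = mv k (mv g e) & mv h ta = mv k (mv g ta) & k : els" using h that by blast
  qed
 qed
 show ?thesis
 proof (rule that[of m])
  show "m e ta : pts" if "e : pts" "ta : tops" for e ta
   using that by (simp add: m_def mv_pts ga w rep_pts)
  show "stab (m e ta) = stab e \<inter> stab ta" if "e : pts" "ta : tops" for e ta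
   unfolding m_def using stab_mv_Int[of "w (rep e ta)" "fst (rep e ta)" "snd (rep e ta)" "ga e ta"] that
   by (simp add: w rep_pts tops_pts ga)
  fix g e ta assume g: "g : els" "e : pts" "ta : tops"
  hence g': "mv g e : pts" "mv g ta : tops" by (simp_all add: mv_pts mv_tops)
  have r: "rep (mv g e) (mv g ta) = rep e ta" by (simp add: rep_def orb_mv g)
  define h where "h = inv (g \<otimes> ga e ta) \<otimes> ga (mv g e) (mv g ta)"
  have h: "h : els" using g g' ga by (simp add: h_def)
  have cr: "ga (mv g e) (mv g ta) = g \<otimes> ga e ta \<otimes> h" "ga (mv g e) (mv g ta) : els" "ga e ta : els"
   using g g' ga by (simp_all add: h_def m_assoc [symmetric])
  have fixes_: "mv h x = x" if x: "x : pts" "mv (ga (mv g e) (mv g ta)) x = mv g (mv (ga e ta) x)" for x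
   using x cr g unfolding h_def by (simp add: mv_mult mv_pts inv_mult_group mv_inv)
  have "mv h (fst (rep e ta)) = fst (rep e ta)" "mv h (snd (rep e ta)) = snd (rep e ta)"
   using fixes_ g g' ga[OF g'] ga[OF g(2,3)] rep_pts[OF g(2,3)] r tops_pts by auto
  hence "h : stab (fst (rep e ta)) \<inter> stab (snd (rep e ta))" using h by (simp add: stab_def mv_def prod_eq_iff)
  hence "h : stab (w (rep e ta))" using w rep_pts[OF g(2,3)] by simp
  hence "mv h (w (rep e ta)) = w (rep e ta)" by (rule stab_fix)
  thus "m (mv g e) (mv g ta) = mv g (m e ta)"
   unfolding m_def r cr(1) using g h cr w rep_pts[OF g(2,3)] by (simp add: mv_mult mv_pts)
 qed
qed


text \<open>
  Chains of two to five points for this preorder, and equivariant cochains \<open>Kn\<close> with values in \<open>A\<close> on chains of \<open>n + 1\<close> points of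
  \<open>V\<close>, with the usual alternating differentials \<open>Dn\<close>.
\<close>

definition "sle e e' <-> stab e \<subseteq> stab e'"
definition "ch2 V e0 e1 <-> e0 : V & e1 : V & sle e0 e1"
definition "ch3 V e0 e1 e2 <-> ch2 V e0 e1 & ch2 V e1 e2"
definition "ch4 V e0 e1 e2 e3 <-> ch3 V e0 e1 e2 & ch2 V e2 e3"
definition "ch5 V e0 e1 e2 e3 e4 <-> ch4 V e0 e1 e2 e3 & ch2 V e3 e4"
lemmas chs = ch2_def ch3_def ch4_def ch5_def

definition "K1 V v <-> (ALL e0 e1. ch2 V e0 e1 --> v e0 e1 : A &
 (ALL g:els. v (mv g e0) (mv g e1) = act g (v e0 e1)))"
definition "K2 V v <-> (ALL e0 e1 e2. ch3 V e0 e1 e2 --> v e0 e1 e2 : A &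
 (ALL g:els. v (mv g e0) (mv g e1) (mv g e2) = act g (v e0 e1 e2)))"
definition "K3 V v <-> (ALL e0 e1 e2 e3. ch4 V e0 e1 e2 e3 --> v e0 e1 e2 e3 : A &
 (ALL g:els. v (mv g e0) (mv g e1) (mv g e2) (mv g e3) = act g (v e0 e1 e2 e3)))"

definition D1 :: "('e => 'e => 'a) => 'e => 'e => 'e => 'a" where
 "D1 v e0 e1 e2 = v e1 e2 - v e0 e2 + v e0 e1"
definition D2 :: "('e => 'e => 'e => 'a) => 'e => 'e => 'e => 'e => 'a" where
 "D2 t e0 e1 e2 e3 = t e1 e2 e3 - t e0 e2 e3 + t e0 e1 e3 - t e0 e1 e2"
definition D3 :: "('e => 'e => 'e => 'e => 'a) => 'e => 'e => 'e => 'e => 'e => 'a" where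
 "D3 c e0 e1 e2 e3 e4 = c e1 e2 e3 e4 - c e0 e2 e3 e4 + c e0 e1 e3 e4 - c e0 e1 e2 e4 + c e0 e1 e2 e3"
lemmas Ds = D1_def D2_def D3_def

lemma faces3: "ch3 V e0 e1 e2 ==> ch2 V e0 e1 & ch2 V e1 e2 & ch2 V e0 e2"
 by (auto simp: chs sle_def)

lemma faces4: "ch4 V e0 e1 e2 e3 ==> ch3 V e0 e1 e2 & ch3 V e1 e2 e3 & ch3 V e0 e2 e3 & ch3 V e0 e1 e3"
 by (auto simp: chs sle_def)

lemma faces5: "ch5 V e0 e1 e2 e3 e4 ==> ch4 V e0 e1 e2 e3 & ch4 V e1 e2 e3 e4 & ch4 V e0 e2 e3 e4 & ch4 V e0 e1 e3 e4 & ch4 V e0 e1 e2 e4"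
 by (auto simp: chs sle_def)

lemma K1D: "K1 V v ==> ch2 V e0 e1 ==> v e0 e1 : A"
 "K1 V v ==> ch2 V e0 e1 ==> g : els ==> v (mv g e0) (mv g e1) = act g (v e0 e1)"
 by (simp_all add: K1_def)

lemma K2D: "K2 V v2 ==> ch3 V e0 e1 e2 ==> v2 e0 e1 e2 : A"
 "K2 V v2 ==> ch3 V e0 e1 e2 ==> g : els ==> v2 (mv g e0) (mv g e1) (mv g e2) = act g (v2 e0 e1 e2)"
 by (simp_all add: K2_def)

lemma K3D: "K3 V v3 ==> ch4 V e0 e1 e2 e3 ==> v3 e0 e1 e2 e3 : A"
 "K3 V v3 ==> ch4 V e0 e1 e2 e3 ==> g : els ==>
  v3 (mv g e0) (mv g e1) (mv g e2) (mv g e3) = act g (v3 e0 e1 e2 e3)"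
 by (simp_all add: K3_def)

lemma K_D: "K1 V v1 ==> K2 V (D1 v1)" "K2 V v2 ==> K3 V (D2 v2)"
proof -
 assume K: "K1 V v1" show "K2 V (D1 v1)"
  unfolding K2_def
 proof (intro allI impI)
  fix e0 e1 e2 assume "ch3 V e0 e1 e2"
  from faces3[OF this] show "D1 v1 e0 e1 e2 : A & (ALL g:els. D1 v1 (mv g e0) (mv g e1) (mv g e2) = act g (D1 v1 e0 e1 e2))"
   by (simp add: D1_def K1D[OF K] Acl act_add act_diff)
 qed
next
 assume K: "K2 V v2" show "K3 V (D2 v2)"
  unfolding K3_def
 proof (intro allI impI)
  fix e0 e1 e2 e3 assume "ch4 V e0 e1 e2 e3"
  from faces4[OF this] show "D2 v2 e0 e1 e2 e3 : A & (ALL g:els. D2 v2 (mv g e0) (mv g e1) (mv g e2) (mv g e3) = act g (D2 v2 e0 e1 e2 e3))"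
   by (simp add: D2_def K2D[OF K] Acl act_add act_diff)
 qed
qed

lemma D_D: "D2 (D1 v) e0 e1 e2 e3 = 0" "D3 (D2 t) e0 e1 e2 e3 e4 = 0"
 by (simp_all add: Ds algebra_simps)

lemma K_diff:
 "K1 V v ==> K1 V v' ==> K1 V (%e0 e1. v e0 e1 - v' e0 e1)"
 "K2 V t ==> K2 V t' ==> K2 V (%e0 e1 e2. t e0 e1 e2 - t' e0 e1 e2)"
 by (simp_all add: K1_def K2_def Acl act_diff)

lemma D_diff:
 "D1 (%e0 e1. v e0 e1 - v' e0 e1) e0 e1 e2 = D1 v e0 e1 e2 - D1 v' e0 e1 e2"
 "D2 (%e0 e1 e2. t e0 e1 e2 - t' e0 e1 e2) e0 e1 e2 e3 = D2 t e0 e1 e2 e3 - D2 t' e0 e1 e2 e3"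
 by (simp_all add: Ds algebra_simps)

lemma sum_tops_mv:
 assumes "g : els" shows "(\<Sum>ta\<in>tops. f (mv g ta)) = (\<Sum>ta\<in>tops. f ta)"
 by (rule sum.reindex_bij_betw[OF bij_mv_tops[OF assms]])

lemma nmul_diff: "nmul k (u - v) = nmul k u - (nmul k v :: 'a)"
 by (induction k) (simp_all add: algebra_simps)

lemma nmul_plus: "nmul k (u + v) = nmul k u + (nmul k v :: 'a)"
 by (induction k) (simp_all add: algebra_simps)

text \<open>
  For a fixed top point, the meet with it lies below both the original chain and the top point, and the
  prism over this zigzag is a contracting homotopy. The sum over all top points is equivariant, and is corrected by
  an inverse \<open>k\<close> of their number.
\<close>

lemma acyclic_2:
 assumes k: "!!u. u : A ==> nmul k (nmul (card tops) u) = u"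
  and t: "K2 pts t" and cocycle: "!!e0 e1 e2 e3. ch4 pts e0 e1 e2 e3 ==> D2 t e0 e1 e2 e3 = 0"
 shows "EX v. K1 pts v & (ALL e0 e1 e2. ch3 pts e0 e1 e2 --> D1 v e0 e1 e2 = t e0 e1 e2)"
proof (rule equivariant_meet)
 fix m :: "'g set \<times> 'g set => 'g set \<times> 'g set => 'g set \<times> 'g set"
 assume m: "!!e ta. e : pts ==> ta : tops ==> m e ta : pts"
  "!!e ta. e : pts ==> ta : tops ==> stab (m e ta) = stab e \<inter> stab ta"
  "!!g e ta. g : els ==> e : pts ==> ta : tops ==> m (mv g e) (mv g ta) = mv g (m e ta)"
 define s where "s ta e0 e1 = t (m e0 ta) e0 e1 - t (m e0 ta) (m e1 ta) e1 + t (m e0 ta) (m e1 ta) ta" for ta e0 e1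
 have ch: "ch3 pts (m e0 ta) e0 e1" "ch3 pts (m e0 ta) (m e1 ta) e1" "ch3 pts (m e0 ta) (m e1 ta) ta"
  if "ch2 pts e0 e1" "ta : tops" for e0 e1 ta
  using that m(1,2) tops_pts by (auto simp: chs sle_def)
 have sA: "s ta e0 e1 : A" if "ch2 pts e0 e1" "ta : tops" for ta e0 e1
  unfolding s_def using ch[OF that] K2D(1)[OF t] by (simp add: Acl)
 have seq: "s (mv g ta) (mv g e0) (mv g e1) = act g (s ta e0 e1)"
  if c: "ch2 pts e0 e1" "ta : tops" and g: "g : els" for g ta e0 e1
 proof -
  have "e0 : pts" "e1 : pts" using c by (auto simp: chs)
  thus ?thesis
   unfolding s_def using ch[OF c] K2D[OF t] g c(2) by (simp add: m(3) Acl act_add act_diff)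
 qed
 have Ds: "D1 (s ta) e0 e1 e2 = t e0 e1 e2" if c: "ch3 pts e0 e1 e2" "ta : tops" for ta e0 e1 e2
 proof -
  have "ch4 pts (m e0 ta) e0 e1 e2" "ch4 pts (m e0 ta) (m e1 ta) e1 e2" "ch4 pts (m e0 ta) (m e1 ta) (m e2 ta) e2"
   "ch4 pts (m e0 ta) (m e1 ta) (m e2 ta) ta"
   using c m(1,2) tops_pts by (auto simp: chs sle_def)
  note z = this[THEN cocycle]
  have "D1 (s ta) e0 e1 e2 = t e0 e1 e2 - D2 t (m e0 ta) e0 e1 e2 + D2 t (m e0 ta) (m e1 ta) e1 e2
    - D2 t (m e0 ta) (m e1 ta) (m e2 ta) e2 + D2 t (m e0 ta) (m e1 ta) (m e2 ta) ta"
   unfolding s_def D1_def D2_def by (simp add: algebra_simps)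
  thus ?thesis by (simp add: z)
 qed
 define v where "v e0 e1 = nmul k (\<Sum>ta\<in>tops. s ta e0 e1)" for e0 e1
 have "K1 pts v"
  unfolding K1_def
 proof (intro allI impI conjI ballI)
  fix e0 e1 assume c: "ch2 pts e0 e1"
  show "v e0 e1 : A" unfolding v_def by (intro add_subgroup_nmul[OF A] add_subgroup_sum[OF A] sA c)
  fix g assume g: "g : els"
  have "(\<Sum>ta\<in>tops. s ta (mv g e0) (mv g e1)) = (\<Sum>ta\<in>tops. s (mv g ta) (mv g e0) (mv g e1))"
   by (rule sum_tops_mv[OF g, symmetric])
  also have "... = (\<Sum>ta\<in>tops. act g (s ta e0 e1))" by (intro sum.cong refl seq c g)
  also have "... = act g (\<Sum>ta\<in>tops. s ta e0 e1)" by (rule act_sum[OF g, symmetric]) (rule sA[OF c])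
  finally show "v (mv g e0) (mv g e1) = act g (v e0 e1)"
   unfolding v_def by (simp add: act_nmul[OF g add_subgroup_sum[OF A sA[OF c]]])
 qed
 moreover have "D1 v e0 e1 e2 = t e0 e1 e2" if c: "ch3 pts e0 e1 e2" for e0 e1 e2
 proof -
  have "D1 v e0 e1 e2 = nmul k (\<Sum>ta\<in>tops. D1 (s ta) e0 e1 e2)"
   unfolding v_def D1_def by (simp add: nmul_diff nmul_plus sum.distrib sum_subtractf)
  also have "(\<Sum>ta\<in>tops. D1 (s ta) e0 e1 e2) = (\<Sum>ta\<in>tops. t e0 e1 e2)" by (intro sum.cong refl Ds c)
  finally show ?thesis using k[OF K2D(1)[OF t c]] by (simp add: sum_const_nmul finite_tops)
 qed
 ultimately show ?thesis by blast
qed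

text \<open>
  The same prism one degree higher.
\<close>

lemma acyclic_3:
 assumes k: "!!u. u : A ==> nmul k (nmul (card tops) u) = u"
  and t: "K3 pts t" and cocycle: "!!e0 e1 e2 e3 e4. ch5 pts e0 e1 e2 e3 e4 ==> D3 t e0 e1 e2 e3 e4 = 0"
 shows "EX v. K2 pts v & (ALL e0 e1 e2 e3. ch4 pts e0 e1 e2 e3 --> D2 v e0 e1 e2 e3 = t e0 e1 e2 e3)"
proof (rule equivariant_meet)
 fix m :: "'g set \<times> 'g set => 'g set \<times> 'g set => 'g set \<times> 'g set"
 assume m: "!!e ta. e : pts ==> ta : tops ==> m e ta : pts"
  "!!e ta. e : pts ==> ta : tops ==> stab (m e ta) = stab e \<inter> stab ta"
  "!!g e ta. g : els ==> e : pts ==> ta : tops ==> m (mv g e) (mv g ta) = mv g (m e ta)"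
 define s where "s ta e0 e1 e2 = t (m e0 ta) e0 e1 e2 - t (m e0 ta) (m e1 ta) e1 e2 + t (m e0 ta) (m e1 ta) (m e2 ta) e2
  - t (m e0 ta) (m e1 ta) (m e2 ta) ta" for ta e0 e1 e2
 have ch: "ch4 pts (m e0 ta) e0 e1 e2" "ch4 pts (m e0 ta) (m e1 ta) e1 e2" "ch4 pts (m e0 ta) (m e1 ta) (m e2 ta) e2"
   "ch4 pts (m e0 ta) (m e1 ta) (m e2 ta) ta"
  if "ch3 pts e0 e1 e2" "ta : tops" for e0 e1 e2 ta
  using that m(1,2) tops_pts by (auto simp: chs sle_def)
 have sA: "s ta e0 e1 e2 : A" if "ch3 pts e0 e1 e2" "ta : tops" for ta e0 e1 e2
  unfolding s_def using ch[OF that] K3D(1)[OF t] by (simp add: Acl)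
 have seq: "s (mv g ta) (mv g e0) (mv g e1) (mv g e2) = act g (s ta e0 e1 e2)"
  if c: "ch3 pts e0 e1 e2" "ta : tops" and g: "g : els" for g ta e0 e1 e2
 proof -
  have "e0 : pts" "e1 : pts" "e2 : pts" using c by (auto simp: chs)
  thus ?thesis
   unfolding s_def using ch[OF c] K3D[OF t] g c(2) by (simp add: m(3) Acl act_add act_diff)
 qed
 have Ds: "D2 (s ta) e0 e1 e2 e3 = t e0 e1 e2 e3" if c: "ch4 pts e0 e1 e2 e3" "ta : tops" for ta e0 e1 e2 e3
 proof -
  have "ch5 pts (m e0 ta) e0 e1 e2 e3" "ch5 pts (m e0 ta) (m e1 ta) e1 e2 e3" "ch5 pts (m e0 ta) (m e1 ta) (m e2 ta) e2 e3"
   "ch5 pts (m e0 ta) (m e1 ta) (m e2 ta) (m e3 ta) e3" "ch5 pts (m e0 ta) (m e1 ta) (m e2 ta) (m e3 ta) ta"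
   using c m(1,2) tops_pts by (auto simp: chs sle_def)
  note z = this[THEN cocycle]
  have "D2 (s ta) e0 e1 e2 e3 = t e0 e1 e2 e3 - D3 t (m e0 ta) e0 e1 e2 e3 + D3 t (m e0 ta) (m e1 ta) e1 e2 e3
    - D3 t (m e0 ta) (m e1 ta) (m e2 ta) e2 e3 + D3 t (m e0 ta) (m e1 ta) (m e2 ta) (m e3 ta) e3
    - D3 t (m e0 ta) (m e1 ta) (m e2 ta) (m e3 ta) ta"
   unfolding s_def D2_def D3_def by (simp add: algebra_simps)
  thus ?thesis by (simp add: z)
 qed
 define v where "v e0 e1 e2 = nmul k (\<Sum>ta\<in>tops. s ta e0 e1 e2)" for e0 e1 e2
 have "K2 pts v"
  unfolding K2_def
 proof (intro allI impI conjI ballI)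
  fix e0 e1 e2 assume c: "ch3 pts e0 e1 e2"
  show "v e0 e1 e2 : A" unfolding v_def by (intro add_subgroup_nmul[OF A] add_subgroup_sum[OF A] sA c)
  fix g assume g: "g : els"
  have "(\<Sum>ta\<in>tops. s ta (mv g e0) (mv g e1) (mv g e2)) = (\<Sum>ta\<in>tops. s (mv g ta) (mv g e0) (mv g e1) (mv g e2))"
   by (rule sum_tops_mv[OF g, symmetric])
  also have "... = (\<Sum>ta\<in>tops. act g (s ta e0 e1 e2))" by (intro sum.cong refl seq c g)
  also have "... = act g (\<Sum>ta\<in>tops. s ta e0 e1 e2)" by (rule act_sum[OF g, symmetric]) (rule sA[OF c])
  finally show "v (mv g e0) (mv g e1) (mv g e2) = act g (v e0 e1 e2)"
   unfolding v_def by (simp add: act_nmul[OF g add_subgroup_sum[OF A sA[OF c]]])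
 qed
 moreover have "D2 v e0 e1 e2 e3 = t e0 e1 e2 e3" if c: "ch4 pts e0 e1 e2 e3" for e0 e1 e2 e3
 proof -
  have "D2 v e0 e1 e2 e3 = nmul k (\<Sum>ta\<in>tops. D2 (s ta) e0 e1 e2 e3)"
   unfolding v_def D2_def by (simp add: nmul_diff nmul_plus sum.distrib sum_subtractf)
  also have "(\<Sum>ta\<in>tops. D2 (s ta) e0 e1 e2 e3) = (\<Sum>ta\<in>tops. t e0 e1 e2 e3)" by (intro sum.cong refl Ds c)
  finally show ?thesis using k[OF K3D(1)[OF t c]] by (simp add: sum_const_nmul finite_tops)
 qed
 ultimately show ?thesis by blast
qed

definition up_family :: "('g set \<times> 'g set) set => bool" where
 "up_family V <-> V \<subseteq> pts & (ALL g:els. ALL e:V. mv g e : V) & (ALL e:V. ALL e':pts. sle e e' --> e' : V)"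

lemma up_family_pts: "up_family pts"
 by (auto simp: up_family_def mv_pts)

lemma up_familyD:
 assumes "up_family V"
 shows "e : V ==> e : pts" "g : els ==> e : V ==> mv g e : V" "e : V ==> top_pt e : V"
  "e : V ==> e' : pts ==> sle e e' ==> e' : V"
  "e : pts ==> g : els ==> mv g e : V <-> e : V"
proof -
 show 1: "e : V ==> e : pts" "g : els ==> e : V ==> mv g e : V"
   "e : V ==> e' : pts ==> sle e e' ==> e' : V" for e e' g
  using assms by (auto simp: up_family_def)
 show "e : V ==> top_pt e : V" using 1(1) 1(3)[of e "top_pt e"] stab_top top_pts by (auto simp: sle_def)
 show "e : pts ==> g : els ==> mv g e : V <-> e : V"
  using 1(2)[of g e] 1(2)[of "inv g" "mv g e"] by (auto simp: mv_inv)
qed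

lemma ch2_mv: "ch2 pts e0 e1 ==> g : els ==> ch2 pts (mv g e0) (mv g e1)"
 by (auto simp: chs sle_def mv_pts dest: stab_mv_mono)


text \<open>
  Cochains of linking systems are normalised: they vanish on chains whose points all lie in one coset of
  \<open>T\<close>, since there the functor from the transporter category of \<open>S\<close> prescribes the morphisms.
\<close>

definition "N1 V v <-> (ALL e0 e1. ch2 V e0 e1 --> top_pt e0 = top_pt e1 --> v e0 e1 = 0)"
definition "N2 V t <-> (ALL e0 e1 e2. ch3 V e0 e1 e2 --> top_pt e0 = top_pt e1 --> top_pt e1 = top_pt e2 --> t e0 e1 e2 = 0)"

text \<open>
  A chain in one coset of \<open>T\<close> can be coned off with that coset, so restricted to such chains every
  cocycle is a coboundary in an equivariant way.
\<close>

lemma normalise_cocycle: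
 assumes V: "up_family V" and t: "K2 V t" "!!e0 e1 e2 e3. ch4 V e0 e1 e2 e3 ==> D2 t e0 e1 e2 e3 = 0"
 shows "EX v. K1 V v & N2 V (%e0 e1 e2. t e0 e1 e2 - D1 v e0 e1 e2)"
proof (intro exI conjI)
 let ?v = "%e0 e1. t e0 e1 (top_pt e1)"
 have ch: "ch3 V e0 e1 (top_pt e1)" if "ch2 V e0 e1" for e0 e1
  using that V stab_top by (auto simp: chs sle_def up_familyD)
 show "K1 V ?v"
  unfolding K1_def
 proof (intro allI impI)
  fix e0 e1 assume c: "ch2 V e0 e1"
  hence "e1 : pts" using V by (auto simp: chs up_familyD)
  thus "?v e0 e1 : A & (ALL g:els. ?v (mv g e0) (mv g e1) = act g (?v e0 e1))"
   using K2D[OF t(1) ch[OF c]] by (simp add: top_mv)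
 qed
 show "N2 V (%e0 e1 e2. t e0 e1 e2 - D1 ?v e0 e1 e2)"
  unfolding N2_def
 proof (intro allI impI)
  fix e0 e1 e2 assume c: "ch3 V e0 e1 e2" "top_pt e0 = top_pt e1" "top_pt e1 = top_pt e2"
  hence "ch4 V e0 e1 e2 (top_pt e2)" using ch[of e1 e2] by (auto simp: ch4_def ch3_def)
  from t(2)[OF this] show "t e0 e1 e2 - D1 ?v e0 e1 e2 = 0" using c(2,3) by (simp add: Ds algebra_simps)
 qed
qed

lemma normalise_coboundary:
 assumes V: "up_family V" and v: "K1 V v" "N2 V (D1 v)"
 shows "EX v'. K1 V v' & N1 V v' & (ALL e0 e1 e2. ch3 V e0 e1 e2 --> D1 v' e0 e1 e2 = D1 v e0 e1 e2)"
proof (intro exI conjI allI impI)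
 let ?w = "%e. v e (top_pt e)"
 let ?v = "%e0 e1. v e0 e1 - ?w e0 + ?w e1"
 have ch: "ch2 V e (top_pt e)" if "e : V" for e
  using that up_familyD(3)[OF V that] stab_top[OF up_familyD(1)[OF V that]] by (simp add: ch2_def sle_def)
 show "K1 V ?v"
  unfolding K1_def
 proof (intro allI impI)
  fix e0 e1 assume c: "ch2 V e0 e1"
  hence e: "e0 : V" "e1 : V" "e0 : pts" "e1 : pts" using V by (auto simp: chs up_familyD)
  show "?v e0 e1 : A & (ALL g:els. ?v (mv g e0) (mv g e1) = act g (?v e0 e1))"
   using K1D[OF v(1) ch[OF e(1)]] K1D[OF v(1) ch[OF e(2)]] K1D[OF v(1) c] e
   by (simp add: top_mv [symmetric] Acl act_add act_diff)
 qed
 show "N1 V ?v"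
  unfolding N1_def
 proof (intro allI impI)
  fix e0 e1 assume c: "ch2 V e0 e1" "top_pt e0 = top_pt e1"
  hence e: "e1 : V" "e1 : pts" using V by (auto simp: chs up_familyD)
  hence "ch3 V e0 e1 (top_pt e1)" using c ch[of e1] by (auto simp: ch3_def)
  hence "D1 v e0 e1 (top_pt e1) = 0" using v(2) c e by (simp add: N2_def top_top)
  thus "?v e0 e1 = 0" using c by (simp add: D1_def algebra_simps)
 qed
 show "D1 ?v e0 e1 e2 = D1 v e0 e1 e2" for e0 e1 e2 by (simp add: D1_def algebra_simps)
qed

text \<open>
  Normalised 2-cocycles on \<open>V\<close>, and 3-cocycles on all points that are relative to \<open>V\<close>, with their relations of
  being cohomologous. As \<open>V\<close> is closed upwards, a chain lies in \<open>V\<close> if its first point does.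
\<close>

definition "NZ2 V = {t. K2 V t & N2 V t & (ALL e0 e1 e2 e3. ch4 V e0 e1 e2 e3 --> D2 t e0 e1 e2 e3 = 0)}"
definition "NE2 V t t' <-> (EX v. K1 V v & N1 V v & (ALL e0 e1 e2. ch3 V e0 e1 e2 --> t e0 e1 e2 - t' e0 e1 e2 = D1 v e0 e1 e2))"
definition "FZ3 V = {c. K3 pts c & (ALL e0 e1 e2 e3. ch4 pts e0 e1 e2 e3 --> e0 : V --> c e0 e1 e2 e3 = 0) &
 (ALL e0 e1 e2 e3 e4. ch5 pts e0 e1 e2 e3 e4 --> D3 c e0 e1 e2 e3 e4 = 0)}"
definition "FE3 V c c' <-> (EX b. K2 pts b & (ALL e0 e1 e2. ch3 pts e0 e1 e2 --> e0 : V --> b e0 e1 e2 = 0) &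
 (ALL e0 e1 e2 e3. ch4 pts e0 e1 e2 e3 --> c e0 e1 e2 e3 - c' e0 e1 e2 e3 = D2 b e0 e1 e2 e3))"

lemma ch_up:
 assumes "up_family V"
 shows "e0 : V ==> ch2 pts e0 e1 <-> ch2 V e0 e1"
  "e0 : V ==> ch3 pts e0 e1 e2 <-> ch3 V e0 e1 e2"
  "e0 : V ==> ch4 pts e0 e1 e2 e3 <-> ch4 V e0 e1 e2 e3"
proof -
 show 1: "e0 : V ==> ch2 pts e0 e1 <-> ch2 V e0 e1" for e0 e1
  unfolding ch2_def
  using up_familyD(1)[OF assms, of e0] up_familyD(1)[OF assms, of e1] up_familyD(4)[OF assms, of e0 e1] by blast
 have 2: "e1 : V" if "ch2 V e0 e1" for e0 e1 using that by (simp add: ch2_def)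
 show 3: "e0 : V ==> ch3 pts e0 e1 e2 <-> ch3 V e0 e1 e2" for e0 e1 e2
  unfolding ch3_def using 1[of e0 e1] 1[of e1 e2] 2[of e0 e1] by blast
 have 4: "e2 : V" if "ch3 V e0 e1 e2" for e0 e1 e2 using that by (simp add: ch3_def ch2_def)
 show "e0 : V ==> ch4 pts e0 e1 e2 e3 <-> ch4 V e0 e1 e2 e3"
  unfolding ch4_def using 3[of e0 e1 e2] 1[of e2 e3] 4[of e0 e1 e2] by blast
qed

lemma K1_ext:
 assumes V: "up_family V" and v: "K1 V v"
 shows "K1 pts (%e0 e1. if e0 : V then v e0 e1 else 0)"
 unfolding K1_def
proof (intro allI impI)
 fix e0 e1 assume c: "ch2 pts e0 e1"
 hence "e0 : pts" by (simp add: ch2_def)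
 thus "(if e0 : V then v e0 e1 else 0) : A & (ALL g:els. (if mv g e0 : V then v (mv g e0) (mv g e1) else 0) =
   act g (if e0 : V then v e0 e1 else 0))"
  using K1D[OF v] c ch_up(1)[OF V, of e0 e1] by (simp add: up_familyD(5)[OF V] Acl act_zero)
qed

lemma K2_ext:
 assumes V: "up_family V" and v: "K2 V v"
 shows "K2 pts (%e0 e1 e2. if e0 : V then v e0 e1 e2 else 0)"
 unfolding K2_def
proof (intro allI impI)
 fix e0 e1 e2 assume c: "ch3 pts e0 e1 e2"
 hence "e0 : pts" by (simp add: chs)
 thus "(if e0 : V then v e0 e1 e2 else 0) : A & (ALL g:els. (if mv g e0 : V then v (mv g e0) (mv g e1) (mv g e2) else 0) =
   act g (if e0 : V then v e0 e1 e2 else 0))"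
  using K2D[OF v] c ch_up(2)[OF V, of e0 e1 e2] by (simp add: up_familyD(5)[OF V] Acl act_zero)
qed

lemma K_restrict: assumes "up_family V" shows "K1 pts v ==> K1 V v" "K2 pts t ==> K2 V t"
proof -
 have *: "ch2 V e0 e1 ==> ch2 pts e0 e1" "ch3 V e0 e1 e2 ==> ch3 pts e0 e1 e2" for e0 e1 e2
  using up_familyD(1)[OF assms] by (auto simp: chs)
 show "K1 pts v ==> K1 V v" "K2 pts t ==> K2 V t" using * by (auto simp: K1_def K2_def)
qed

text \<open>
  The connecting homomorphism of the pair: extend a cocycle on \<open>V\<close> by zero and apply the differential. It is
  bijective on cohomology since the cochains on all points are acyclic.
\<close>

theorem connecting_corr:
 assumes k: "!!u. u : A ==> nmul k (nmul (card tops) u) = u" and V: "up_family V"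
 shows "corr (NZ2 V) (NE2 V) (FZ3 V) (FE3 V)"
proof (rule corrI[where R = "%t c. EX b. K2 pts b & (ALL e0 e1 e2 e3. ch4 pts e0 e1 e2 e3 --> D2 b e0 e1 e2 e3 = c e0 e1 e2 e3) &
  (ALL e0 e1 e2. ch3 V e0 e1 e2 --> b e0 e1 e2 = t e0 e1 e2)"])
 have V3: "e0 : V" if "ch3 V e0 e1 e2" for e0 e1 e2 using that by (simp add: chs)
 have V4: "e0 : V & e1 : V & e2 : V & e3 : V" if "ch4 V e0 e1 e2 e3" for e0 e1 e2 e3 using that by (simp add: chs)
 fix t assume t: "t : NZ2 V"
 define b where "b = (%e0 e1 e2. if e0 : V then t e0 e1 e2 else 0)"
 have b: "K2 pts b" unfolding b_def by (rule K2_ext[OF V]) (use t in \<open>simp add: NZ2_def\<close>)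
 have "D2 b : FZ3 V"
  unfolding FZ3_def
 proof (intro CollectI conjI allI impI)
  show "K3 pts (D2 b)" by (rule K_D(2)[OF b])
  show "D3 (D2 b) e0 e1 e2 e3 e4 = 0" for e0 e1 e2 e3 e4 by (rule D_D(2))
  fix e0 e1 e2 e3 assume "ch4 pts e0 e1 e2 e3" "e0 : V"
  hence c: "ch4 V e0 e1 e2 e3" using ch_up(3)[OF V] by simp
  show "D2 b e0 e1 e2 e3 = 0" using t c V4[OF c] by (simp add: NZ2_def D2_def b_def)
 qed
 moreover have "b e0 e1 e2 = t e0 e1 e2" if "ch3 V e0 e1 e2" for e0 e1 e2 using V3[OF that] by (simp add: b_def)
 ultimately show "EX c:FZ3 V. EX b. K2 pts b & (ALL e0 e1 e2 e3. ch4 pts e0 e1 e2 e3 --> D2 b e0 e1 e2 e3 = c e0 e1 e2 e3) &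
  (ALL e0 e1 e2. ch3 V e0 e1 e2 --> b e0 e1 e2 = t e0 e1 e2)"
  using b by (intro bexI[of _ "D2 b"] exI[of _ b]) simp_all
next
 have V4: "ch4 pts e0 e1 e2 e3 & e0 : V" if "ch4 V e0 e1 e2 e3" for e0 e1 e2 e3
  using that up_familyD(1)[OF V] by (auto simp: chs)
 have V3: "e0 : V & e1 : V" if "ch3 V e0 e1 e2" for e0 e1 e2 using that by (simp add: chs)
 fix c assume c: "c : FZ3 V"
 hence "EX b. K2 pts b & (ALL e0 e1 e2 e3. ch4 pts e0 e1 e2 e3 --> D2 b e0 e1 e2 e3 = c e0 e1 e2 e3)"
  by (intro acyclic_3[OF k]) (simp_all add: FZ3_def)
 then obtain b where b: "K2 pts b" "!!e0 e1 e2 e3. ch4 pts e0 e1 e2 e3 ==> D2 b e0 e1 e2 e3 = c e0 e1 e2 e3" by blast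
 have "D2 b e0 e1 e2 e3 = 0" if "ch4 V e0 e1 e2 e3" for e0 e1 e2 e3
  using b(2) V4[OF that] c by (simp add: FZ3_def)
 then obtain v where v: "K1 V v" "N2 V (%e0 e1 e2. b e0 e1 e2 - D1 v e0 e1 e2)"
  using normalise_cocycle[OF V K_restrict(2)[OF V b(1)]] by blast
 define v' where "v' = (%e0 e1. if e0 : V then v e0 e1 else 0)"
 have v': "K1 pts v'" unfolding v'_def by (rule K1_ext[OF V v(1)])
 have v'v: "D1 v' e0 e1 e2 = D1 v e0 e1 e2" if "ch3 V e0 e1 e2" for e0 e1 e2
  using V3[OF that] by (simp add: D1_def v'_def)
 define b' where "b' = (%e0 e1 e2. b e0 e1 e2 - D1 v' e0 e1 e2)"
 have b': "K2 pts b'" unfolding b'_def by (rule K_diff(2)[OF b(1) K_D(1)[OF v']])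
 have Db': "D2 b' e0 e1 e2 e3 = c e0 e1 e2 e3" if "ch4 pts e0 e1 e2 e3" for e0 e1 e2 e3
  unfolding b'_def D_diff D_D b(2)[OF that] by simp
 have "b' : NZ2 V"
  unfolding NZ2_def
 proof (intro CollectI conjI allI impI)
  show "K2 V b'" by (rule K_restrict(2)[OF V b'])
  show "N2 V b'" using v(2) v'v by (auto simp: N2_def b'_def)
  show "D2 b' e0 e1 e2 e3 = 0" if "ch4 V e0 e1 e2 e3" for e0 e1 e2 e3
   using Db' V4[OF that] c by (simp add: FZ3_def)
 qed
 thus "EX t:NZ2 V. EX b. K2 pts b & (ALL e0 e1 e2 e3. ch4 pts e0 e1 e2 e3 --> D2 b e0 e1 e2 e3 = c e0 e1 e2 e3) &
  (ALL e0 e1 e2. ch3 V e0 e1 e2 --> b e0 e1 e2 = t e0 e1 e2)"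
  using b' Db' by (intro bexI[of _ b'] exI[of _ b']) simp_all
next
 have V4: "ch4 pts e0 e1 e2 e3 & e0 : V" if "ch4 V e0 e1 e2 e3" for e0 e1 e2 e3
  using that up_familyD(1)[OF V] by (auto simp: chs)
 have V3: "ch3 pts e0 e1 e2 & e0 : V & e1 : V" if "ch3 V e0 e1 e2" for e0 e1 e2
  using that up_familyD(1)[OF V] by (auto simp: chs)
 fix t t' c c'
 assume t: "t : NZ2 V" "t' : NZ2 V"
  and "EX b. K2 pts b & (ALL e0 e1 e2 e3. ch4 pts e0 e1 e2 e3 --> D2 b e0 e1 e2 e3 = c e0 e1 e2 e3) &
   (ALL e0 e1 e2. ch3 V e0 e1 e2 --> b e0 e1 e2 = t e0 e1 e2)"
  "EX b. K2 pts b & (ALL e0 e1 e2 e3. ch4 pts e0 e1 e2 e3 --> D2 b e0 e1 e2 e3 = c' e0 e1 e2 e3) &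
   (ALL e0 e1 e2. ch3 V e0 e1 e2 --> b e0 e1 e2 = t' e0 e1 e2)"
 then obtain b b' where b: "K2 pts b" "!!e0 e1 e2 e3. ch4 pts e0 e1 e2 e3 ==> D2 b e0 e1 e2 e3 = c e0 e1 e2 e3"
   "!!e0 e1 e2. ch3 V e0 e1 e2 ==> b e0 e1 e2 = t e0 e1 e2"
  and b': "K2 pts b'" "!!e0 e1 e2 e3. ch4 pts e0 e1 e2 e3 ==> D2 b' e0 e1 e2 e3 = c' e0 e1 e2 e3"
   "!!e0 e1 e2. ch3 V e0 e1 e2 ==> b' e0 e1 e2 = t' e0 e1 e2" by blast
 define z where "z = (%e0 e1 e2. b e0 e1 e2 - b' e0 e1 e2)"
 have z: "K2 pts z" "!!e0 e1 e2 e3. ch4 pts e0 e1 e2 e3 ==> D2 z e0 e1 e2 e3 = c e0 e1 e2 e3 - c' e0 e1 e2 e3"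
  "!!e0 e1 e2. ch3 V e0 e1 e2 ==> z e0 e1 e2 = t e0 e1 e2 - t' e0 e1 e2"
  unfolding z_def using K_diff(2)[OF b(1) b'(1)] b b' by (simp_all add: D_diff)
 show "NE2 V t t' <-> FE3 V c c'"
 proof
  assume "NE2 V t t'"
  then obtain v where v: "K1 V v" "!!e0 e1 e2. ch3 V e0 e1 e2 ==> t e0 e1 e2 - t' e0 e1 e2 = D1 v e0 e1 e2" by (auto simp: NE2_def)
  define v' where "v' = (%e0 e1. if e0 : V then v e0 e1 else 0)"
  have v': "K1 pts v'" unfolding v'_def by (rule K1_ext[OF V v(1)])
  have v'v: "D1 v' e0 e1 e2 = D1 v e0 e1 e2" if "ch3 V e0 e1 e2" for e0 e1 e2
   using V3[OF that] by (simp add: D1_def v'_def)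
  define f where "f = (%e0 e1 e2. z e0 e1 e2 - D1 v' e0 e1 e2)"
  have "K2 pts f" unfolding f_def by (rule K_diff(2)[OF z(1) K_D(1)[OF v']])
  moreover have "f e0 e1 e2 = 0" if "ch3 pts e0 e1 e2" "e0 : V" for e0 e1 e2
  proof -
   have "ch3 V e0 e1 e2" using that ch_up(2)[OF V] by simp
   thus ?thesis by (simp add: f_def z v'v v)
  qed
  moreover have "c e0 e1 e2 e3 - c' e0 e1 e2 e3 = D2 f e0 e1 e2 e3" if "ch4 pts e0 e1 e2 e3" for e0 e1 e2 e3
   unfolding f_def D_diff D_D z(2)[OF that] by simp
  ultimately show "FE3 V c c'" unfolding FE3_def by (intro exI[of _ f]) simp
 next
  assume "FE3 V c c'"
  then obtain f where f: "K2 pts f" "!!e0 e1 e2. ch3 pts e0 e1 e2 ==> e0 : V ==> f e0 e1 e2 = 0"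
   "!!e0 e1 e2 e3. ch4 pts e0 e1 e2 e3 ==> c e0 e1 e2 e3 - c' e0 e1 e2 e3 = D2 f e0 e1 e2 e3" by (auto simp: FE3_def)
  have "EX v. K1 pts v & (ALL e0 e1 e2. ch3 pts e0 e1 e2 --> D1 v e0 e1 e2 = z e0 e1 e2 - f e0 e1 e2)"
   by (rule acyclic_2[OF k]) (simp_all add: K_diff(2)[OF z(1) f(1)] D_diff z f)
  then obtain v where v: "K1 pts v" "!!e0 e1 e2. ch3 pts e0 e1 e2 ==> D1 v e0 e1 e2 = z e0 e1 e2 - f e0 e1 e2" by blast
  have tv: "D1 v e0 e1 e2 = t e0 e1 e2 - t' e0 e1 e2" if "ch3 V e0 e1 e2" for e0 e1 e2
   using V3[OF that] v(2) f(2) z(3)[OF that] by simp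
  have "N2 V (D1 v)" using t tv by (simp add: NZ2_def N2_def)
  then obtain v' where "K1 V v'" "N1 V v'" "!!e0 e1 e2. ch3 V e0 e1 e2 ==> D1 v' e0 e1 e2 = D1 v e0 e1 e2"
   using normalise_coboundary[OF V K_restrict(1)[OF V v(1)]] by blast
  thus "NE2 V t t'" unfolding NE2_def using tv by (intro exI[of _ v']) simp
 qed
qed

lemma NE2_pts:
 assumes k: "!!u. u : A ==> nmul k (nmul (card tops) u) = u" and t: "t : NZ2 pts" "t' : NZ2 pts"
 shows "NE2 pts t t'"
proof -
 have K: "K2 pts (%e0 e1 e2. t e0 e1 e2 - t' e0 e1 e2)" using t by (intro K_diff(2)) (simp_all add: NZ2_def)
 hence "EX v. K1 pts v & (ALL e0 e1 e2. ch3 pts e0 e1 e2 --> D1 v e0 e1 e2 = t e0 e1 e2 - t' e0 e1 e2)"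
  by (intro acyclic_2[OF k]) (use t in \<open>simp_all add: D_diff NZ2_def\<close>)
 then obtain v where v: "K1 pts v" "!!e0 e1 e2. ch3 pts e0 e1 e2 ==> D1 v e0 e1 e2 = t e0 e1 e2 - t' e0 e1 e2" by blast
 have "N2 pts (D1 v)" using t v(2) by (simp add: NZ2_def N2_def)
 then obtain v' where "K1 pts v'" "N1 pts v'" "!!e0 e1 e2. ch3 pts e0 e1 e2 ==> D1 v' e0 e1 e2 = D1 v e0 e1 e2"
  using normalise_coboundary[OF up_family_pts v(1)] by blast
 thus ?thesis unfolding NE2_def using v(2) by (intro exI[of _ v']) simp
qed

end

section \<open>Bar cochains of the atomic functor\<close>

text \<open>
  A resolution of the functor that is \<open>A\<close> on the trivial subgroup and zero elsewhere.
\<close>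

locale orbit_resolution = coset_cochains \<Gamma> T A act +
 AR: acyclic_resolution "Obj (orbit_category \<Gamma> T)" "arrows (orbit_category \<Gamma> T)" src tgt "arrow_comp (orbit_category \<Gamma> T)" X \<rho> d r
 for \<Gamma> :: "('g, 'b) monoid_scheme" (structure) and T A and act :: "'g => 'a::ab_group_add => 'a"
  and X :: "nat => 'g set => 'u::ab_group_add set" and \<rho> d r +
 fixes kp :: "'a => 'u"
 assumes kp_add: "u : A ==> v : A ==> kp (u + v) = kp u + kp v"
  and kp_inj: "inj_on kp A" and kp_image: "kp ` A = {u : X 0 {\<one>}. d 0 {\<one>} u = 0}"
  and kp_nat: "a : arrows (orbit_category \<Gamma> T) ==> src a = {\<one>} ==> tgt a = {\<one>} ==> g : carrier \<Gamma> ==> mor a {\<one>} = g <# {\<one>} ==>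
   u : A ==> \<rho> 0 a (kp u) = kp (act g u)"
  and trivial_elsewhere: "P : Obj (orbit_category \<Gamma> T) ==> P ~= {\<one>} ==> x : X 0 P ==> d 0 P x = 0 ==> x = 0"
begin

abbreviation C where "C \<equiv> orbit_category \<Gamma> T"

definition push :: "'g set \<times> ('g set => 'g set) \<times> 'g set => 'g set \<times> 'g set => 'g set \<times> 'g set" where
 "push a e = (tgt a, mor a (snd e))"

text \<open>
  An arrow of the orbit category moves points by \<open>push\<close>, and arrows out of an object correspond to the
  points above any given coset of it. So a string of arrows out of the trivial subgroup is the same
  as a chain of points starting in \<open>x0\<close>, and the free orbit of \<open>x0\<close> makes equivariant cochains determined on these.
\<close>

definition x0 where "x0 = ({\<one>}, {\<one>})"
definition above where "above = {e : pts. fst e ~= {\<one>}}"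

lemma orbit_Obj: "P : Obj C <-> subgroup P \<Gamma> & P \<subseteq> T"
 by (simp add: orbit_category_def subgroups_of_def)

lemma pts_iff: "e : pts <-> fst e : Obj C & snd e : lcosets (fst e)"
 unfolding orbit_Obj pts_def LCOSETS_def by (cases e) auto

lemma arrowD:
 assumes "a : arrows C" shows "src a : Obj C" "tgt a : Obj C" "mor a : lcosets (src a) \<rightarrow>\<^sub>E lcosets (tgt a)"
  "g : els ==> B : lcosets (src a) ==> mor a (g <# B) = g <# mor a B"
 using arrowsD[OF assms] by (simp_all add: orbit_category_def)

lemma fst_push [simp]: "fst (push a e) = tgt a"
 by (simp add: push_def)

lemma push_pts: assumes "a : arrows C" "e : pts" "fst e = src a" shows "push a e : pts"
 using arrowD(2,3)[OF assms(1)] assms(2,3) by (auto simp: pts_iff push_def)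

lemma push_mv: assumes "a : arrows C" "e : pts" "fst e = src a" "g : els" shows "push a (mv g e) = mv g (push a e)"
 using arrowD(4)[OF assms(1,4), of "snd e"] assms(2,3) by (simp add: pts_iff push_def mv_def)

lemma sle_push: assumes "a : arrows C" "e : pts" "fst e = src a" shows "sle e (push a e)"
 unfolding sle_def
proof
 fix g assume g: "g : stab e"
 hence "g : els" using stab_carrier by blast
 hence "push a (mv g e) = mv g (push a e)" by (rule push_mv[OF assms])
 hence "mv g (push a e) = push a e" unfolding stab_fix[OF g] by (rule sym)
 thus "g : stab (push a e)" using \<open>g : els\<close> by (simp add: stab_def mv_def prod_eq_iff)
qed

lemma push_comp:
 assumes "a : arrows C" "b : arrows C" "tgt a = src b" "e : pts" "fst e = src a"
 shows "push (arrow_comp C b a) e = push b (push a e)"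
 using assms(3-5) by (simp add: push_def arrow_comp_def orbit_category_def compose_def pts_iff)

lemma x0_pts: "x0 : pts" and mv_x0: "g : els ==> mv g x0 = ({\<one>}, g <# {\<one>})" and fst_x0 [simp]: "fst x0 = {\<one>}"
proof -
 have "({\<one>}, \<one> <# {\<one>}) : pts" by (rule ptsI) (use triv_subgroup subgroup.one_closed[OF T] in auto)
 thus "x0 : pts" by (simp add: x0_def l_coset_def)
 show "g : els ==> mv g x0 = ({\<one>}, g <# {\<one>})" "fst x0 = {\<one>}" by (simp_all add: mv_def x0_def)
qed

lemma free_orbit: assumes "e : pts" "fst e = {\<one>}" shows "EX g:els. e = mv g x0"
 using assms by (elim ptsE) (auto simp: mv_x0)

lemma mv_x0_inj: assumes "g : els" "h : els" "mv g x0 = mv h x0" shows "g = h"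
 using assms by (simp add: mv_x0 l_coset_def)

lemma translates:
 assumes "B : lcosets P" "B' : lcosets P" "subgroup P \<Gamma>" shows "EX g:els. B' = g <# B"
proof -
 from assms obtain a b where ab: "a : els" "b : els" "B = a <# P" "B' = b <# P" by (auto simp: LCOSETS_def)
 have "B' = (b \<otimes> inv a) <# B" using ab by (simp add: lcos_m_assoc subgroup.subset[OF assms(3)] m_assoc)
 thus ?thesis using ab by blast
qed

lemma arrow_unique:
 assumes "a : arrows C" "a' : arrows C" "e : pts" "fst e = src a" "src a' = src a" "push a e = push a' e"
 shows "a' = a"
proof -
 have t: "tgt a' = tgt a" "mor a' (snd e) = mor a (snd e)" using assms(6) by (simp_all add: push_def)
 have sb: "subgroup (src a) \<Gamma>" and se: "snd e : lcosets (src a)" using assms(3,4) by (simp_all add: pts_iff orbit_Obj)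
 have "mor a' = mor a"
 proof (rule PiE_ext)
  show "mor a : lcosets (src a) \<rightarrow>\<^sub>E lcosets (tgt a)" "mor a' : lcosets (src a) \<rightarrow>\<^sub>E lcosets (tgt a)"
   using arrowD(3)[OF assms(1)] arrowD(3)[OF assms(2)] t assms(5) by simp_all
  fix B assume "B : lcosets (src a)"
  from translates[OF se this sb] obtain g where g: "g : els" "B = g <# snd e" by blast
  thus "mor a' B = mor a B" using arrowD(4)[OF assms(1) g(1)] arrowD(4)[OF assms(2) g(1)] se t assms(5) by simp
 qed
 thus ?thesis using t assms(5) by (cases a; cases a') simp
qed

lemma arrow_exists:
 assumes "ch2 pts e e'" shows "EX a:arrows C. src a = fst e & push a e = e'"
proof -
 have e: "e : pts" "e' : pts" "sle e e'" using assms by (auto simp: ch2_def)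
 obtain P B where PB: "e = (P, B)" by (cases e)
 obtain Q B' where QB: "e' = (Q, B')" by (cases e')
 have P: "P : Obj C" "B : lcosets P" "subgroup P \<Gamma>" and Q: "Q : Obj C" "B' : lcosets Q" "subgroup Q \<Gamma>"
  using e(1,2) unfolding PB QB by (simp_all add: pts_iff orbit_Obj)
 have wd: "g <# B' = h <# B'" if "g : els" "h : els" "g <# B = h <# B" for g h
 proof -
  have "mv g e = mv h e" using that by (simp add: mv_def PB)
  hence "mv (inv h \<otimes> g) e = e" using e(1) that by (simp add: mv_mult mv_inv)
  hence "inv h \<otimes> g : stab e" using that by (simp add: stab_def mv_def PB)
  hence "inv h \<otimes> g : stab e'" using e(3) unfolding sle_def by (rule subsetD[rotated])
  hence "mv (inv h \<otimes> g) e' = e'" by (rule stab_fix)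
  hence "mv h (mv (inv h) (mv g e')) = mv h e'" using e(2) that by (simp add: mv_mult)
  hence "mv g e' = mv h e'" using that e(2) by (simp add: mv_inv mv_pts)
  thus ?thesis by (simp add: mv_def QB)
 qed
 define s where "s Z = (SOME g. g : els & Z = g <# B)" for Z
 have s: "s Z : els" "s Z <# B = Z" if "Z : lcosets P" for Z
  using someI_ex[of "%g. g : els & Z = g <# B"] translates[OF P(2) that P(3)] unfolding s_def by blast+
 define \<phi> where "\<phi> = (\<lambda>Z\<in>lcosets P. s Z <# B')"
 have cl: "g <# Z : lcosets R" if "Z : lcosets R" "g : els" "subgroup R \<Gamma>" for g Z R
  using that by (auto simp: LCOSETS_def lcos_m_assoc subgroup.subset)
 have ass: "g <# (h <# Z) = (g \<otimes> h) <# Z" if "Z : lcosets R" "g : els" "h : els" "subgroup R \<Gamma>" for g h Z R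
  using that by (auto simp: LCOSETS_def lcos_m_assoc subgroup.subset m_assoc)
 have \<phi>: "\<phi> (g <# B) = g <# B'" if "g : els" for g
 proof -
  note gB = cl[OF P(2) that P(3)]
  show ?thesis unfolding \<phi>_def restrict_apply'[OF gB] by (rule wd[OF s(1)[OF gB] that s(2)[OF gB]])
 qed
 have "\<phi> : Mor C P Q"
  unfolding orbit_category_def
 proof (simp, intro conjI ballI)
  show "\<phi> : lcosets P \<rightarrow>\<^sub>E lcosets Q" using cl[OF Q(2) s(1) Q(3)] by (auto simp: \<phi>_def)
  fix g Z assume g: "g : els" and Z: "Z : lcosets P"
  have "\<phi> (g <# Z) = \<phi> ((g \<otimes> s Z) <# B)" using s[OF Z] ass[OF P(2) g s(1)[OF Z] P(3)] by simp
  also have "... = g <# (s Z <# B')" using \<phi>[of "g \<otimes> s Z"] g s(1)[OF Z] ass[OF Q(2) g s(1)[OF Z] Q(3)] by simp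
  also have "... = g <# \<phi> Z" using Z by (simp add: \<phi>_def)
  finally show "\<phi> (g <# Z) = g <# \<phi> Z" .
 qed
 hence "(P, \<phi>, Q) : arrows C" using P Q by (simp add: arrows_def)
 moreover have "\<phi> B = B'"
 proof -
  have "\<one> <# B = B" "\<one> <# B' = B'" using mv_one[OF e(1)] mv_one[OF e(2)] by (simp_all add: mv_def PB QB)
  thus ?thesis using \<phi>[OF one_closed] by simp
 qed
 ultimately show ?thesis by (intro bexI[of _ "(P, \<phi>, Q)"]) (simp_all add: push_def PB QB)
qed

definition arr where "arr e e' = (SOME a. a : arrows C & src a = fst e & push a e = e')"

lemma arr:
 assumes "ch2 pts e e'" shows "arr e e' : arrows C" "src (arr e e') = fst e" "push (arr e e') e = e'" "tgt (arr e e') = fst e'"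
proof -
 have "EX a. a : arrows C & src a = fst e & push a e = e'" using arrow_exists[OF assms] by blast
 from someI_ex[OF this] show 1: "arr e e' : arrows C" "src (arr e e') = fst e" "push (arr e e') e = e'" unfolding arr_def by blast+
 show "tgt (arr e e') = fst e'" using arg_cong[OF 1(3), of fst] by simp
qed

lemma arr_push: assumes "a : arrows C" "e : pts" "fst e = src a" shows "arr e (push a e) = a"
proof -
 have c: "ch2 pts e (push a e)" using assms push_pts[OF assms] sle_push[OF assms] by (simp add: ch2_def)
 show ?thesis by (rule arrow_unique[OF assms(1) arr(1)[OF c] assms(2,3)]) (use arr[OF c] assms in simp_all)
qed

lemma arr_mv: assumes "ch2 pts e e'" "g : els" shows "arr (mv g e) (mv g e') = arr e e'"
proof -
 have p: "e : pts" using assms by (simp add: ch2_def)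
 have "push (arr e e') (mv g e) = mv g e'" using push_mv[OF arr(1)[OF assms(1)] p _ assms(2)] arr[OF assms(1)] by simp
 thus ?thesis using arr_push[OF arr(1)[OF assms(1)] mv_pts[OF assms(2) p]] arr(2)[OF assms(1)] by (simp add: mv_def)
qed

lemma ch_push:
 assumes "e : pts" "fst e = src a"
 shows "a : arrows C ==> ch2 pts e (push a e)"
  "AR.comp2 a b ==> ch3 pts e (push a e) (push b (push a e))"
  "AR.comp3 a b f ==> ch4 pts e (push a e) (push b (push a e)) (push f (push b (push a e)))"
  "AR.comp4 a b f h ==> ch5 pts e (push a e) (push b (push a e)) (push f (push b (push a e))) (push h (push f (push b (push a e))))"
proof -
 have 1: "ch2 pts e (push a e)" if "a : arrows C" "e : pts" "fst e = src a" for a e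
  using that push_pts[OF that] sle_push[OF that] by (simp add: ch2_def)
 have p: "push a e : pts" if "a : arrows C" using push_pts[OF that assms] .
 show "a : arrows C ==> ch2 pts e (push a e)" using 1 assms by simp
 show 2: "AR.comp2 a b ==> ch3 pts e (push a e) (push b (push a e))"
  using 1[of a e] 1[of b "push a e"] assms p by (simp add: ch3_def AR.comps)
 have p2: "push b (push a e) : pts" if "AR.comp2 a b" using push_pts[of b "push a e"] p that by (simp add: AR.comps)
 show 3: "AR.comp3 a b f ==> ch4 pts e (push a e) (push b (push a e)) (push f (push b (push a e)))"
  using 2 1[of f "push b (push a e)"] p2 by (simp add: ch4_def AR.comps)
 have p3: "push f (push b (push a e)) : pts" if "AR.comp3 a b f" using push_pts[of f "push b (push a e)"] p2 that by (simp add: AR.comps)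
 show "AR.comp4 a b f h ==> ch5 pts e (push a e) (push b (push a e)) (push f (push b (push a e))) (push h (push f (push b (push a e))))"
  using 3 1[of h "push f (push b (push a e))"] p3 by (simp add: ch5_def AR.comps)
qed

lemma above_up: "up_family above"
 unfolding up_family_def
proof (intro conjI ballI impI)
 show "above \<subseteq> pts" by (auto simp: above_def)
 show "mv g e : above" if "g : els" "e : above" for g e using that by (simp add: above_def mv_pts) (simp add: mv_def)
 fix e e' assume e: "e : above" "e' : pts" "sle e e'"
 have ep: "e : pts" "fst e ~= {\<one>}" using e(1) by (auto simp: above_def)
 show "e' : above"
 proof (rule ccontr)
  assume "e' ~: above"
  hence "fst e' = {\<one>}" using e(2) by (simp add: above_def)
  then obtain g where g: "g : els" "e' = mv g x0" using free_orbit[OF e(2)] by blast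
  from ep(1) obtain P a where P: "subgroup P \<Gamma>" "P \<subseteq> T" "a : els" "e = (P, a <# P)" by (rule ptsE)
  have "x = \<one>" if x: "x : P" for x
  proof -
   have xc: "x : els" using x subgroup.subset[OF P(1)] by blast
   have "inv a \<otimes> (a \<otimes> x \<otimes> inv a) \<otimes> a = x" using xc P(3) by (simp add: m_assoc) (simp add: m_assoc [symmetric])
   hence "a \<otimes> x \<otimes> inv a : stab e" unfolding P(4) using stab_pt[OF P(1,3), of "a \<otimes> x \<otimes> inv a"] xc P(3) x by simp
   hence "a \<otimes> x \<otimes> inv a : stab e'" using e(3) unfolding sle_def by (rule subsetD[rotated])
   hence "mv (a \<otimes> x \<otimes> inv a) e' = e'" by (rule stab_fix)
   hence "mv (a \<otimes> x \<otimes> inv a \<otimes> g) x0 = mv g x0" unfolding g(2) using xc P(3) g(1) by (simp add: mv_mult x0_pts)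
   hence "a \<otimes> x \<otimes> inv a \<otimes> g = g" using mv_x0_inj xc P(3) g(1) by simp
   hence "a \<otimes> x \<otimes> inv a = \<one>" using xc P(3) g(1) by simp
   hence "inv a \<otimes> (a \<otimes> x \<otimes> inv a) \<otimes> a = \<one>" using P(3) by simp
   thus ?thesis using \<open>inv a \<otimes> (a \<otimes> x \<otimes> inv a) \<otimes> a = x\<close> by simp
  qed
  hence "P \<subseteq> {\<one>}" by blast
  hence "P = {\<one>}" using subgroup.one_closed[OF P(1)] by blast
  thus False using ep(2) P(4) by simp
 qed
qed

lemma kp_zero: "kp 0 = 0"
 using kp_add[OF Acl(1) Acl(1)] by simp

lemma kp_diff: assumes "u : A" "v : A" shows "kp (u - v) = kp u - kp v"
 using kp_add[of "u - v" v] assms Acl by simp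

lemma kp_eq_iff: "u : A ==> v : A ==> kp u = kp v <-> u = v"
 using kp_inj by (auto dest: inj_onD)

lemma kp_closed: "u : A ==> kp u : X 0 {\<one>}" "u : A ==> d 0 {\<one>} (kp u) = 0"
 using kp_image by blast+

lemma kp_surj: "u : X 0 {\<one>} ==> d 0 {\<one>} u = 0 ==> EX v:A. u = kp v"
 using kp_image by blast

text \<open>
  \<open>Bn\<close> evaluates a relative equivariant cochain on the chain of a string of arrows, and \<open>cochn\<close> is the inverse:
  translate the chain so that it starts in \<open>x0\<close>, evaluate, and act back by the offset.
\<close>

definition B2 where "B2 c a b = (if src a = {\<one>} then kp (c x0 (push a x0) (push b (push a x0))) else 0)"
definition B3 where "B3 c a b f = (if src a = {\<one>} then kp (c x0 (push a x0) (push b (push a x0)) (push f (push b (push a x0)))) else 0)"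

definition offset where "offset e = (SOME g. g : els & e = mv g x0)"

lemma offset: assumes "e : pts" "fst e = {\<one>}" shows "offset e : els" "mv (offset e) x0 = e"
proof -
 have "EX g. g : els & e = mv g x0" using free_orbit[OF assms] by blast
 from someI_ex[OF this] have "offset e : els & e = mv (offset e) x0" unfolding offset_def .
 thus "offset e : els" "mv (offset e) x0 = e" by simp_all
qed

lemma offset_mv: assumes "e : pts" "fst e = {\<one>}" "g : els" shows "offset (mv g e) = g \<otimes> offset e"
proof (rule mv_x0_inj)
 have "mv g e : pts" by (rule mv_pts[OF assms(3,1)])
 moreover have "fst (mv g e) = {\<one>}" using assms(2) by (simp add: mv_def)
 ultimately
 have o: "offset (mv g e) : els" "mv (offset (mv g e)) x0 = mv g e" by (rule offset)+
 show "offset (mv g e) : els" by (rule o(1))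
 show "g \<otimes> offset e : els" using assms offset(1) by simp
 show "mv (offset (mv g e)) x0 = mv (g \<otimes> offset e) x0"
  using o(2) offset[OF assms(1,2)] assms(3) by (simp add: mv_mult x0_pts)
qed

definition coch2 where "coch2 b e0 e1 e2 = (if fst e0 = {\<one>} then act (offset e0) (inv_into A kp (b (arr e0 e1) (arr e1 e2))) else 0)"
definition coch3 where "coch3 b e0 e1 e2 e3 = (if fst e0 = {\<one>} then act (offset e0) (inv_into A kp (b (arr e0 e1) (arr e1 e2) (arr e2 e3))) else 0)"

text \<open>
  The two sides of the comparison: bar cochains with values in the kernel of \<open>d 0\<close>, which is the functor
  itself, and equivariant cochains that vanish on chains starting at a nontrivial subgroup.
\<close>

definition "cyc2 b <-> AR.C2 0 b & (ALL a a'. AR.comp2 a a' --> d 0 (src a) (b a a') = 0)"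
definition "cyc3 b <-> AR.C3 0 b & (ALL a a' f. AR.comp3 a a' f --> d 0 (src a) (b a a' f) = 0)"
definition "van2 c <-> K2 pts c & (ALL e0 e1 e2. ch3 pts e0 e1 e2 --> e0 : above --> c e0 e1 e2 = 0)"
definition "van3 c <-> K3 pts c & (ALL e0 e1 e2 e3. ch4 pts e0 e1 e2 e3 --> e0 : above --> c e0 e1 e2 e3 = 0)"

lemma next_arrow: "AR.comp2 a b ==> EX f. AR.comp3 a b f" "AR.comp3 a b f ==> EX h. AR.comp4 a b f h"
proof -
 have "EX f:arrows C. src f = P" if "P : Obj C" for P
 proof -
  have sb: "subgroup P \<Gamma>" "P \<subseteq> T" using that by (auto simp: orbit_Obj)
  have "ch2 pts (P, \<one> <# P) (P, \<one> <# P)" using ptsI[OF sb one_closed] by (simp add: ch2_def sle_def)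
  from arr[OF this] show ?thesis by auto
 qed
 thus "AR.comp2 a b ==> EX f. AR.comp3 a b f" "AR.comp3 a b f ==> EX h. AR.comp4 a b f h"
  using AR.ar(2) unfolding AR.comps by metis+
qed

lemma ext_cochain:
 "cyc2 b ==> cyc3 (%a a' f. b a a')" "van2 c ==> van3 (%e0 e1 e2 e3. c e0 e1 e2)"
 "B3 (%e0 e1 e2 e3. c e0 e1 e2) a a' f = B2 c a a'" "coch3 (%a a' f. b a a') e0 e1 e2 e3 = coch2 b e0 e1 e2"
 by (auto simp: cyc2_def cyc3_def AR.C2_def AR.C3_def AR.comp3_def van2_def van3_def K2_def K3_def ch4_def B2_def B3_def coch2_def coch3_def)

lemma cyc_values:
 shows "cyc2 b2 ==> AR.comp2 a a' ==> if src a = {\<one>} then EX v:A. b2 a a' = kp v else b2 a a' = 0"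
  and "cyc3 b3 ==> AR.comp3 a a' f ==> if src a = {\<one>} then EX v:A. b3 a a' f = kp v else b3 a a' f = 0"
proof -
 have v: "if P = {\<one>} then EX v:A. u = kp v else u = 0" if "P : Obj C" "u : X 0 P" "d 0 P u = 0" for P u
  using kp_surj[of u] trivial_elsewhere[OF that(1) _ that(2,3)] that by (cases "P = {\<one>}") simp_all
 show 3: "cyc3 b3 ==> AR.comp3 a a' f ==> if src a = {\<one>} then EX v:A. b3 a a' f = kp v else b3 a a' f = 0" for b3 f
  by (rule v) (auto simp: cyc3_def AR.C3_def AR.comps intro: AR.ar)
 show "cyc2 b2 ==> AR.comp2 a a' ==> if src a = {\<one>} then EX v:A. b2 a a' = kp v else b2 a a' = 0"
  using next_arrow(1)[of a a'] 3[OF ext_cochain(1)] by blast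
qed

lemma B_cyc: "van2 c2 ==> cyc2 (B2 c2)" "van3 c3 ==> cyc3 (B3 c3)"
proof -
 have 0: "P : Obj C ==> 0 : X 0 P & d 0 P 0 = 0" for P using AR.Xcl(1) AR.d_zero by simp
 show 3: "cyc3 (B3 c3)" if c: "van3 c3" for c3
 proof -
  have "B3 c3 a b f : X 0 (src a) & d 0 (src a) (B3 c3 a b f) = 0" if ab: "AR.comp3 a b f" for a b f
  proof (cases "src a = {\<one>}")
   case True
   have "c3 x0 (push a x0) (push b (push a x0)) (push f (push b (push a x0))) : A"
    using K3D(1)[OF _ ch_push(3)[OF x0_pts _ ab]] c True by (simp add: van3_def)
   thus ?thesis using True kp_closed by (simp add: B3_def)
  qed (use 0[of "src a"] ab in \<open>simp add: B3_def AR.comps AR.ar\<close>)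
  thus ?thesis by (simp add: cyc3_def AR.C3_def)
 qed
 show "cyc2 (B2 c2)" if "van2 c2"
  using 3[OF ext_cochain(2)[OF that]] next_arrow(1) unfolding cyc2_def cyc3_def AR.C2_def AR.C3_def ext_cochain(3) by blast
qed

text \<open>The value on the first face, which the bar differential transports along the first arrow.\<close>

lemma \<rho>_B3:
 assumes c: "van3 c" and ab: "AR.comp4 a b f h" and a: "src a = {\<one>}"
 shows "\<rho> 0 a (B3 c b f h) = kp (c (push a x0) (push b (push a x0)) (push f (push b (push a x0))) (push h (push f (push b (push a x0)))))"
proof -
 have ar: "a : arrows C" "b : arrows C" "f : arrows C" "tgt a = src b" "tgt b = src f" "h : arrows C" "tgt f = src h"
  using ab by (auto simp: AR.comps)
 have p: "push a x0 : pts" using push_pts[OF ar(1) x0_pts] a by simp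
 have bf: "AR.comp3 b f h" using ab by (simp add: AR.comps)
 show ?thesis
 proof (cases "src b = {\<one>}")
  case True
  obtain g where g: "g : els" "push a x0 = mv g x0" using free_orbit[OF p] ar(4) True by auto
  have ch: "ch4 pts x0 (push b x0) (push f (push b x0)) (push h (push f (push b x0)))" using ch_push(3)[OF x0_pts _ bf] True by simp
  have u: "c x0 (push b x0) (push f (push b x0)) (push h (push f (push b x0))) : A" using K3D(1)[OF _ ch] c by (auto simp: van3_def)
  have "mor a {\<one>} = g <# {\<one>}" using g by (simp add: push_def x0_def mv_def)
  hence "\<rho> 0 a (B3 c b f h) = kp (act g (c x0 (push b x0) (push f (push b x0)) (push h (push f (push b x0)))))"
   using kp_nat[OF ar(1) a _ g(1) _ u] ar(4) True by (simp add: B3_def)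
  also have "act g (c x0 (push b x0) (push f (push b x0)) (push h (push f (push b x0)))) =
    c (mv g x0) (mv g (push b x0)) (mv g (push f (push b x0))) (mv g (push h (push f (push b x0))))"
   using K3D(2)[OF _ ch g(1)] c by (simp add: van3_def)
  also have "mv g (push h (push f (push b x0))) = push h (mv g (push f (push b x0)))"
   using push_mv[OF ar(6) push_pts[OF ar(3) push_pts[OF ar(2) x0_pts]] _ g(1)] True ar(5,7) by simp
  also have "mv g (push f (push b x0)) = push f (mv g (push b x0))"
   using push_mv[OF ar(3) push_pts[OF ar(2) x0_pts] _ g(1)] True ar(5) by simp
  also have "mv g (push b x0) = push b (mv g x0)" using push_mv[OF ar(2) x0_pts _ g(1)] True by simp
  finally show ?thesis using g(2) by simp
 next
  case False
  have "push a x0 : above" using p False ar(4) by (simp add: above_def)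
  moreover have "ch4 pts (push a x0) (push b (push a x0)) (push f (push b (push a x0))) (push h (push f (push b (push a x0))))"
   using ch_push(3)[OF p _ bf] ar(4) by simp
  ultimately show ?thesis using c False by (simp add: van3_def B3_def kp_zero AR.\<rho>_zero[OF ar(1)])
 qed
qed

lemma \<rho>_B2:
 assumes c: "van2 c" and ab: "AR.comp3 a b f" and a: "src a = {\<one>}"
 shows "\<rho> 0 a (B2 c b f) = kp (c (push a x0) (push b (push a x0)) (push f (push b (push a x0))))"
proof -
 obtain h where h: "AR.comp4 a b f h" using next_arrow(2)[OF ab] by blast
 show ?thesis using \<rho>_B3[OF ext_cochain(2)[OF c] h a] by (simp add: ext_cochain(3))
qed

lemma dt_B2:
 assumes c: "van2 c" and ab: "AR.comp3 a b f" and a: "src a = {\<one>}"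
 shows "AR.dt2 0 (B2 c) a b f = kp (D2 c x0 (push a x0) (push b (push a x0)) (push f (push b (push a x0))))"
proof -
 have ar: "a : arrows C" "b : arrows C" "f : arrows C" "tgt a = src b" "tgt b = src f" using ab by (auto simp: AR.comps)
 have K: "K2 pts c" using c by (simp add: van2_def)
 have p: "push a x0 : pts" using push_pts[OF ar(1) x0_pts] a by simp
 have s: "src (arrow_comp C b a) = {\<one>}" using a by (simp add: arrow_comp_def)
 have pc: "push (arrow_comp C b a) x0 = push b (push a x0)" using push_comp[OF ar(1,2,4) x0_pts] a by simp
 have pc2: "push (arrow_comp C f b) (push a x0) = push f (push b (push a x0))" using push_comp[OF ar(2,3,5) p] ar(4) by simp
 note fc = faces4[OF ch_push(3)[OF x0_pts _ ab]]
 have A4: "c (push a x0) (push b (push a x0)) (push f (push b (push a x0))) : A" "c x0 (push b (push a x0)) (push f (push b (push a x0))) : A"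
  "c x0 (push a x0) (push f (push b (push a x0))) : A" "c x0 (push a x0) (push b (push a x0)) : A"
  using fc K2D(1)[OF K] a by auto
 show ?thesis
  unfolding AR.dt2_def \<rho>_B2[OF assms] D2_def using A4 Acl by (simp add: B2_def s a pc pc2 kp_add kp_diff)
qed

lemma dt_B3:
 assumes c: "van3 c" and ab: "AR.comp4 a b f h" and a: "src a = {\<one>}"
 shows "AR.dt3 0 (B3 c) a b f h = kp (D3 c x0 (push a x0) (push b (push a x0)) (push f (push b (push a x0))) (push h (push f (push b (push a x0)))))"
proof -
 have ar: "a : arrows C" "b : arrows C" "f : arrows C" "tgt a = src b" "tgt b = src f" "h : arrows C" "tgt f = src h"
  using ab by (auto simp: AR.comps)
 have K: "K3 pts c" using c by (simp add: van3_def)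
 have p: "push a x0 : pts" using push_pts[OF ar(1) x0_pts] a by simp
 have p2: "push b (push a x0) : pts" using push_pts[OF ar(2) p] ar(4) by simp
 have s: "src (arrow_comp C b a) = {\<one>}" using a by (simp add: arrow_comp_def)
 have pc: "push (arrow_comp C b a) x0 = push b (push a x0)" using push_comp[OF ar(1,2,4) x0_pts] a by simp
 have pc2: "push (arrow_comp C f b) (push a x0) = push f (push b (push a x0))" using push_comp[OF ar(2,3,5) p] ar(4) by simp
 have pc3: "push (arrow_comp C h f) (push b (push a x0)) = push h (push f (push b (push a x0)))" using push_comp[OF ar(3,6,7) p2] ar(5) by simp
 note fc = faces5[OF ch_push(4)[OF x0_pts _ ab]]
 let ?e1 = "push a x0" and ?e2 = "push b (push a x0)" and ?e3 = "push f (push b (push a x0))" and ?e4 = "push h (push f (push b (push a x0)))"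
 have A4: "c ?e1 ?e2 ?e3 ?e4 : A" "c x0 ?e2 ?e3 ?e4 : A" "c x0 ?e1 ?e3 ?e4 : A" "c x0 ?e1 ?e2 ?e4 : A" "c x0 ?e1 ?e2 ?e3 : A"
  using fc K3D(1)[OF K] a by auto
 show ?thesis
  unfolding AR.dt3_def \<rho>_B3[OF assms] D3_def using A4 Acl by (simp add: B3_def s a pc pc2 pc3 kp_add kp_diff)
qed

lemma inv_kp: "u : A ==> inv_into A kp (kp u) = u"
 using kp_inj by simp

lemma comp_arr:
 shows "ch3 pts e0 e1 e2 ==> AR.comp2 (arr e0 e1) (arr e1 e2)"
  and "ch4 pts e0 e1 e2 e3 ==> AR.comp3 (arr e0 e1) (arr e1 e2) (arr e2 e3)"
  and "ch5 pts e0 e1 e2 e3 e4 ==> AR.comp4 (arr e0 e1) (arr e1 e2) (arr e2 e3) (arr e3 e4)"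
 by (simp_all add: ch3_def ch4_def ch5_def AR.comps arr)

lemma coch_van: "cyc2 b2 ==> van2 (coch2 b2)" "cyc3 b3 ==> van3 (coch3 b3)"
proof -
 show 3: "van3 (coch3 b3)" if b: "cyc3 b3" for b3
  unfolding van3_def K3_def
 proof (intro conjI allI impI ballI)
  fix e0 e1 e2 e3 assume ch: "ch4 pts e0 e1 e2 e3"
  have e0: "e0 : pts" and c2: "ch2 pts e0 e1" "ch2 pts e1 e2" "ch2 pts e2 e3" using ch by (auto simp: chs)
  have v: "fst e0 = {\<one>} ==> inv_into A kp (b3 (arr e0 e1) (arr e1 e2) (arr e2 e3)) : A"
   using cyc_values(2)[OF b comp_arr(2)[OF ch]] arr(2)[OF c2(1)] by (auto simp: inv_kp)
  show "coch3 b3 e0 e1 e2 e3 : A" using v offset(1)[OF e0] by (simp add: coch3_def Acl act_closed)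
  show "coch3 b3 (mv g e0) (mv g e1) (mv g e2) (mv g e3) = act g (coch3 b3 e0 e1 e2 e3)" if g: "g : els" for g
  proof (cases "fst e0 = {\<one>}")
   case True
   thus ?thesis using v offset(1)[OF e0 True] offset_mv[OF e0 True g] g arr_mv[OF c2(1) g] arr_mv[OF c2(2) g] arr_mv[OF c2(3) g]
    by (simp add: coch3_def act_mult) (simp add: mv_def)
  qed (simp add: coch3_def mv_def act_zero[OF g])
  show "coch3 b3 e0 e1 e2 e3 = 0" if "e0 : above" using that by (simp add: coch3_def above_def)
 qed
 show "van2 (coch2 b2)" if "cyc2 b2"
 proof -
  have "ch4 pts e0 e1 e2 e2" if "ch3 pts e0 e1 e2" for e0 e1 e2 using that by (simp add: chs sle_def)
  thus ?thesis using 3[OF ext_cochain(1)[OF that]] unfolding van2_def van3_def K2_def K3_def ext_cochain(4) by blast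
 qed
qed

lemma offset_x0: "offset x0 = \<one>"
 by (rule mv_x0_inj) (use offset[OF x0_pts] mv_one[OF x0_pts] in simp_all)

lemma B_coch:
 shows "cyc2 b2 ==> AR.comp2 a a' ==> B2 (coch2 b2) a a' = b2 a a'"
  and "cyc3 b3 ==> AR.comp3 a a' f ==> B3 (coch3 b3) a a' f = b3 a a' f"
proof -
 show 3: "B3 (coch3 b3) a a' f = b3 a a' f" if b: "cyc3 b3" and ab: "AR.comp3 a a' f" for b3 f
 proof (cases "src a = {\<one>}")
  case True
  have ar: "a : arrows C" "a' : arrows C" "tgt a = src a'" "f : arrows C" "tgt a' = src f" using ab by (auto simp: AR.comps)
  have p: "push a x0 : pts" using push_pts[OF ar(1) x0_pts] True by simp
  have p2: "push a' (push a x0) : pts" using push_pts[OF ar(2) p] ar(3) by simp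
  obtain v where v: "v : A" "b3 a a' f = kp v" using cyc_values(2)[OF b ab] True by auto
  show ?thesis using True v arr_push[OF ar(1) x0_pts] arr_push[OF ar(2) p] arr_push[OF ar(4) p2] ar(3,5)
   by (simp add: B3_def coch3_def offset_x0 inv_kp act_one)
 qed (use cyc_values(2)[OF b ab] in \<open>simp add: B3_def\<close>)
 show "B2 (coch2 b2) a a' = b2 a a'" if b: "cyc2 b2" and ab: "AR.comp2 a a'"
 proof -
  obtain f where f: "AR.comp3 a a' f" using next_arrow(1)[OF ab] by blast
  show ?thesis using 3[OF ext_cochain(1)[OF b] f] by (cases "src a = {\<one>}") (simp_all add: B2_def B3_def ext_cochain(4))
 qed
qed

lemma D_van:
 shows "van2 c2 ==> ch4 pts e0 e1 e2 e3 ==> g : els ==> D2 c2 (mv g e0) (mv g e1) (mv g e2) (mv g e3) = act g (D2 c2 e0 e1 e2 e3)"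
  and "van3 c3 ==> ch5 pts e0 e1 e2 e3 e4 ==> g : els ==>
   D3 c3 (mv g e0) (mv g e1) (mv g e2) (mv g e3) (mv g e4) = act g (D3 c3 e0 e1 e2 e3 e4)"
  and "van2 c2 ==> ch4 pts e0 e1 e2 e3 ==> e0 : above ==> D2 c2 e0 e1 e2 e3 = 0"
  and "van3 c3 ==> ch5 pts e0 e1 e2 e3 e4 ==> e0 : above ==> D3 c3 e0 e1 e2 e3 e4 = 0"
proof -
 have up: "e' : above" if "ch2 pts e e'" "e : above" for e e'
  using up_familyD(4)[OF above_up that(2)] that(1) by (auto simp: ch2_def)
 show "D2 c2 (mv g e0) (mv g e1) (mv g e2) (mv g e3) = act g (D2 c2 e0 e1 e2 e3)" if "van2 c2" "ch4 pts e0 e1 e2 e3" "g : els"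
 proof -
  have K: "K2 pts c2" using that by (simp add: van2_def)
  show ?thesis using faces4[OF that(2)] K2D[OF K] that(3) Acl by (simp add: D2_def act_diff act_add)
 qed
 show "D3 c3 (mv g e0) (mv g e1) (mv g e2) (mv g e3) (mv g e4) = act g (D3 c3 e0 e1 e2 e3 e4)"
  if "van3 c3" "ch5 pts e0 e1 e2 e3 e4" "g : els"
 proof -
  have K: "K3 pts c3" using that by (simp add: van3_def)
  show ?thesis using faces5[OF that(2)] K3D[OF K] that(3) Acl by (simp add: D3_def act_diff act_add)
 qed
 show "D2 c2 e0 e1 e2 e3 = 0" if "van2 c2" "ch4 pts e0 e1 e2 e3" "e0 : above"
  using faces4[OF that(2)] that up[of e0 e1] by (simp add: D2_def van2_def chs)
 show "D3 c3 e0 e1 e2 e3 e4 = 0" if "van3 c3" "ch5 pts e0 e1 e2 e3 e4" "e0 : above"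
  using faces5[OF that(2)] that up[of e0 e1] by (simp add: D3_def van3_def chs)
qed

text \<open>
  The bijections above commute with the differentials. On strings that start at a nontrivial subgroup
  both sides vanish, as the kernel of \<open>d 0\<close> is zero there.
\<close>

theorem atomic_bar_corr: "corr (FZ3 above) (FE3 above) (AR.Z3 0) (AR.E3 0)"
proof (rule corrI[where R = "%c b. ALL a a' f. AR.comp3 a a' f --> B3 c a a' f = b a a' f"])
 have Z: "b : AR.Z3 0 <-> cyc3 b & (ALL a a' f h. AR.comp4 a a' f h --> AR.dt3 0 b a a' f h = 0)" for b
  by (auto simp: AR.Z3_def cyc3_def)
 have FZ: "c : FZ3 above <-> van3 c & (ALL e0 e1 e2 e3 e4. ch5 pts e0 e1 e2 e3 e4 --> D3 c e0 e1 e2 e3 e4 = 0)" for c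
  by (auto simp: FZ3_def van3_def)
 have diff3: "AR.dt3 0 b a a' f h = AR.dt3 0 b' a a' f h"
  if "AR.comp4 a a' f h" "!!a a' f. AR.comp3 a a' f ==> b a a' f = b' a a' f" for b b' :: "_ => _ => _ => 'u" and a a' f h
  unfolding AR.dt3_def using that by (simp add: AR.comps AR.cmp)
 have diff2: "AR.dt2 0 b a a' f = AR.dt2 0 b' a a' f"
  if "AR.comp3 a a' f" "!!a a'. AR.comp2 a a' ==> b a a' = b' a a'" for b b' :: "_ => _ => 'u" and a a' f
  unfolding AR.dt2_def using that by (simp add: AR.comps AR.cmp)
 have el: "AR.dt3 0 b a a' f h = 0" if b: "cyc3 b" and ab: "AR.comp4 a a' f h" and a: "src a ~= {\<one>}" for b a a' f h
 proof -
  have ar: "a : arrows C" "a' : arrows C" "tgt a = src a'" "f : arrows C" "tgt a' = src f" "h : arrows C" "tgt f = src h" using ab by (auto simp: AR.comps)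
  have z: "b x y z = 0" if "AR.comp3 x y z" "src x = src a" for x y z using cyc_values(2)[OF b that(1)] that(2) a by simp
  have "b a' f h : X 0 (tgt a)" "d 0 (tgt a) (b a' f h) = 0" using b ar unfolding cyc3_def AR.C3_def by (simp_all add: AR.comps)
  hence "\<rho> 0 a (b a' f h) = 0"
   using trivial_elsewhere[OF AR.ar(1)[OF ar(1)] a AR.\<rho>(1)[OF ar(1)]] AR.d(3)[OF ar(1), of "b a' f h" 0] AR.\<rho>_zero[OF ar(1)] by simp
  thus ?thesis unfolding AR.dt3_def using ar by (simp add: z AR.comps AR.cmp)
 qed
 have el2: "AR.dt2 0 b a a' f = 0" if b: "cyc2 b" and ab: "AR.comp3 a a' f" and a: "src a ~= {\<one>}" for b a a' f
 proof -
  have ar: "a : arrows C" "a' : arrows C" "tgt a = src a'" "f : arrows C" "tgt a' = src f" using ab by (auto simp: AR.comps)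
  have z: "b x y = 0" if "AR.comp2 x y" "src x = src a" for x y using cyc_values(1)[OF b that(1)] that(2) a by simp
  have "b a' f : X 0 (tgt a)" "d 0 (tgt a) (b a' f) = 0" using b ar unfolding cyc2_def AR.C2_def by (simp_all add: AR.comps)
  hence "\<rho> 0 a (b a' f) = 0"
   using trivial_elsewhere[OF AR.ar(1)[OF ar(1)] a AR.\<rho>(1)[OF ar(1)]] AR.d(3)[OF ar(1), of "b a' f" 0] AR.\<rho>_zero[OF ar(1)] by simp
  thus ?thesis unfolding AR.dt2_def using ar by (simp add: z AR.comps AR.cmp)
 qed
 show "EX b:AR.Z3 0. ALL a a' f. AR.comp3 a a' f --> B3 c a a' f = b a a' f" if c: "c : FZ3 above" for c
 proof (intro bexI[of _ "B3 c"] allI impI refl)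
  have v: "van3 c" using c by (simp add: FZ)
  have "AR.dt3 0 (B3 c) a a' f h = 0" if ab: "AR.comp4 a a' f h" for a a' f h
  proof (cases "src a = {\<one>}")
   case True
   show ?thesis unfolding dt_B3[OF v ab True] using c ch_push(4)[OF x0_pts _ ab] True by (simp add: FZ kp_zero)
  qed (rule el[OF B_cyc(2)[OF v] ab])
  thus "B3 c : AR.Z3 0" using B_cyc(2)[OF v] by (simp add: Z)
 qed
 show "EX c:FZ3 above. ALL a a' f. AR.comp3 a a' f --> B3 c a a' f = b a a' f" if b: "b : AR.Z3 0" for b
 proof (intro bexI[of _ "coch3 b"] allI impI)
  have cb: "cyc3 b" using b by (simp add: Z)
  show "B3 (coch3 b) a a' f = b a a' f" if "AR.comp3 a a' f" for a a' f by (rule B_coch(2)[OF cb that])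
  note v = coch_van(2)[OF cb]
  have x: "D3 (coch3 b) x0 e1 e2 e3 e4 = 0" if ch: "ch5 pts x0 e1 e2 e3 e4" for e1 e2 e3 e4
  proof -
   have c2: "ch2 pts x0 e1" "ch2 pts e1 e2" "ch2 pts e2 e3" "ch2 pts e3 e4" using ch by (auto simp: chs)
   note cm = comp_arr(3)[OF ch]
   have "kp (D3 (coch3 b) x0 e1 e2 e3 e4) = AR.dt3 0 (B3 (coch3 b)) (arr x0 e1) (arr e1 e2) (arr e2 e3) (arr e3 e4)"
    using dt_B3[OF v cm] arr[OF c2(1)] arr(3)[OF c2(2)] arr(3)[OF c2(3)] arr(3)[OF c2(4)] by simp
   also have "... = AR.dt3 0 b (arr x0 e1) (arr e1 e2) (arr e2 e3) (arr e3 e4)" by (rule diff3[OF cm B_coch(2)[OF cb]])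
   also have "... = kp 0" using b cm by (simp add: Z kp_zero)
   finally have eq: "kp (D3 (coch3 b) x0 e1 e2 e3 e4) = kp 0" .
   have "D3 (coch3 b) x0 e1 e2 e3 e4 : A"
    using faces5[OF ch] v Acl K3D(1)[of pts "coch3 b"] by (simp add: D3_def van3_def)
   thus ?thesis using eq kp_eq_iff Acl(1) by simp
  qed
  have "D3 (coch3 b) e0 e1 e2 e3 e4 = 0" if ch: "ch5 pts e0 e1 e2 e3 e4" for e0 e1 e2 e3 e4
  proof (cases "e0 : above")
   case False
   have e: "e0 : pts" "e1 : pts" "e2 : pts" "e3 : pts" "e4 : pts" using ch by (auto simp: chs)
   have f: "fst e0 = {\<one>}" using False e(1) by (simp add: above_def)
   note o = offset[OF e(1) f]
   let ?m = "mv (inv (offset e0))"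
   have m0: "?m e0 = x0" using mv_inv(1)[OF o(1) x0_pts] o(2) by simp
   have io: "inv (offset e0) : els" using o(1) by simp
   have ch': "ch5 pts x0 (?m e1) (?m e2) (?m e3) (?m e4)" using ch ch2_mv[OF _ io, of e0 e1] ch2_mv[OF _ io, of e1 e2] ch2_mv[OF _ io, of e2 e3] ch2_mv[OF _ io, of e3 e4]
    by (simp add: ch3_def ch4_def ch5_def m0)
   show ?thesis using D_van(2)[OF v ch' o(1)] x[OF ch'] o e by (simp add: mv_inv act_zero)
  qed (rule D_van(4)[OF v ch])
  thus "coch3 b : FZ3 above" using v by (simp add: FZ)
 qed
 show "FE3 above c c' <-> AR.E3 0 b b'" if c: "c : FZ3 above" "c' : FZ3 above" and b: "b : AR.Z3 0" "b' : AR.Z3 0"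
  and R: "ALL a a' f. AR.comp3 a a' f --> B3 c a a' f = b a a' f" "ALL a a' f. AR.comp3 a a' f --> B3 c' a a' f = b' a a' f" for c c' b b'
 proof -
  have cv: "van3 c" "van3 c'" and bc: "cyc3 b" "cyc3 b'" using c b by (simp_all add: Z FZ)
  have KK: "K3 pts c" "K3 pts c'" using cv by (simp_all add: van3_def)
  have bd: "b a a' f - b' a a' f = kp (c x0 (push a x0) (push a' (push a x0)) (push f (push a' (push a x0))) -
     c' x0 (push a x0) (push a' (push a x0)) (push f (push a' (push a x0))))" if ab: "AR.comp3 a a' f" "src a = {\<one>}" for a a' f
  proof -
   have ch: "ch4 pts x0 (push a x0) (push a' (push a x0)) (push f (push a' (push a x0)))" using ch_push(3)[OF x0_pts _ ab(1)] ab(2) by simp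
   have "b a a' f = B3 c a a' f" "b' a a' f = B3 c' a a' f" using R ab(1) by simp_all
   thus ?thesis using ab(2) kp_diff[OF K3D(1)[OF KK(1) ch] K3D(1)[OF KK(2) ch]] by (simp add: B3_def)
  qed
  have FE: "FE3 above c c' <-> (EX y. van2 y & (ALL e0 e1 e2 e3. ch4 pts e0 e1 e2 e3 --> c e0 e1 e2 e3 - c' e0 e1 e2 e3 = D2 y e0 e1 e2 e3))"
   by (auto simp: FE3_def van2_def)
  have E: "AR.E3 0 b b' <-> (EX y. cyc2 y & (ALL a a' f. AR.comp3 a a' f --> b a a' f - b' a a' f = AR.dt2 0 y a a' f))"
   by (auto simp: AR.E3_def cyc2_def)
  show ?thesis
  proof
   assume "FE3 above c c'"
   then obtain y where y: "van2 y" "!!e0 e1 e2 e3. ch4 pts e0 e1 e2 e3 ==> c e0 e1 e2 e3 - c' e0 e1 e2 e3 = D2 y e0 e1 e2 e3"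
    using FE by blast
   have "b a a' f - b' a a' f = AR.dt2 0 (B2 y) a a' f" if ab: "AR.comp3 a a' f" for a a' f
   proof (cases "src a = {\<one>}")
    case True
    show ?thesis unfolding bd[OF ab True] dt_B2[OF y(1) ab True] using y(2) ch_push(3)[OF x0_pts _ ab] True by simp
   next
    case False
    thus ?thesis using el2[OF B_cyc(1)[OF y(1)] ab False] cyc_values(2)[OF bc(1) ab] cyc_values(2)[OF bc(2) ab] by simp
   qed
   thus "AR.E3 0 b b'" using E B_cyc(1)[OF y(1)] by blast
  next
   assume "AR.E3 0 b b'"
   then obtain y where y: "cyc2 y" "!!a a' f. AR.comp3 a a' f ==> b a a' f - b' a a' f = AR.dt2 0 y a a' f" using E by blast
   note v = coch_van(1)[OF y(1)]
   have x: "c x0 e1 e2 e3 - c' x0 e1 e2 e3 = D2 (coch2 y) x0 e1 e2 e3" if ch: "ch4 pts x0 e1 e2 e3" for e1 e2 e3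
   proof -
    have c2: "ch2 pts x0 e1" "ch2 pts e1 e2" "ch2 pts e2 e3" using ch by (auto simp: chs)
    note cm = comp_arr(2)[OF ch]
    note pu = arr[OF c2(1)] arr(3)[OF c2(2)] arr(3)[OF c2(3)]
    have "kp (c x0 e1 e2 e3 - c' x0 e1 e2 e3) = b (arr x0 e1) (arr e1 e2) (arr e2 e3) - b' (arr x0 e1) (arr e1 e2) (arr e2 e3)"
     using bd[OF cm] pu by simp
    also have "... = AR.dt2 0 y (arr x0 e1) (arr e1 e2) (arr e2 e3)" by (rule y(2)[OF cm])
    also have "... = AR.dt2 0 (B2 (coch2 y)) (arr x0 e1) (arr e1 e2) (arr e2 e3)" by (rule diff2[OF cm B_coch(1)[OF y(1), symmetric]])
    also have "... = kp (D2 (coch2 y) x0 e1 e2 e3)" using dt_B2[OF v cm] pu by simp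
    finally have eq: "kp (c x0 e1 e2 e3 - c' x0 e1 e2 e3) = kp (D2 (coch2 y) x0 e1 e2 e3)" .
    have "D2 (coch2 y) x0 e1 e2 e3 : A" using faces4[OF ch] v Acl K2D(1)[of pts "coch2 y"] by (simp add: D2_def van2_def)
    thus ?thesis using eq kp_eq_iff Acl K3D(1)[OF KK(1) ch] K3D(1)[OF KK(2) ch] by simp
   qed
   have "c e0 e1 e2 e3 - c' e0 e1 e2 e3 = D2 (coch2 y) e0 e1 e2 e3" if ch: "ch4 pts e0 e1 e2 e3" for e0 e1 e2 e3
   proof (cases "e0 : above")
    case True
    thus ?thesis using D_van(3)[OF v ch] cv ch by (simp add: van3_def)
   next
    case False
    have e: "e0 : pts" "e1 : pts" "e2 : pts" "e3 : pts" using ch by (auto simp: chs)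
    have f: "fst e0 = {\<one>}" using False e(1) by (simp add: above_def)
    note o = offset[OF e(1) f]
    let ?m = "mv (inv (offset e0))"
    have m0: "?m e0 = x0" using mv_inv(1)[OF o(1) x0_pts] o(2) by simp
    have io: "inv (offset e0) : els" using o(1) by simp
    have ch': "ch4 pts x0 (?m e1) (?m e2) (?m e3)" using ch ch2_mv[OF _ io, of e0 e1] ch2_mv[OF _ io, of e1 e2] ch2_mv[OF _ io, of e2 e3]
     by (simp add: ch3_def ch4_def m0)
    have mm: "mv (offset e0) (?m e) = e" if "e : pts" for e using mv_inv(2)[OF o(1) that] .
    have "c e0 e1 e2 e3 = act (offset e0) (c x0 (?m e1) (?m e2) (?m e3))" "c' e0 e1 e2 e3 = act (offset e0) (c' x0 (?m e1) (?m e2) (?m e3))"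
     using K3D(2)[OF KK(1) ch' o(1)] K3D(2)[OF KK(2) ch' o(1)] o(2) e by (simp_all add: mm)
    hence "c e0 e1 e2 e3 - c' e0 e1 e2 e3 = act (offset e0) (c x0 (?m e1) (?m e2) (?m e3) - c' x0 (?m e1) (?m e2) (?m e3))"
     using act_diff[OF o(1) K3D(1)[OF KK(1) ch'] K3D(1)[OF KK(2) ch']] by simp
    also have "... = D2 (coch2 y) e0 e1 e2 e3" unfolding x[OF ch'] using D_van(1)[OF v ch' o(1)] o e by (simp add: mm)
    finally show ?thesis .
   qed
   thus "FE3 above c c'" using FE v by blast
  qed
 qed
qed

end

section \<open>Isomorphisms of linking systems\<close>

lemma linking_systemD:
 assumes "linking_system G S \<XX> (L, \<pi>, dt)"
 shows "linking_family G S \<XX>" "category L" "Obj L = \<XX>"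
  "is_cfunctor L (full_subcat (fusion_system G S) \<XX>) \<pi>" "is_cfunctor (transporter_cat G S \<XX>) L dt"
  "P : \<XX> ==> obj_map \<pi> P = P" "P : \<XX> ==> obj_map dt P = P"
  "P : \<XX> ==> Q : \<XX> ==> f : Mor L P Q ==> z : center_of G P ==> comp L P P Q f (mor_map dt P P z) = f ==> z = \<one>\<^bsub>G\<^esub>"
  "P : \<XX> ==> Q : \<XX> ==> mor_map \<pi> P Q ` Mor L P Q = Mor (fusion_system G S) P Q"
  "P : \<XX> ==> Q : \<XX> ==> f : Mor L P Q ==> f' : Mor L P Q ==> mor_map \<pi> P Q f = mor_map \<pi> P Q f' <->
    (EX z:center_of G P. f' = comp L P P Q f (mor_map dt P P z))"
  "P : \<XX> ==> Q : \<XX> ==> g : transporter G S P Q ==> mor_map \<pi> P Q (mor_map dt P Q g) = restrict (conj_by G g) P"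
  "P : \<XX> ==> Q : \<XX> ==> f : Mor L P Q ==> x : P ==> comp L P P Q f (mor_map dt P P x) =
     comp L P Q Q (mor_map dt Q Q (mor_map \<pi> P Q f x)) f"
proof -
 note a = assms[unfolded linking_system_def prod.case]
 show "linking_family G S \<XX>" "category L" "Obj L = \<XX>"
  "is_cfunctor L (full_subcat (fusion_system G S) \<XX>) \<pi>" "is_cfunctor (transporter_cat G S \<XX>) L dt"
  "P : \<XX> ==> obj_map \<pi> P = P" "P : \<XX> ==> obj_map dt P = P"
  using a by simp_all
 assume P: "P : \<XX>" and Q: "Q : \<XX>"
 from a have A: "ALL P:\<XX>. ALL Q:\<XX>.
    (ALL f:Mor L P Q. ALL z:center_of G P.
      comp L P P Q f (mor_map dt P P z) = f --> z = \<one>\<^bsub>G\<^esub>) &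
    mor_map \<pi> P Q ` Mor L P Q = Mor (fusion_system G S) P Q &
    (ALL f:Mor L P Q. ALL f':Mor L P Q. mor_map \<pi> P Q f = mor_map \<pi> P Q f' <->
      (EX z:center_of G P. f' = comp L P P Q f (mor_map dt P P z)))" by (elim conjE)
 note A = A[THEN bspec, OF P, THEN bspec, OF Q]
 show "f : Mor L P Q ==> z : center_of G P ==> comp L P P Q f (mor_map dt P P z) = f ==> z = \<one>\<^bsub>G\<^esub>" using A by blast
 show "mor_map \<pi> P Q ` Mor L P Q = Mor (fusion_system G S) P Q" using A by blast
 show "f : Mor L P Q ==> f' : Mor L P Q ==> mor_map \<pi> P Q f = mor_map \<pi> P Q f' <->
    (EX z:center_of G P. f' = comp L P P Q f (mor_map dt P P z))" using A by blast
 show "g : transporter G S P Q ==> mor_map \<pi> P Q (mor_map dt P Q g) = restrict (conj_by G g) P"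
  using a P Q by simp
 show "f : Mor L P Q ==> x : P ==> comp L P P Q f (mor_map dt P P x) =
     comp L P Q Q (mor_map dt Q Q (mor_map \<pi> P Q f x)) f" using a P Q by simp
qed

lemma linking_system_mor:
 assumes "linking_system G S \<XX> (L, \<pi>, dt)" "P : \<XX>" "Q : \<XX>"
 shows "g : transporter G S P Q ==> mor_map dt P Q g : Mor L P Q"
  and "mor_map dt P P \<one>\<^bsub>G\<^esub> = ident L P"
  and "R : \<XX> ==> g : transporter G S P Q ==> h : transporter G S Q R ==>
    mor_map dt P R (h \<otimes>\<^bsub>G\<^esub> g) = comp L P Q R (mor_map dt Q R h) (mor_map dt P Q g)"
  and "f : Mor L P Q ==> mor_map \<pi> P Q f : Mor (fusion_system G S) P Q"
  and "R : \<XX> ==> f : Mor L P Q ==> f' : Mor L Q R ==>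
    mor_map \<pi> P R (comp L P Q R f' f) = compose P (mor_map \<pi> Q R f') (mor_map \<pi> P Q f)"
proof -
 note ls = linking_systemD[OF assms(1)]
 show "g : transporter G S P Q ==> mor_map dt P Q g : Mor L P Q"
  using ls(5,7) assms(2,3) unfolding is_cfunctor_def by (auto simp: transporter_cat_def)
 show "mor_map dt P P \<one>\<^bsub>G\<^esub> = ident L P"
  using ls(5,7) assms(2) unfolding is_cfunctor_def by (auto simp: transporter_cat_def)
 show "R : \<XX> ==> g : transporter G S P Q ==> h : transporter G S Q R ==>
    mor_map dt P R (h \<otimes>\<^bsub>G\<^esub> g) = comp L P Q R (mor_map dt Q R h) (mor_map dt P Q g)"
  using ls(5,7) assms(2,3) unfolding is_cfunctor_def by (simp add: transporter_cat_def)
 show "f : Mor L P Q ==> mor_map \<pi> P Q f : Mor (fusion_system G S) P Q"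
  using ls(9)[OF assms(2,3)] by blast
 show "R : \<XX> ==> f : Mor L P Q ==> f' : Mor L Q R ==>
    mor_map \<pi> P R (comp L P Q R f' f) = compose P (mor_map \<pi> Q R f') (mor_map \<pi> P Q f)"
  using ls(3,4,6) assms(2,3) unfolding is_cfunctor_def by (simp add: full_subcat_def fusion_system_def)
qed

text \<open>
  An isomorphism of linking systems is the identity on objects, as both projections are, so it is a
  family of bijections between morphism sets.
\<close>

definition iso_maps ::
 "('g, 'b) monoid_scheme => 'g set => 'g set set => ('g, 'l) linking_data => ('g, 'k) linking_data =>
  ('g set => 'g set => 'l => 'k) => bool" where
 "iso_maps G S \<XX> = (%(L1, \<pi>1, dt1) (L2, \<pi>2, dt2) ps. ALL P:\<XX>. ALL Q:\<XX>.
   bij_betw (ps P Q) (Mor L1 P Q) (Mor L2 P Q) &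
   (ALL f:Mor L1 P Q. mor_map \<pi>2 P Q (ps P Q f) = mor_map \<pi>1 P Q f) &
   (ALL g:transporter G S P Q. ps P Q (mor_map dt1 P Q g) = mor_map dt2 P Q g) &
   (ALL R:\<XX>. ALL f:Mor L1 P Q. ALL g:Mor L1 Q R.
    ps P R (comp L1 P Q R g f) = comp L2 P Q R (ps Q R g) (ps P Q f)))"

lemma iso_mapsD:
 assumes "iso_maps G S \<XX> (L1, \<pi>1, dt1) (L2, \<pi>2, dt2) ps" "P : \<XX>" "Q : \<XX>"
 shows "bij_betw (ps P Q) (Mor L1 P Q) (Mor L2 P Q)"
  "f : Mor L1 P Q ==> ps P Q f : Mor L2 P Q"
  "f : Mor L1 P Q ==> mor_map \<pi>2 P Q (ps P Q f) = mor_map \<pi>1 P Q f"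
  "g : transporter G S P Q ==> ps P Q (mor_map dt1 P Q g) = mor_map dt2 P Q g"
  "R : \<XX> ==> f : Mor L1 P Q ==> f' : Mor L1 Q R ==> ps P R (comp L1 P Q R f' f) = comp L2 P Q R (ps Q R f') (ps P Q f)"
proof -
 note a = assms(1)[unfolded iso_maps_def prod.case, THEN bspec, OF assms(2), THEN bspec, OF assms(3)]
 show b: "bij_betw (ps P Q) (Mor L1 P Q) (Mor L2 P Q)" using a by blast
 show "f : Mor L1 P Q ==> ps P Q f : Mor L2 P Q" using b bij_betwE by blast
 show "f : Mor L1 P Q ==> mor_map \<pi>2 P Q (ps P Q f) = mor_map \<pi>1 P Q f"
  "g : transporter G S P Q ==> ps P Q (mor_map dt1 P Q g) = mor_map dt2 P Q g"
  "R : \<XX> ==> f : Mor L1 P Q ==> f' : Mor L1 Q R ==> ps P R (comp L1 P Q R f' f) = comp L2 P Q R (ps Q R f') (ps P Q f)"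
  using a by simp_all
qed

lemma linking_iso_iff:
 assumes G: "group G" and S: "subgroup S G"
  and 1: "linking_system G S \<XX> (L1, \<pi>1, dt1)" and 2: "linking_system G S \<XX> (L2, \<pi>2, dt2)"
 shows "linking_iso G S \<XX> (L1, \<pi>1, dt1) (L2, \<pi>2, dt2) <-> (EX ps. iso_maps G S \<XX> (L1, \<pi>1, dt1) (L2, \<pi>2, dt2) ps)"
proof
 note ls1 = linking_systemD[OF 1] and ls2 = linking_systemD[OF 2]
 assume "linking_iso G S \<XX> (L1, \<pi>1, dt1) (L2, \<pi>2, dt2)"
 then obtain \<Psi> where \<Psi>: "cat_isomorphism L1 L2 \<Psi>" "cfunctor_eq L1 (cfunctor_comp \<pi>2 \<Psi>) \<pi>1"
  "cfunctor_eq (transporter_cat G S \<XX>) (cfunctor_comp \<Psi> dt1) dt2" by (auto simp: linking_iso_def)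
 then obtain \<Theta> where F: "is_cfunctor L1 L2 \<Psi>" and \<Theta>: "is_cfunctor L2 L1 \<Theta>" "cfunctor_eq L1 (cfunctor_comp \<Theta> \<Psi>) cfunctor_id"
  "cfunctor_eq L2 (cfunctor_comp \<Psi> \<Theta>) cfunctor_id" by (auto simp: cat_isomorphism_def)
 have ob: "obj_map \<Psi> P = P" if P: "P : \<XX>" for P
 proof -
  have "obj_map \<Psi> P : \<XX>" using F P ls1(3) ls2(3) by (auto simp: is_cfunctor_def)
  hence "obj_map \<pi>2 (obj_map \<Psi> P) = obj_map \<Psi> P" by (rule ls2(6))
  moreover have "obj_map \<pi>2 (obj_map \<Psi> P) = P"
   using \<Psi>(2) P ls1(3) ls1(6)[OF P] by (simp add: cfunctor_eq_def cfunctor_comp_def)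
  ultimately show ?thesis by simp
 qed
 have ob': "obj_map \<Theta> P = P" if P: "P : \<XX>" for P
 proof -
  have "obj_map \<Theta> (obj_map \<Psi> P) = P"
   using \<Theta>(2) P ls1(3) by (simp add: cfunctor_eq_def cfunctor_comp_def cfunctor_id_def)
  thus ?thesis by (simp add: ob[OF P])
 qed
 have "iso_maps G S \<XX> (L1, \<pi>1, dt1) (L2, \<pi>2, dt2) (mor_map \<Psi>)"
  unfolding iso_maps_def prod.case
 proof (intro ballI conjI)
  fix P Q assume P: "P : \<XX>" and Q: "Q : \<XX>"
  show "bij_betw (mor_map \<Psi> P Q) (Mor L1 P Q) (Mor L2 P Q)"
  proof (rule bij_betwI[where g = "mor_map \<Theta> P Q"])
   show "mor_map \<Psi> P Q : Mor L1 P Q \<rightarrow> Mor L2 P Q" using F P Q ob ls1(3) by (auto simp: is_cfunctor_def)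
   show "mor_map \<Theta> P Q : Mor L2 P Q \<rightarrow> Mor L1 P Q" using \<Theta>(1) P Q ob' ls2(3) by (auto simp: is_cfunctor_def)
   show "mor_map \<Theta> P Q (mor_map \<Psi> P Q f) = f" if "f : Mor L1 P Q" for f
    using \<Theta>(2) P Q ob ls1(3) that by (simp add: cfunctor_eq_def cfunctor_comp_def cfunctor_id_def)
   show "mor_map \<Psi> P Q (mor_map \<Theta> P Q f) = f" if "f : Mor L2 P Q" for f
    using \<Theta>(3) P Q ob' ls2(3) that by (simp add: cfunctor_eq_def cfunctor_comp_def cfunctor_id_def)
  qed
  show "mor_map \<pi>2 P Q (mor_map \<Psi> P Q f) = mor_map \<pi>1 P Q f" if "f : Mor L1 P Q" for f
   using \<Psi>(2) P Q ob ls1(3) that by (simp add: cfunctor_eq_def cfunctor_comp_def)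
  show "mor_map \<Psi> P Q (mor_map dt1 P Q g) = mor_map dt2 P Q g" if "g : transporter G S P Q" for g
   using \<Psi>(3) P Q ls1(7) that by (simp add: cfunctor_eq_def cfunctor_comp_def transporter_cat_def)
  show "mor_map \<Psi> P R (comp L1 P Q R g f) = comp L2 P Q R (mor_map \<Psi> Q R g) (mor_map \<Psi> P Q f)"
   if "R : \<XX>" "f : Mor L1 P Q" "g : Mor L1 Q R" for R f g
   using F P Q that ob ls1(3) by (simp add: is_cfunctor_def)
 qed
 thus "EX ps. iso_maps G S \<XX> (L1, \<pi>1, dt1) (L2, \<pi>2, dt2) ps" by blast
next
 note ls1 = linking_systemD[OF 1] and ls2 = linking_systemD[OF 2]
 assume "EX ps. iso_maps G S \<XX> (L1, \<pi>1, dt1) (L2, \<pi>2, dt2) ps"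
 then obtain ps where ps: "iso_maps G S \<XX> (L1, \<pi>1, dt1) (L2, \<pi>2, dt2) ps" by blast
 note m = iso_mapsD[OF ps]
 interpret G: group G by fact
 have idT: "\<one>\<^bsub>G\<^esub> : transporter G S P P" if P: "P : \<XX>" for P
 proof -
  have "P : centric_subgroups G S" using ls1(1) P unfolding linking_family_def by blast
  hence "subgroup P G" by (simp add: centric_subgroups_def subgroups_of_def)
  hence "P \<subseteq> carrier G" by (rule subgroup.subset)
  hence "conj_by G \<one>\<^bsub>G\<^esub> x = x" if "x : P" for x using that by (simp add: conj_by_def subset_iff)
  thus ?thesis using subgroup.one_closed[OF S] by (simp add: transporter_def image_subset_iff)
 qed
 have id: "ps P P (ident L1 P) = ident L2 P" if P: "P : \<XX>" for P
  using m(4)[OF P P idT[OF P]] linking_system_mor(2)[OF 1 P P] linking_system_mor(2)[OF 2 P P] by simp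
 define \<theta> where "\<theta> P Q = inv_into (Mor L1 P Q) (ps P Q)" for P Q
 have \<theta>: "\<theta> P Q f : Mor L1 P Q" "ps P Q (\<theta> P Q f) = f" if "P : \<XX>" "Q : \<XX>" "f : Mor L2 P Q" for P Q f
  using m(1)[OF that(1,2)] that(3) unfolding \<theta>_def bij_betw_def by (auto intro: inv_into_into f_inv_into_f)
 have \<theta>ps: "\<theta> P Q (ps P Q f) = f" if "P : \<XX>" "Q : \<XX>" "f : Mor L1 P Q" for P Q f
  using m(1)[OF that(1,2)] that(3) unfolding \<theta>_def bij_betw_def by (simp add: inv_into_f_f)
 let ?\<Psi> = "\<lparr>obj_map = (%P. P), mor_map = ps\<rparr>" and ?\<Theta> = "\<lparr>obj_map = (%P. P), mor_map = \<theta>\<rparr>"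
 have "is_cfunctor L1 L2 ?\<Psi>"
  unfolding is_cfunctor_def ls1(3) ls2(3) using m(2,5) id by simp
 moreover have "is_cfunctor L2 L1 ?\<Theta>"
  unfolding is_cfunctor_def ls1(3) ls2(3) cfunctor.simps
 proof (intro conjI ballI)
  fix P assume P: "P : \<XX>"
  show "P : \<XX>" by fact
  show "\<theta> P P (ident L2 P) = ident L1 P"
   using id[OF P] \<theta>ps[OF P P] ls1(2) P by (simp add: category_def ls1(3) flip: id)
  fix Q assume Q: "Q : \<XX>"
  show "\<theta> P Q f : Mor L1 P Q" if "f : Mor L2 P Q" for f by (rule \<theta>(1)[OF P Q that])
  fix R f g assume R: "R : \<XX>" "f : Mor L2 P Q" "g : Mor L2 Q R"
  have c: "comp L1 P Q R (\<theta> Q R g) (\<theta> P Q f) : Mor L1 P R"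
   using ls1(2) P Q R(1) \<theta>(1)[OF P Q R(2)] \<theta>(1)[OF Q R(1,3)] by (simp add: category_def ls1(3))
  have "comp L2 P Q R g f = ps P R (comp L1 P Q R (\<theta> Q R g) (\<theta> P Q f))"
   using m(5)[OF P Q R(1) \<theta>(1)[OF P Q R(2)] \<theta>(1)[OF Q R(1,3)]] \<theta>(2)[OF P Q R(2)] \<theta>(2)[OF Q R(1,3)] by simp
  thus "\<theta> P R (comp L2 P Q R g f) = comp L1 P Q R (\<theta> Q R g) (\<theta> P Q f)"
   using \<theta>ps[OF P R(1) c] by simp
 qed
 moreover have "cfunctor_eq L1 (cfunctor_comp ?\<Theta> ?\<Psi>) cfunctor_id"
  using \<theta>ps by (simp add: cfunctor_eq_def cfunctor_comp_def cfunctor_id_def ls1(3))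
 moreover have "cfunctor_eq L2 (cfunctor_comp ?\<Psi> ?\<Theta>) cfunctor_id"
  using \<theta>(2) by (simp add: cfunctor_eq_def cfunctor_comp_def cfunctor_id_def ls2(3))
 ultimately have "cat_isomorphism L1 L2 ?\<Psi>" unfolding cat_isomorphism_def by blast
 moreover have "cfunctor_eq L1 (cfunctor_comp \<pi>2 ?\<Psi>) \<pi>1"
  using m(3) ls1(6) ls2(6) by (simp add: cfunctor_eq_def cfunctor_comp_def ls1(3))
 moreover have "cfunctor_eq (transporter_cat G S \<XX>) (cfunctor_comp ?\<Psi> dt1) dt2"
  using m(4) ls1(7) ls2(7) by (simp add: cfunctor_eq_def cfunctor_comp_def transporter_cat_def)
 ultimately show "linking_iso G S \<XX> (L1, \<pi>1, dt1) (L2, \<pi>2, dt2)" by (auto simp: linking_iso_def)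
qed

lemma iso_maps_refl: "iso_maps G S \<XX> (L, \<pi>, dt) (L, \<pi>, dt) (%P Q f. f)"
 by (simp add: iso_maps_def bij_betw_def)

lemma iso_maps_trans:
 assumes "iso_maps G S \<XX> (L1, \<pi>1, dt1) (L2, \<pi>2, dt2) ps" "iso_maps G S \<XX> (L2, \<pi>2, dt2) (L3, \<pi>3, dt3) ps'"
 shows "iso_maps G S \<XX> (L1, \<pi>1, dt1) (L3, \<pi>3, dt3) (%P Q f. ps' P Q (ps P Q f))"
 unfolding iso_maps_def prod.case
proof (intro ballI conjI)
 note m = iso_mapsD[OF assms(1)] and m' = iso_mapsD[OF assms(2)]
 fix P Q assume P: "P : \<XX>" and Q: "Q : \<XX>"
 show "bij_betw (%f. ps' P Q (ps P Q f)) (Mor L1 P Q) (Mor L3 P Q)"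
  using bij_betw_trans[OF m(1)[OF P Q] m'(1)[OF P Q]] by (simp add: o_def)
qed (simp_all add: iso_mapsD[OF assms(1)] iso_mapsD[OF assms(2)])

lemma iso_maps_sym:
 assumes L1: "category L1" "Obj L1 = \<XX>" and dt: "!!P Q g. P : \<XX> ==> Q : \<XX> ==> g : transporter G S P Q ==> mor_map dt1 P Q g : Mor L1 P Q"
  and i: "iso_maps G S \<XX> (L1, \<pi>1, dt1) (L2, \<pi>2, dt2) ps"
 shows "iso_maps G S \<XX> (L2, \<pi>2, dt2) (L1, \<pi>1, dt1) (%P Q. inv_into (Mor L1 P Q) (ps P Q))"
 unfolding iso_maps_def prod.case
proof (intro ballI conjI)
 note m = iso_mapsD[OF i]
 define \<theta> where "\<theta> P Q = inv_into (Mor L1 P Q) (ps P Q)" for P Q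
 have \<theta>: "\<theta> P Q f : Mor L1 P Q" "ps P Q (\<theta> P Q f) = f" if "P : \<XX>" "Q : \<XX>" "f : Mor L2 P Q" for P Q f
  using m(1)[OF that(1,2)] that(3) unfolding \<theta>_def bij_betw_def by (auto intro: inv_into_into f_inv_into_f)
 have \<theta>ps: "\<theta> P Q (ps P Q f) = f" if "P : \<XX>" "Q : \<XX>" "f : Mor L1 P Q" for P Q f
  using m(1)[OF that(1,2)] that(3) unfolding \<theta>_def bij_betw_def by (simp add: inv_into_f_f)
 fix P Q assume P: "P : \<XX>" and Q: "Q : \<XX>"
 show "bij_betw (inv_into (Mor L1 P Q) (ps P Q)) (Mor L2 P Q) (Mor L1 P Q)"
  by (rule bij_betw_inv_into[OF m(1)[OF P Q]])
 show "mor_map \<pi>1 P Q (inv_into (Mor L1 P Q) (ps P Q) f) = mor_map \<pi>2 P Q f" if "f : Mor L2 P Q" for f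
  using m(3)[OF P Q \<theta>(1)[OF P Q that]] \<theta>(2)[OF P Q that] by (simp add: \<theta>_def)
 show "inv_into (Mor L1 P Q) (ps P Q) (mor_map dt2 P Q g) = mor_map dt1 P Q g" if "g : transporter G S P Q" for g
  using \<theta>ps[OF P Q dt[OF P Q that]] m(4)[OF P Q that] by (simp add: \<theta>_def)
 fix R f g assume R: "R : \<XX>" "f : Mor L2 P Q" "g : Mor L2 Q R"
 have c: "comp L1 P Q R (\<theta> Q R g) (\<theta> P Q f) : Mor L1 P R"
  using L1 P Q R(1) \<theta>(1)[OF P Q R(2)] \<theta>(1)[OF Q R(1,3)] by (simp add: category_def)
 have "comp L2 P Q R g f = ps P R (comp L1 P Q R (\<theta> Q R g) (\<theta> P Q f))"
  using m(5)[OF P Q R(1) \<theta>(1)[OF P Q R(2)] \<theta>(1)[OF Q R(1,3)]] \<theta>(2)[OF P Q R(2)] \<theta>(2)[OF Q R(1,3)] by simp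
 thus "inv_into (Mor L1 P R) (ps P R) (comp L2 P Q R g f) =
   comp L1 P Q R (inv_into (Mor L1 Q R) (ps Q R) g) (inv_into (Mor L1 P Q) (ps P Q) f)"
  using \<theta>ps[OF P R(1) c] by (simp add: \<theta>_def)
qed

lemma linking_iso_equiv:
 fixes G :: "('g, 'b) monoid_scheme"
 assumes G: "group G" and S: "subgroup S G"
 shows "equiv {L :: ('g, 'l) linking_data. linking_system G S \<XX> L}
  {(L, L'). L : {L. linking_system G S \<XX> L} & L' : {L. linking_system G S \<XX> L} & linking_iso G S \<XX> L L'}"
  (is "equiv ?A ?r")
proof (rule equivI)
 note iff = linking_iso_iff[OF G S]
 show "?r \<subseteq> ?A \<times> ?A" by auto
 show "refl_on ?A ?r"
  unfolding refl_on_def using iff iso_maps_refl by fastforce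
 show "sym ?r"
 proof (rule symI, clarsimp)
  fix L1 L2 :: "('g set, 'l) cat" and \<pi>1 \<pi>2 dt1 dt2
  assume ls: "linking_system G S \<XX> (L1, \<pi>1, dt1)" "linking_system G S \<XX> (L2, \<pi>2, dt2)"
   and "linking_iso G S \<XX> (L1, \<pi>1, dt1) (L2, \<pi>2, dt2)"
  then obtain ps where "iso_maps G S \<XX> (L1, \<pi>1, dt1) (L2, \<pi>2, dt2) ps" using iff by blast
  from iso_maps_sym[OF linking_systemD(2,3)[OF ls(1)] linking_system_mor(1)[OF ls(1)] this]
  show "linking_iso G S \<XX> (L2, \<pi>2, dt2) (L1, \<pi>1, dt1)" using iff[OF ls(2,1)] by blast
 qed
 show "trans ?r"
 proof (rule transI, clarsimp)
  fix L1 L2 L3 :: "('g set, 'l) cat" and \<pi>1 \<pi>2 \<pi>3 dt1 dt2 dt3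
  assume ls: "linking_system G S \<XX> (L1, \<pi>1, dt1)" "linking_system G S \<XX> (L2, \<pi>2, dt2)" "linking_system G S \<XX> (L3, \<pi>3, dt3)"
   and "linking_iso G S \<XX> (L1, \<pi>1, dt1) (L2, \<pi>2, dt2)" "linking_iso G S \<XX> (L2, \<pi>2, dt2) (L3, \<pi>3, dt3)"
  then obtain ps ps' where "iso_maps G S \<XX> (L1, \<pi>1, dt1) (L2, \<pi>2, dt2) ps" "iso_maps G S \<XX> (L2, \<pi>2, dt2) (L3, \<pi>3, dt3) ps'"
   using iff[OF ls(1,2)] iff[OF ls(2,3)] by blast
  from iso_maps_trans[OF this] show "linking_iso G S \<XX> (L1, \<pi>1, dt1) (L3, \<pi>3, dt3)" using iff[OF ls(1,3)] by blast
 qed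
qed

lemma linking_system_restrict:
 assumes L: "linking_system G S \<XX> L" and Y: "\<YY> \<subseteq> \<XX>" "linking_family G S \<YY>"
 shows "linking_system G S \<YY> (linking_restrict \<YY> L)"
proof -
 obtain L0 \<pi> dt where L0: "L = (L0, \<pi>, dt)" by (cases L) auto
 note ls = linking_systemD[OF L[unfolded L0]]
 note lm = linking_system_mor[OF L[unfolded L0]]
 have sub: "!!P. P : \<YY> ==> P : \<XX>" using Y(1) by blast
 show ?thesis
  unfolding L0 linking_restrict_def linking_system_def prod.case
 proof (intro conjI)
  show "category (full_subcat L0 \<YY>)"
   using ls(2,3) sub unfolding category_def full_subcat_def by simp
  show "is_cfunctor (full_subcat L0 \<YY>) (full_subcat (fusion_system G S) \<YY>) \<pi>"
   using ls(3,4,6) sub unfolding is_cfunctor_def full_subcat_def by simp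
  show "is_cfunctor (transporter_cat G S \<YY>) (full_subcat L0 \<YY>) dt"
   using ls(3,5,7) sub unfolding is_cfunctor_def full_subcat_def transporter_cat_def by simp
  show "ALL P:\<YY>. ALL Q:\<YY>.
    (ALL f:Mor (full_subcat L0 \<YY>) P Q. ALL z:center_of G P.
      comp (full_subcat L0 \<YY>) P P Q f (mor_map dt P P z) = f --> z = \<one>\<^bsub>G\<^esub>) &
    mor_map \<pi> P Q ` Mor (full_subcat L0 \<YY>) P Q = Mor (fusion_system G S) P Q &
    (ALL f:Mor (full_subcat L0 \<YY>) P Q. ALL f':Mor (full_subcat L0 \<YY>) P Q. mor_map \<pi> P Q f = mor_map \<pi> P Q f' <->
      (EX z:center_of G P. f' = comp (full_subcat L0 \<YY>) P P Q f (mor_map dt P P z)))"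
  proof (intro ballI conjI impI)
   fix P Q assume "P : \<YY>" "Q : \<YY>"
   hence P: "P : \<XX>" and Q: "Q : \<XX>" using sub by auto
   show "z = \<one>\<^bsub>G\<^esub>" if "f : Mor (full_subcat L0 \<YY>) P Q" "z : center_of G P" "comp (full_subcat L0 \<YY>) P P Q f (mor_map dt P P z) = f" for f z
    using ls(8)[OF P Q, of f z] that by (simp add: full_subcat_def)
   show "mor_map \<pi> P Q ` Mor (full_subcat L0 \<YY>) P Q = Mor (fusion_system G S) P Q"
    using ls(9)[OF P Q] by (simp add: full_subcat_def)
   show "mor_map \<pi> P Q f = mor_map \<pi> P Q f' <->
      (EX z:center_of G P. f' = comp (full_subcat L0 \<YY>) P P Q f (mor_map dt P P z))"
    if "f : Mor (full_subcat L0 \<YY>) P Q" "f' : Mor (full_subcat L0 \<YY>) P Q" for f f'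
    using ls(10)[OF P Q, of f f'] that by (simp add: full_subcat_def)
  qed
  show "ALL P:\<YY>. ALL Q:\<YY>. ALL f:Mor (full_subcat L0 \<YY>) P Q. ALL g:P.
    comp (full_subcat L0 \<YY>) P P Q f (mor_map dt P P g) =
     comp (full_subcat L0 \<YY>) P Q Q (mor_map dt Q Q (mor_map \<pi> P Q f g)) f"
   using ls(12) sub by (simp add: full_subcat_def)
 qed (use Y(2) ls(6,7,11) sub in \<open>simp_all add: full_subcat_def\<close>)
qed

lemma linking_iso_restrict:
 assumes G: "group G" and S: "subgroup S G"
  and L: "linking_system G S \<XX> L" "linking_system G S \<XX> L'" "linking_iso G S \<XX> L L'"
  and Y: "\<YY> \<subseteq> \<XX>" "linking_family G S \<YY>"
 shows "linking_iso G S \<YY> (linking_restrict \<YY> L) (linking_restrict \<YY> L')"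
proof -
 obtain L1 \<pi>1 dt1 where L1: "L = (L1, \<pi>1, dt1)" by (cases L) auto
 obtain L2 \<pi>2 dt2 where L2: "L' = (L2, \<pi>2, dt2)" by (cases L') auto
 obtain ps where ps: "iso_maps G S \<XX> (L1, \<pi>1, dt1) (L2, \<pi>2, dt2) ps"
  using linking_iso_iff[OF G S] L unfolding L1 L2 by blast
 have "iso_maps G S \<YY> (full_subcat L1 \<YY>, \<pi>1, dt1) (full_subcat L2 \<YY>, \<pi>2, dt2) ps"
  using ps Y(1) unfolding iso_maps_def prod.case full_subcat_def by (simp add: subset_iff)
 thus ?thesis
  using linking_iso_iff[OF G S] linking_system_restrict[OF L(1) Y] linking_system_restrict[OF L(2) Y]
  unfolding L1 L2 linking_restrict_def prod.case by blast
qed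

section \<open>Subgroups containing the kernel of an extension\<close>

text \<open>
  An extension \<open>G\<close> of \<open>\<Gamma>\<close> by the faithful module \<open>A\<close>.
\<close>

locale group_extension = coset_cochains \<Gamma> T A act + G: group G
 for \<Gamma> :: "('g, 'b) monoid_scheme" (structure) and T A and act :: "'g => 'a::ab_group_add => 'a" and G :: "('h, 'c) monoid_scheme" +
 fixes \<beta> :: "'h => 'g" and nv :: "'a => 'h"
 assumes \<beta>_hom: "\<beta> : hom G \<Gamma>" and \<beta>_surj: "\<beta> ` carrier G = carrier \<Gamma>"
  and nv_inj: "inj_on nv A" and nv_add: "u : A ==> v : A ==> nv (u + v) = nv u \<otimes>\<^bsub>G\<^esub> nv v"
  and nv_image: "nv ` A = {g : carrier G. \<beta> g = \<one>}"
  and nv_conj: "g : carrier G ==> u : A ==> g \<otimes>\<^bsub>G\<^esub> nv u \<otimes>\<^bsub>G\<^esub> inv\<^bsub>G\<^esub> g = nv (act (\<beta> g) u)"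
  and faithful: "a : carrier \<Gamma> ==> (!!u. u : A ==> act a u = u) ==> a = \<one>"

sublocale group_extension \<subseteq> \<beta>: group_hom G \<Gamma> \<beta>
 by unfold_locales (rule \<beta>_hom)

context group_extension
begin

abbreviation mulG (infixl "**" 70) where "x ** y \<equiv> x \<otimes>\<^bsub>G\<^esub> y"
abbreviation invG where "invG x \<equiv> inv\<^bsub>G\<^esub> x"

lemma nv_carrier [simp]: "u : A ==> nv u : carrier G" and \<beta>_nv [simp]: "u : A ==> \<beta> (nv u) = \<one>"
 using nv_image by blast+

lemma nv_ker: "g : carrier G ==> \<beta> g = \<one> ==> EX u:A. g = nv u"
 using nv_image by blast

lemma nv_zero [simp]: "nv 0 = \<one>\<^bsub>G\<^esub>"
 using nv_add[of 0 0] Acl(1) by (metis G.r_cancel_one' nv_carrier add_0)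

lemma nv_eq_iff: "u : A ==> v : A ==> nv u = nv v <-> u = v"
 using nv_inj by (auto dest: inj_onD)

lemma nv_uminus: assumes "u : A" shows "nv (- u) = invG (nv u)"
proof -
 have "nv (- u) ** nv u = \<one>\<^bsub>G\<^esub>" using nv_add[of "- u" u] assms Acl by simp
 thus ?thesis using assms Acl by (simp add: G.inv_equality)
qed

lemma nv_left: assumes "g : carrier G" "u : A" shows "g ** nv u = nv (act (\<beta> g) u) ** g"
proof -
 have "g ** nv u = g ** nv u ** invG g ** g" using assms by (simp add: G.m_assoc)
 thus ?thesis by (simp only: nv_conj[OF assms])
qed

lemma nv_right: assumes "g : carrier G" "u : A" shows "nv u ** g = g ** nv (act (inv (\<beta> g)) u)"
 using nv_left[OF assms(1), of "act (inv (\<beta> g)) u"] assms by (simp add: act_closed act_mult [symmetric] act_one)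

lemma nv_shift:
 assumes "h : carrier G" "g : carrier G" "u : A"
 shows "h ** nv u ** g = h ** g ** nv (act (inv (\<beta> g)) u)"
 using nv_right[OF assms(2,3)] assms by (simp add: G.m_assoc act_closed)

definition SS where "SS = {g : carrier G. \<beta> g : T}"

lemma T_carrier: "T \<subseteq> els"
 using T by (rule subgroup.subset)

lemma pre_subgroup: assumes "subgroup B \<Gamma>" shows "subgroup {g : carrier G. \<beta> g : B} G"
proof (rule G.subgroupI)
 have "\<one>\<^bsub>G\<^esub> : {g : carrier G. \<beta> g : B}" using subgroup.one_closed[OF assms] by simp
 thus "{g : carrier G. \<beta> g : B} ~= {}" by blast
qed (use assms in \<open>auto simp: subgroup.m_closed subgroup.m_inv_closed\<close>)

lemma SS_subgroup: "subgroup SS G"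
 unfolding SS_def using T by (rule pre_subgroup)

lemma SS_carrier: "SS \<subseteq> carrier G"
 by (auto simp: SS_def)

text \<open>
  The subgroups of \<open>S\<close> that contain \<open>A\<close>; \<open>bar\<close> and \<open>pre\<close> identify them with the subgroups of \<open>T\<close>.
\<close>

definition full where "full = {P : subgroups_of G SS. nv ` A \<subseteq> P}"
definition bar where "bar P = \<beta> ` P"
definition pre where "pre B = {g : carrier G. \<beta> g : B}"

lemma fullD: "P : full ==> subgroup P G" "P : full ==> P \<subseteq> SS" "P : full ==> P \<subseteq> carrier G" "P : full ==> u : A ==> nv u : P"
 by (auto simp: full_def subgroups_of_def dest: subgroup.subset)

lemma full_mem: assumes "P : full" shows "g : P <-> g : carrier G & \<beta> g : bar P"
proof
 assume "g : P" thus "g : carrier G & \<beta> g : bar P" using fullD(3)[OF assms] by (auto simp: bar_def)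
next
 assume g: "g : carrier G & \<beta> g : bar P"
 then obtain x where x: "x : P" "\<beta> g = \<beta> x" by (auto simp: bar_def)
 have xG: "x : carrier G" using x(1) fullD(3)[OF assms] by blast
 have "\<beta> (invG x ** g) = \<one>" using g x xG by simp
 then obtain u where "u : A" "invG x ** g = nv u" using nv_ker[of "invG x ** g"] g xG by auto
 hence "x ** (invG x ** g) : P" using fullD(1,4)[OF assms] x(1) by (simp add: subgroup.m_closed)
 thus "g : P" using g xG by (simp add: G.m_assoc [symmetric])
qed

lemma bar_subgroup: "P : full ==> subgroup (bar P) \<Gamma>"
 unfolding bar_def by (rule \<beta>.subgroup_img_is_subgroup) (rule fullD(1))

lemma bar_T: "P : full ==> bar P \<subseteq> T"
 using fullD(2) by (auto simp: bar_def SS_def)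

lemma pre_full: assumes "subgroup B \<Gamma>" "B \<subseteq> T" shows "pre B : full"
 using pre_subgroup[OF assms(1)] assms by (auto simp: full_def subgroups_of_def pre_def SS_def subgroup.one_closed)

lemma bar_pre: assumes "subgroup B \<Gamma>" shows "bar (pre B) = B"
proof -
 have "B \<subseteq> \<beta> ` carrier G" using \<beta>_surj subgroup.subset[OF assms] by simp
 thus ?thesis by (auto simp: bar_def pre_def)
qed

lemma pre_bar: "P : full ==> pre (bar P) = P"
 using full_mem by (auto simp: pre_def)

lemma lift_exists: "a : els ==> EX g:carrier G. \<beta> g = a"
 using \<beta>_surj by (metis imageE)

definition tr where "tr P Q = {g : carrier G. ALL x:P. g ** x ** invG g : Q}"

lemma trD: "g : tr P Q ==> g : carrier G" "g : tr P Q ==> x : P ==> g ** x ** invG g : Q"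
 by (simp_all add: tr_def)

lemma tr_comp: assumes "P : full" "g : tr P Q" "h : tr Q R" shows "h ** g : tr P R"
proof -
 have "h ** g ** x ** invG (h ** g) = h ** (g ** x ** invG g) ** invG h" if "x : P" for x
  using that fullD(3)[OF assms(1)] trD(1)[OF assms(2)] trD(1)[OF assms(3)] by (auto simp: G.inv_mult_group G.m_assoc)
 thus ?thesis using trD[OF assms(2)] trD[OF assms(3)] by (auto simp: tr_def)
qed

lemma tr_self: assumes "P : full" "p : P" shows "p : tr P P"
 using fullD(1,3)[OF assms(1)] assms(2) by (auto simp: tr_def subgroup.m_closed subgroup.m_inv_closed)

lemma tr_one: assumes "P : full" shows "\<one>\<^bsub>G\<^esub> : tr P P"
 by (rule tr_self[OF assms subgroup.one_closed[OF fullD(1)[OF assms]]])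

lemma transporter_SS: assumes "P : full" shows "g : transporter G SS P Q <-> g : SS & g : tr P Q"
 using SS_carrier by (auto simp: transporter_def tr_def conj_by_def)

definition Afix where "Afix P = {u : A. ALL a:bar P. act a u = u}"

lemma AfixD: "u : Afix P ==> u : A" "u : Afix P ==> p : P ==> act (\<beta> p) u = u"
 by (auto simp: Afix_def bar_def)

lemma Afix_commute: assumes "P : full" "u : Afix P" "p : P" shows "p ** nv u = nv u ** p"
 using nv_left[of p u] AfixD[OF assms(2)] assms(3) fullD(3)[OF assms(1)] by auto

lemma Afix_act_inv: assumes "P : full" "u : Afix P" "p : P" shows "act (inv (\<beta> p)) u = u"
 using AfixD(2)[OF assms(2), of "invG p"] assms fullD(1,3)[OF assms(1)] by (auto simp: subgroup.m_inv_closed)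

text \<open>
  By faithfulness, what centralizes \<open>A\<close> lies in \<open>A\<close>. This makes all overgroups of \<open>A\<close> centric, with the fixed points
  as centres.
\<close>

lemma centralizing_ker:
 assumes P: "P : full" and z: "z : carrier G" and c: "!!x. x : P ==> z ** x = x ** z"
 shows "EX u:Afix P. z = nv u"
proof -
 have "act (\<beta> z) u = u" if u: "u : A" for u
 proof -
  have "nv (act (\<beta> z) u) ** z = nv u ** z" using nv_left[OF z u] c[OF fullD(4)[OF P u]] by simp
  thus ?thesis using u z nv_eq_iff by (simp add: act_closed)
 qed
 hence "\<beta> z = \<one>" using faithful z by simp
 then obtain u where u: "u : A" "z = nv u" using nv_ker[OF z] by blast
 have "act a u = u" if "a : bar P" for a
 proof -
  from that obtain p where p: "p : P" "a = \<beta> p" by (auto simp: bar_def)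
  have pG: "p : carrier G" using p fullD(3)[OF P] by blast
  have "nv (act a u) ** p = nv u ** p" using c[OF p(1)] nv_left[OF pG u(1)] u(2) p(2) by simp
  thus ?thesis using u(1) pG nv_eq_iff p(2) by (simp add: act_closed)
 qed
 thus ?thesis using u by (auto simp: Afix_def)
qed

lemma center_full: assumes "P : full" shows "center_of G P = nv ` Afix P"
proof
 show "center_of G P \<subseteq> nv ` Afix P"
 proof
  fix z assume "z : center_of G P"
  hence z: "z : P" "!!x. x : P ==> z ** x = x ** z" by (simp_all add: center_of_def centralizer_in_def)
  have zG: "z : carrier G" using z(1) fullD(3)[OF assms] by blast
  show "z : nv ` Afix P" using centralizing_ker[OF assms zG z(2)] by blast
 qed
 show "nv ` Afix P \<subseteq> center_of G P"
  using Afix_commute[OF assms] fullD(4)[OF assms] AfixD(1) by (auto simp: center_of_def centralizer_in_def)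
qed

lemma centralizer_full: assumes "P : full" shows "centralizer_in G SS P \<subseteq> P"
proof
 fix z assume "z : centralizer_in G SS P"
 then obtain u where "u : Afix P" "z = nv u" using centralizing_ker[OF assms, of z] SS_carrier by (auto simp: centralizer_in_def)
 thus "z : P" using fullD(4)[OF assms] AfixD(1) by blast
qed

lemma fusion_Mor: "Mor (fusion_system G SS) P Q = (%g. restrict (conj_by G g) P) ` tr P Q"
proof
 show "Mor (fusion_system G SS) P Q \<subseteq> (%g. restrict (conj_by G g) P) ` tr P Q"
 proof
  fix \<phi> assume "\<phi> : Mor (fusion_system G SS) P Q"
  then obtain g where g: "\<phi> : extensional P" "g : carrier G" "!!x. x : P ==> \<phi> x = conj_by G g x & \<phi> x : Q"
   by (auto simp: fusion_system_def)
  have "\<phi> = restrict (conj_by G g) P" using g by (intro extensionalityI[where A = P]) auto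
  moreover have "g ** x ** invG g : Q" if "x : P" for x using g(3)[OF that] unfolding conj_by_def by metis
  hence "g : tr P Q" using g(2) by (simp add: tr_def)
  ultimately show "\<phi> : (%g. restrict (conj_by G g) P) ` tr P Q" by blast
 qed
 show "(%g. restrict (conj_by G g) P) ` tr P Q \<subseteq> Mor (fusion_system G SS) P Q"
  by (auto simp: fusion_system_def tr_def conj_by_def)
qed

lemma conj_compose:
 assumes P: "P : full" and g: "g : tr P Q" and h: "h : tr Q R"
 shows "compose P (restrict (conj_by G h) Q) (restrict (conj_by G g) P) = restrict (conj_by G (h ** g)) P"
 unfolding compose_def
proof (rule restrict_ext)
 fix x assume x: "x : P"
 have "x : carrier G" using x fullD(3)[OF P] by blast
 hence "conj_by G (h ** g) x = conj_by G h (conj_by G g x)"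
  using trD(1)[OF g] trD(1)[OF h] by (simp add: conj_by_def G.inv_mult_group G.m_assoc)
 moreover have "conj_by G g x : Q" using trD(2)[OF g x] by (simp add: conj_by_def)
 ultimately show "restrict (conj_by G h) Q (restrict (conj_by G g) P x) = conj_by G (h ** g) x" using x by simp
qed

lemma conj_restrict_eq:
 assumes P: "P : full" and g: "g : carrier G" "g' : carrier G"
 shows "restrict (conj_by G g) P = restrict (conj_by G g') P <-> (EX u:Afix P. g' = g ** nv u)"
proof
 assume eq: "restrict (conj_by G g) P = restrict (conj_by G g') P"
 have "(invG g ** g') ** x = x ** (invG g ** g')" if x: "x : P" for x
 proof -
  have xG: "x : carrier G" using x fullD(3)[OF P] by blast
  have "g ** x ** invG g = g' ** x ** invG g'" using fun_cong[OF eq, of x] x by (simp add: conj_by_def)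
  hence "invG g ** (g ** x ** invG g) ** g' = invG g ** (g' ** x ** invG g') ** g'" by simp
  moreover have "invG g ** (g ** x ** invG g) ** g' = x ** (invG g ** g')"
   using g xG by (simp add: G.m_assoc [symmetric])
  moreover have "invG g ** (g' ** x ** invG g') ** g' = (invG g ** g') ** x"
   using g xG by (simp add: G.m_assoc)
  ultimately show ?thesis by simp
 qed
 then obtain u where u: "u : Afix P" "invG g ** g' = nv u" using centralizing_ker[OF P, of "invG g ** g'"] g by auto
 hence "g' = g ** nv u" using g by (simp add: u(2) [symmetric] G.m_assoc [symmetric])
 thus "EX u:Afix P. g' = g ** nv u" using u(1) by blast
next
 assume "EX u:Afix P. g' = g ** nv u"
 then obtain u where u: "u : Afix P" "g' = g ** nv u" by blast
 show "restrict (conj_by G g) P = restrict (conj_by G g') P"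
 proof (rule restrict_ext)
  fix x assume x: "x : P"
  have xG: "x : carrier G" "nv u : carrier G" using x fullD(3)[OF P] AfixD(1)[OF u(1)] by auto
  have "g' ** x ** invG g' = g ** (nv u ** x) ** invG (nv u) ** invG g"
   using g xG u(2) by (simp add: G.inv_mult_group G.m_assoc)
  also have "... = g ** x ** invG g"
   unfolding Afix_commute[OF P u(1) x, symmetric] using g xG by (simp add: G.m_assoc)
  finally show "conj_by G g x = conj_by G g' x" by (simp add: conj_by_def)
 qed
qed

lemma tr_nv: assumes "P : full" "g : tr P Q" "u : A" shows "g ** nv u : tr P Q"
 by (rule tr_comp[OF assms(1) tr_self[OF assms(1) fullD(4)[OF assms(1,3)]] assms(2)])

text \<open>
  The end of the chain that represents a transporter element: the pair of \<open>P\<close> at the unit and \<open>Q\<close> at \<open>g\<close> represents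
  \<open>g\<close> as an element from \<open>P\<close> to \<open>Q\<close>, up to left multiplication by \<open>Q\<close> (\<open>qp_eq\<close>).
\<close>

definition qp where "qp P g = (bar P, inv (\<beta> g) <# bar P)"

lemma qp_pts: "P : full ==> g : carrier G ==> qp P g : pts"
 unfolding qp_def by (intro ptsI bar_subgroup bar_T) simp_all

lemma mv_qp: "P : full ==> g : carrier G ==> x : carrier G ==> mv (inv (\<beta> x)) (qp P g) = qp P (g ** x)"
 unfolding qp_def by (simp add: mv_pt bar_subgroup inv_mult_group)

lemma qp_eq: assumes P: "P : full" and g: "g : carrier G" "g' : carrier G" shows "qp P g = qp P g' <-> g' ** invG g : P"
proof -
 have "qp P g = qp P g' <-> \<beta> (g ** invG g') : bar P"
  unfolding qp_def using lcoset_eq_iff[OF bar_subgroup[OF P], of "inv (\<beta> g)" "inv (\<beta> g')"] g by simp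
 also have "... <-> g ** invG g' : P" using full_mem[OF P, of "g ** invG g'"] g by simp
 also have "... <-> g' ** invG g : P"
  using subgroup.m_inv_closed[OF fullD(1)[OF P], of "g ** invG g'"] subgroup.m_inv_closed[OF fullD(1)[OF P], of "g' ** invG g"] g
  by (auto simp: G.inv_mult_group)
 finally show ?thesis .
qed

lemma qp_nv: "P : full ==> g : carrier G ==> u : A ==> qp P (g ** nv u) = qp P g"
 by (simp add: qp_def)

lemma qp_left: assumes "P : full" "p : P" "g : carrier G" shows "qp P (p ** g) = qp P g"
proof -
 have p: "p : carrier G" using assms fullD(3) by blast
 have "p ** g ** invG g = p" using assms p by (simp add: G.m_assoc)
 thus ?thesis using qp_eq[OF assms(1), of g "p ** g"] assms p by simp
qed

lemma qp_self: "P : full ==> p : P ==> qp P p = qp P \<one>\<^bsub>G\<^esub>"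
 using qp_left[of P p "\<one>\<^bsub>G\<^esub>"] subsetD[OF fullD(3), of P p] by simp

text \<open>
  The stabilizer of \<open>qp P g\<close> is the conjugate of \<open>P\<close> by the inverse of \<open>g\<close>, modulo \<open>A\<close>.
\<close>

lemma sle_qp: assumes P: "P : full" and Q: "Q : full" and g: "g : carrier G" "k : carrier G"
 shows "sle (qp P g) (qp Q k) <-> k ** invG g : tr P Q"
proof -
 have st: "\<beta> y : stab (qp P' g') <-> g' ** y ** invG g' : P'" if "P' : full" "g' : carrier G" "y : carrier G" for P' g' y
  using stab_pt[OF bar_subgroup[OF that(1)], of "inv (\<beta> g')" "\<beta> y"] full_mem[OF that(1), of "g' ** y ** invG g'"] that
  by (simp add: qp_def)
 have eq: "(k ** invG g) ** (g ** y ** invG g) ** invG (k ** invG g) = k ** y ** invG k" if "y : carrier G" for y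
 proof -
  have "(k ** invG g) ** (g ** y ** invG g) ** invG (k ** invG g) = k ** (invG g ** g) ** y ** (invG g ** g) ** invG k"
   using g that by (simp only: G.inv_mult_group G.inv_inv G.m_assoc G.m_closed G.inv_closed)
  thus ?thesis using g that by simp
 qed
 show ?thesis
 proof
  assume le: "sle (qp P g) (qp Q k)"
  have "(k ** invG g) ** x ** invG (k ** invG g) : Q" if x: "x : P" for x
  proof -
   have xG: "x : carrier G" using x fullD(3)[OF P] by blast
   define y where "y = invG g ** x ** g"
   have y: "y : carrier G" "g ** y ** invG g = x" using xG g by (simp_all add: y_def G.m_assoc) (simp add: G.m_assoc [symmetric])
   have "\<beta> y : stab (qp P g)" using st[OF P g(1) y(1)] y(2) x by simp
   hence "\<beta> y : stab (qp Q k)" using le by (auto simp: sle_def)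
   thus ?thesis using st[OF Q g(2) y(1)] eq[OF y(1)] y(2) by simp
  qed
  thus "k ** invG g : tr P Q" using g by (simp add: tr_def)
 next
  assume t: "k ** invG g : tr P Q"
  show "sle (qp P g) (qp Q k)"
   unfolding sle_def
  proof
   fix a assume a: "a : stab (qp P g)"
   then obtain y where y: "y : carrier G" "a = \<beta> y" using lift_exists stab_carrier by blast
   have "g ** y ** invG g : P" using st[OF P g(1) y(1)] a y(2) by simp
   from trD(2)[OF t this] show "a : stab (qp Q k)" using st[OF Q g(2) y(1)] eq[OF y(1)] y(2) by simp
  qed
 qed
qed

lemma top_qp_eq: assumes P: "P : full" and Q: "Q : full" and g: "g : carrier G" "k : carrier G"
 shows "top_pt (qp P g) = top_pt (qp Q k) <-> k ** invG g : SS"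
proof -
 have t: "top_pt (qp P' g') = (T, inv (\<beta> g') <# T)" if "P' : full" "g' : carrier G" for P' g'
  unfolding qp_def using that by (simp add: top_pt bar_subgroup bar_T)
 have "top_pt (qp P g) = top_pt (qp Q k) <-> \<beta> g \<otimes> inv (\<beta> k) : T"
  unfolding t[OF P g(1)] t[OF Q g(2)] using lcoset_eq_iff[OF T, of "inv (\<beta> g)" "inv (\<beta> k)"] g by simp
 also have "... <-> \<beta> k \<otimes> inv (\<beta> g) : T"
  using subgroup.m_inv_closed[OF T, of "\<beta> g \<otimes> inv (\<beta> k)"] subgroup.m_inv_closed[OF T, of "\<beta> k \<otimes> inv (\<beta> g)"] g
  by (auto simp: inv_mult_group)
 finally show ?thesis using g by (simp add: SS_def)
qed

lemma stab_fixes_K1: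
 assumes v: "K1 V v" and c: "ch2 V e0 e1" and a: "a : stab e0" shows "act a (v e0 e1) = v e0 e1"
proof -
 have "a : stab e1" "a : els" using a c stab_carrier[of e0] by (auto simp: chs sle_def)
 thus ?thesis using K1D(2)[OF v c, of a] stab_fix a by simp
qed

lemma stab_fixes_K2:
 assumes t: "K2 V t" and c: "ch3 V e0 e1 e2" and a: "a : stab e0" shows "act a (t e0 e1 e2) = t e0 e1 e2"
proof -
 have "a : stab e1" "a : stab e2" "a : els" using a c stab_carrier[of e0] by (auto simp: chs sle_def)
 thus ?thesis using K2D(2)[OF t c, of a] stab_fix a by simp
qed

lemma NZ2_degenerate:
 assumes V: "up_family V" and t: "t : NZ2 V" and c: "ch2 V e0 e1"
 shows "t e0 e0 e1 = 0" "t e0 e1 e1 = 0"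
proof -
 have e: "ch4 V e0 e0 e0 e1" "ch4 V e0 e1 e1 e1" "ch3 V e0 e0 e0" "ch3 V e1 e1 e1" using c by (auto simp: chs sle_def)
 have z: "t e0 e0 e0 = 0" "t e1 e1 e1 = 0" using t e(3,4) by (simp_all add: NZ2_def N2_def)
 have "D2 t e0 e0 e0 e1 = 0" "D2 t e0 e1 e1 e1 = 0" using t e(1,2) by (simp_all add: NZ2_def)
 thus "t e0 e0 e1 = 0" "t e0 e1 e1 = 0" using z by (simp_all add: D2_def)
qed

end

text \<open>
  Closure under conjugation is only asked for conjugates that are again overgroups of \<open>A\<close> in \<open>S\<close>; by
  \<open>fusion_conj\<close> this covers all subgroups that fuse to a member of the family.
\<close>

locale linking_setup = group_extension \<Gamma> T A act G \<beta> nv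
 for \<Gamma> :: "('g, 'b) monoid_scheme" (structure) and T A and act :: "'g => 'a::ab_group_add => 'a"
  and G :: "('h, 'c) monoid_scheme" and \<beta> :: "'h => 'g" and nv :: "'a => 'h" +
 fixes \<XX> :: "'h set set"
 assumes XX_full: "\<XX> \<subseteq> full" and XX_nonempty: "\<XX> ~= {}"
  and XX_up: "P : \<XX> ==> Q : full ==> P \<subseteq> Q ==> Q : \<XX>"
  and XX_conj: "P : \<XX> ==> g : carrier G ==> Q : full ==> conj_by G g ` P = Q ==> Q : \<XX>"
begin

lemma XXf: "P : \<XX> ==> P : full"
 using XX_full by blast

lemma fusion_conj:
 assumes "P : full" "Q : subgroups_of G SS" "isomorphic_in (fusion_system G SS) P Q"
 shows "Q : full & (EX g:carrier G. conj_by G g ` P = Q)"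
proof -
 from assms(3) obtain f f' where f: "f : Mor (fusion_system G SS) P Q" "f' : Mor (fusion_system G SS) Q P"
   and eq: "comp (fusion_system G SS) Q P Q f f' = ident (fusion_system G SS) Q" unfolding isomorphic_in_def by blast
 from f obtain g g' where g: "g : tr P Q" "f = restrict (conj_by G g) P" and g': "g' : tr Q P" "f' = restrict (conj_by G g') Q"
  unfolding fusion_Mor by blast
 have "y : conj_by G g ` P" if y: "y : Q" for y
 proof -
  have "f' y : P" using y g' by (simp add: conj_by_def trD(2))
  moreover have "compose Q f f' y = y" using eq y by (simp add: fusion_system_def)
  hence "f (f' y) = y" using y by (simp add: compose_def)
  ultimately show ?thesis using g(2) by (intro image_eqI[of _ _ "f' y"]) simp_all
 qed
 hence im: "conj_by G g ` P = Q" using trD(2)[OF g(1)] by (auto simp: conj_by_def)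
 have "nv u : Q" if u: "u : A" for u
 proof -
  have gG: "g : carrier G" by (rule trD(1)[OF g(1)])
  have "conj_by G g (nv (act (inv (\<beta> g)) u)) = nv u"
   using nv_conj[OF gG, of "act (inv (\<beta> g)) u"] u gG by (simp add: conj_by_def act_closed act_mult [symmetric] act_one)
  moreover have "nv (act (inv (\<beta> g)) u) : P" using fullD(4)[OF assms(1)] u gG by (simp add: act_closed)
  ultimately show ?thesis using im by (metis imageI)
 qed
 thus ?thesis using assms(2) im trD(1)[OF g(1)] by (auto simp: full_def)
qed

lemma XX_linking_family: "linking_family G SS \<XX>"
 unfolding linking_family_def
proof (intro conjI ballI impI)
 show "\<XX> ~= {}" by (rule XX_nonempty)
 show "\<XX> \<subseteq> centric_subgroups G SS"
 proof
  fix P assume P: "P : \<XX>"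
  hence "P : subgroups_of G SS" using XXf by (auto simp: full_def)
  thus "P : centric_subgroups G SS"
   using fusion_conj[OF XXf[OF P]] centralizer_full by (auto simp: centric_subgroups_def)
 qed
 fix P Q assume P: "P : \<XX>" and Q: "Q : subgroups_of G SS"
 show "Q : \<XX>" if "isomorphic_in (fusion_system G SS) P Q"
  using fusion_conj[OF XXf[OF P] Q that] XX_conj[OF P] by blast
 show "Q : \<XX>" if "P \<subseteq> Q"
 proof -
  have "Q : full" using Q that XXf[OF P] by (auto simp: full_def)
  thus ?thesis using XX_up[OF P _ that] by blast
 qed
qed

definition V where "V = {e : pts. pre (fst e) : \<XX>}"

lemma qp_V: "P : \<XX> ==> g : carrier G ==> qp P g : V"
 using qp_pts[of P g] XXf[of P] by (simp add: V_def) (simp add: qp_def pre_bar)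

lemma V_qp: assumes "e : V" shows "EX P:\<XX>. EX x:carrier G. e = qp P x"
proof -
 from assms have "e : pts" "pre (fst e) : \<XX>" by (auto simp: V_def)
 from this(1) obtain B a where B: "subgroup B \<Gamma>" "B \<subseteq> T" "a : els" "e = (B, a <# B)" by (rule ptsE)
 obtain x where x: "x : carrier G" "\<beta> x = inv a" using lift_exists[of "inv a"] B(3) by auto
 have "e = qp (pre B) x" using B x by (simp add: qp_def bar_pre)
 moreover have "pre B : \<XX>" using \<open>pre (fst e) : \<XX>\<close> B(4) by simp
 ultimately show ?thesis using x(1) by (intro bexI[of _ "pre B"] bexI[of _ x])
qed

lemma V_up: "up_family V"
 unfolding up_family_def
proof (intro conjI ballI impI)
 show "V \<subseteq> pts" by (auto simp: V_def)
 show "mv g e : V" if "g : els" "e : V" for g e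
  using that by (simp add: V_def mv_pts) (simp add: mv_def)
 fix e e' assume e: "e : V" "e' : pts" "sle e e'"
 obtain P x where P: "P : \<XX>" "x : carrier G" "e = qp P x" using V_qp[OF e(1)] by blast
 from e(2) obtain B a where B: "subgroup B \<Gamma>" "B \<subseteq> T" "a : els" "e' = (B, a <# B)" by (rule ptsE)
 obtain y where y: "y : carrier G" "\<beta> y = inv a" using lift_exists[of "inv a"] B(3) by auto
 define Q where "Q = pre B"
 have Q: "Q : full" unfolding Q_def by (rule pre_full[OF B(1,2)])
 have e': "e' = qp Q y" using B y by (simp add: qp_def bar_pre Q_def)
 define c where "c = y ** invG x"
 have c: "c : tr P Q" using e(3) sle_qp[OF XXf[OF P(1)] Q P(2) y(1)] unfolding P(3) e' c_def by simp
 have cG: "c : carrier G" by (rule trD(1)[OF c])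
 note Pf = XXf[OF P(1)]
 define P' where "P' = conj_by G c ` P"
 have P'Q: "P' \<subseteq> Q" using trD(2)[OF c] by (auto simp: P'_def conj_by_def)
 have "subgroup P' G"
 proof (rule G.subgroupI)
  show "P' \<subseteq> carrier G" using P'Q fullD(3)[OF Q] by blast
  show "P' ~= {}" using subgroup.one_closed[OF fullD(1)[OF Pf]] by (auto simp: P'_def)
  show "invG a : P'" if "a : P'" for a
  proof -
   from that obtain p where p: "p : P" "a = c ** p ** invG c" by (auto simp: P'_def conj_by_def)
   have "invG a = c ** invG p ** invG c" using p cG fullD(3)[OF Pf] by (auto simp: G.inv_mult_group G.m_assoc)
   thus ?thesis using subgroup.m_inv_closed[OF fullD(1)[OF Pf] p(1)] by (auto simp: P'_def conj_by_def)
  qed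
  show "a ** b : P'" if "a : P'" "b : P'" for a b
  proof -
   from that obtain p q where p: "p : P" "a = c ** p ** invG c" "q : P" "b = c ** q ** invG c" by (auto simp: P'_def conj_by_def)
   have pq: "p : carrier G" "q : carrier G" using p fullD(3)[OF Pf] by auto
   have "a ** b = c ** p ** (invG c ** c) ** q ** invG c"
    unfolding p(2,4) using cG pq by (simp only: G.m_assoc G.m_closed G.inv_closed)
   hence "a ** b = c ** (p ** q) ** invG c" using cG pq by (simp add: G.m_assoc)
   thus ?thesis using subgroup.m_closed[OF fullD(1)[OF Pf] p(1,3)] by (auto simp: P'_def conj_by_def)
  qed
 qed
 moreover have "nv u : P'" if u: "u : A" for u
 proof -
  have "conj_by G c (nv (act (inv (\<beta> c)) u)) = nv u"
   using nv_conj[OF cG, of "act (inv (\<beta> c)) u"] u cG by (simp add: conj_by_def act_closed act_mult [symmetric] act_one)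
  moreover have "nv (act (inv (\<beta> c)) u) : P" using fullD(4)[OF Pf] u cG by (simp add: act_closed)
  ultimately show ?thesis unfolding P'_def by (metis imageI)
 qed
 ultimately have "P' : full" using P'Q fullD(2)[OF Q] by (auto simp: full_def subgroups_of_def)
 hence "P' : \<XX>" using XX_conj[OF P(1) cG] by (simp add: P'_def)
 hence "Q : \<XX>" using XX_up Q P'Q by blast
 thus "e' : V" using qp_V y(1) e' by simp
qed

lemma ch2_qp: "P : \<XX> ==> Q : \<XX> ==> x : carrier G ==> g : tr P Q ==> ch2 V (qp P x) (qp Q (g ** x))"
 using sle_qp[of P Q x "g ** x"] trD(1)[of g P Q] XXf by (simp add: ch2_def qp_V G.m_assoc)

lemma ch3_qp: "P : \<XX> ==> Q : \<XX> ==> R : \<XX> ==> x : carrier G ==> g : tr P Q ==> h : tr Q R ==>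
  ch3 V (qp P x) (qp Q (g ** x)) (qp R (h ** g ** x))"
 using ch2_qp[of P Q x g] ch2_qp[of Q R "g ** x" h] trD(1)[of g P Q] trD(1)[of h Q R] by (simp add: ch3_def G.m_assoc)

lemma ch4_qp: "P : \<XX> ==> Q : \<XX> ==> R : \<XX> ==> U : \<XX> ==> x : carrier G ==> g : tr P Q ==> h : tr Q R ==> k : tr R U ==>
  ch4 V (qp P x) (qp Q (g ** x)) (qp R (h ** g ** x)) (qp U (k ** h ** g ** x))"
 using ch3_qp[of P Q R x g h] ch2_qp[of R U "h ** g ** x" k] trD(1)[of g P Q] trD(1)[of h Q R] trD(1)[of k R U]
 by (simp add: ch4_def G.m_assoc)

lemma ch2_qpE:
 assumes "ch2 V e0 e1" "e0 = qp P x" "P : \<XX>" "x : carrier G"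
 shows "EX Q:\<XX>. EX g:tr P Q. e1 = qp Q (g ** x)"
proof -
 obtain Q y where Q: "Q : \<XX>" "y : carrier G" "e1 = qp Q y" using V_qp[of e1] assms(1) by (auto simp: ch2_def)
 have "y ** invG x : tr P Q" using sle_qp[OF XXf[OF assms(3)] XXf[OF Q(1)] assms(4) Q(2)] assms(1,2) Q(3) by (simp add: ch2_def)
 moreover have "y ** invG x ** x = y" using Q(2) assms(4) by (simp add: G.m_assoc)
 ultimately show ?thesis using Q by metis
qed

lemma ch2_cases:
 assumes "ch2 V e0 e1"
 obtains P Q x g where "P : \<XX>" "Q : \<XX>" "x : carrier G" "g : tr P Q" "e0 = qp P x" "e1 = qp Q (g ** x)"
proof -
 obtain P x where "P : \<XX>" "x : carrier G" "e0 = qp P x" using V_qp[of e0] assms by (auto simp: ch2_def)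
 thus ?thesis using ch2_qpE[OF assms] that by blast
qed

lemma ch3_cases:
 assumes "ch3 V e0 e1 e2"
 obtains P Q R x g h where "P : \<XX>" "Q : \<XX>" "R : \<XX>" "x : carrier G" "g : tr P Q" "h : tr Q R"
  "e0 = qp P x" "e1 = qp Q (g ** x)" "e2 = qp R (h ** g ** x)"
proof -
 have c: "ch2 V e0 e1" "ch2 V e1 e2" using assms by (auto simp: ch3_def)
 from c(1) obtain P Q x g where 1: "P : \<XX>" "Q : \<XX>" "x : carrier G" "g : tr P Q" "e0 = qp P x" "e1 = qp Q (g ** x)" by (rule ch2_cases)
 have gx: "g : carrier G" "g ** x : carrier G" using 1(3) trD(1)[OF 1(4)] by simp_all
 obtain R h where R: "R : \<XX>" "h : tr Q R" "e2 = qp R (h ** (g ** x))" using ch2_qpE[OF c(2) 1(6,2) gx(2)] by blast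
 have "h ** (g ** x) = h ** g ** x" using trD(1)[OF R(2)] gx(1) 1(3) by (simp add: G.m_assoc)
 thus ?thesis using that 1 R by metis
qed

lemma ch4_cases:
 assumes "ch4 V e0 e1 e2 e3"
 obtains P Q R U x g h k where "P : \<XX>" "Q : \<XX>" "R : \<XX>" "U : \<XX>" "x : carrier G" "g : tr P Q" "h : tr Q R" "k : tr R U"
  "e0 = qp P x" "e1 = qp Q (g ** x)" "e2 = qp R (h ** g ** x)" "e3 = qp U (k ** h ** g ** x)"
proof -
 have c: "ch3 V e0 e1 e2" "ch2 V e2 e3" using assms by (auto simp: ch4_def)
 from c(1) obtain P Q R x g h where 1: "P : \<XX>" "Q : \<XX>" "R : \<XX>" "x : carrier G" "g : tr P Q" "h : tr Q R"
  "e0 = qp P x" "e1 = qp Q (g ** x)" "e2 = qp R (h ** g ** x)" by (rule ch3_cases)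
 have gx: "g : carrier G" "h : carrier G" "h ** g ** x : carrier G" using 1(4) trD(1)[OF 1(5)] trD(1)[OF 1(6)] by simp_all
 obtain U k where U: "U : \<XX>" "k : tr R U" "e3 = qp U (k ** (h ** g ** x))" using ch2_qpE[OF c(2) 1(9,3) gx(3)] by blast
 have "k ** (h ** g ** x) = k ** h ** g ** x" using trD(1)[OF U(2)] gx 1(4) by (simp add: G.m_assoc)
 thus ?thesis using that 1 U by metis
qed

lemma K2_Afix:
 assumes t: "K2 V t" and P: "P : \<XX>" "Q : \<XX>" "R : \<XX>" "g : tr P Q" "h : tr Q R"
 shows "t (qp P \<one>\<^bsub>G\<^esub>) (qp Q g) (qp R (h ** g)) : Afix P"
proof -
 have G': "g : carrier G" "h : carrier G" using trD(1)[OF P(4)] trD(1)[OF P(5)] by auto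
 have c: "ch3 V (qp P \<one>\<^bsub>G\<^esub>) (qp Q g) (qp R (h ** g))" using ch3_qp[OF P(1-3) G.one_closed P(4,5)] G' by simp
 have "a : stab (qp P \<one>\<^bsub>G\<^esub>)" if "a : bar P" for a
 proof -
  have "a : els" using that subgroup.subset[OF bar_subgroup[OF XXf[OF P(1)]]] by blast
  thus ?thesis unfolding qp_def using stab_pt[OF bar_subgroup[OF XXf[OF P(1)]], of "inv (\<beta> \<one>\<^bsub>G\<^esub>)" a] that by simp
 qed
 thus ?thesis using K2D(1)[OF t c] stab_fixes_K2[OF t c] by (simp add: Afix_def)
qed

lemma K1_Afix:
 assumes t: "K1 V t" and P: "P : \<XX>" "Q : \<XX>" "g : tr P Q"
 shows "t (qp P \<one>\<^bsub>G\<^esub>) (qp Q g) : Afix P"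
proof -
 have G': "g : carrier G" using trD(1)[OF P(3)] by auto
 have c: "ch2 V (qp P \<one>\<^bsub>G\<^esub>) (qp Q g)" using ch2_qp[OF P(1,2) G.one_closed P(3)] G' by simp
 have "a : stab (qp P \<one>\<^bsub>G\<^esub>)" if "a : bar P" for a
 proof -
  have "a : els" using that subgroup.subset[OF bar_subgroup[OF XXf[OF P(1)]]] by blast
  thus ?thesis unfolding qp_def using stab_pt[OF bar_subgroup[OF XXf[OF P(1)]], of "inv (\<beta> \<one>\<^bsub>G\<^esub>)" a] that by simp
 qed
 thus ?thesis using K1D(1)[OF t c] stab_fixes_K1[OF t c] by (simp add: Afix_def)
qed

lemma K1_qp: assumes t: "K1 V t" and P: "P : \<XX>" "Q : \<XX>" "g : tr P Q" "x : carrier G"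
 shows "t (qp P x) (qp Q (g ** x)) = act (inv (\<beta> x)) (t (qp P \<one>\<^bsub>G\<^esub>) (qp Q g))"
proof -
 have G': "g : carrier G" using trD(1)[OF P(3)] by auto
 have c: "ch2 V (qp P \<one>\<^bsub>G\<^esub>) (qp Q g)" using ch2_qp[OF P(1,2) G.one_closed P(3)] G' by simp
 show ?thesis using K1D(2)[OF t c, of "inv (\<beta> x)"] P(4) G' mv_qp[OF XXf[OF P(1)] G.one_closed P(4)] mv_qp[OF XXf[OF P(2)] G' P(4)] by simp
qed

lemma K2_qp: assumes t: "K2 V t" and P: "P : \<XX>" "Q : \<XX>" "R : \<XX>" "g : tr P Q" "h : tr Q R" "x : carrier G"
 shows "t (qp P x) (qp Q (g ** x)) (qp R (h ** g ** x)) = act (inv (\<beta> x)) (t (qp P \<one>\<^bsub>G\<^esub>) (qp Q g) (qp R (h ** g)))"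
proof -
 have G': "g : carrier G" "h : carrier G" using trD(1)[OF P(4)] trD(1)[OF P(5)] by auto
 have c: "ch3 V (qp P \<one>\<^bsub>G\<^esub>) (qp Q g) (qp R (h ** g))" using ch3_qp[OF P(1-3) G.one_closed P(4,5)] G' by simp
 show ?thesis
  using K2D(2)[OF t c, of "inv (\<beta> x)"] P(6) G' mv_qp[OF XXf[OF P(1)] G.one_closed P(6)] mv_qp[OF XXf[OF P(2)] G'(1) P(6)]
   mv_qp[OF XXf[OF P(3)] _ P(6), of "h ** g"] by simp
qed

lemma qp_determined:
 assumes P: "P : \<XX>" "P' : \<XX>" "x : carrier G" "x' : carrier G" "qp P x = qp P' x'"
 shows "P' = P" "EX p:P. x' = p ** x"
proof -
 have "bar P = bar P'" using assms(5) by (simp add: qp_def)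
 thus "P' = P" using pre_bar[OF XXf[OF P(1)]] pre_bar[OF XXf[OF P(2)]] by metis
 hence "x' ** invG x : P" using qp_eq[OF XXf[OF P(1)] P(3,4)] P(5) by simp
 moreover have "x' = x' ** invG x ** x" using P(3,4) by (simp add: G.m_assoc)
 ultimately show "EX p:P. x' = p ** x" by blast
qed

text \<open>
  A function of two composable transporter elements is an equivariant cochain as soon as it is fixed by the source and
  invariant under the elements of the three subgroups, since chains are translates of those that start at the unit.
\<close>

lemma descend_2:
 assumes w: "!!P Q R g h. P : \<XX> ==> Q : \<XX> ==> R : \<XX> ==> g : tr P Q ==> h : tr Q R ==> w P Q R h g : Afix P"
  and inv: "!!P Q R g h r y p. P : \<XX> ==> Q : \<XX> ==> R : \<XX> ==> g : tr P Q ==> h : tr Q R ==> r : R ==> y : Q ==> p : P ==>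
    w P Q R (r ** h ** invG y) (y ** g ** invG p) = w P Q R h g"
 shows "EX t. K2 V t & (ALL P:\<XX>. ALL Q:\<XX>. ALL R:\<XX>. ALL g:tr P Q. ALL h:tr Q R.
   t (qp P \<one>\<^bsub>G\<^esub>) (qp Q g) (qp R (h ** g)) = w P Q R h g)"
proof -
 define v where "v e0 e1 e2 = (SOME u. EX P:\<XX>. EX Q:\<XX>. EX R:\<XX>. EX x:carrier G. EX g:tr P Q. EX h:tr Q R.
  e0 = qp P x & e1 = qp Q (g ** x) & e2 = qp R (h ** g ** x) & u = act (inv (\<beta> x)) (w P Q R h g))" for e0 e1 e2
 have v: "v (qp P x) (qp Q (g ** x)) (qp R (h ** g ** x)) = act (inv (\<beta> x)) (w P Q R h g)"
  if P: "P : \<XX>" "Q : \<XX>" "R : \<XX>" "x : carrier G" "g : tr P Q" "h : tr Q R" for P Q R x g h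
  unfolding v_def
 proof (rule some_equality)
  show "EX P':\<XX>. EX Q':\<XX>. EX R':\<XX>. EX x':carrier G. EX g':tr P' Q'. EX h':tr Q' R'. qp P x = qp P' x' & qp Q (g ** x) = qp Q' (g' ** x') &
    qp R (h ** g ** x) = qp R' (h' ** g' ** x') & act (inv (\<beta> x)) (w P Q R h g) = act (inv (\<beta> x')) (w P' Q' R' h' g')" using P by blast
  fix u assume "EX P':\<XX>. EX Q':\<XX>. EX R':\<XX>. EX x':carrier G. EX g':tr P' Q'. EX h':tr Q' R'. qp P x = qp P' x' & qp Q (g ** x) = qp Q' (g' ** x') &
    qp R (h ** g ** x) = qp R' (h' ** g' ** x') & u = act (inv (\<beta> x')) (w P' Q' R' h' g')"
  then obtain P' Q' R' x' g' h' where P': "P' : \<XX>" "Q' : \<XX>" "R' : \<XX>" "x' : carrier G" "g' : tr P' Q'" "h' : tr Q' R'" "qp P x = qp P' x'"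
   "qp Q (g ** x) = qp Q' (g' ** x')" "qp R (h ** g ** x) = qp R' (h' ** g' ** x')" "u = act (inv (\<beta> x')) (w P' Q' R' h' g')" by blast
  have gG: "g : carrier G" "g' : carrier G" "g ** x : carrier G" "g' ** x' : carrier G" "h : carrier G" "h' : carrier G"
   "h ** g ** x : carrier G" "h' ** g' ** x' : carrier G" using P P' by (auto dest: trD(1))
  note PP = qp_determined[OF P(1) P'(1) P(4) P'(4,7)] and QQ = qp_determined[OF P(2) P'(2) gG(3,4) P'(8)]
   and RR = qp_determined[OF P(3) P'(3) gG(7,8) P'(9)]
  obtain p y r where p: "p : P" "x' = p ** x" and y: "y : Q" "g' ** x' = y ** (g ** x)" and r: "r : R" "h' ** g' ** x' = r ** (h ** g ** x)"
   using PP(2) QQ(2) RR(2) by blast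
  have pG: "p : carrier G" "y : carrier G" "r : carrier G" using p y r XXf P fullD(3) by blast+
  have "g' = g' ** x' ** invG x'" using gG P'(4) by (simp add: G.m_assoc)
  also have "... = y ** g ** x ** invG x ** invG p" unfolding y(2) unfolding p(2) using gG(1) pG P(4) by (simp only: G.inv_mult_group G.m_assoc G.m_closed G.inv_closed)
  also have "... = y ** g ** (x ** invG x) ** invG p" using gG pG P(4) by (simp only: G.m_assoc G.m_closed G.inv_closed)
  also have "... = y ** g ** invG p" using gG pG P(4) by simp
  finally have g': "g' = y ** g ** invG p" .
  have "h' = (h' ** g' ** x') ** invG (g' ** x')" using gG P'(4) by (simp add: G.m_assoc)
  also have "... = r ** h ** (g ** x) ** invG (g ** x) ** invG y" unfolding y(2) r(2) using gG(1,5) pG P(4) by (simp add: G.inv_mult_group G.m_assoc)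
  also have "... = r ** h ** invG y" using gG(1,3,5) pG P(4) by (simp add: G.m_assoc)
  finally have h': "h' = r ** h ** invG y" .
  have "w P Q R h' g' = w P Q R h g" unfolding g' h' by (rule inv[OF P(1,2,3,5,6) r(1) y(1) p(1)])
  hence "u = act (inv (\<beta> x) \<otimes> inv (\<beta> p)) (w P Q R h g)" using P'(10) PP(1) QQ(1) RR(1) p(2) pG P(4) by (simp add: inv_mult_group)
  also have "... = act (inv (\<beta> x)) (w P Q R h g)"
   using Afix_act_inv[OF XXf[OF P(1)] w[OF P(1,2,3,5,6)] p(1)] AfixD(1)[OF w[OF P(1,2,3,5,6)]] pG P(4) by (simp add: act_mult)
  finally show "u = act (inv (\<beta> x)) (w P Q R h g)" .
 qed
 have v1: "v (qp P \<one>\<^bsub>G\<^esub>) (qp Q g) (qp R (h ** g)) = w P Q R h g" if P: "P : \<XX>" "Q : \<XX>" "R : \<XX>" "g : tr P Q" "h : tr Q R" for P Q R g h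
  using v[OF P(1-3) G.one_closed P(4,5)] trD(1)[OF P(4)] trD(1)[OF P(5)] AfixD(1)[OF w[OF P]] by (simp add: act_one)
 have "K2 V v"
  unfolding K2_def
 proof (intro allI impI)
  fix e0 e1 e2 assume "ch3 V e0 e1 e2"
  then obtain P Q R x g h where 1: "P : \<XX>" "Q : \<XX>" "R : \<XX>" "x : carrier G" "g : tr P Q" "h : tr Q R"
   "e0 = qp P x" "e1 = qp Q (g ** x)" "e2 = qp R (h ** g ** x)" by (rule ch3_cases)
  have gG: "g : carrier G" "h : carrier G" using trD(1)[OF 1(5)] trD(1)[OF 1(6)] by auto
  have wA: "w P Q R h g : A" using AfixD(1)[OF w[OF 1(1,2,3,5,6)]] .
  have "v (mv a e0) (mv a e1) (mv a e2) = act a (v e0 e1 e2)" if a: "a : els" for a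
  proof -
   obtain b where b: "b : carrier G" "\<beta> b = inv a" using lift_exists[of "inv a"] a by auto
   have m: "mv a (qp P' k) = qp P' (k ** b)" if "P' : full" "k : carrier G" for P' k using mv_qp[OF that b(1)] b(2) a by simp
   have "v (mv a e0) (mv a e1) (mv a e2) = v (qp P (x ** b)) (qp Q (g ** (x ** b))) (qp R (h ** g ** (x ** b)))"
    using 1 gG b(1) by (simp add: m XXf G.m_assoc)
   also have "... = act (inv (\<beta> (x ** b))) (w P Q R h g)" using v[OF 1(1-3) _ 1(5,6), of "x ** b"] 1(4) b(1) by simp
   also have "inv (\<beta> (x ** b)) = a \<otimes> inv (\<beta> x)" using 1(4) b a by (simp add: inv_mult_group)
   also have "act (a \<otimes> inv (\<beta> x)) (w P Q R h g) = act a (v e0 e1 e2)"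
    unfolding 1(7-9) v[OF 1(1-6)] using 1(4) a wA by (simp add: act_mult)
   finally show ?thesis .
  qed
  moreover have "v e0 e1 e2 : A" unfolding 1(7-9) v[OF 1(1-6)] using 1(4) wA by (simp add: act_closed)
  ultimately show "v e0 e1 e2 : A & (ALL a:els. v (mv a e0) (mv a e1) (mv a e2) = act a (v e0 e1 e2))" by blast
 qed
 thus ?thesis using v1 by blast
qed

lemma descend_1:
 assumes w: "!!P Q g. P : \<XX> ==> Q : \<XX> ==> g : tr P Q ==> w P Q g : Afix P"
  and inv: "!!P Q g y p. P : \<XX> ==> Q : \<XX> ==> g : tr P Q ==> y : Q ==> p : P ==> w P Q (y ** g ** invG p) = w P Q g"
 shows "EX v. K1 V v & (ALL P:\<XX>. ALL Q:\<XX>. ALL g:tr P Q. v (qp P \<one>\<^bsub>G\<^esub>) (qp Q g) = w P Q g)"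
proof -
 obtain t where t: "K2 V t" "!!P Q R g h. P : \<XX> ==> Q : \<XX> ==> R : \<XX> ==> g : tr P Q ==> h : tr Q R ==>
   t (qp P \<one>\<^bsub>G\<^esub>) (qp Q g) (qp R (h ** g)) = w P Q g"
  using descend_2[of "%P Q R h g. w P Q g", OF w inv] by blast
 have "K1 V (%e0 e1. t e0 e1 e1)" using t(1) by (auto simp: K1_def K2_def chs sle_def)
 moreover have "t (qp P \<one>\<^bsub>G\<^esub>) (qp Q g) (qp Q g) = w P Q g" if "P : \<XX>" "Q : \<XX>" "g : tr P Q" for P Q g
  using t(2)[OF that(1,2,2,3) tr_one[OF XXf[OF that(2)]]] trD(1)[OF that(3)] by simp
 ultimately show ?thesis by blast
qed

end

section \<open>Linking systems twisted by cocycles\<close>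

context linking_setup
begin

text \<open>
  The transporter category of \<open>G\<close> with the product of \<open>h\<close> and \<open>g\<close> multiplied by the value of the cocycle. Morphisms are
  named by an injection into the type of morphisms.
\<close>

definition twist :: "('h => 'l) => _ => ('h, 'l) linking_data" where
 "twist io t =
  (let un = inv_into (carrier G) io in
   (\<lparr>Obj = \<XX>, Mor = (%P Q. io ` tr P Q),
    comp = (%P Q R h g. io (un h ** un g ** nv (t (qp P \<one>\<^bsub>G\<^esub>) (qp Q (un g)) (qp R (un h ** un g))))),
    ident = (%P. io \<one>\<^bsub>G\<^esub>)\<rparr>,
   \<lparr>obj_map = (%P. P), mor_map = (%P Q f. restrict (conj_by G (un f)) P)\<rparr>,
   \<lparr>obj_map = (%P. P), mor_map = (%P Q g. io g)\<rparr>))"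

definition Ltw where "Ltw io t = fst (twist io t)"
definition \<pi>tw where "\<pi>tw io = fst (snd (twist io undefined))"
definition dttw where "dttw io = snd (snd (twist io undefined))"

lemma twist_eq: "twist io t = (Ltw io t, \<pi>tw io, dttw io)"
 by (simp add: Ltw_def \<pi>tw_def dttw_def twist_def Let_def)

lemma twist_simps:
 assumes "inj_on io (carrier G)"
 shows "Obj (Ltw io t) = \<XX>" "Mor (Ltw io t) P Q = io ` tr P Q" "ident (Ltw io t) P = io \<one>\<^bsub>G\<^esub>"
  "g : carrier G ==> h : carrier G ==> comp (Ltw io t) P Q R (io h) (io g) = io (h ** g ** nv (t (qp P \<one>\<^bsub>G\<^esub>) (qp Q g) (qp R (h ** g))))"
  "obj_map (\<pi>tw io) P = P" "obj_map (dttw io) P = P" "mor_map (dttw io) P Q g = io g"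
  "g : carrier G ==> mor_map (\<pi>tw io) P Q (io g) = restrict (conj_by G g) P"
 by (simp_all add: Ltw_def \<pi>tw_def dttw_def twist_def Let_def inv_into_f_f[OF assms])

lemma trG: "g : tr P Q ==> g : carrier G"
 by (rule trD(1))

lemma tr_SS: "P : full ==> g : transporter G SS P Q ==> g : SS & g : tr P Q"
 by (simp add: transporter_SS)

lemma NZ2_SS:
 assumes t: "t : NZ2 V" and P: "P : \<XX>" "Q : \<XX>" "R : \<XX>" "g : tr P Q" "h : tr Q R" "g : SS" "h : SS"
 shows "t (qp P \<one>\<^bsub>G\<^esub>) (qp Q g) (qp R (h ** g)) = 0"
proof -
 have G': "g : carrier G" "h : carrier G" using P trG by auto
 have c: "ch3 V (qp P \<one>\<^bsub>G\<^esub>) (qp Q g) (qp R (h ** g))" using ch3_qp[OF P(1-3) G.one_closed P(4,5)] G' by simp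
 have "top_pt (qp P \<one>\<^bsub>G\<^esub>) = top_pt (qp Q g)" using top_qp_eq[OF XXf[OF P(1)] XXf[OF P(2)] G.one_closed G'(1)] P(6) G' by simp
 moreover have "top_pt (qp Q g) = top_pt (qp R (h ** g))"
  using top_qp_eq[OF XXf[OF P(2)] XXf[OF P(3)] G'(1), of "h ** g"] P(7) G' by (simp add: G.m_assoc)
 ultimately show ?thesis using t c by (simp add: NZ2_def N2_def)
qed

text \<open>
  Normalisation makes all cochains with a repeated point vanish, so composition with elements of the
  subgroups is untwisted.
\<close>

lemma NZ2_unit:
 assumes t: "t : NZ2 V" and P: "P : \<XX>" "Q : \<XX>" "g : tr P Q"
 shows "p : P ==> t (qp P \<one>\<^bsub>G\<^esub>) (qp P p) (qp Q (g ** p)) = 0"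
  and "y : Q ==> t (qp P \<one>\<^bsub>G\<^esub>) (qp Q g) (qp Q (y ** g)) = 0"
proof -
 have G': "g : carrier G" using P trG by auto
 show "t (qp P \<one>\<^bsub>G\<^esub>) (qp P p) (qp Q (g ** p)) = 0" if p: "p : P"
 proof -
  have pG: "p : carrier G" using p fullD(3)[OF XXf[OF P(1)]] by blast
  have "g ** p : tr P Q" by (rule tr_comp[OF XXf[OF P(1)] tr_self[OF XXf[OF P(1)] p] P(3)])
  hence "ch2 V (qp P \<one>\<^bsub>G\<^esub>) (qp Q (g ** p))" using ch2_qp[OF P(1,2) G.one_closed, of "g ** p"] G' pG by simp
  thus ?thesis using NZ2_degenerate(1)[OF V_up t] qp_self[OF XXf[OF P(1)] p] by simp
 qed
 show "t (qp P \<one>\<^bsub>G\<^esub>) (qp Q g) (qp Q (y ** g)) = 0" if y: "y : Q"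
 proof -
  have "ch2 V (qp P \<one>\<^bsub>G\<^esub>) (qp Q g)" using ch2_qp[OF P(1,2) G.one_closed P(3)] G' by simp
  thus ?thesis using NZ2_degenerate(2)[OF V_up t] qp_left[OF XXf[OF P(2)] y G'] by simp
 qed
qed

text \<open>
  Associativity is the cocycle identity. The values of the cocycle lie in the centre of the source,
  hence do not change the projection to the fusion system.
\<close>

lemma twisted_linking_system:
 assumes io: "inj_on io (carrier G)" and t: "t : NZ2 V"
 shows "linking_system G SS \<XX> (twist io t)"
 unfolding twist_eq linking_system_def prod.case
proof (intro conjI)
 note tw = twist_simps[OF io]
 have tK: "K2 V t" and tZ: "!!e0 e1 e2 e3. ch4 V e0 e1 e2 e3 ==> D2 t e0 e1 e2 e3 = 0" using t by (auto simp: NZ2_def)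
 have tA: "t (qp P \<one>\<^bsub>G\<^esub>) (qp Q g) (qp R (h ** g)) : Afix P" "t (qp P \<one>\<^bsub>G\<^esub>) (qp Q g) (qp R (h ** g)) : A"
  if "P : \<XX>" "Q : \<XX>" "R : \<XX>" "g : tr P Q" "h : tr Q R" for P Q R g h
  using K2_Afix[OF tK that] AfixD(1) by blast+
 have ioeq: "io g = io h <-> g = h" if "g : carrier G" "h : carrier G" for g h using io that by (auto dest: inj_onD)
 have cG: "h ** g ** nv (t (qp P \<one>\<^bsub>G\<^esub>) (qp Q g) (qp R (h ** g))) : tr P R"
  if "P : \<XX>" "Q : \<XX>" "R : \<XX>" "g : tr P Q" "h : tr Q R" for P Q R g h
  by (rule tr_nv[OF XXf[OF that(1)] tr_comp[OF XXf[OF that(1)] that(4,5)] tA(2)[OF that]])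
 have one0: "io \<one>\<^bsub>G\<^esub> = io \<one>\<^bsub>G\<^esub>" ..
 have oneP: "\<one>\<^bsub>G\<^esub> : P" if "P : \<XX>" for P by (rule subgroup.one_closed[OF fullD(1)[OF XXf[OF that]]])
 show "linking_family G SS \<XX>" by (rule XX_linking_family)
 show "Obj (Ltw io t) = \<XX>" by (simp add: tw)
 show "category (Ltw io t)"
  unfolding category_def tw(1)
 proof (intro conjI ballI)
  fix P assume P: "P : \<XX>"
  show "ident (Ltw io t) P : Mor (Ltw io t) P P" using tr_one[OF XXf[OF P]] by (simp add: tw)
  fix Q f assume Q: "Q : \<XX>"
  show "comp (Ltw io t) P P Q f (ident (Ltw io t) P) = f" if f: "f : Mor (Ltw io t) P Q" for f
  proof -
   from f obtain g where g: "g : tr P Q" "f = io g" by (auto simp: tw)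
   show ?thesis using NZ2_unit(1)[OF t P Q g(1) oneP[OF P]] trG[OF g(1)] by (simp add: tw g(2))
  qed
  show "comp (Ltw io t) P Q Q (ident (Ltw io t) Q) f = f" if f: "f : Mor (Ltw io t) P Q" for f
  proof -
   from f obtain g where g: "g : tr P Q" "f = io g" by (auto simp: tw)
   show ?thesis using NZ2_unit(2)[OF t P Q g(1) oneP[OF Q]] trG[OF g(1)] by (simp add: tw g(2))
  qed
  fix R assume R: "R : \<XX>"
  show "comp (Ltw io t) P Q R g f : Mor (Ltw io t) P R" if "f : Mor (Ltw io t) P Q" "g : Mor (Ltw io t) Q R" for f g
   using that cG[OF P Q R] trG by (auto simp: tw)
  fix U f g h assume U: "U : \<XX>" and fgh: "f : Mor (Ltw io t) P Q" "g : Mor (Ltw io t) Q R" "h : Mor (Ltw io t) R U"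
  obtain a b c where a: "a : tr P Q" "f = io a" and b: "b : tr Q R" "g = io b" and c: "c : tr R U" "h = io c"
   using fgh by (auto simp: tw)
  have G': "a : carrier G" "b : carrier G" "c : carrier G" using a b c trG by auto
  note ba = tr_comp[OF XXf[OF P] a(1) b(1)] and cb = tr_comp[OF XXf[OF Q] b(1) c(1)]
  let ?e0 = "qp P \<one>\<^bsub>G\<^esub>" and ?e1 = "qp Q a" and ?e2 = "qp R (b ** a)" and ?e3 = "qp U (c ** b ** a)"
  have ch: "ch4 V ?e0 ?e1 ?e2 ?e3" using ch4_qp[OF P Q R U G.one_closed a(1) b(1) c(1)] G' by simp
  note fc = faces4[OF ch]
  have A4: "t ?e0 ?e1 ?e2 : A" "t ?e0 ?e2 ?e3 : A" "t ?e1 ?e2 ?e3 : A" "t ?e0 ?e1 ?e3 : A" using fc K2D(1)[OF tK] by auto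
  let ?z1 = "t (qp Q \<one>\<^bsub>G\<^esub>) (qp R b) (qp U (c ** b))"
  have z1A: "?z1 : A" by (rule tA(2)[OF Q R U b(1) c(1)])
  have z1: "t ?e1 ?e2 ?e3 = act (inv (\<beta> a)) ?z1" by (rule K2_qp[OF tK Q R U b(1) c(1) G'(1)])
  have q1: "qp U (c ** b ** nv ?z1 ** a) = ?e3"
   using nv_shift[of "c ** b" a ?z1] qp_nv[OF XXf[OF U], of "c ** b ** a"] G' z1A by (simp add: act_closed)
  have q2: "qp R (b ** a ** nv (t ?e0 ?e1 ?e2)) = ?e2" using qp_nv[OF XXf[OF R], of "b ** a"] G' A4(1) by simp
  have q3: "qp U (c ** (b ** a ** nv (t ?e0 ?e1 ?e2))) = ?e3"
   using qp_nv[OF XXf[OF U], of "c ** b ** a"] G' A4(1) by (simp add: G.m_assoc)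
  have "comp (Ltw io t) P Q U (comp (Ltw io t) Q R U h g) f = io (c ** b ** nv ?z1 ** a ** nv (t ?e0 ?e1 ?e3))"
   using G' z1A by (simp add: a b c tw q1)
  also have "c ** b ** nv ?z1 ** a ** nv (t ?e0 ?e1 ?e3) = c ** b ** a ** nv (t ?e1 ?e2 ?e3 + t ?e0 ?e1 ?e3)"
   using nv_shift[of "c ** b" a ?z1] G' z1A A4 by (simp add: z1 [symmetric] nv_add G.m_assoc)
  also have "t ?e1 ?e2 ?e3 + t ?e0 ?e1 ?e3 = t ?e0 ?e1 ?e2 + t ?e0 ?e2 ?e3"
   using tZ[OF ch] by (simp add: D2_def algebra_simps)
  also have "c ** b ** a ** nv (t ?e0 ?e1 ?e2 + t ?e0 ?e2 ?e3) = c ** (b ** a ** nv (t ?e0 ?e1 ?e2)) ** nv (t ?e0 ?e2 ?e3)"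
   using G' A4 by (simp add: nv_add G.m_assoc)
  also have "io ... = comp (Ltw io t) P R U h (comp (Ltw io t) P Q R g f)"
   using G' A4(1) by (simp add: a b c tw q2 q3)
  finally show "comp (Ltw io t) P Q U (comp (Ltw io t) Q R U h g) f = comp (Ltw io t) P R U h (comp (Ltw io t) P Q R g f)" .
 qed
 show "is_cfunctor (Ltw io t) (full_subcat (fusion_system G SS) \<XX>) (\<pi>tw io)"
  unfolding is_cfunctor_def tw(1)
 proof (intro conjI ballI)
  fix P assume P: "P : \<XX>"
  show "obj_map (\<pi>tw io) P : Obj (full_subcat (fusion_system G SS) \<XX>)" using P by (simp add: tw full_subcat_def)
  show "mor_map (\<pi>tw io) P P (ident (Ltw io t) P) = ident (full_subcat (fusion_system G SS) \<XX>) (obj_map (\<pi>tw io) P)"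
   using fullD(3)[OF XXf[OF P]] by (auto simp: tw full_subcat_def fusion_system_def conj_by_def intro!: restrict_ext)
  fix Q assume Q: "Q : \<XX>"
  show "mor_map (\<pi>tw io) P Q f : Mor (full_subcat (fusion_system G SS) \<XX>) (obj_map (\<pi>tw io) P) (obj_map (\<pi>tw io) Q)"
   if f: "f : Mor (Ltw io t) P Q" for f
  proof -
   from f obtain g where g: "g : tr P Q" "f = io g" by (auto simp: tw)
   have "restrict (conj_by G g) P : Mor (fusion_system G SS) P Q" unfolding fusion_Mor using g by blast
   thus ?thesis using trG[OF g(1)] by (simp add: tw g(2) full_subcat_def)
  qed
  fix R f g assume R: "R : \<XX>" "f : Mor (Ltw io t) P Q" "g : Mor (Ltw io t) Q R"
  obtain a b where a: "a : tr P Q" "f = io a" and b: "b : tr Q R" "g = io b" using R by (auto simp: tw)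
  have G': "a : carrier G" "b : carrier G" using a b trG by auto
  let ?z = "t (qp P \<one>\<^bsub>G\<^esub>) (qp Q a) (qp R (b ** a))"
  have z: "?z : Afix P" "?z : A" by (rule tA[OF P Q R(1) a(1) b(1)])+
  have "mor_map (\<pi>tw io) P R (comp (Ltw io t) P Q R g f) = restrict (conj_by G (b ** a ** nv ?z)) P"
   using G' z(2) by (simp add: tw a b)
  also have "... = restrict (conj_by G (b ** a)) P"
   using conj_restrict_eq[OF XXf[OF P], of "b ** a" "b ** a ** nv ?z"] z G' by auto
  also have "... = compose P (restrict (conj_by G b) Q) (restrict (conj_by G a) P)"
   by (rule conj_compose[OF XXf[OF P] a(1) b(1), symmetric])
  finally show "mor_map (\<pi>tw io) P R (comp (Ltw io t) P Q R g f) =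
    comp (full_subcat (fusion_system G SS) \<XX>) (obj_map (\<pi>tw io) P) (obj_map (\<pi>tw io) Q) (obj_map (\<pi>tw io) R)
     (mor_map (\<pi>tw io) Q R g) (mor_map (\<pi>tw io) P Q f)"
   using G' by (simp add: tw a b full_subcat_def fusion_system_def)
 qed
 show "is_cfunctor (transporter_cat G SS \<XX>) (Ltw io t) (dttw io)"
  unfolding is_cfunctor_def
 proof (intro conjI ballI)
  fix P assume "P : Obj (transporter_cat G SS \<XX>)"
  hence P: "P : \<XX>" by (simp add: transporter_cat_def)
  show "obj_map (dttw io) P : Obj (Ltw io t)" using P by (simp add: tw)
  show "mor_map (dttw io) P P (ident (transporter_cat G SS \<XX>) P) = ident (Ltw io t) (obj_map (dttw io) P)"
   by (simp add: tw transporter_cat_def)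
  fix Q assume "Q : Obj (transporter_cat G SS \<XX>)"
  hence Q: "Q : \<XX>" by (simp add: transporter_cat_def)
  show "mor_map (dttw io) P Q f : Mor (Ltw io t) (obj_map (dttw io) P) (obj_map (dttw io) Q)" if "f : Mor (transporter_cat G SS \<XX>) P Q" for f
   using that tr_SS[OF XXf[OF P], of f Q] by (simp add: tw transporter_cat_def)
  fix R f g assume "R : Obj (transporter_cat G SS \<XX>)" "f : Mor (transporter_cat G SS \<XX>) P Q" "g : Mor (transporter_cat G SS \<XX>) Q R"
  hence R: "R : \<XX>" and f: "f : SS" "f : tr P Q" and g: "g : SS" "g : tr Q R"
   using tr_SS[OF XXf[OF P], of f Q] tr_SS[OF XXf[OF Q], of g R] by (auto simp: transporter_cat_def)
  have "t (qp P \<one>\<^bsub>G\<^esub>) (qp Q f) (qp R (g ** f)) = 0" by (rule NZ2_SS[OF t P Q R f(2) g(2) f(1) g(1)])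
  thus "mor_map (dttw io) P R (comp (transporter_cat G SS \<XX>) P Q R g f) =
    comp (Ltw io t) (obj_map (dttw io) P) (obj_map (dttw io) Q) (obj_map (dttw io) R) (mor_map (dttw io) Q R g) (mor_map (dttw io) P Q f)"
   using trG[OF f(2)] trG[OF g(2)] by (simp add: tw transporter_cat_def)
 qed
 show "ALL P:\<XX>. obj_map (\<pi>tw io) P = P & obj_map (dttw io) P = P" by (simp add: tw)
 show "ALL P:\<XX>. ALL Q:\<XX>.
    (ALL f:Mor (Ltw io t) P Q. ALL z:center_of G P. comp (Ltw io t) P P Q f (mor_map (dttw io) P P z) = f --> z = \<one>\<^bsub>G\<^esub>) &
    mor_map (\<pi>tw io) P Q ` Mor (Ltw io t) P Q = Mor (fusion_system G SS) P Q &
    (ALL f:Mor (Ltw io t) P Q. ALL f':Mor (Ltw io t) P Q. mor_map (\<pi>tw io) P Q f = mor_map (\<pi>tw io) P Q f' <->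
      (EX z:center_of G P. f' = comp (Ltw io t) P P Q f (mor_map (dttw io) P P z)))"
 proof (intro ballI conjI impI)
  fix P Q assume P: "P : \<XX>" and Q: "Q : \<XX>"
  have cz: "comp (Ltw io t) P P Q (io g) (mor_map (dttw io) P P (nv u)) = io (g ** nv u)" if "g : tr P Q" "u : A" for g u
   using NZ2_unit(1)[OF t P Q that(1) fullD(4)[OF XXf[OF P] that(2)]] trG[OF that(1)] that(2) by (simp add: tw)
  show "z = \<one>\<^bsub>G\<^esub>" if f: "f : Mor (Ltw io t) P Q" and z: "z : center_of G P" and eq: "comp (Ltw io t) P P Q f (mor_map (dttw io) P P z) = f" for f z
  proof -
   from f obtain g where g: "g : tr P Q" "f = io g" by (auto simp: tw)
   from z obtain u where u: "u : A" "z = nv u" using AfixD(1) by (auto simp: center_full[OF XXf[OF P]])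
   have "io (g ** nv u) = io g" using eq cz[OF g(1) u(1)] by (simp add: g(2) u(2))
   hence "g ** nv u = g" using ioeq trG[OF g(1)] u(1) by simp
   thus ?thesis using trG[OF g(1)] u by simp
  qed
  show "mor_map (\<pi>tw io) P Q ` Mor (Ltw io t) P Q = Mor (fusion_system G SS) P Q"
   unfolding fusion_Mor tw(2) image_image by (intro image_cong refl) (simp add: tw trG)
  show "mor_map (\<pi>tw io) P Q f = mor_map (\<pi>tw io) P Q f' <->
      (EX z:center_of G P. f' = comp (Ltw io t) P P Q f (mor_map (dttw io) P P z))"
   if "f : Mor (Ltw io t) P Q" "f' : Mor (Ltw io t) P Q" for f f'
  proof -
   from that obtain g g' where g: "g : tr P Q" "f = io g" "g' : tr P Q" "f' = io g'" by (auto simp: tw)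
   have "mor_map (\<pi>tw io) P Q f = mor_map (\<pi>tw io) P Q f' <-> (EX u:Afix P. g' = g ** nv u)"
    using conj_restrict_eq[OF XXf[OF P] trG[OF g(1)] trG[OF g(3)]] trG[OF g(1)] trG[OF g(3)] by (simp add: tw g)
   also have "... <-> (EX u:Afix P. f' = comp (Ltw io t) P P Q f (mor_map (dttw io) P P (nv u)))"
    using cz[OF g(1) AfixD(1)] ioeq trG[OF g(1)] trG[OF g(3)] AfixD(1) by (intro bex_cong refl) (simp add: g)
   finally show ?thesis unfolding center_full[OF XXf[OF P]] by simp
  qed
 qed
 show "ALL P:\<XX>. ALL Q:\<XX>. ALL g:transporter G SS P Q. mor_map (\<pi>tw io) P Q (mor_map (dttw io) P Q g) = restrict (conj_by G g) P"
 proof (intro ballI)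
  fix P Q g assume "P : \<XX>" "Q : \<XX>" "g : transporter G SS P Q"
  hence "g : carrier G" using tr_SS[OF XXf] trG by blast
  thus "mor_map (\<pi>tw io) P Q (mor_map (dttw io) P Q g) = restrict (conj_by G g) P" by (simp add: tw)
 qed
 show "ALL P:\<XX>. ALL Q:\<XX>. ALL f:Mor (Ltw io t) P Q. ALL g:P. comp (Ltw io t) P P Q f (mor_map (dttw io) P P g) =
     comp (Ltw io t) P Q Q (mor_map (dttw io) Q Q (mor_map (\<pi>tw io) P Q f g)) f"
 proof (intro ballI)
  fix P Q f x assume P: "P : \<XX>" and Q: "Q : \<XX>" and f: "f : Mor (Ltw io t) P Q" and x: "x : P"
  from f obtain g where g: "g : tr P Q" "f = io g" by (auto simp: tw)
  have G': "g : carrier G" "x : carrier G" using trG[OF g(1)] x fullD(3)[OF XXf[OF P]] by auto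
  have y: "g ** x ** invG g : Q" by (rule trD(2)[OF g(1) x])
  have "g ** x = g ** x ** invG g ** g" using G' by (simp add: G.m_assoc)
  thus "comp (Ltw io t) P P Q f (mor_map (dttw io) P P x) = comp (Ltw io t) P Q Q (mor_map (dttw io) Q Q (mor_map (\<pi>tw io) P Q f x)) f"
   using NZ2_unit(1)[OF t P Q g(1) x] NZ2_unit(2)[OF t P Q g(1) y] G' x by (simp add: tw g(2) conj_by_def)
 qed
qed

lemma twist_comp_nv:
 assumes io: "inj_on io (carrier G)" and t: "K2 V t" and P: "P : \<XX>" "Q : \<XX>" "R : \<XX>" "a : tr P Q" "b : tr Q R"
  and u: "u : A" "u' : A"
 shows "comp (Ltw io t) P Q R (io (b ** nv u')) (io (a ** nv u)) =
  io (b ** a ** nv (act (inv (\<beta> a)) u' + u + t (qp P \<one>\<^bsub>G\<^esub>) (qp Q a) (qp R (b ** a))))"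
proof -
 have G': "a : carrier G" "b : carrier G" using P trG by auto
 have tA: "t (qp P \<one>\<^bsub>G\<^esub>) (qp Q a) (qp R (b ** a)) : A" by (rule AfixD(1)[OF K2_Afix[OF t P]])
 have vA: "act (inv (\<beta> a)) u' : A" using u G' by (simp add: act_closed)
 note sA = Acl(2)[OF vA u(1)]
 have "b ** nv u' ** (a ** nv u) = b ** a ** nv (act (inv (\<beta> a)) u') ** nv u"
  unfolding nv_shift[OF G'(2,1) u(2), symmetric] using G' u by (simp add: G.m_assoc)
 also have "... = b ** a ** nv (act (inv (\<beta> a)) u' + u)" using G' u vA by (simp add: nv_add G.m_assoc)
 finally have q: "b ** nv u' ** (a ** nv u) = b ** a ** nv (act (inv (\<beta> a)) u' + u)" .
 have "qp Q (a ** nv u) = qp Q a" "qp R (b ** a ** nv (act (inv (\<beta> a)) u' + u)) = qp R (b ** a)"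
  using qp_nv[OF XXf[OF P(2)] G'(1) u(1)] qp_nv[OF XXf[OF P(3)], of "b ** a"] G' sA by simp_all
 thus ?thesis using G' u tA sA by (simp add: twist_simps[OF io] q nv_add G.m_assoc)
qed

text \<open>
  An isomorphism over the fusion system multiplies the morphism of \<open>g\<close> by an element of the centre of the
  source; compatibility with composition says that these elements cobound the difference of the cocycles.
\<close>

lemma twist_iso_iff:
 assumes io: "inj_on io (carrier G)" and t: "t : NZ2 V" and t': "t' : NZ2 V"
 shows "linking_iso G SS \<XX> (twist io t) (twist io t') <-> NE2 V t t'"
proof -
 note tw = twist_simps[OF io]
 have ioeq: "io g = io h <-> g = h" if "g : carrier G" "h : carrier G" for g h using io that by (auto dest: inj_onD)
 have iff: "linking_iso G SS \<XX> (twist io t) (twist io t') <->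
   (EX ps. iso_maps G SS \<XX> (Ltw io t, \<pi>tw io, dttw io) (Ltw io t', \<pi>tw io, dttw io) ps)"
  using linking_iso_iff[OF G.is_group SS_subgroup] twisted_linking_system[OF io t] twisted_linking_system[OF io t']
  unfolding twist_eq by blast
 have K: "K2 V t" "K2 V t'" using t t' by (auto simp: NZ2_def)
 have tA: "t (qp P \<one>\<^bsub>G\<^esub>) (qp Q g) (qp R (h ** g)) : A" "t' (qp P \<one>\<^bsub>G\<^esub>) (qp Q g) (qp R (h ** g)) : A"
  if "P : \<XX>" "Q : \<XX>" "R : \<XX>" "g : tr P Q" "h : tr Q R" for P Q R g h
  using K2_Afix[OF K(1) that] K2_Afix[OF K(2) that] AfixD(1) by blast+
 show ?thesis
  unfolding iff
 proof
  assume "NE2 V t t'"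
  then obtain v where v: "K1 V v" "N1 V v" "!!e0 e1 e2. ch3 V e0 e1 e2 ==> t e0 e1 e2 - t' e0 e1 e2 = D1 v e0 e1 e2"
   by (auto simp: NE2_def)
  define un where "un = inv_into (carrier G) io"
  have un: "un (io g) = g" if "g : carrier G" for g unfolding un_def by (rule inv_into_f_f[OF io that])
  define w where "w P Q g = v (qp P \<one>\<^bsub>G\<^esub>) (qp Q g)" for P Q g
  have w: "w P Q g : Afix P" "w P Q g : A" if "P : \<XX>" "Q : \<XX>" "g : tr P Q" for P Q g
   unfolding w_def using K1_Afix[OF v(1) that] AfixD(1) by blast+
  have wnv: "w P Q (g ** nv u) = w P Q g" if "Q : \<XX>" "g : carrier G" "u : A" for P Q g u
   unfolding w_def using qp_nv[OF XXf[OF that(1)] that(2,3)] by simp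
  define ps where "ps P Q f = io (un f ** nv (w P Q (un f)))" for P Q f
  have "iso_maps G SS \<XX> (Ltw io t, \<pi>tw io, dttw io) (Ltw io t', \<pi>tw io, dttw io) ps"
   unfolding iso_maps_def prod.case
  proof (intro ballI conjI)
   fix P Q assume P: "P : \<XX>" and Q: "Q : \<XX>"
   have ps: "ps P Q (io g) = io (g ** nv (w P Q g))" if "g : tr P Q" for g using trG[OF that] by (simp add: ps_def un)
   show "bij_betw (ps P Q) (Mor (Ltw io t) P Q) (Mor (Ltw io t') P Q)"
   proof (rule bij_betwI[where g = "%f. io (un f ** nv (- w P Q (un f)))"])
    show "ps P Q : Mor (Ltw io t) P Q \<rightarrow> Mor (Ltw io t') P Q"
     using ps tr_nv[OF XXf[OF P]] w(2)[OF P Q] by (auto simp: tw)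
    show "(%f. io (un f ** nv (- w P Q (un f)))) : Mor (Ltw io t') P Q \<rightarrow> Mor (Ltw io t) P Q"
     using tr_nv[OF XXf[OF P]] w(2)[OF P Q] by (auto simp: tw un trG Acl)
    show "io (un (ps P Q f) ** nv (- w P Q (un (ps P Q f)))) = f" if f: "f : Mor (Ltw io t) P Q" for f
    proof -
     from f obtain g where g: "g : tr P Q" "f = io g" by (auto simp: tw)
     have wA: "w P Q g : A" and gG: "g : carrier G" using w(2)[OF P Q g(1)] trG[OF g(1)] by auto
     have "g ** nv (w P Q g) ** nv (- w P Q g) = g" using wA gG by (simp add: nv_uminus G.m_assoc)
     thus ?thesis using wA gG by (simp add: g(2) ps[OF g(1)] un wnv[OF Q])
    qed
    show "ps P Q (io (un f ** nv (- w P Q (un f)))) = f" if f: "f : Mor (Ltw io t') P Q" for f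
    proof -
     from f obtain g where g: "g : tr P Q" "f = io g" by (auto simp: tw)
     have wA: "w P Q g : A" and gG: "g : carrier G" using w(2)[OF P Q g(1)] trG[OF g(1)] by auto
     have "g ** nv (- w P Q g) ** nv (w P Q g) = g" using wA gG by (simp add: nv_uminus G.m_assoc)
     thus ?thesis using wA gG Acl(3)[OF wA] by (simp add: g(2) ps_def un wnv[OF Q])
    qed
   qed
   show "mor_map (\<pi>tw io) P Q (ps P Q f) = mor_map (\<pi>tw io) P Q f" if f: "f : Mor (Ltw io t) P Q" for f
   proof -
    from f obtain g where g: "g : tr P Q" "f = io g" by (auto simp: tw)
    have "restrict (conj_by G g) P = restrict (conj_by G (g ** nv (w P Q g))) P"
     using conj_restrict_eq[OF XXf[OF P] trG[OF g(1)], of "g ** nv (w P Q g)"] w[OF P Q g(1)] trG[OF g(1)] by auto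
    thus ?thesis using trG[OF g(1)] w(2)[OF P Q g(1)] by (simp add: tw g(2) ps[OF g(1)])
   qed
   show "ps P Q (mor_map (dttw io) P Q g) = mor_map (dttw io) P Q g" if "g : transporter G SS P Q" for g
   proof -
    have g: "g : SS" "g : tr P Q" using tr_SS[OF XXf[OF P] that] by auto
    have "ch2 V (qp P \<one>\<^bsub>G\<^esub>) (qp Q g)" using ch2_qp[OF P Q G.one_closed g(2)] trG[OF g(2)] by simp
    moreover have "top_pt (qp P \<one>\<^bsub>G\<^esub>) = top_pt (qp Q g)"
     using top_qp_eq[OF XXf[OF P] XXf[OF Q] G.one_closed trG[OF g(2)]] g trG[OF g(2)] by simp
    ultimately have "w P Q g = 0" using v(2) by (simp add: N1_def w_def)
    thus ?thesis using trG[OF g(2)] by (simp add: tw ps[OF g(2)])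
   qed
   fix R f h assume R: "R : \<XX>" and f: "f : Mor (Ltw io t) P Q" and h: "h : Mor (Ltw io t) Q R"
   obtain a b where a: "a : tr P Q" "f = io a" and b: "b : tr Q R" "h = io b" using f h by (auto simp: tw)
   have G': "a : carrier G" "b : carrier G" using a b trG by auto
   note ba = tr_comp[OF XXf[OF P] a(1) b(1)]
   let ?e0 = "qp P \<one>\<^bsub>G\<^esub>" and ?e1 = "qp Q a" and ?e2 = "qp R (b ** a)"
   have ch: "ch3 V ?e0 ?e1 ?e2" using ch3_qp[OF P Q R G.one_closed a(1) b(1)] G' by simp
   have tz: "t ?e0 ?e1 ?e2 : A" "t' ?e0 ?e1 ?e2 : A" by (rule tA[OF P Q R a(1) b(1)])+
   have wz: "w P Q a : A" "w Q R b : A" "w P R (b ** a) : A" using w(2) P Q R a(1) b(1) ba by auto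
   have v12: "v ?e1 ?e2 = act (inv (\<beta> a)) (w Q R b)" unfolding w_def by (rule K1_qp[OF v(1) Q R b(1) G'(1)])
   have vA: "act (inv (\<beta> a)) (w Q R b) : A" using wz G' by (simp add: act_closed)
   have eq: "t ?e0 ?e1 ?e2 + w P R (b ** a) = act (inv (\<beta> a)) (w Q R b) + w P Q a + t' ?e0 ?e1 ?e2"
    using v(3)[OF ch] v12 by (simp add: D1_def w_def algebra_simps)
   have "ps P R (comp (Ltw io t) P Q R h f) = io (b ** a ** nv (t ?e0 ?e1 ?e2) ** nv (w P R (b ** a)))"
    using G' tz by (simp add: tw a b ps_def un wnv[OF R])
   also have "b ** a ** nv (t ?e0 ?e1 ?e2) ** nv (w P R (b ** a)) = b ** a ** nv (act (inv (\<beta> a)) (w Q R b) + w P Q a + t' ?e0 ?e1 ?e2)"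
    unfolding eq [symmetric] using G' tz wz by (simp add: nv_add G.m_assoc)
   also have "io ... = comp (Ltw io t') P Q R (ps Q R h) (ps P Q f)"
    unfolding twist_comp_nv[OF io K(2) P Q R a(1) b(1) wz(1,2), symmetric] using G' by (simp add: a b ps_def un)
   finally show "ps P R (comp (Ltw io t) P Q R h f) = comp (Ltw io t') P Q R (ps Q R h) (ps P Q f)" .
  qed
  thus "EX ps. iso_maps G SS \<XX> (Ltw io t, \<pi>tw io, dttw io) (Ltw io t', \<pi>tw io, dttw io) ps" by blast
 next
  assume "EX ps. iso_maps G SS \<XX> (Ltw io t, \<pi>tw io, dttw io) (Ltw io t', \<pi>tw io, dttw io) ps"
  then obtain ps where ps: "iso_maps G SS \<XX> (Ltw io t, \<pi>tw io, dttw io) (Ltw io t', \<pi>tw io, dttw io) ps" by blast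
  note m = iso_mapsD[OF ps]
  define w where "w P Q g = (SOME u. u : Afix P & ps P Q (io g) = io (g ** nv u))" for P Q g
  have wex: "EX u. u : Afix P & ps P Q (io g) = io (g ** nv u)" if P: "P : \<XX>" "Q : \<XX>" "g : tr P Q" for P Q g
  proof -
   have gM: "io g : Mor (Ltw io t) P Q" using P by (simp add: tw)
   have "ps P Q (io g) : Mor (Ltw io t') P Q" by (rule m(2)[OF P(1,2) gM])
   then obtain g' where g': "g' : tr P Q" "ps P Q (io g) = io g'" by (auto simp: tw)
   have "restrict (conj_by G g) P = restrict (conj_by G g') P"
    using m(3)[OF P(1,2) gM] trG[OF P(3)] trG[OF g'(1)] by (simp add: tw g'(2))
   thus ?thesis using conj_restrict_eq[OF XXf[OF P(1)] trG[OF P(3)] trG[OF g'(1)]] g'(2) by blast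
  qed
  have w: "w P Q g : Afix P" "ps P Q (io g) = io (g ** nv (w P Q g))" "w P Q g : A" if "P : \<XX>" "Q : \<XX>" "g : tr P Q" for P Q g
   using someI_ex[OF wex[OF that]] AfixD(1) unfolding w_def by blast+
  have wu: "w P Q g = u" if "P : \<XX>" "Q : \<XX>" "g : tr P Q" "u : A" "ps P Q (io g) = io (g ** nv u)" for P Q g u
  proof -
   have "g ** nv (w P Q g) = g ** nv u" using w(2,3)[OF that(1-3)] that(4,5) ioeq trG[OF that(3)] by simp
   thus ?thesis using trG[OF that(3)] that(4) w(3)[OF that(1-3)] nv_eq_iff by simp
  qed
  have winv: "w P Q (y ** g ** invG p) = w P Q g" if P: "P : \<XX>" "Q : \<XX>" "g : tr P Q" and y: "y : Q" and p: "p : P" for P Q g y p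
  proof -
   note Pf = XXf[OF P(1)] and Qf = XXf[OF P(2)]
   have p': "invG p : P" by (rule subgroup.m_inv_closed[OF fullD(1)[OF Pf] p])
   have gp: "g ** invG p : tr P Q" by (rule tr_comp[OF Pf tr_self[OF Pf p'] P(3)])
   have G': "g : carrier G" "y : carrier G" "p : carrier G" using trG[OF P(3)] y p fullD(3)[OF Pf] fullD(3)[OF Qf] by auto
   have ygp: "y ** (g ** invG p) : tr P Q" by (rule tr_comp[OF Pf gp tr_self[OF Qf y]])
   have dty: "y : transporter G SS Q Q" using transporter_SS[OF Qf] tr_self[OF Qf y] fullD(2)[OF Qf] y by blast
   have dtp: "invG p : transporter G SS P P" using transporter_SS[OF Pf] tr_self[OF Pf p'] fullD(2)[OF Pf] p' by blast
   have psy: "ps Q Q (io y) = io y" using m(4)[OF P(2,2) dty] by (simp add: tw)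
   have psp: "ps P P (io (invG p)) = io (invG p)" using m(4)[OF P(1,1) dtp] by (simp add: tw)
   let ?u = "w P Q g"
   note wg = w[OF P]
   have gu: "g ** nv ?u : tr P Q" by (rule tr_nv[OF Pf P(3) wg(3)])
   have "io (g ** invG p) = comp (Ltw io t) P P Q (io g) (io (invG p))"
    using NZ2_unit(1)[OF t P p'] G' by (simp add: tw)
   hence "ps P Q (io (g ** invG p)) = comp (Ltw io t') P P Q (io (g ** nv ?u)) (io (invG p))"
    using m(5)[OF P(1,1,2), of "io (invG p)" "io g"] tr_self[OF Pf p'] P(3) by (simp add: tw psp wg(2))
   also have "... = io (g ** nv ?u ** invG p)" using NZ2_unit(1)[OF t' P(1,2) gu p'] G' wg(3) by (simp add: tw)
   also have "g ** nv ?u ** invG p = g ** invG p ** nv ?u" using Afix_commute[OF Pf wg(1) p'] G' wg(3) by (simp add: G.m_assoc)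
   finally have 1: "ps P Q (io (g ** invG p)) = io (g ** invG p ** nv ?u)" .
   have gpu: "g ** invG p ** nv ?u : tr P Q" by (rule tr_nv[OF Pf gp wg(3)])
   have "io (y ** (g ** invG p)) = comp (Ltw io t) P Q Q (io y) (io (g ** invG p))"
    using NZ2_unit(2)[OF t P(1,2) gp y] G' by (simp add: tw)
   hence "ps P Q (io (y ** (g ** invG p))) = comp (Ltw io t') P Q Q (io y) (io (g ** invG p ** nv ?u))"
    using m(5)[OF P(1,2,2), of "io (g ** invG p)" "io y"] tr_self[OF Qf y] gp by (simp add: tw psy 1)
   also have "... = io (y ** (g ** invG p ** nv ?u))" using NZ2_unit(2)[OF t' P(1,2) gpu y] G' wg(3) by (simp add: tw)
   also have "y ** (g ** invG p ** nv ?u) = y ** (g ** invG p) ** nv ?u" using G' wg(3) by (simp add: G.m_assoc)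
   finally have "w P Q (y ** (g ** invG p)) = ?u" by (rule wu[OF P(1,2) ygp wg(3)])
   thus ?thesis using G' by (simp add: G.m_assoc)
  qed
  have "EX v. K1 V v & (ALL P:\<XX>. ALL Q:\<XX>. ALL g:tr P Q. v (qp P \<one>\<^bsub>G\<^esub>) (qp Q g) = w P Q g)"
   by (rule descend_1[OF w(1) winv])
  then obtain v where v: "K1 V v" "!!P Q g. P : \<XX> ==> Q : \<XX> ==> g : tr P Q ==> v (qp P \<one>\<^bsub>G\<^esub>) (qp Q g) = w P Q g" by blast
  show "NE2 V t t'"
   unfolding NE2_def
  proof (intro exI conjI allI impI)
   show "K1 V v" by (rule v(1))
   show "N1 V v"
    unfolding N1_def
   proof (intro allI impI)
    fix e0 e1 assume c: "ch2 V e0 e1" and top: "top_pt e0 = top_pt e1"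
    from c obtain P Q x g where 1: "P : \<XX>" "Q : \<XX>" "x : carrier G" "g : tr P Q" "e0 = qp P x" "e1 = qp Q (g ** x)" by (rule ch2_cases)
    have gG: "g : carrier G" by (rule trG[OF 1(4)])
    have "g : SS" using top top_qp_eq[OF XXf[OF 1(1)] XXf[OF 1(2)] 1(3), of "g ** x"] 1 gG by (simp add: G.m_assoc)
    hence "g : transporter G SS P Q" using transporter_SS[OF XXf[OF 1(1)]] 1(4) by blast
    hence "ps P Q (io g) = io (g ** nv 0)" using m(4)[OF 1(1,2)] gG by (simp add: tw)
    hence "w P Q g = 0" by (rule wu[OF 1(1,2,4) Acl(1)])
    thus "v e0 e1 = 0" using K1_qp[OF v(1) 1(1,2,4,3)] v(2)[OF 1(1,2,4)] 1(3) by (simp add: 1(5,6) act_zero)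
   qed
   fix e0 e1 e2 assume "ch3 V e0 e1 e2"
   then obtain P Q R x a b where 1: "P : \<XX>" "Q : \<XX>" "R : \<XX>" "x : carrier G" "a : tr P Q" "b : tr Q R"
    "e0 = qp P x" "e1 = qp Q (a ** x)" "e2 = qp R (b ** a ** x)" by (rule ch3_cases)
   have G': "a : carrier G" "b : carrier G" using 1 trG by auto
   note ba = tr_comp[OF XXf[OF 1(1)] 1(5,6)]
   let ?e0 = "qp P \<one>\<^bsub>G\<^esub>" and ?e1 = "qp Q a" and ?e2 = "qp R (b ** a)"
   have tz: "t ?e0 ?e1 ?e2 : A" "t' ?e0 ?e1 ?e2 : A" by (rule tA[OF 1(1,2,3,5,6)])+
   have wz: "w P Q a : A" "w Q R b : A" "w P R (b ** a) : A" using w(3) 1 ba by auto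
   have vA: "act (inv (\<beta> a)) (w Q R b) : A" using wz G' by (simp add: act_closed)
   have bat: "b ** a ** nv (t ?e0 ?e1 ?e2) : tr P R" by (rule tr_nv[OF XXf[OF 1(1)] ba tz(1)])
   have c1: "comp (Ltw io t) P Q R (io b) (io a) = io (b ** a ** nv (t ?e0 ?e1 ?e2))" using G' by (simp add: tw)
   have "ps P R (io (b ** a ** nv (t ?e0 ?e1 ?e2))) = comp (Ltw io t') P Q R (io (b ** nv (w Q R b))) (io (a ** nv (w P Q a)))"
    using m(5)[OF 1(1-3), of "io a" "io b"] 1(5,6) c1 w(2)[OF 1(1,2,5)] w(2)[OF 1(2,3,6)] by (simp add: tw)
   also have "... = io (b ** a ** nv (act (inv (\<beta> a)) (w Q R b) + w P Q a + t' ?e0 ?e1 ?e2))"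
    by (rule twist_comp_nv[OF io K(2) 1(1,2,3,5,6) wz(1,2)])
   finally have "io (b ** a ** nv (t ?e0 ?e1 ?e2) ** nv (w P R (b ** a ** nv (t ?e0 ?e1 ?e2)))) = ..."
    using w(2)[OF 1(1,3) bat] by simp
   moreover have wba: "w P R (b ** a ** nv (t ?e0 ?e1 ?e2)) = w P R (b ** a)"
   proof -
    have "nv (- t ?e0 ?e1 ?e2) : P" using fullD(4)[OF XXf[OF 1(1)]] Acl(3)[OF tz(1)] by simp
    from winv[OF 1(1,3) ba subgroup.one_closed[OF fullD(1)[OF XXf[OF 1(3)]]] this]
    show ?thesis using G' tz(1) by (simp add: nv_uminus)
   qed
   ultimately have "b ** a ** nv (t ?e0 ?e1 ?e2 + w P R (b ** a)) = b ** a ** nv (act (inv (\<beta> a)) (w Q R b) + w P Q a + t' ?e0 ?e1 ?e2)"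
    using ioeq G' tz wz vA Acl by (simp add: nv_add G.m_assoc)
   hence eq: "t ?e0 ?e1 ?e2 + w P R (b ** a) = act (inv (\<beta> a)) (w Q R b) + w P Q a + t' ?e0 ?e1 ?e2"
    using G' tz wz vA Acl nv_eq_iff by simp
   have v12: "v ?e1 ?e2 = act (inv (\<beta> a)) (w Q R b)" using K1_qp[OF v(1) 1(2,3,6) G'(1)] v(2)[OF 1(2,3,6)] by simp
   have base: "t ?e0 ?e1 ?e2 - t' ?e0 ?e1 ?e2 = D1 v ?e0 ?e1 ?e2"
    unfolding D1_def v12 v(2)[OF 1(1,2,5)] v(2)[OF 1(1,3) ba] using eq by (simp add: algebra_simps)
   have KD: "K2 V (D1 v)" by (rule K_D(1)[OF v(1)])
   have Kd: "K2 V (%e0 e1 e2. t e0 e1 e2 - t' e0 e1 e2)" by (rule K_diff(2)[OF K])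
   show "t e0 e1 e2 - t' e0 e1 e2 = D1 v e0 e1 e2"
    using K2_qp[OF KD 1(1-3,5,6,4)] K2_qp[OF Kd 1(1-3,5,6,4)] base by (simp add: 1(7-9))
  qed
 qed
qed

end

section \<open>Every linking system is twisted by a cocycle\<close>

locale given_linking_system = linking_setup \<Gamma> T A act G \<beta> nv \<XX>
 for \<Gamma> :: "('g, 'b) monoid_scheme" (structure) and T A and act :: "'g => 'a::ab_group_add => 'a"
  and G :: "('h, 'c) monoid_scheme" and \<beta> :: "'h => 'g" and nv :: "'a => 'h" and \<XX> :: "'h set set" +
 fixes L :: "('h set, 'l) cat" and \<pi> :: "('h set, 'l, 'h set, 'h => 'h) cfunctor" and dt :: "('h set, 'h, 'h set, 'l) cfunctor"
 assumes linking: "linking_system G SS \<XX> (L, \<pi>, dt)"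
begin

lemmas ls = linking_systemD[OF linking]
lemmas lm = linking_system_mor[OF linking]
lemmas lcat = categoryD[OF ls(2), unfolded ls(3)]

abbreviation dl where "dl P Q g \<equiv> mor_map dt P Q g"

definition over where "over P Q g f <-> g : tr P Q & f : Mor L P Q & mor_map \<pi> P Q f = restrict (conj_by G g) P"

lemma overD: "over P Q g f ==> g : tr P Q" "over P Q g f ==> f : Mor L P Q"
 "over P Q g f ==> mor_map \<pi> P Q f = restrict (conj_by G g) P" "over P Q g f ==> g : carrier G"
 by (auto simp: over_def trG)

lemma over_delta: assumes "P : \<XX>" "Q : \<XX>" "g : SS" "g : tr P Q" shows "over P Q g (dl P Q g)"
proof -
 have "g : transporter G SS P Q" using assms transporter_SS[OF XXf[OF assms(1)]] by blast
 thus ?thesis using assms(4) lm(1)[OF assms(1,2)] ls(11)[OF assms(1,2)] by (simp add: over_def)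
qed

lemma over_self: assumes "P : \<XX>" "p : P" shows "over P P p (dl P P p)"
 by (rule over_delta[OF assms(1,1)]) (use assms fullD(2) XXf tr_self in blast)+

lemma over_comp:
 assumes P: "P : \<XX>" "Q : \<XX>" "R : \<XX>" and f: "over P Q g f" and f': "over Q R h f'"
 shows "over P R (h ** g) (comp L P Q R f' f)"
 unfolding over_def
proof (intro conjI)
 show "h ** g : tr P R" by (rule tr_comp[OF XXf[OF P(1)] overD(1)[OF f] overD(1)[OF f']])
 show "comp L P Q R f' f : Mor L P R" by (rule lcat(2)[OF P overD(2)[OF f] overD(2)[OF f']])
 have "mor_map \<pi> P R (comp L P Q R f' f) = compose P (restrict (conj_by G h) Q) (restrict (conj_by G g) P)"
  using lm(5)[OF P overD(2)[OF f] overD(2)[OF f']] overD(3)[OF f] overD(3)[OF f'] by simp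
 also have "... = restrict (conj_by G (h ** g)) P" by (rule conj_compose[OF XXf[OF P(1)] overD(1)[OF f] overD(1)[OF f']])
 finally show "mor_map \<pi> P R (comp L P Q R f' f) = restrict (conj_by G (h ** g)) P" .
qed

lemma over_exists:
 assumes "P : \<XX>" "Q : \<XX>" "g : tr P Q" shows "EX f. over P Q g f"
proof -
 have "restrict (conj_by G g) P : mor_map \<pi> P Q ` Mor L P Q" unfolding ls(9)[OF assms(1,2)] fusion_Mor using assms(3) by blast
 then obtain f where "restrict (conj_by G g) P = mor_map \<pi> P Q f" "f : Mor L P Q" by (rule imageE)
 thus ?thesis using assms(3) by (intro exI[of _ f]) (simp add: over_def)
qed

lemma over_unique:
 assumes P: "P : \<XX>" "Q : \<XX>" and f: "over P Q g f" "over P Q g f'"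
 shows "EX u:Afix P. f' = comp L P P Q f (dl P P (nv u))"
 using ls(10)[OF P overD(2)[OF f(1)] overD(2)[OF f(2)]] overD(3)[OF f(1)] overD(3)[OF f(2)]
 unfolding center_full[OF XXf[OF P(1)]] by auto

lemma over_conj:
 assumes P: "P : \<XX>" "Q : \<XX>" and f: "over P Q g f" and p: "p : P"
 shows "comp L P P Q f (dl P P p) = comp L P Q Q (dl Q Q (g ** p ** invG g)) f"
 using ls(12)[OF P overD(2)[OF f] p] overD(3)[OF f] p by (simp add: conj_by_def)

lemma delta_mult:
 assumes "P : \<XX>" "x : P" "y : P" shows "comp L P P P (dl P P x) (dl P P y) = dl P P (x ** y)"
proof -
 have "z : transporter G SS P P" if "z : P" for z
  using transporter_SS[OF XXf[OF assms(1)]] tr_self[OF XXf[OF assms(1)] that] fullD(2)[OF XXf[OF assms(1)]] that by blast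
 thus ?thesis using lm(3)[OF assms(1,1,1)] assms(2,3) by simp
qed

text \<open>
  The chosen lift \<open>sg\<close> must commute with left multiplication by \<open>Q\<close>, so it is chosen at one representative of each coset of
  \<open>Q\<close>; compatibility with right multiplication by \<open>P\<close> follows from axiom (C).
\<close>

definition rep where "rep Q g = (SOME k. k : (%y. y ** g) ` Q)"

definition sg where "sg P Q g = (if g : SS then dl P Q g
  else comp L P Q Q (dl Q Q (g ** invG (rep Q g))) (SOME f. over P Q (rep Q g) f))"

lemma rep: assumes "Q : \<XX>" shows "EX y:Q. rep Q g = y ** g"
proof -
 have "\<one>\<^bsub>G\<^esub> : Q" by (rule subgroup.one_closed[OF fullD(1)[OF XXf[OF assms]]])
 hence "(%y. y ** g) ` Q ~= {}" by blast
 from some_in_eq[THEN iffD2, OF this] show ?thesis unfolding rep_def by blast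
qed

lemma rep_left: assumes "Q : \<XX>" "y : Q" "g : carrier G" shows "rep Q (y ** g) = rep Q g"
proof -
 note Qs = fullD(1)[OF XXf[OF assms(1)]] and Qc = fullD(3)[OF XXf[OF assms(1)]]
 have yG: "y : carrier G" using assms(2) Qc by blast
 have "(%z. z ** (y ** g)) ` Q = (%z. z ** g) ` Q"
 proof
  show "(%z. z ** (y ** g)) ` Q \<subseteq> (%z. z ** g) ` Q"
  proof (rule image_subsetI)
   fix z assume z: "z : Q"
   have "z ** (y ** g) = z ** y ** g" using z Qc yG assms(3) by (auto simp: G.m_assoc)
   thus "z ** (y ** g) : (%z. z ** g) ` Q" using subgroup.m_closed[OF Qs z assms(2)] by blast
  qed
  show "(%z. z ** g) ` Q \<subseteq> (%z. z ** (y ** g)) ` Q"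
  proof (rule image_subsetI)
   fix z assume z: "z : Q"
   have zG: "z : carrier G" using z Qc by blast
   have "z ** g = z ** (invG y ** y) ** g" using zG yG assms(3) by simp
   also have "... = (z ** invG y) ** (y ** g)" using zG yG assms(3) by (simp only: G.m_assoc G.m_closed G.inv_closed)
   finally show "z ** g : (%z. z ** (y ** g)) ` Q"
    using subgroup.m_closed[OF Qs z subgroup.m_inv_closed[OF Qs assms(2)]] by blast
  qed
 qed
 thus ?thesis by (simp add: rep_def)
qed

lemma sg_SS: "g : SS ==> sg P Q g = dl P Q g"
 by (simp add: sg_def)

lemma rep_aux:
 assumes P: "P : \<XX>" "Q : \<XX>" "g : tr P Q"
 shows "over P Q (rep Q g) (SOME f. over P Q (rep Q g) f)" "g ** invG (rep Q g) : Q" "g ** invG (rep Q g) ** rep Q g = g"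
proof -
 obtain y where y: "y : Q" "rep Q g = y ** g" using rep[OF P(2)] by blast
 have G': "y : carrier G" "g : carrier G" using y fullD(3)[OF XXf[OF P(2)]] trG[OF P(3)] by auto
 have "rep Q g : tr P Q" unfolding y(2) by (rule tr_comp[OF XXf[OF P(1)] P(3) tr_self[OF XXf[OF P(2)] y(1)]])
 thus "over P Q (rep Q g) (SOME f. over P Q (rep Q g) f)" using over_exists[OF P(1,2)] by (metis someI_ex)
 have e: "g ** invG (rep Q g) = invG y"
 proof -
  have "g ** invG (rep Q g) = g ** invG g ** invG y" unfolding y(2) using G' by (simp only: G.inv_mult_group G.m_assoc G.m_closed G.inv_closed)
  thus ?thesis using G' by simp
 qed
 show "g ** invG (rep Q g) : Q" unfolding e by (rule subgroup.m_inv_closed[OF fullD(1)[OF XXf[OF P(2)]] y(1)])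
 show "g ** invG (rep Q g) ** rep Q g = g" unfolding e unfolding y(2) using G' by (simp add: G.m_assoc [symmetric])
qed

lemma sg_over: assumes P: "P : \<XX>" "Q : \<XX>" "g : tr P Q" shows "over P Q g (sg P Q g)"
proof (cases "g : SS")
 case True
 thus ?thesis using over_delta[OF P(1,2) True P(3)] by (simp add: sg_SS)
next
 case False
 have "over P Q (g ** invG (rep Q g) ** rep Q g) (comp L P Q Q (dl Q Q (g ** invG (rep Q g))) (SOME f. over P Q (rep Q g) f))"
  by (rule over_comp[OF P(1,2,2) rep_aux(1)[OF P] over_self[OF P(2) rep_aux(2)[OF P]]])
 thus ?thesis using False by (simp add: sg_def rep_aux(3)[OF P])
qed

lemma sg_left: assumes P: "P : \<XX>" "Q : \<XX>" "g : tr P Q" and y: "y : Q" shows "sg P Q (y ** g) = comp L P Q Q (dl Q Q y) (sg P Q g)"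
proof -
 have G': "y : carrier G" "g : carrier G" using y fullD(3)[OF XXf[OF P(2)]] trG[OF P(3)] by auto
 have ySS: "y : SS" using y fullD(2)[OF XXf[OF P(2)]] by blast
 show ?thesis
 proof (cases "g : SS")
  case True
  have "y : transporter G SS Q Q" "g : transporter G SS P Q"
   using transporter_SS[OF XXf[OF P(1)]] transporter_SS[OF XXf[OF P(2)]] tr_self[OF XXf[OF P(2)] y] ySS True P(3) by blast+
  hence "dl P Q (y ** g) = comp L P Q Q (dl Q Q y) (dl P Q g)" using lm(3)[OF P(1,2,2)] by blast
  thus ?thesis using True subgroup.m_closed[OF SS_subgroup ySS True] by (simp add: sg_SS)
 next
  case False
  have ng: "y ** g ~: SS"
  proof
   assume "y ** g : SS"
   hence "invG y ** (y ** g) : SS" by (rule subgroup.m_closed[OF SS_subgroup subgroup.m_inv_closed[OF SS_subgroup ySS]])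
   thus False using False G' by (simp add: G.m_assoc [symmetric])
  qed
  let ?k = "rep Q g" and ?f = "SOME f. over P Q (rep Q g) f"
  note r = rep_aux[OF P]
  have kG: "?k : carrier G" by (rule overD(4)[OF r(1)])
  have "sg P Q (y ** g) = comp L P Q Q (dl Q Q (y ** (g ** invG ?k))) ?f"
   using ng G' kG by (simp add: sg_def rep_left[OF P(2) y G'(2)] G.m_assoc)
  also have "... = comp L P Q Q (comp L Q Q Q (dl Q Q y) (dl Q Q (g ** invG ?k))) ?f"
   by (simp add: delta_mult[OF P(2) y r(2)])
  also have "... = comp L P Q Q (dl Q Q y) (comp L P Q Q (dl Q Q (g ** invG ?k)) ?f)"
   by (rule lcat(5)[OF P(1,2,2,2) overD(2)[OF r(1)] overD(2)[OF over_self[OF P(2) r(2)]] overD(2)[OF over_self[OF P(2) y]]])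
  finally show ?thesis using False by (simp add: sg_def)
 qed
qed

lemma sg_right: assumes P: "P : \<XX>" "Q : \<XX>" "g : tr P Q" and p: "p : P" shows "sg P Q (g ** p) = comp L P P Q (sg P Q g) (dl P P p)"
proof -
 have G': "p : carrier G" "g : carrier G" using p fullD(3)[OF XXf[OF P(1)]] trG[OF P(3)] by auto
 have "g ** p = g ** p ** invG g ** g" using G' by (simp add: G.m_assoc)
 thus ?thesis using sg_left[OF P trD(2)[OF P(3) p]] over_conj[OF P(1,2) sg_over[OF P] p] by simp
qed

lemma sg_over_eq:
 assumes P: "P : \<XX>" "Q : \<XX>" and f: "over P Q g f" shows "EX u:Afix P. f = sg P Q (g ** nv u)"
proof -
 obtain u where u: "u : Afix P" "f = comp L P P Q (sg P Q g) (dl P P (nv u))"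
  using over_unique[OF P sg_over[OF P overD(1)[OF f]] f] by blast
 thus ?thesis using sg_right[OF P overD(1)[OF f] fullD(4)[OF XXf[OF P(1)] AfixD(1)[OF u(1)]]] by (intro bexI[of _ u]) simp_all
qed

lemma sg_inj: assumes P: "P : \<XX>" "Q : \<XX>" "g : tr P Q" "g' : tr P Q" and eq: "sg P Q g = sg P Q g'" shows "g = g'"
proof -
 have "restrict (conj_by G g) P = restrict (conj_by G g') P"
  using overD(3)[OF sg_over[OF P(1,2,3)]] overD(3)[OF sg_over[OF P(1,2,4)]] eq by simp
 then obtain u where u: "u : Afix P" "g' = g ** nv u" using conj_restrict_eq[OF XXf[OF P(1)] trG[OF P(3)] trG[OF P(4)]] by blast
 have uA: "u : A" by (rule AfixD(1)[OF u(1)])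
 have "comp L P P Q (sg P Q g) (dl P P (nv u)) = sg P Q g"
  using sg_right[OF P(1-3) fullD(4)[OF XXf[OF P(1)] uA]] eq u(2) by simp
 hence "nv u = \<one>\<^bsub>G\<^esub>"
  using ls(8)[OF P(1,2) overD(2)[OF sg_over[OF P(1-3)]], of "nv u"] u(1) center_full[OF XXf[OF P(1)]] by blast
 thus ?thesis using u(2) trG[OF P(3)] by simp
qed

lemma sg_bij: assumes P: "P : \<XX>" "Q : \<XX>" shows "bij_betw (sg P Q) (tr P Q) (Mor L P Q)"
 unfolding bij_betw_def
proof
 show "inj_on (sg P Q) (tr P Q)" using sg_inj[OF P] by (auto simp: inj_on_def)
 show "sg P Q ` tr P Q = Mor L P Q"
 proof
  show "sg P Q ` tr P Q \<subseteq> Mor L P Q" using overD(2)[OF sg_over[OF P]] by blast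
  show "Mor L P Q \<subseteq> sg P Q ` tr P Q"
  proof
   fix f assume f: "f : Mor L P Q"
   have "mor_map \<pi> P Q f : (%g. restrict (conj_by G g) P) ` tr P Q" using lm(4)[OF P f] unfolding fusion_Mor .
   then obtain g where g: "mor_map \<pi> P Q f = restrict (conj_by G g) P" "g : tr P Q" by (rule imageE)
   hence o: "over P Q g f" using f by (simp add: over_def)
   obtain u where u: "u : Afix P" "f = sg P Q (g ** nv u)" using sg_over_eq[OF P o] by blast
   thus "f : sg P Q ` tr P Q" using tr_nv[OF XXf[OF P(1)] g(2) AfixD(1)[OF u(1)]] by blast
  qed
 qed
qed

text \<open>
  The deviation of the chosen morphisms from being a functor.
\<close>

definition w where "w P Q R h g = (SOME u. u : Afix P & comp L P Q R (sg Q R h) (sg P Q g) = sg P R (h ** g ** nv u))"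

lemma w:
 assumes P: "P : \<XX>" "Q : \<XX>" "R : \<XX>" "g : tr P Q" "h : tr Q R"
 shows "w P Q R h g : Afix P" "comp L P Q R (sg Q R h) (sg P Q g) = sg P R (h ** g ** nv (w P Q R h g))" "w P Q R h g : A"
proof -
 have "EX u. u : Afix P & comp L P Q R (sg Q R h) (sg P Q g) = sg P R (h ** g ** nv u)"
  using sg_over_eq[OF P(1,3) over_comp[OF P(1-3) sg_over[OF P(1,2,4)] sg_over[OF P(2,3,5)]]] by blast
 from someI_ex[OF this] show "w P Q R h g : Afix P" "comp L P Q R (sg Q R h) (sg P Q g) = sg P R (h ** g ** nv (w P Q R h g))"
  unfolding w_def by blast+
 thus "w P Q R h g : A" by (auto dest: AfixD(1))
qed

lemma sg_nv_cancel:
 assumes P: "P : \<XX>" "Q : \<XX>" "g : tr P Q" "u : A" "v : A" and eq: "sg P Q (g ** nv u) = sg P Q (g ** nv v)" shows "u = v"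
proof -
 have "g ** nv u = g ** nv v" by (rule sg_inj[OF P(1,2) tr_nv[OF XXf[OF P(1)] P(3,4)] tr_nv[OF XXf[OF P(1)] P(3,5)] eq])
 thus ?thesis using trG[OF P(3)] P(4,5) nv_eq_iff by simp
qed

lemma w_unique:
 assumes P: "P : \<XX>" "Q : \<XX>" "R : \<XX>" "g : tr P Q" "h : tr Q R" "u : A"
  and eq: "comp L P Q R (sg Q R h) (sg P Q g) = sg P R (h ** g ** nv u)"
 shows "w P Q R h g = u"
 using sg_nv_cancel[OF P(1,3) tr_comp[OF XXf[OF P(1)] P(4,5)] w(3)[OF P(1-5)] P(6)] w(2)[OF P(1-5)] eq by simp

lemma w_left:
 assumes P: "P : \<XX>" "Q : \<XX>" "R : \<XX>" "g : tr P Q" "h : tr Q R" and r: "r : R"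
 shows "w P Q R (r ** h) g = w P Q R h g"
proof -
 have G': "g : carrier G" "h : carrier G" "r : carrier G" using trG P r fullD(3)[OF XXf[OF P(3)]] by auto
 note hg = tr_comp[OF XXf[OF P(1)] P(4,5)] and rh = tr_comp[OF XXf[OF P(2)] P(5) tr_self[OF XXf[OF P(3)] r]]
 note wA = w(3)[OF P]
 have "comp L P Q R (sg Q R (r ** h)) (sg P Q g) = comp L P Q R (comp L Q R R (dl R R r) (sg Q R h)) (sg P Q g)"
  by (simp add: sg_left[OF P(2,3,5) r])
 also have "... = comp L P R R (dl R R r) (comp L P Q R (sg Q R h) (sg P Q g))"
  by (rule lcat(5)[OF P(1,2,3,3) overD(2)[OF sg_over[OF P(1,2,4)]] overD(2)[OF sg_over[OF P(2,3,5)]] overD(2)[OF over_self[OF P(3) r]]])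
 also have "... = sg P R (r ** (h ** g ** nv (w P Q R h g)))"
  unfolding w(2)[OF P] by (rule sg_left[OF P(1,3) tr_nv[OF XXf[OF P(1)] hg wA] r, symmetric])
 also have "r ** (h ** g ** nv (w P Q R h g)) = r ** h ** g ** nv (w P Q R h g)" using G' wA by (simp add: G.m_assoc)
 finally show ?thesis by (rule w_unique[OF P(1-4) rh wA])
qed

lemma w_right:
 assumes P: "P : \<XX>" "Q : \<XX>" "R : \<XX>" "g : tr P Q" "h : tr Q R" and p: "p : P"
 shows "w P Q R h (g ** p) = w P Q R h g"
proof -
 have G': "g : carrier G" "h : carrier G" "p : carrier G" using trG P p fullD(3)[OF XXf[OF P(1)]] by auto
 note hg = tr_comp[OF XXf[OF P(1)] P(4,5)] and gp = tr_comp[OF XXf[OF P(1)] tr_self[OF XXf[OF P(1)] p] P(4)]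
 note wA = w(3)[OF P]
 have "comp L P Q R (sg Q R h) (sg P Q (g ** p)) = comp L P Q R (sg Q R h) (comp L P P Q (sg P Q g) (dl P P p))"
  by (simp add: sg_right[OF P(1,2,4) p])
 also have "... = comp L P P R (comp L P Q R (sg Q R h) (sg P Q g)) (dl P P p)"
  by (rule lcat(5)[OF P(1,1,2,3) overD(2)[OF over_self[OF P(1) p]] overD(2)[OF sg_over[OF P(1,2,4)]] overD(2)[OF sg_over[OF P(2,3,5)]], symmetric])
 also have "... = sg P R (h ** g ** nv (w P Q R h g) ** p)"
  unfolding w(2)[OF P] by (rule sg_right[OF P(1,3) tr_nv[OF XXf[OF P(1)] hg wA] p, symmetric])
 also have "h ** g ** nv (w P Q R h g) ** p = h ** (g ** p) ** nv (w P Q R h g)"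
  using G' wA Afix_commute[OF XXf[OF P(1)] w(1)[OF P] p] by (simp add: G.m_assoc)
 finally show ?thesis by (rule w_unique[OF P(1-3) gp P(5) wA])
qed

lemma w_middle:
 assumes P: "P : \<XX>" "Q : \<XX>" "R : \<XX>" "g : tr P Q" "h : tr Q R" and y: "y : Q"
 shows "w P Q R (h ** invG y) (y ** g) = w P Q R h g"
proof -
 have G': "g : carrier G" "h : carrier G" "y : carrier G" using trG P y fullD(3)[OF XXf[OF P(2)]] by auto
 have y': "invG y : Q" by (rule subgroup.m_inv_closed[OF fullD(1)[OF XXf[OF P(2)]] y])
 note yg = tr_comp[OF XXf[OF P(1)] P(4) tr_self[OF XXf[OF P(2)] y]] and hy = tr_comp[OF XXf[OF P(2)] tr_self[OF XXf[OF P(2)] y'] P(5)]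
 note wA = w(3)[OF P]
 note m = overD(2)[OF sg_over[OF P(1,2) yg]] overD(2)[OF over_self[OF P(2) y']] overD(2)[OF sg_over[OF P(2,3,5)]]
 have "comp L P Q R (sg Q R (h ** invG y)) (sg P Q (y ** g)) = comp L P Q R (comp L Q Q R (sg Q R h) (dl Q Q (invG y))) (sg P Q (y ** g))"
  by (simp add: sg_right[OF P(2,3,5) y'])
 also have "... = comp L P Q R (sg Q R h) (comp L P Q Q (dl Q Q (invG y)) (sg P Q (y ** g)))"
  by (rule lcat(5)[OF P(1,2,2,3) m])
 also have "comp L P Q Q (dl Q Q (invG y)) (sg P Q (y ** g)) = sg P Q (invG y ** (y ** g))"
  by (rule sg_left[OF P(1,2) yg y', symmetric])
 also have "invG y ** (y ** g) = g" using G' by (simp add: G.m_assoc [symmetric])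
 also have "comp L P Q R (sg Q R h) (sg P Q g) = sg P R (h ** g ** nv (w P Q R h g))" by (rule w(2)[OF P])
 also have "h ** g = h ** (invG y ** y) ** g" using G' by simp
 also have "... = h ** invG y ** (y ** g)" using G' by (simp only: G.m_assoc G.m_closed G.inv_closed)
 finally show ?thesis by (rule w_unique[OF P(1-3) yg hy wA])
qed

lemma w_invariant:
 assumes P: "P : \<XX>" "Q : \<XX>" "R : \<XX>" "g : tr P Q" "h : tr Q R" and r: "r : R" and y: "y : Q" and p: "p : P"
 shows "w P Q R (r ** h ** invG y) (y ** g ** invG p) = w P Q R h g"
proof -
 have p': "invG p : P" by (rule subgroup.m_inv_closed[OF fullD(1)[OF XXf[OF P(1)]] p])
 have y': "invG y : Q" by (rule subgroup.m_inv_closed[OF fullD(1)[OF XXf[OF P(2)]] y])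
 note rh = tr_comp[OF XXf[OF P(2)] P(5) tr_self[OF XXf[OF P(3)] r]] and yg = tr_comp[OF XXf[OF P(1)] P(4) tr_self[OF XXf[OF P(2)] y]]
 note rhy = tr_comp[OF XXf[OF P(2)] tr_self[OF XXf[OF P(2)] y'] rh]
 show ?thesis using w_right[OF P(1-3) yg rhy p'] w_middle[OF P(1-4) rh y] w_left[OF P r] by simp
qed

lemma w_SS:
 assumes P: "P : \<XX>" "Q : \<XX>" "R : \<XX>" "g : tr P Q" "h : tr Q R" "g : SS" "h : SS"
 shows "w P Q R h g = 0"
proof -
 have "g : transporter G SS P Q" "h : transporter G SS Q R"
  using transporter_SS[OF XXf[OF P(1)]] transporter_SS[OF XXf[OF P(2)]] P by blast+
 hence "dl P R (h ** g) = comp L P Q R (dl Q R h) (dl P Q g)" using lm(3)[OF P(1-3)] by blast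
 hence "comp L P Q R (sg Q R h) (sg P Q g) = sg P R (h ** g ** nv 0)"
  using P(6,7) subgroup.m_closed[OF SS_subgroup P(7,6)] trG[OF P(4)] trG[OF P(5)] by (simp add: sg_SS)
 thus ?thesis by (rule w_unique[OF P(1-5) Acl(1)])
qed

lemma w_cocycle:
 assumes P: "P : \<XX>" "Q : \<XX>" "R : \<XX>" "U : \<XX>" and a: "a : tr P Q" and b: "b : tr Q R" and c: "c : tr R U"
 shows "w P R U c (b ** a) + w P Q R b a = w P Q U (c ** b) a + act (inv (\<beta> a)) (w Q R U c b)"
proof -
 have G': "a : carrier G" "b : carrier G" "c : carrier G" using a b c trG by auto
 note Pf = XXf[OF P(1)] and Qf = XXf[OF P(2)]
 note ba = tr_comp[OF Pf a b] and cb = tr_comp[OF Qf b c]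
 note cba = tr_comp[OF Pf ba c]
 have cba': "c ** b ** a : tr P U" using cba G' by (simp add: G.m_assoc)
 let ?w1 = "w P R U c (b ** a)" and ?w2 = "w P Q R b a" and ?w3 = "w P Q U (c ** b) a" and ?w4 = "w Q R U c b"
 have wA: "?w1 : A" "?w2 : A" "?w3 : A" "?w4 : A"
  using w(3)[OF P(1,3,4) ba c] w(3)[OF P(1,2,3) a b] w(3)[OF P(1,2,4) a cb] w(3)[OF P(2,3,4) b c] by auto
 have w4: "act (inv (\<beta> a)) ?w4 : A" using wA(4) G' by (simp add: act_closed)
 note Ma = overD(2)[OF sg_over[OF P(1,2) a]] and Mb = overD(2)[OF sg_over[OF P(2,3) b]] and Mc = overD(2)[OF sg_over[OF P(3,4) c]]
 have nvP: "nv u : P" if "u : A" for u by (rule fullD(4)[OF Pf that])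
 have nvQ: "nv u : Q" if "u : A" for u by (rule fullD(4)[OF Qf that])
 have "comp L P R U (sg R U c) (comp L P Q R (sg Q R b) (sg P Q a)) = comp L P R U (sg R U c) (comp L P P R (sg P R (b ** a)) (dl P P (nv ?w2)))"
  unfolding w(2)[OF P(1-3) a b] sg_right[OF P(1,3) ba nvP[OF wA(2)]] ..
 also have "... = comp L P P U (comp L P R U (sg R U c) (sg P R (b ** a))) (dl P P (nv ?w2))"
  by (rule lcat(5)[OF P(1,1,3,4) overD(2)[OF over_self[OF P(1) nvP[OF wA(2)]]] overD(2)[OF sg_over[OF P(1,3) ba]] Mc, symmetric])
 also have "... = sg P U (c ** (b ** a) ** nv ?w1 ** nv ?w2)"
  unfolding w(2)[OF P(1,3,4) ba c] by (rule sg_right[OF P(1,4) tr_nv[OF Pf cba wA(1)] nvP[OF wA(2)], symmetric])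
 also have "c ** (b ** a) ** nv ?w1 ** nv ?w2 = c ** b ** a ** nv (?w1 + ?w2)" using G' wA by (simp add: nv_add G.m_assoc)
 finally have 1: "comp L P R U (sg R U c) (comp L P Q R (sg Q R b) (sg P Q a)) = sg P U (c ** b ** a ** nv (?w1 + ?w2))" .
 have "comp L P Q U (comp L Q R U (sg R U c) (sg Q R b)) (sg P Q a) =
   comp L P Q U (comp L Q Q U (sg Q U (c ** b)) (dl Q Q (nv ?w4))) (sg P Q a)"
  unfolding w(2)[OF P(2-4) b c] sg_right[OF P(2,4) cb nvQ[OF wA(4)]] ..
 also have "... = comp L P Q U (sg Q U (c ** b)) (comp L P Q Q (dl Q Q (nv ?w4)) (sg P Q a))"
  by (rule lcat(5)[OF P(1,2,2,4) Ma overD(2)[OF over_self[OF P(2) nvQ[OF wA(4)]]] overD(2)[OF sg_over[OF P(2,4) cb]]])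
 also have "comp L P Q Q (dl Q Q (nv ?w4)) (sg P Q a) = sg P Q (nv ?w4 ** a)" by (rule sg_left[OF P(1,2) a nvQ[OF wA(4)], symmetric])
 also have "nv ?w4 ** a = a ** nv (act (inv (\<beta> a)) ?w4)" by (rule nv_right[OF G'(1) wA(4)])
 also have "sg P Q (a ** nv (act (inv (\<beta> a)) ?w4)) = comp L P P Q (sg P Q a) (dl P P (nv (act (inv (\<beta> a)) ?w4)))"
  by (rule sg_right[OF P(1,2) a nvP[OF w4]])
 also have "comp L P Q U (sg Q U (c ** b)) ... = comp L P P U (comp L P Q U (sg Q U (c ** b)) (sg P Q a)) (dl P P (nv (act (inv (\<beta> a)) ?w4)))"
  by (rule lcat(5)[OF P(1,1,2,4) overD(2)[OF over_self[OF P(1) nvP[OF w4]]] Ma overD(2)[OF sg_over[OF P(2,4) cb]], symmetric])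
 also have "... = sg P U (c ** b ** a ** nv ?w3 ** nv (act (inv (\<beta> a)) ?w4))"
  unfolding w(2)[OF P(1,2,4) a cb] by (rule sg_right[OF P(1,4) tr_nv[OF Pf cba' wA(3)] nvP[OF w4], symmetric])
 also have "c ** b ** a ** nv ?w3 ** nv (act (inv (\<beta> a)) ?w4) = c ** b ** a ** nv (?w3 + act (inv (\<beta> a)) ?w4)"
  using G' wA w4 by (simp add: nv_add G.m_assoc)
 finally have 2: "comp L P Q U (comp L Q R U (sg R U c) (sg Q R b)) (sg P Q a) = sg P U (c ** b ** a ** nv (?w3 + act (inv (\<beta> a)) ?w4))" .
 have "sg P U (c ** b ** a ** nv (?w1 + ?w2)) = sg P U (c ** b ** a ** nv (?w3 + act (inv (\<beta> a)) ?w4))"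
  using 1 2 lcat(5)[OF P Ma Mb Mc] by simp
 thus ?thesis by (rule sg_nv_cancel[OF P(1,4) cba' Acl(2)[OF wA(1,2)] Acl(2)[OF wA(3) w4]])
qed

text \<open>
  The deviation is a normalised cocycle, and the chosen morphisms give an isomorphism from the
  category twisted by it.
\<close>

lemma is_twisted:
 assumes io: "inj_on io (carrier G)"
 shows "EX t:NZ2 V. linking_iso G SS \<XX> (twist io t) (L, \<pi>, dt)"
proof -
 note tw = twist_simps[OF io]
 obtain t where t: "K2 V t" "!!P Q R g h. P : \<XX> ==> Q : \<XX> ==> R : \<XX> ==> g : tr P Q ==> h : tr Q R ==>
   t (qp P \<one>\<^bsub>G\<^esub>) (qp Q g) (qp R (h ** g)) = w P Q R h g"
  using descend_2[of w, OF w(1) w_invariant] by blast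
 have tx: "t (qp P x) (qp Q (g ** x)) (qp R (h ** g ** x)) = act (inv (\<beta> x)) (w P Q R h g)"
  if "P : \<XX>" "Q : \<XX>" "R : \<XX>" "g : tr P Q" "h : tr Q R" "x : carrier G" for P Q R g h x
  using K2_qp[OF t(1) that] t(2)[OF that(1-5)] by simp
 have N: "N2 V t"
  unfolding N2_def
 proof (intro allI impI)
  fix e0 e1 e2 assume ch: "ch3 V e0 e1 e2" and top: "top_pt e0 = top_pt e1" "top_pt e1 = top_pt e2"
  obtain P Q R x g h where 1: "P : \<XX>" "Q : \<XX>" "R : \<XX>" "x : carrier G" "g : tr P Q" "h : tr Q R"
   "e0 = qp P x" "e1 = qp Q (g ** x)" "e2 = qp R (h ** g ** x)" using ch by (rule ch3_cases)
  have G': "g : carrier G" "h : carrier G" using 1 trG by auto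
  have "g : SS" using top top_qp_eq[OF XXf[OF 1(1)] XXf[OF 1(2)] 1(4), of "g ** x"] 1(4,7,8) G' by (simp add: G.m_assoc)
  moreover have "h : SS"
  proof -
   have "h ** g ** x ** invG (g ** x) = h" using G' 1(4) by (simp add: G.m_assoc [of h g x] G.m_assoc [of h "g ** x"])
   thus ?thesis using top top_qp_eq[OF XXf[OF 1(2)] XXf[OF 1(3)], of "g ** x" "h ** g ** x"] 1(4,8,9) G' by simp
  qed
  ultimately have "w P Q R h g = 0" by (rule w_SS[OF 1(1-3,5,6)])
  thus "t e0 e1 e2 = 0" using tx[OF 1(1-3,5,6,4)] 1(4) by (simp add: 1(7-9) act_zero)
 qed
 have D: "D2 t e0 e1 e2 e3 = 0" if ch: "ch4 V e0 e1 e2 e3" for e0 e1 e2 e3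
 proof -
  obtain P Q R U x g h k where 1: "P : \<XX>" "Q : \<XX>" "R : \<XX>" "U : \<XX>" "x : carrier G" "g : tr P Q" "h : tr Q R" "k : tr R U"
   "e0 = qp P x" "e1 = qp Q (g ** x)" "e2 = qp R (h ** g ** x)" "e3 = qp U (k ** h ** g ** x)" using ch by (rule ch4_cases)
  have G': "g : carrier G" "h : carrier G" "k : carrier G" using 1 trG by auto
  note hg = tr_comp[OF XXf[OF 1(1)] 1(6,7)] and kh = tr_comp[OF XXf[OF 1(2)] 1(7,8)]
  have a1: "t e1 e2 e3 = act (inv (\<beta> x)) (act (inv (\<beta> g)) (w Q R U k h))"
   using tx[OF 1(2-4,7,8), of "g ** x"] G' 1(5) w(3)[OF 1(2-4,7,8)] by (simp add: 1(10-12) G.m_assoc inv_mult_group act_mult)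
  have a2: "t e0 e2 e3 = act (inv (\<beta> x)) (w P R U k (h ** g))"
   using tx[OF 1(1,3,4) hg 1(8,5)] G' 1(5) by (simp add: 1(9,11,12) G.m_assoc)
  have a3: "t e0 e1 e3 = act (inv (\<beta> x)) (w P Q U (k ** h) g)" using tx[OF 1(1,2,4,6) kh 1(5)] by (simp add: 1(9,10,12))
  have a4: "t e0 e1 e2 = act (inv (\<beta> x)) (w P Q R h g)" using tx[OF 1(1-3,6,7,5)] by (simp add: 1(9-11))
  have wA: "w Q R U k h : A" "w P R U k (h ** g) : A" "w P Q U (k ** h) g : A" "w P Q R h g : A"
   using w(3)[OF 1(2-4,7,8)] w(3)[OF 1(1,3,4) hg 1(8)] w(3)[OF 1(1,2,4,6) kh] w(3)[OF 1(1-3,6,7)] by auto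
  have "t e0 e2 e3 + t e0 e1 e2 = t e0 e1 e3 + t e1 e2 e3"
   unfolding a1 a2 a3 a4 using w_cocycle[OF 1(1-4,6-8)] wA G' 1(5) by (simp add: act_add [symmetric] act_closed)
  thus ?thesis by (simp add: D2_def algebra_simps)
 qed
 have Z: "t : NZ2 V" using t(1) N D by (auto simp: NZ2_def)
 define un where "un = inv_into (carrier G) io"
 have un: "un (io g) = g" if "g : carrier G" for g unfolding un_def by (rule inv_into_f_f[OF io that])
 have tA: "t (qp P \<one>\<^bsub>G\<^esub>) (qp Q g) (qp R (h ** g)) : A" if "P : \<XX>" "Q : \<XX>" "R : \<XX>" "g : tr P Q" "h : tr Q R" for P Q R g h
  using t(2)[OF that] w(3)[OF that] by simp
 have "iso_maps G SS \<XX> (Ltw io t, \<pi>tw io, dttw io) (L, \<pi>, dt) (%P Q f. sg P Q (un f))"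
  unfolding iso_maps_def prod.case
 proof (intro ballI conjI)
  fix P Q assume P: "P : \<XX>" and Q: "Q : \<XX>"
  have "bij_betw un (io ` tr P Q) (tr P Q)"
  proof (rule bij_betwI[where g = io])
   show "un : io ` tr P Q \<rightarrow> tr P Q" using un trG by auto
   show "io (un f) = f" if "f : io ` tr P Q" for f using that un trG by auto
  qed (use un trG in auto)
  from bij_betw_trans[OF this sg_bij[OF P Q]]
  show "bij_betw (%f. sg P Q (un f)) (Mor (Ltw io t) P Q) (Mor L P Q)" by (simp add: tw o_def)
  show "mor_map \<pi> P Q (sg P Q (un f)) = mor_map (\<pi>tw io) P Q f" if f: "f : Mor (Ltw io t) P Q" for f
  proof -
   from f obtain g where g: "g : tr P Q" "f = io g" by (auto simp: tw)
   show ?thesis using overD(3)[OF sg_over[OF P Q g(1)]] trG[OF g(1)] by (simp add: g(2) un tw)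
  qed
  show "sg P Q (un (mor_map (dttw io) P Q g)) = dl P Q g" if "g : transporter G SS P Q" for g
   using tr_SS[OF XXf[OF P] that] trG by (auto simp: tw un sg_SS)
  fix R f f' assume R: "R : \<XX>" and f: "f : Mor (Ltw io t) P Q" and f': "f' : Mor (Ltw io t) Q R"
  obtain g h where g: "g : tr P Q" "f = io g" and h: "h : tr Q R" "f' = io h" using f f' by (auto simp: tw)
  show "sg P R (un (comp (Ltw io t) P Q R f' f)) = comp L P Q R (sg Q R (un f')) (sg P Q (un f))"
   using w(2)[OF P Q R g(1) h(1)] t(2)[OF P Q R g(1) h(1)] tA[OF P Q R g(1) h(1)] trG[OF g(1)] trG[OF h(1)] by (simp add: g(2) h(2) tw un)
 qed
 hence "linking_iso G SS \<XX> (twist io t) (L, \<pi>, dt)"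
  unfolding twist_eq using linking_iso_iff[OF G.is_group SS_subgroup twisted_linking_system[OF io Z, unfolded twist_eq] linking] by blast
 thus ?thesis using Z by blast
qed

end

context linking_setup
begin

theorem linking_systems_correspond:
 fixes io :: "'h => 'l"
 assumes io: "inj_on io (carrier G)"
 shows "corr {L :: ('h, 'l) linking_data. linking_system G SS \<XX> L} (linking_iso G SS \<XX>) (NZ2 V) (NE2 V)"
proof (rule corr_sym, rule corrI[where R = "%t L. linking_iso G SS \<XX> (twist io t) L"])
 let ?C = "{L :: ('h, 'l) linking_data. linking_system G SS \<XX> L}"
 have eq: "equiv ?C {(L, L'). L : ?C & L' : ?C & linking_iso G SS \<XX> L L'}"
  by (rule linking_iso_equiv[OF G.is_group SS_subgroup])
 have sym: "linking_iso G SS \<XX> L' L" if "L : ?C" "L' : ?C" "linking_iso G SS \<XX> L L'" for L L'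
  using equivE[OF eq] that by (auto dest: symD)
 have trans: "linking_iso G SS \<XX> L L''" if "L : ?C" "L' : ?C" "L'' : ?C" "linking_iso G SS \<XX> L L'" "linking_iso G SS \<XX> L' L''" for L L' L''
 proof -
  have "trans {(L, L'). L : ?C & L' : ?C & linking_iso G SS \<XX> L L'}" using eq by (rule equivE)
  from transD[OF this, of L L' L''] that show ?thesis by simp
 qed
 have tw: "twist io t : ?C" if "t : NZ2 V" for t using twisted_linking_system[OF io that] by simp
 show "EX L:?C. linking_iso G SS \<XX> (twist io t) L" if "t : NZ2 V" for t
 proof -
  have "refl_on ?C {(L, L'). L : ?C & L' : ?C & linking_iso G SS \<XX> L L'}" using eq by (rule equivE)
  from refl_onD[OF this tw[OF that]] show ?thesis using tw[OF that] by blast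
 qed
 show "EX t:NZ2 V. linking_iso G SS \<XX> (twist io t) L" if "L : ?C" for L
 proof -
  obtain L0 \<pi> dt where L: "L = (L0, \<pi>, dt)" by (cases L) auto
  interpret given_linking_system \<Gamma> T A act G \<beta> nv \<XX> L0 \<pi> dt by unfold_locales (use that L in simp)
  show ?thesis unfolding L by (rule is_twisted[OF io])
 qed
 show "NE2 V t t' <-> linking_iso G SS \<XX> L L'" if a: "t : NZ2 V" "t' : NZ2 V" "L : ?C" "L' : ?C"
  "linking_iso G SS \<XX> (twist io t) L" "linking_iso G SS \<XX> (twist io t') L'" for t t' L L'
  unfolding twist_iso_iff[OF io a(1,2), symmetric]
 proof
  note tt = tw[OF a(1)] tw[OF a(2)]
  assume "linking_iso G SS \<XX> (twist io t) (twist io t')"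
  from trans[OF tt(1,2) a(4) this a(6)] have "linking_iso G SS \<XX> (twist io t) L'" .
  from trans[OF a(3) tt(1) a(4) sym[OF tt(1) a(3,5)] this] show "linking_iso G SS \<XX> L L'" .
 next
  note tt = tw[OF a(1)] tw[OF a(2)]
  assume "linking_iso G SS \<XX> L L'"
  from trans[OF tt(1) a(3,4,5) this] have "linking_iso G SS \<XX> (twist io t) L'" .
  from trans[OF tt(1) a(4) tt(2) this sym[OF tt(2) a(4,6)]] show "linking_iso G SS \<XX> (twist io t) (twist io t')" .
 qed
qed

end

section \<open>Orders of elements\<close>

lemma nmul_mod: assumes "nmul p u = 0" shows "nmul n u = nmul (n mod p) u"
proof -
 have "nmul (n div p * p) u = 0" using assms by (simp add: nmul_nmul [symmetric])
 hence "nmul (n div p * p + n mod p) u = nmul (n mod p) u" by (simp only: nmul_add add_0)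
 thus ?thesis by (simp only: div_mult_mod_eq)
qed

lemma nmul_inverse:
 assumes "prime (p::nat)" "~ p dvd n" shows "EX k. ALL u. nmul p u = 0 --> nmul k (nmul n u) = u"
proof -
 have "coprime n p" using prime_imp_coprime[OF assms] by (simp add: coprime_commute)
 then obtain k where k: "[n * k = 1] (mod p)" using cong_solve_coprime_nat[of n p] by auto
 have "nmul k (nmul n u) = u" if "nmul p u = 0" for u :: "'a::monoid_add"
  using nmul_mod[OF that, of "k * n"] nmul_mod[OF that, of 1] k by (simp add: nmul_nmul cong_def mult.commute)
 thus ?thesis by blast
qed

text \<open>
  Another prime divisor of the order would give, by Sylow, a nonzero element killed by two primes.
\<close>

lemma card_elementary:
 assumes A: "add_subgroup A" "finite A" and p: "prime (p::nat)" "!!u. u : A ==> nmul p u = 0"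
 shows "EX k. card A = p ^ k"
proof -
 have n0: "card A ~= 0" using A add_subgroupD(1) by auto
 obtain y where y: "card A = p ^ multiplicity p (card A) * y" "~ p dvd y"
  using multiplicity_decompose'[OF n0, of p] p(1) not_prime_unit by blast
 have "y = 1"
 proof (rule ccontr)
  assume "y ~= 1"
  then obtain q where q: "prime q" "q dvd y" using prime_factor_nat by blast
  interpret t: comm_group "typegroup A" by (rule comm_group_typegroup[OF A(1)])
  obtain j where j: "y = q * j" using q(2) by blast
  have "card A = q * (p ^ multiplicity p (card A) * j)" using y(1) unfolding j by (metis mult.left_commute)
  hence m: "order (typegroup A) = q ^ 1 * (p ^ multiplicity p (card A) * j)" by (simp only: order_def typegroup_simps power_one_right)
  obtain H where H: "subgroup H (typegroup A)" "card H = q"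
   using sylow_thm[OF q(1) t.is_group m] A(2) by auto
  have "H ~= {0}" using H(2) q(1) by auto
  moreover have "0 : H" using subgroup.one_closed[OF H(1)] by simp
  ultimately obtain x where x: "x : H" "x ~= 0" by blast
  have xA: "x : A" using subgroup.subset[OF H(1)] x(1) by auto
  interpret h: group "typegroup A\<lparr>carrier := H\<rparr>" by (rule subgroup.subgroup_is_group[OF H(1) t.is_group])
  have "x [^]\<^bsub>typegroup A\<lparr>carrier := H\<rparr>\<^esub> q = \<one>\<^bsub>typegroup A\<^esub>" using h.pow_order_eq_1[of x] x(1) H(2) by (simp add: order_def)
  hence "nmul q x = 0" by (simp add: t.nat_pow_consistent [symmetric] typegroup_pow)
  moreover obtain k where "nmul k (nmul q x) = x" using nmul_inverse[OF p(1), of q] p(2)[OF xA] q y(2) primes_dvd_imp_eq[OF p(1) q(1)] by blast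
  ultimately show False using x(2) by simp
 qed
 thus ?thesis using y(1) by auto
qed

section \<open>The orbit category\<close>

lemma (in group) orbit_finite_cat:
 assumes "finite (carrier G)" shows "finite_cat (orbit_category G T)"
proof -
 let ?C = "orbit_category G T"
 have Mor: "f : Mor ?C P Q <-> f : lcosets P \<rightarrow>\<^sub>E lcosets Q & (ALL g:carrier G. ALL A:lcosets P. f (g <#\<^bsub>G\<^esub> A) = g <#\<^bsub>G\<^esub> f A)" for f P Q
  by (simp add: orbit_category_def)
 have comp: "comp ?C P Q R g f = compose (lcosets P) g f" and id: "ident ?C P = (\<lambda>A\<in>lcosets P. A)" for P Q R f g
  by (simp_all add: orbit_category_def)
 have Obj: "P : Obj ?C ==> subgroup P G" for P by (simp add: orbit_category_def subgroups_of_def)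
 have cl: "g <#\<^bsub>G\<^esub> A : lcosets P" if "subgroup P G" "g : carrier G" "A : lcosets P" for g A P
  using that by (auto simp: LCOSETS_def lcos_m_assoc subgroup.subset)
 have "category ?C"
  unfolding category_def
 proof (intro conjI ballI)
  fix P assume P: "P : Obj ?C"
  show "ident ?C P : Mor ?C P P" using cl[OF Obj[OF P]] by (auto simp: Mor id)
  fix Q f assume "f : Mor ?C P Q"
  hence "f : lcosets P \<rightarrow>\<^sub>E lcosets Q" by (simp add: Mor)
  thus "comp ?C P P Q f (ident ?C P) = f" "comp ?C P Q Q (ident ?C Q) f = f"
   by (auto simp: comp id PiE_def compose_Id Id_compose)
 next
  fix P Q R f g assume "f : Mor ?C P Q" "g : Mor ?C Q R"
  thus "comp ?C P Q R g f : Mor ?C P R" if "P : Obj ?C"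
   using cl[OF Obj[OF that]] by (auto simp: Mor comp compose_def PiE_def Pi_def)
 next
  fix P Q R U f g h assume "f : Mor ?C P Q"
  thus "comp ?C P Q U (comp ?C Q R U h g) f = comp ?C P R U h (comp ?C P Q R g f)"
   unfolding comp by (intro compose_assoc[symmetric]) (auto simp: Mor PiE_def)
 qed
 moreover have "finite (Obj ?C)"
  by (rule finite_subset[of _ "Pow (carrier G)"]) (use assms Obj subgroup.subset in auto)
 moreover have "finite (Mor ?C P Q)" for P Q
 proof -
  have "finite (lcosets P \<rightarrow>\<^sub>E lcosets Q)" using assms by (intro finite_PiE) (auto simp: LCOSETS_def)
  thus ?thesis by (rule finite_subset[rotated]) (rule subsetI, drule Mor[THEN iffD1], erule conjunct1)
 qed
 ultimately show ?thesis by (simp add: finite_cat_def)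
qed

section \<open>Linking systems over all, and over all proper, overgroups of the kernel\<close>

context group_extension
begin

definition proper where "proper = {P : full. nv ` A \<subset> P}"

lemma kernel_subset: "P : full ==> nv ` A \<subseteq> P"
 using fullD(4) by blast

lemma full_setup: "linking_setup \<Gamma> T A act G \<beta> nv full"
proof unfold_locales
 have "SS : full" using SS_subgroup subgroup.one_closed[OF T] by (auto simp: full_def subgroups_of_def SS_def)
 thus "full ~= {}" by blast
qed simp_all

lemma proper_setup: assumes "proper ~= {}" shows "linking_setup \<Gamma> T A act G \<beta> nv proper"
proof unfold_locales
 show "proper \<subseteq> full" by (auto simp: proper_def)
 show "Q : proper" if "P : proper" "Q : full" "P \<subseteq> Q" for P Q using that by (auto simp: proper_def)
 show "Q : proper" if P: "P : proper" and g: "g : carrier G" and Q: "Q : full" "conj_by G g ` P = Q" for P Q g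
 proof -
  obtain x where x: "x : P" "x ~: nv ` A" and Pf: "P : full" using P by (auto simp: proper_def)
  have xG: "x : carrier G" using x(1) fullD(3)[OF Pf] by blast
  have "\<beta> x ~= \<one>" using nv_ker[OF xG] x(2) by blast
  moreover have "\<beta> (conj_by G g x) = \<beta> g \<otimes> \<beta> x \<otimes> inv (\<beta> g)" using xG g by (simp add: conj_by_def)
  moreover have "\<beta> g \<otimes> \<beta> x \<otimes> inv (\<beta> g) = \<one> ==> \<beta> x = \<one>"
  proof -
   assume "\<beta> g \<otimes> \<beta> x \<otimes> inv (\<beta> g) = \<one>"
   hence "inv (\<beta> g) \<otimes> (\<beta> g \<otimes> \<beta> x \<otimes> inv (\<beta> g)) \<otimes> \<beta> g = \<one>" using xG g by simp
   moreover have "inv (\<beta> g) \<otimes> (\<beta> g \<otimes> \<beta> x \<otimes> inv (\<beta> g)) \<otimes> \<beta> g = \<beta> x"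
    using xG g by (simp add: m_assoc) (simp add: m_assoc [symmetric])
   ultimately show "\<beta> x = \<one>" by simp
  qed
  ultimately have "conj_by G g x ~: nv ` A" using nv_image by auto
  moreover have "conj_by G g x : Q" using x(1) Q(2) by blast
  ultimately show ?thesis using Q(1) kernel_subset by (auto simp: proper_def)
 qed
qed (rule assms)

lemma full_V: "linking_setup.V \<Gamma> T G \<beta> full = pts"
proof -
 interpret s: linking_setup \<Gamma> T A act G \<beta> nv full by (rule full_setup)
 show ?thesis using pre_full by (auto simp: s.V_def elim!: ptsE intro: ptsI)
qed

lemma proper_pre: assumes "subgroup B \<Gamma>" "B \<subseteq> T" shows "pre B : proper <-> B ~= {\<one>}"
proof -
 note f = pre_full[OF assms]
 have "pre B = nv ` A <-> B = {\<one>}"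
 proof
  assume "pre B = nv ` A"
  hence "bar (pre B) = bar (pre {\<one>})" using nv_image by (simp add: pre_def)
  thus "B = {\<one>}" using bar_pre assms(1) triv_subgroup by simp
 qed (simp add: pre_def nv_image)
 thus ?thesis using f kernel_subset[OF f] by (auto simp: proper_def)
qed

text \<open>
  A subgroup contains \<open>A\<close> properly if and only if its image in \<open>T\<close> is nontrivial.
\<close>

lemma proper_V: assumes "proper ~= {}" shows "linking_setup.V \<Gamma> T G \<beta> proper = {e : pts. fst e ~= {\<one>}}"
proof -
 interpret s: linking_setup \<Gamma> T A act G \<beta> nv proper by (rule proper_setup[OF assms])
 show ?thesis using proper_pre by (auto simp: s.V_def elim!: ptsE intro: ptsI)
qed

lemma proper_empty: assumes "proper = {}" shows "{e : pts. fst e ~= {\<one>}} = {}"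
proof (rule equals0I)
 fix e assume "e : {e : pts. fst e ~= {\<one>}}"
 hence e: "e : pts" "fst e ~= {\<one>}" by simp_all
 from e(1) obtain P a where "subgroup P \<Gamma>" "P \<subseteq> T" "e = (P, a <# P)" by (rule ptsE)
 thus False using proper_pre[of P] e(2) assms by simp
qed

lemma full_unique:
 fixes io :: "'h => 'l"
 assumes io: "inj_on io (carrier G)" and k: "!!u. u : A ==> nmul k (nmul (card tops) u) = u"
 shows "EX L :: ('h, 'l) linking_data. linking_system G SS full L"
  and "linking_system G SS full (L :: ('h, 'l) linking_data) ==> linking_system G SS full (L' :: ('h, 'l) linking_data) ==> linking_iso G SS full L L'"
proof -
 interpret s: linking_setup \<Gamma> T A act G \<beta> nv full by (rule full_setup)
 have c: "corr {L :: ('h, 'l) linking_data. linking_system G SS full L} (linking_iso G SS full) (NZ2 pts) (NE2 pts)"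
  using s.linking_systems_correspond[OF io] unfolding full_V .
 obtain R where R: "ALL a:{L :: ('h, 'l) linking_data. linking_system G SS full L}. EX b:NZ2 pts. R a b"
  "ALL b:NZ2 pts. EX a:{L. linking_system G SS full L}. R a b"
  "ALL a:{L. linking_system G SS full L}. ALL a':{L. linking_system G SS full L}. ALL b:NZ2 pts. ALL b':NZ2 pts.
    R a b --> R a' b' --> (linking_iso G SS full a a' <-> NE2 pts b b')"
  using c by (rule corrE)
 have "(%e0 e1 e2. 0) : NZ2 pts" by (simp add: NZ2_def K2_def N2_def D2_def Acl act_zero)
 thus "EX L :: ('h, 'l) linking_data. linking_system G SS full L" using R(2) by blast
 assume L: "linking_system G SS full (L :: ('h, 'l) linking_data)" "linking_system G SS full (L' :: ('h, 'l) linking_data)"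
 then obtain b b' where b: "b : NZ2 pts" "R L b" "b' : NZ2 pts" "R L' b'" using R(1) by blast
 have "NE2 pts b b'" by (rule NE2_pts[OF k b(1,3)])
 thus "linking_iso G SS full L L'" using R(3) L b by simp
qed

end

section \<open>The semidirect product\<close>

locale fp_extension = group \<Gamma> for \<Gamma> :: "('g, 'b) monoid_scheme" (structure) +
 fixes p :: nat and M :: "(int, 'm) module" and act :: "'g => 'm => 'm" and T :: "'g set"
 assumes p: "prime p" and fin: "finite (carrier \<Gamma>)" and Fp: "Fp_module p \<Gamma> M act" and finM: "finite (carrier M)"
  and faith: "faithful_action \<Gamma> (carrier M) act" and Syl: "T : Syl p \<Gamma>"
begin

lemma M_module: "module (residue_ring (int p)) M" and action: "group_action \<Gamma> (carrier M) act"
 and act_plus: "g : carrier \<Gamma> ==> x : carrier M ==> y : carrier M ==> act g (x \<oplus>\<^bsub>M\<^esub> y) = act g x \<oplus>\<^bsub>M\<^esub> act g y"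
 using Fp by (simp_all add: Fp_module_def)

sublocale M: abelian_group M
 using M_module by (rule module.axioms)

lemma T_sub: "subgroup T \<Gamma>"
 using Syl by (simp add: Syl_def)

lemma act_in: "g : carrier \<Gamma> ==> x : carrier M ==> act g x : carrier M"
 using group_action.element_image[OF action] by blast

lemma act_comp: "g : carrier \<Gamma> ==> h : carrier \<Gamma> ==> x : carrier M ==> act (g \<otimes> h) x = act g (act h x)"
 by (rule group_action.composition_rule[OF action])

lemma act_unit: "x : carrier M ==> act \<one> x = x"
 using fun_cong[OF group_action.id_eq_one[OF action], of x] by simp

lemma act_0: assumes "g : carrier \<Gamma>" shows "act g \<zero>\<^bsub>M\<^esub> = \<zero>\<^bsub>M\<^esub>"
 using act_plus[OF assms, of "\<zero>\<^bsub>M\<^esub>" "\<zero>\<^bsub>M\<^esub>"] act_in[OF assms, of "\<zero>\<^bsub>M\<^esub>"] by simp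

lemma act_faithful: assumes "g : carrier \<Gamma>" "!!x. x : carrier M ==> act g x = x" shows "g = \<one>"
proof -
 have ext: "act h : extensional (carrier M)" if "h : carrier \<Gamma>" for h
  using group_action.bij_prop0[OF action that] by (simp add: Bij_def)
 have "act g = act \<one>" by (rule extensionalityI[OF ext ext]) (use assms act_unit in simp_all)
 thus ?thesis using faithful_action.faithful[OF faith] assms(1) by (auto dest: inj_onD)
qed

abbreviation GG where "GG \<equiv> semidirect M \<Gamma> act"

lemma GG_simps [simp]: "carrier GG = carrier M \<times> carrier \<Gamma>" "(x, g) \<otimes>\<^bsub>GG\<^esub> (y, h) = (x \<oplus>\<^bsub>M\<^esub> act g y, g \<otimes> h)" "\<one>\<^bsub>GG\<^esub> = (\<zero>\<^bsub>M\<^esub>, \<one>)"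
 by (simp_all add: semidirect_def)

lemma GG_group: "group GG"
proof (rule groupI)
 fix x assume "x : carrier GG"
 then obtain u g where x: "x = (u, g)" "u : carrier M" "g : carrier \<Gamma>" by auto
 have "act (inv g) u \<oplus>\<^bsub>M\<^esub> act (inv g) (\<ominus>\<^bsub>M\<^esub> u) = \<zero>\<^bsub>M\<^esub>" using x by (simp add: act_plus [symmetric] act_0 M.r_neg)
 hence "act (inv g) (\<ominus>\<^bsub>M\<^esub> u) \<oplus>\<^bsub>M\<^esub> act (inv g) u = \<zero>\<^bsub>M\<^esub>" using x act_in by (simp add: M.a_comm)
 hence "(act (inv g) (\<ominus>\<^bsub>M\<^esub> u), inv g) \<otimes>\<^bsub>GG\<^esub> x = \<one>\<^bsub>GG\<^esub>" using x by simp
 thus "EX y:carrier GG. y \<otimes>\<^bsub>GG\<^esub> x = \<one>\<^bsub>GG\<^esub>" using x act_in by (intro bexI[of _ "(act (inv g) (\<ominus>\<^bsub>M\<^esub> u), inv g)"]) simp_all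
qed (auto simp: act_in act_comp act_plus act_unit act_0 m_assoc M.a_assoc)

text \<open>
  The module, as an abelian group with addition given by a type class.
\<close>

definition \<mu> :: "'m => 'm bidual" where
 "\<mu> = (SOME e. (ALL x:carrier M. ALL y:carrier M. e (x \<oplus>\<^bsub>M\<^esub> y) = e x + e y) & (ALL x:carrier M. e x = 0 <-> x = \<zero>\<^bsub>M\<^esub>))"

lemma \<mu>: "x : carrier M ==> y : carrier M ==> \<mu> (x \<oplus>\<^bsub>M\<^esub> y) = \<mu> x + \<mu> y" "x : carrier M ==> \<mu> x = 0 <-> x = \<zero>\<^bsub>M\<^esub>"
proof -
 have "EX e :: 'm => 'm bidual. (ALL x:carrier M. ALL y:carrier M. e (x \<oplus>\<^bsub>M\<^esub> y) = e x + e y) & (ALL x:carrier M. e x = 0 <-> x = \<zero>\<^bsub>M\<^esub>)"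
  using bidual_embedding[OF M.a_comm_group group.triv_subgroup[OF M.a_group]] by simp
 from someI_ex[OF this] show "x : carrier M ==> y : carrier M ==> \<mu> (x \<oplus>\<^bsub>M\<^esub> y) = \<mu> x + \<mu> y" "x : carrier M ==> \<mu> x = 0 <-> x = \<zero>\<^bsub>M\<^esub>"
  unfolding \<mu>_def by blast+
qed

lemma \<mu>_minus: assumes "x : carrier M" shows "\<mu> (\<ominus>\<^bsub>M\<^esub> x) = - \<mu> x"
proof -
 have "\<mu> (\<ominus>\<^bsub>M\<^esub> x) + \<mu> x = 0" using \<mu>(1)[of "\<ominus>\<^bsub>M\<^esub> x" x] \<mu>(2)[of "\<zero>\<^bsub>M\<^esub>"] assms by (simp add: M.l_neg)
 thus ?thesis by (simp add: eq_neg_iff_add_eq_0)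
qed

lemma \<mu>_inj: "inj_on \<mu> (carrier M)"
proof (rule inj_onI)
 fix x y assume xy: "x : carrier M" "y : carrier M" "\<mu> x = \<mu> y"
 hence "\<mu> (x \<oplus>\<^bsub>M\<^esub> (\<ominus>\<^bsub>M\<^esub> y)) = 0" using \<mu>(1)[of x "\<ominus>\<^bsub>M\<^esub> y"] \<mu>_minus by simp
 hence "x \<oplus>\<^bsub>M\<^esub> (\<ominus>\<^bsub>M\<^esub> y) = \<zero>\<^bsub>M\<^esub>" using \<mu>(2) xy by simp
 thus "x = y" using xy by (metis M.a_inv_closed M.minus_equality M.minus_minus M.a_comm)
qed

definition "AA = \<mu> ` carrier M"
definition "iM = inv_into (carrier M) \<mu>"
definition "actA g u = \<mu> (act g (iM u))"
definition "nu u = (iM u, \<one>)"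

lemma iM: "x : carrier M ==> iM (\<mu> x) = x" "u : AA ==> iM u : carrier M" "u : AA ==> \<mu> (iM u) = u"
 using \<mu>_inj by (auto simp: iM_def AA_def)

lemma iM_add: assumes "u : AA" "v : AA" shows "iM (u + v) = iM u \<oplus>\<^bsub>M\<^esub> iM v"
 using iM(1)[of "iM u \<oplus>\<^bsub>M\<^esub> iM v"] iM assms by (simp add: \<mu>)

lemma iM_act: "g : carrier \<Gamma> ==> u : AA ==> iM (actA g u) = act g (iM u)"
 using iM act_in by (simp add: actA_def)

lemma AA_sub: "add_subgroup AA"
 unfolding add_subgroup_def
proof (intro conjI ballI)
 show "0 : AA" using \<mu>(2)[of "\<zero>\<^bsub>M\<^esub>"] by (auto simp: AA_def image_iff intro!: bexI[of _ "\<zero>\<^bsub>M\<^esub>"])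
 show "u + v : AA" if "u : AA" "v : AA" for u v using that \<mu>(1)[symmetric] by (auto simp: AA_def)
 show "- u : AA" if "u : AA" for u using that \<mu>_minus[symmetric] by (auto simp: AA_def)
qed

sublocale coset_cochains \<Gamma> T AA actA
proof (intro coset_cochains.intro coset_cochains_axioms.intro is_group)
 show "finite (carrier \<Gamma>)" "subgroup T \<Gamma>" "add_subgroup AA" by (rule fin T_sub AA_sub)+
 fix g u assume g: "g : carrier \<Gamma>" and u: "u : AA"
 show "actA g u : AA" using act_in[OF g] iM(2)[OF u] by (simp add: actA_def AA_def)
 show "actA g (u + v) = actA g u + actA g v" if "v : AA" for v
  using iM_add[OF u that] iM(2) u that g by (simp add: actA_def act_plus \<mu> act_in)
 show "actA (g \<otimes> h) u = actA g (actA h u)" if "h : carrier \<Gamma>" for h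
  using iM_act[OF that u] g that iM(2)[OF u] by (simp add: actA_def act_comp)
next
 show "actA \<one> u = u" if "u : AA" for u using that iM by (simp add: actA_def act_unit)
qed

sublocale group_extension \<Gamma> T AA actA GG snd nu
proof -
 interpret G: group GG by (rule GG_group)
 show "group_extension \<Gamma> T AA actA GG snd nu"
 proof unfold_locales
  show "snd : hom GG \<Gamma>" by (auto simp: hom_def)
  show "snd ` carrier GG = carrier \<Gamma>" using M.zero_closed by force
  show "inj_on nu AA" by (rule inj_onI) (metis nu_def iM(3) prod.inject)
  fix u v assume u: "u : AA" and v: "v : AA"
  show "nu (u + v) = nu u \<otimes>\<^bsub>GG\<^esub> nu v" using iM_add[OF u v] iM(2)[OF v] by (simp add: nu_def act_unit)
 next
  show "nu ` AA = {g : carrier GG. snd g = \<one>}" using iM by (force simp: nu_def AA_def image_iff)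
  fix g u assume g: "g : carrier GG" and u: "u : AA"
  obtain x a where x: "g = (x, a)" "x : carrier M" "a : carrier \<Gamma>" using g by auto
  have nG: "nu w : carrier GG" if "w : AA" for w using that iM(2) by (simp add: nu_def)
  have w: "actA a u : AA" using act_in[OF x(3)] iM(2)[OF u] by (simp add: actA_def AA_def)
  have "g \<otimes>\<^bsub>GG\<^esub> nu u = nu (actA a u) \<otimes>\<^bsub>GG\<^esub> g"
   using x iM_act[OF x(3) u] act_in[OF x(3) iM(2)[OF u]] by (simp add: nu_def act_unit M.a_comm)
  hence "g \<otimes>\<^bsub>GG\<^esub> nu u \<otimes>\<^bsub>GG\<^esub> inv\<^bsub>GG\<^esub> g = nu (actA a u) \<otimes>\<^bsub>GG\<^esub> (g \<otimes>\<^bsub>GG\<^esub> inv\<^bsub>GG\<^esub> g)"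
   by (simp only: G.m_assoc[OF nG[OF w] g G.inv_closed[OF g]])
  also have "... = nu (actA a u)" by (simp only: G.r_inv[OF g] G.r_one[OF nG[OF w]])
  finally show "g \<otimes>\<^bsub>GG\<^esub> nu u \<otimes>\<^bsub>GG\<^esub> inv\<^bsub>GG\<^esub> g = nu (actA (snd g) u)" by (simp only: x(1) snd_conv)
 next
  fix a assume a: "a : carrier \<Gamma>" and fx: "!!u. u : AA ==> actA a u = u"
  show "a = \<one>"
  proof (rule act_faithful[OF a])
   fix x assume x: "x : carrier M"
   have "actA a (\<mu> x) = \<mu> x" using fx x by (simp add: AA_def)
   hence "\<mu> (act a x) = \<mu> x" using iM(1)[OF x] by (simp add: actA_def)
   thus "act a x = x" using \<mu>_inj act_in[OF a x] x by (auto dest: inj_onD)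
  qed
 qed
qed

lemma SS_eq: "SS = carrier M \<times> T"
 using T_carrier by (auto simp: SS_def)

lemma kernel_eq: "nu ` AA = carrier M \<times> {\<one>}"
 unfolding nv_image by auto

lemma torsion: assumes "u : AA" shows "nmul p u = 0"
proof -
 interpret R: residues "int p" "residue_ring (int p)" by unfold_locales (use prime_gt_1_nat[OF p] in simp_all)
 obtain x where x: "x : carrier M" "u = \<mu> x" using assms by (auto simp: AA_def)
 note sm = module.smult_closed[OF M_module] and sl = module.smult_l_distr[OF M_module] and s1 = module.smult_one[OF M_module]
 have "nmul n u = \<mu> ((int n mod int p) \<odot>\<^bsub>M\<^esub> x)" for n
 proof (induction n)
  case 0
  have "\<zero>\<^bsub>residue_ring (int p)\<^esub> \<odot>\<^bsub>M\<^esub> x = \<zero>\<^bsub>M\<^esub>" by (rule module.smult_l_null[OF M_module x(1)])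
  thus ?case using \<mu>(2)[of "\<zero>\<^bsub>M\<^esub>"] by (simp add: R.res_zero_eq)
 next
  case (Suc n)
  have "int (Suc n) mod int p = 1 \<oplus>\<^bsub>residue_ring (int p)\<^esub> (int n mod int p)" by (simp add: R.res_add_eq mod_add_right_eq)
  moreover have "(1 \<oplus>\<^bsub>residue_ring (int p)\<^esub> (int n mod int p)) \<odot>\<^bsub>M\<^esub> x = x \<oplus>\<^bsub>M\<^esub> (int n mod int p) \<odot>\<^bsub>M\<^esub> x"
   using sl[of 1 "int n mod int p" x] s1[OF x(1)] x(1) R.one_closed by (simp add: R.res_one_eq)
  ultimately show ?case using Suc x sm[of "int n mod int p" x] by (simp add: \<mu>)
 qed
 from this[of p] show ?thesis
  using module.smult_l_null[OF M_module x(1)] \<mu>(2)[of "\<zero>\<^bsub>M\<^esub>"] by (simp add: R.res_zero_eq)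
qed

lemma card_T: "order \<Gamma> = card tops * card T" "card T = p ^ multiplicity p (order \<Gamma>)"
 using l_lagrange[OF fin T_sub] card_tops Syl by (simp_all add: Syl_def)

lemma index_prime: "~ p dvd card tops"
proof
 assume "p dvd card tops"
 hence "p ^ Suc (multiplicity p (order \<Gamma>)) dvd order \<Gamma>" using card_T by (auto simp: dvd_def mult_ac)
 moreover have "order \<Gamma> ~= 0" using fin order_gt_0_iff_finite by auto
 ultimately show False using power_dvd_iff_le_multiplicity[of "order \<Gamma>" p "Suc (multiplicity p (order \<Gamma>))"] p not_prime_unit by auto
qed

lemma index_inverse: "EX k. ALL u:AA. nmul k (nmul (card tops) u) = u"
 using nmul_inverse[OF p index_prime] torsion by blast

lemma SS_Syl: "SS : Syl p GG"
proof -
 have cA: "card AA = card (carrier M)" unfolding AA_def by (rule card_image[OF \<mu>_inj])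
 obtain k where k: "card (carrier M) = p ^ k" using card_elementary[OF AA_sub _ p torsion] finM cA by (auto simp: AA_def)
 have o: "order \<Gamma> ~= 0" using fin order_gt_0_iff_finite by auto
 have "order GG = p ^ k * order \<Gamma>" using k by (simp add: order_def card_cartesian_product)
 hence "multiplicity p (order GG) = k + multiplicity p (order \<Gamma>)"
  using p o by (simp add: prime_elem_multiplicity_mult_distrib multiplicity_same_power not_prime_unit)
 moreover have "card SS = p ^ k * card T" using k by (simp add: SS_eq card_cartesian_product)
 ultimately show ?thesis using SS_subgroup card_T(2) by (simp add: Syl_def power_add)
qed

text \<open>
  A nontrivial subgroup has no morphism to the trivial one, so restriction maps that pass through
  another object than the trivial subgroup cause no conflict with functoriality.
\<close>

lemma atomic_ab_presheaf: "ab_presheaf (orbit_category \<Gamma> T) (atomic_presheaf \<Gamma> M act)"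
proof -
 let ?C = "orbit_category \<Gamma> T" and ?F = "atomic_presheaf \<Gamma> M act"
 have C: "category ?C" using orbit_finite_cat[OF fin] by (simp add: finite_cat_def)
 have L1: "lcosets {\<one>} = (%g. {g}) ` carrier \<Gamma>" by (auto simp: LCOSETS_def l_coset_def)
 have g1: "g <# {h} = {g \<otimes> h}" for g h by (simp add: l_coset_def)
 have 1: "{\<one>} : lcosets {\<one>}" unfolding L1 by blast
 have el: "EX a:carrier \<Gamma>. f {\<one>} = {a}" if "f : Mor ?C {\<one>} {\<one>}" for f
 proof -
  have "f {\<one>} : lcosets {\<one>}" using that 1 by (auto simp: orbit_category_def)
  thus ?thesis unfolding L1 by blast
 qed
 have down: "Q = {\<one>}" if Q: "Q : Obj ?C" and f: "f : Mor ?C Q {\<one>}" for Q f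
 proof -
  have sQ: "subgroup Q \<Gamma>" using Q by (simp add: orbit_category_def subgroups_of_def)
  have QL: "Q : lcosets Q" unfolding LCOSETS_def using lcos_mult_one[OF subgroup.subset[OF sQ]] by (auto intro!: bexI[of _ \<one>])
  have "f Q : lcosets {\<one>}" using f QL by (auto simp: orbit_category_def)
  then obtain h where h: "h : carrier \<Gamma>" "f Q = {h}" unfolding L1 by blast
  have "x = \<one>" if x: "x : Q" for x
  proof -
   have xG: "x : carrier \<Gamma>" using x subgroup.subset[OF sQ] by blast
   have "f (x <# Q) = x <# f Q" using f QL xG by (simp add: orbit_category_def)
   moreover have "x <# Q = Q" by (rule coset_join3[OF xG sQ x])
   ultimately have "x \<otimes> h = h" using h g1 by simp
   thus ?thesis using xG h by simp
  qed
  thus ?thesis using subgroup.one_closed[OF sQ] by blast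
 qed
 have zz: "\<zero>\<^bsub>M\<^esub> \<oplus>\<^bsub>M\<^esub> \<zero>\<^bsub>M\<^esub> = \<zero>\<^bsub>M\<^esub>" by simp
 show ?thesis
  unfolding ab_presheaf_def
 proof (intro conjI ballI)
  fix P assume P: "P : Obj ?C"
  show "comm_group (grp ?F P)"
  proof (cases "P = {\<one>}")
   case True
   show ?thesis by (rule comm_groupI) (use True in \<open>auto simp: atomic_presheaf_def M.a_ac intro!: bexI[of _ "\<ominus>\<^bsub>M\<^esub> x" for x] M.l_neg\<close>)
  next
   case False
   show ?thesis by (rule comm_groupI) (use False in \<open>auto simp: atomic_presheaf_def\<close>)
  qed
  show "res ?F P P (ident ?C P) x = x" if "x : sect ?F P" for x
   using that act_unit 1 by (auto simp: atomic_presheaf_def orbit_category_def split: if_splits)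
  fix Q f assume Q: "Q : Obj ?C" and f: "f : Mor ?C P Q"
  show "res ?F P Q f : hom (grp ?F Q) (grp ?F P)"
  proof (cases "P = {\<one>} & Q = {\<one>}")
   case True
   then obtain a where "a : carrier \<Gamma>" "f {\<one>} = {a}" using el f by blast
   thus ?thesis using True act_in act_plus by (auto simp: atomic_presheaf_def hom_def)
  next
   case False
   thus ?thesis by (auto simp: atomic_presheaf_def hom_def)
  qed
  fix R g x assume R: "R : Obj ?C" and g: "g : Mor ?C Q R" and x: "x : sect ?F R"
  show "res ?F P R (comp ?C P Q R g f) x = res ?F P Q f (res ?F Q R g x)"
  proof (cases "P = {\<one>} & R = {\<one>}")
   case True
   hence 1: "Q = {\<one>}" using down[OF Q] g by simp
   obtain a where a: "a : carrier \<Gamma>" "f {\<one>} = {a}" using el f True 1 by blast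
   obtain b where b: "b : carrier \<Gamma>" "g {\<one>} = {b}" using el g True 1 by blast
   have "g {a} = g (a <# {\<one>})" using a by (simp add: g1)
   also have "... = a <# g {\<one>}" using g True 1 a(1) L1 by (simp add: orbit_category_def)
   finally have ga: "g {a} = {a \<otimes> b}" by (simp add: b g1)
   have "comp ?C P Q R g f {\<one>} = {a \<otimes> b}" using True L1 a ga by (simp add: orbit_category_def compose_def)
   thus ?thesis using True 1 a b x act_comp by (simp add: atomic_presheaf_def)
  next
   case False
   have "act (the_elem (f {\<one>})) \<zero>\<^bsub>M\<^esub> = \<zero>\<^bsub>M\<^esub>" if "P = {\<one>}" "Q = {\<one>}"
    using el f that act_0 by fastforce
   thus ?thesis using False by (auto simp: atomic_presheaf_def)
  qed
 qed
qed

end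

section \<open>Classification\<close>

lemma finite_inj_infinite: assumes "finite A" shows "EX io :: 'a => 'l::infinite. inj_on io A"
proof -
 obtain B :: "'l set" where B: "finite B" "card B = card A" using infinite_arbitrarily_large[OF infinite_UNIV] by blast
 obtain h where "bij_betw h A B" using finite_same_card_bij[OF assms B(1) B(2)[symmetric]] by blast
 thus ?thesis by (auto simp: bij_betw_def)
qed

context fp_extension
begin

abbreviation free where "free \<equiv> {e : pts. fst e ~= {\<one>}}"

text \<open>
  The kernel of the first term of the resolution is \<open>M\<close> at the trivial subgroup and zero elsewhere, so
  dimension shifting and the comparison with bar cochains both apply.
\<close>

lemma Lambda_corr:
 "EX (Z :: ('g set => 'u::infinite bidual) set) E f. corr (FZ3 free) (FE3 free) Z E &
   equiv Z {(z, z'). z : Z & z' : Z & E z z'} &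
   bij_betw f (Z // {(z, z'). z : Z & z' : Z & E z z'}) (carrier (Lambda_group \<Gamma> T M act 3 :: ('g set => 'u) set monoid)) &
   \<one>\<^bsub>Lambda_group \<Gamma> T M act 3 :: ('g set => 'u) set monoid\<^esub> : carrier (Lambda_group \<Gamma> T M act 3 :: ('g set => 'u) set monoid)"
proof -
 let ?C = "orbit_category \<Gamma> T" and ?F = "atomic_presheaf \<Gamma> M act"
 obtain io :: "'m => 'u" where io: "inj_on io (carrier M)" using finite_inj_infinite[OF finM] by blast
 have gF: "sect ?F P = (if P = {\<one>} then carrier M else {\<zero>\<^bsub>M\<^esub>})" for P by (simp add: atomic_presheaf_def)
 have "inj_on io (sect ?F P)" for P using io by (simp add: gF)
 then obtain X :: "nat => 'g set => 'u bidual set" and \<rho> d r \<theta> where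
  res: "resolves_limit ?C ?F (higher_limit ?C ?F 3 :: ('g set => 'u) set monoid) X \<rho> d r \<theta>"
  using higher_limit_resolves[OF orbit_finite_cat[OF fin] atomic_ab_presheaf, of "%P. io"] by blast
 note rs = res[unfolded resolves_limit_def]
 have ar: "acyclic_resolution (Obj ?C) (arrows ?C) src tgt (arrow_comp ?C) X \<rho> d r" using rs by (elim conjE)
 have th: "!!x y. x : sect ?F P ==> y : sect ?F P ==> \<theta> P (x \<otimes>\<^bsub>grp ?F P\<^esub> y) = \<theta> P x + \<theta> P y"
  "inj_on (\<theta> P) (sect ?F P)" "\<theta> P ` sect ?F P = {u : X 0 P. d 0 P u = 0}" if "P : Obj ?C" for P
  using rs that by auto
 have nat: "\<theta> (src a) (res ?F (src a) (tgt a) (mor a) x) = \<rho> 0 a (\<theta> (tgt a) x)" if "a : arrows ?C" "x : sect ?F (tgt a)" for a x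
  using rs that by blast
 have one: "{\<one>} : Obj ?C" using triv_subgroup subgroup.one_closed[OF T] by (simp add: orbit_category_def subgroups_of_def)
 have iM_im: "iM ` AA = carrier M" using iM by (force simp: AA_def image_iff)
 define kp where "kp u = \<theta> {\<one>} (iM u)" for u
 interpret O: orbit_resolution \<Gamma> T AA actA X \<rho> d r kp
 proof (intro orbit_resolution.intro orbit_resolution_axioms.intro)
  show "coset_cochains \<Gamma> T AA actA" by (rule coset_cochains_axioms)
  show "acyclic_resolution (Obj ?C) (arrows ?C) src tgt (arrow_comp ?C) X \<rho> d r" by (rule ar)
  show "kp (u + v) = kp u + kp v" if "u : AA" "v : AA" for u v
   using th(1)[OF one, of "iM u" "iM v"] iM_add[OF that] iM(2) that by (simp add: kp_def atomic_presheaf_def)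
  show "inj_on kp AA"
  proof (rule inj_onI)
   fix u v assume uv: "u : AA" "v : AA" "kp u = kp v"
   hence "iM u = iM v" using inj_onD[OF th(2)[OF one]] iM(2) by (simp add: kp_def gF)
   thus "u = v" using iM(3) uv by metis
  qed
  have "kp ` AA = \<theta> {\<one>} ` sect ?F {\<one>}" unfolding gF by (simp add: kp_def image_image [symmetric] iM_im)
  thus "kp ` AA = {u : X 0 {\<one>}. d 0 {\<one>} u = 0}" using th(3)[OF one] by simp
  show "\<rho> 0 a (kp u) = kp (actA g u)" if a: "a : arrows ?C" "src a = {\<one>}" "tgt a = {\<one>}" and g: "g : carrier \<Gamma>" "mor a {\<one>} = g <# {\<one>}" and u: "u : AA" for a g u
   using nat[OF a(1), of "iM u"] a g u iM(2)[OF u] iM_act[OF g(1) u] by (simp add: kp_def gF atomic_presheaf_def l_coset_def)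
  show "x = 0" if P: "P : Obj ?C" "P ~= {\<one>}" "x : X 0 P" "d 0 P x = 0" for P x
  proof -
   interpret AR: acyclic_resolution "Obj ?C" "arrows ?C" src tgt "arrow_comp ?C" X \<rho> d r by (rule ar)
   have "{u : X 0 P. d 0 P u = 0} = {\<theta> P \<zero>\<^bsub>M\<^esub>}" using th(3)[OF P(1)] P(2) by (simp add: gF)
   moreover have "0 : {u : X 0 P. d 0 P u = 0}" "x : {u : X 0 P. d 0 P u = 0}"
    using AR.Xcl(1)[OF P(1)] AR.d_zero[OF P(1)] P(3,4) by simp_all
   ultimately have "0 : {\<theta> P \<zero>\<^bsub>M\<^esub>}" "x : {\<theta> P \<zero>\<^bsub>M\<^esub>}" by (simp_all only:)
   thus ?thesis by simp
  qed
 qed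
 have "corr (FZ3 free) (FE3 free) (O.AR.Z0 3) (O.AR.E0 2)"
  using corr_trans[OF O.atomic_bar_corr O.AR.dimension_shift] unfolding O.above_def .
 moreover have "equiv (O.AR.Z0 3) {(z, z'). z : O.AR.Z0 3 & z' : O.AR.Z0 3 & O.AR.E0 2 z z'}"
  using O.AR.E0_equiv[of 2] by (simp only: Suc_numeral Num.arith_simps)
 moreover obtain f where "bij_betw f (O.AR.Z0 3 // {(z, z'). z : O.AR.Z0 3 & z' : O.AR.Z0 3 & O.AR.E0 2 z z'})
   (carrier (higher_limit ?C ?F 3 :: ('g set => 'u) set monoid))"
  using rs by (elim conjE exE)
 moreover have "\<one>\<^bsub>higher_limit ?C ?F 3 :: ('g set => 'u) set monoid\<^esub> : carrier (higher_limit ?C ?F 3 :: ('g set => 'u) set monoid)"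
  using rs by (elim conjE)
 ultimately show ?thesis unfolding Lambda_group_def by blast
qed

lemma proper_classification:
 assumes "proper ~= {}"
 shows "EX f. bij_betw f (linking_iso_classes GG SS proper :: ('m \<times> 'g, 'l::infinite) linking_data set set)
  (carrier (Lambda_group \<Gamma> T M act 3 :: ('g set => 'u::infinite) set monoid))"
proof -
 interpret s: linking_setup \<Gamma> T AA actA GG snd nu proper by (rule proper_setup[OF assms])
 have V: "s.V = free" by (rule proper_V[OF assms])
 obtain k where k: "!!u. u : AA ==> nmul k (nmul (card tops) u) = u" using index_inverse by blast
 obtain io :: "'m \<times> 'g => 'l" where io: "inj_on io (carrier GG)" using finite_inj_infinite[of "carrier GG"] finM fin by auto
 obtain Z :: "('g set => 'u bidual) set" and E f where Z: "corr (FZ3 free) (FE3 free) Z E"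
  "equiv Z {(z, z'). z : Z & z' : Z & E z z'}"
  "bij_betw f (Z // {(z, z'). z : Z & z' : Z & E z z'}) (carrier (Lambda_group \<Gamma> T M act 3 :: ('g set => 'u) set monoid))"
  using Lambda_corr by blast
 have "corr (NZ2 free) (NE2 free) (FZ3 free) (FE3 free)" by (rule connecting_corr[OF k]) (use s.V_up V in simp_all)
 hence "corr {L :: ('m \<times> 'g, 'l) linking_data. linking_system GG SS proper L} (linking_iso GG SS proper) Z E"
  using corr_trans[OF s.linking_systems_correspond[OF io]] corr_trans[OF _ Z(1)] unfolding V by blast
 then obtain f' where "bij_betw f' (linking_iso_classes GG SS proper :: ('m \<times> 'g, 'l) linking_data set set) (Z // {(z, z'). z : Z & z' : Z & E z z'})"
  using corr_bij[OF _ linking_iso_equiv[OF GG_group SS_subgroup] Z(2)] unfolding linking_iso_classes_def mem_Collect_eq by blast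
 from bij_betw_trans[OF this Z(3)] show ?thesis by blast
qed

text \<open>
  Without proper overgroups there are no points with nontrivial stabilizer, and relative cocycles are
  coboundaries by acyclicity.
\<close>

lemma Lambda_trivial:
 assumes "proper = {}"
 shows "carrier (Lambda_group \<Gamma> T M act 3 :: ('g set => 'u::infinite) set monoid) = {\<one>\<^bsub>Lambda_group \<Gamma> T M act 3 :: ('g set => 'u) set monoid\<^esub>}"
proof -
 let ?\<Lambda> = "Lambda_group \<Gamma> T M act 3 :: ('g set => 'u) set monoid"
 obtain k where k: "!!u. u : AA ==> nmul k (nmul (card tops) u) = u" using index_inverse by blast
 obtain Z :: "('g set => 'u bidual) set" and E f where Z: "corr (FZ3 free) (FE3 free) Z E"
  "equiv Z {(z, z'). z : Z & z' : Z & E z z'}"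
  "bij_betw f (Z // {(z, z'). z : Z & z' : Z & E z z'}) (carrier ?\<Lambda>)" "\<one>\<^bsub>?\<Lambda>\<^esub> : carrier ?\<Lambda>"
  using Lambda_corr by blast
 have FE: "FE3 {} c c'" if c: "c : FZ3 {}" "c' : FZ3 {}" for c c'
 proof -
  have K: "K3 pts (%e0 e1 e2 e3. c e0 e1 e2 e3 - c' e0 e1 e2 e3)" using c by (simp add: FZ3_def K3_def Acl act_diff)
  have D: "D3 (%e0 e1 e2 e3. c e0 e1 e2 e3 - c' e0 e1 e2 e3) e0 e1 e2 e3 e4 = D3 c e0 e1 e2 e3 e4 - D3 c' e0 e1 e2 e3 e4" for e0 e1 e2 e3 e4
   by (simp add: D3_def)
  have "EX v. K2 pts v & (ALL e0 e1 e2 e3. ch4 pts e0 e1 e2 e3 --> D2 v e0 e1 e2 e3 = c e0 e1 e2 e3 - c' e0 e1 e2 e3)"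
   by (rule acyclic_3[OF k K]) (use c in \<open>simp_all add: D FZ3_def\<close>)
  thus ?thesis by (auto simp: FE3_def)
 qed
 have "E z z'" if z: "z : Z" "z' : Z" for z z'
 proof -
  obtain R where R: "ALL b:Z. EX a:FZ3 {}. R a b"
   "ALL a:FZ3 {}. ALL a':FZ3 {}. ALL b:Z. ALL b':Z. R a b --> R a' b' --> (FE3 {} a a' <-> E b b')"
   using Z(1) unfolding proper_empty[OF assms] by (rule corrE)
  obtain a a' where "a : FZ3 {}" "R a z" "a' : FZ3 {}" "R a' z'" using R(1) z by blast
  thus ?thesis using R(2) FE z by blast
 qed
 hence "x = y" if "x : Z // {(z, z'). z : Z & z' : Z & E z z'}" "y : Z // {(z, z'). z : Z & z' : Z & E z z'}" for x y
  using that by (auto elim!: quotientE)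
 hence "x = y" if "x : f ` (Z // {(z, z'). z : Z & z' : Z & E z z'})" "y : f ` (Z // {(z, z'). z : Z & z' : Z & E z z'})" for x y
  using that by blast
 hence "x = y" if "x : carrier ?\<Lambda>" "y : carrier ?\<Lambda>" for x y using that unfolding bij_betw_imp_surj_on[OF Z(3), symmetric] .
 thus ?thesis using Z(4) by blast
qed

lemma full_class_unique: "EX! c. c : (linking_iso_classes GG SS full :: ('m \<times> 'g, 'l::infinite) linking_data set set)"
proof -
 let ?A = "{L :: ('m \<times> 'g, 'l) linking_data. linking_system GG SS full L}"
 obtain k where k: "!!u. u : AA ==> nmul k (nmul (card tops) u) = u" using index_inverse by blast
 obtain io :: "'m \<times> 'g => 'l" where io: "inj_on io (carrier GG)" using finite_inj_infinite[of "carrier GG"] finM fin by auto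
 obtain L :: "('m \<times> 'g, 'l) linking_data" where L: "linking_system GG SS full L" using full_unique(1)[OF io k] by blast
 have u: "linking_iso GG SS full L L'" if "L : ?A" "L' : ?A" for L L' using full_unique(2)[OF io k] that by blast
 have "linking_iso_classes GG SS full = ?A // (?A \<times> ?A)"
  unfolding linking_iso_classes_def by (rule arg_cong[where f = "%r. ?A // r"]) (use u in blast)
 also have "... = {?A}" using L by (auto simp: quotient_def)
 finally show ?thesis by simp
qed

lemma extendable_class_unique:
 assumes "proper ~= {}"
 shows "EX! c. c : (linking_iso_classes GG SS proper :: ('m \<times> 'g, 'l::infinite) linking_data set set) &
  (EX L:c. can_be_extended GG SS proper full L)"
proof -
 interpret s: linking_setup \<Gamma> T AA actA GG snd nu proper by (rule proper_setup[OF assms])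
 let ?A = "{L :: ('m \<times> 'g, 'l) linking_data. linking_system GG SS proper L}"
 define r where "r = {(L, L'). L : ?A & L' : ?A & linking_iso GG SS proper L L'}"
 have eq: "equiv ?A r" unfolding r_def by (rule linking_iso_equiv[OF GG_group SS_subgroup])
 have cl: "linking_iso_classes GG SS proper = ?A // r" by (simp add: linking_iso_classes_def r_def)
 obtain k where k: "!!u. u : AA ==> nmul k (nmul (card tops) u) = u" using index_inverse by blast
 obtain io :: "'m \<times> 'g => 'l" where io: "inj_on io (carrier GG)" using finite_inj_infinite[of "carrier GG"] finM fin by auto
 obtain L0 :: "('m \<times> 'g, 'l) linking_data" where L0: "linking_system GG SS full L0" using full_unique(1)[OF io k] by blast
 have u: "linking_iso GG SS full L L0" if "linking_system GG SS full L" for L :: "('m \<times> 'g, 'l) linking_data" using full_unique(2)[OF io k that L0] by blast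
 let ?R = "linking_restrict proper :: ('m \<times> 'g, 'l) linking_data => _"
 have sub: "proper \<subseteq> full" by (auto simp: proper_def)
 have RA: "?R L : ?A" if "linking_system GG SS full L" for L using linking_system_restrict[OF that sub s.XX_linking_family] by simp
 have self: "(?R L0, ?R L0) : r" using eq RA[OF L0] by (simp add: equiv_def refl_on_def)
 show ?thesis
  unfolding cl
 proof (rule ex1I[of _ "r `` {?R L0}"])
  have "can_be_extended GG SS proper full (?R L0)" unfolding can_be_extended_def using L0 self by (auto simp: r_def)
  thus "r `` {?R L0} : ?A // r & (EX L:r `` {?R L0}. can_be_extended GG SS proper full L)"
   using quotientI[OF RA[OF L0]] self by blast
  fix c assume c: "c : ?A // r & (EX L:c. can_be_extended GG SS proper full L)"
  then obtain L L' where L: "L : c" "linking_system GG SS full (L' :: ('m \<times> 'g, 'l) linking_data)" "linking_iso GG SS proper L (?R L')"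
   by (auto simp: can_be_extended_def)
  have LA: "L : ?A" using c L(1) Union_quotient[OF eq] by blast
  have "linking_iso GG SS proper (?R L') (?R L0)"
   by (rule linking_iso_restrict[OF GG_group SS_subgroup L(2) L0 u[OF L(2)] sub s.XX_linking_family])
  hence "(?R L', ?R L0) : r" "(L, ?R L') : r" using RA[OF L0] RA[OF L(2)] LA L(3) by (simp_all add: r_def)
  hence "(L, ?R L0) : r" using eq by (auto simp: equiv_def dest: transD)
  hence "r `` {L} = r `` {?R L0}" by (rule equiv_class_eq[OF eq])
  moreover obtain y where "y : ?A" "c = r `` {y}" using c by (auto elim!: quotientE)
  hence "c = r `` {L}" using L(1) equiv_class_eq[OF eq] by blast
  ultimately show "c = r `` {?R L0}" by simp
 qed
qed

end

theorem theorem1p7: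
  fixes p :: nat
    and \<Gamma> :: "'g monoid"
    and M :: "(int, 'm) module"
    and act :: "'g \<Rightarrow> 'm \<Rightarrow> 'm"
    and T :: "'g set"
    and G :: "('m \<times> 'g) monoid"
    and S M0 :: "('m \<times> 'g) set"
    and \<XX> \<YY> :: "('m \<times> 'g) set set"
    and X_classes Y_classes :: "('m \<times> 'g, 'l::infinite) linking_data set set"
    and \<Lambda>3 :: "('g set \<Rightarrow> 'u::infinite) set monoid"
  assumes "prime p"
    and "group \<Gamma>" and "finite (carrier \<Gamma>)"
    and "Fp_module p \<Gamma> M act" and "finite (carrier M)"
    and "faithful_action \<Gamma> (carrier M) act"
    and "T \<in> Syl p \<Gamma>"
    and "G = semidirect M \<Gamma> act"
    and "M0 = carrier M \<times> {\<one>\<^bsub>\<Gamma>\<^esub>}"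
    and "S = carrier M \<times> T"
    and "\<XX> = {P \<in> subgroups_of G S. M0 \<subseteq> P}"
    and "\<YY> = {P \<in> subgroups_of G S. M0 \<subset> P}"
    and "X_classes = linking_iso_classes G S \<XX>"
    and "Y_classes = linking_iso_classes G S \<YY>"
    and "\<Lambda>3 = Lambda_group \<Gamma> T M act 3"
  shows "(group G \<and> S \<in> Syl p G \<and> \<YY> = \<XX> - {M0}) \<and>
         (\<exists>!c. c \<in> X_classes) \<and>
         (\<YY> \<noteq> {} \<longrightarrow> (\<exists>f. bij_betw f Y_classes (carrier \<Lambda>3))) \<and>
         (carrier \<Lambda>3 \<noteq> {\<one>\<^bsub>\<Lambda>3\<^esub>} \<longrightarrow>
            (\<exists>c\<in>Y_classes. \<exists>c'\<in>Y_classes. c \<noteq> c') \<and>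
            (\<exists>!c. c \<in> Y_classes \<and> (\<exists>L\<in>c. can_be_extended G S \<YY> \<XX> L)))"
proof -
  interpret group \<Gamma> by (rule assms)
  interpret E: fp_extension \<Gamma> p M act T
    by (intro fp_extension.intro fp_extension_axioms.intro is_group) (use assms in simp_all)
  have S: "S = E.SS" and M0: "M0 = E.nu ` E.AA" using assms E.SS_eq E.kernel_eq by simp_all
  have X: "\<XX> = E.full" unfolding assms(11) E.full_def S M0 assms(8) ..
  have Y: "\<YY> = E.proper" unfolding assms(12) E.proper_def E.full_def S M0 assms(8) by auto
  have 1: "group G" "S \<in> Syl p G" "\<YY> = \<XX> - {M0}"
    using E.GG_group E.SS_Syl assms(8,11,12) S by auto
  have 2: "\<exists>!c. c \<in> X_classes" unfolding assms(13) X S assms(8) by (rule E.full_class_unique)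
  have 3: "\<exists>f. bij_betw f Y_classes (carrier \<Lambda>3)" if "\<YY> \<noteq> {}"
    unfolding assms(14,15) Y S assms(8) by (rule E.proper_classification) (use that Y in simp)
  have 4: "(\<exists>c\<in>Y_classes. \<exists>c'\<in>Y_classes. c \<noteq> c') \<and> (\<exists>!c. c \<in> Y_classes \<and> (\<exists>L\<in>c. can_be_extended G S \<YY> \<XX> L))"
    if \<Lambda>: "carrier \<Lambda>3 \<noteq> {\<one>\<^bsub>\<Lambda>3\<^esub>}"
  proof
    have ne: "E.proper \<noteq> {}" using E.Lambda_trivial \<Lambda> unfolding assms(15) by blast
    obtain f where f: "bij_betw f Y_classes (carrier \<Lambda>3)" using 3 ne Y by blast
    have one: "\<one>\<^bsub>\<Lambda>3\<^esub> \<in> carrier \<Lambda>3" unfolding assms(15) using E.Lambda_corr by blast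
    then obtain x where x: "x \<in> carrier \<Lambda>3" "x \<noteq> \<one>\<^bsub>\<Lambda>3\<^esub>" using \<Lambda> by blast
    have "x \<in> f ` Y_classes" "\<one>\<^bsub>\<Lambda>3\<^esub> \<in> f ` Y_classes" unfolding bij_betw_imp_surj_on[OF f] by (rule x(1) one)+
    then obtain c c' where "c \<in> Y_classes" "x = f c" "c' \<in> Y_classes" "\<one>\<^bsub>\<Lambda>3\<^esub> = f c'" by (elim imageE)
    then show "\<exists>c\<in>Y_classes. \<exists>c'\<in>Y_classes. c \<noteq> c'" using x(2) by metis
    show "\<exists>!c. c \<in> Y_classes \<and> (\<exists>L\<in>c. can_be_extended G S \<YY> \<XX> L)"
      unfolding assms(14) X Y S assms(8) by (rule E.extendable_class_unique[OF ne])
  qed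
  show ?thesis by (intro conjI impI 1 2 3 4[THEN conjunct1] 4[THEN conjunct2])
qed

end
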